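(* Let $k$ be a field with $\mathrm{char}(k)=0$ and let $q\in k^\times$ be not a root of unity. Let $d,e\ge0$ and $m\ge1$ be integers with $m\ge ed$, and let $W^e_{m,d}:=\bigoplus_{i=1}^d (V_m^{\otimes e})^{(i)}$ be the direct sum of $d$ copies of the $e$-Hecke pair $V_m^{\otimes e}$. Then the functor $\Gamma^{d,W^e_{m,d}}_{q,e}$ is a projective generator in $\mathcal P^d_{q,e}$.
   Context: $\mathcal B_d$ is the Artin braid group with generators $T_1,\dots,T_{d-1}$ (trivial for $d\le 1$). $\mathcal V$ is the category of finite dimensional $k$-vector spaces. $V_n$ is the $n$-dimensional space with basis $v_1,\dots,v_n$, and $R_n\in\mathrm{End}(V_n\otimes V_n)$ is given by $R_n(v_i\otimes v_j)=v_j\otimes v_i$ if $i<j$, $=q\,v_i\otimes v_i$ if $i=j$, $=(q-q^{-1})v_i\otimes v_j+v_j\otimes v_i$ if $i>j$. Write $R_n(v_i\otimes v_j)=\sum_{k,l}(R_n)^{kl}_{ij}v_k\otimes v_l$. $A_q(n,n)$ is the algebra generated by $x_{ij}$ ($1\le i,j\le n$) with relations $\sum_{k,l}(R_n)^{pq}_{kl}x_{ki}x_{lj}=\sum_{k,l}(R_n)^{kl}_{ij}x_{pk}x_{ql}$; it is a bialgebra graded by $\deg x_{ij}=1$, with $\Delta(x_{ij})=\sum_k x_{ik}\otimes x_{kj}$, $\epsilon(x_{ij})=\delta_{ij}$, and $V_n$ is a right comodule via $v_i\mapsto\sum_j v_j\otimes x_{ji}$. The category of finite dimensional right $A_q(n,n)$-comodules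 is braided monoidal; its braiding $R_{V,W}:V\otimes W\to W\otimes V$ is natural in comodule maps, satisfies $R_{V\otimes W,U}=(R_{V,U}\otimes 1)(1\otimes R_{W,U})$ and $R_{V,W\otimes U}=(1\otimes R_{V,U})(R_{V,W}\otimes 1)$, and $R_{V_n,V_n}=R_n$. Put $R_V:=R_{V,V}$. $T_i\in\mathcal B_d$ acts on $V^{\otimes d}$ by $R_V$ in tensor positions $i,i+1$. An $e$-Hecke pair is a finite dimensional right $A_q(n,n)$-comodule $V$, for some $n\ge1$, whose coaction has image in $V\otimes A_q(n,n)_e$. $\Gamma^d_{q,e}\mathcal V$ is the category whose objects are all $e$-Hecke pairs (all $n\geq 1$), with $\mathrm{Hom}(V,W)=\mathrm{Hom}_{\mathcal B_d}(V^{\otimes d},W^{\otimes d})$. $\mathcal P^d_{q,e}$ is the category of $k$-linear functors $\Gamma^d_{q,e}\mathcal V\to\mathcal V$ with natural transformations as morphisms. For an $e$-Hecke pair $W$, $\Gamma^{d,W}_{q,e}\in\mathcal P^d_{q,e}$ is the representable functor $U\mapsto\mathrm{Hom}_{\mathcal B_d}(W^{\otimes d},U^{\otimes d})$. It is called a projective generator if it is projective in $\mathcal P^d_{q,e}$ and, for every $F\in\mathcal P^d_{q,e}$ and every $e$-Hecke pair $U$, the natural map $\Gamma^{d,W}_{q,e}(U)\otimes F(W)\to F(U)$, $f\otimes v\mapsto F(f)(v)$, is surjective. *)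

theory Defs
  imports
    Complex_Main
    "HOL-Library.Poly_Mapping"
    "HOL-Library.Product_Plus"
    "HOL-Library.Function_Algebras"
    "HOL-Algebra.QuotRing"
begin

text \<open>
  Indices run over \<open>{0..<n}\<close> instead of \<open>{1..n}\<close> throughout.
  For a matrix indexed by pairs, the row (output) index always comes before the
  column (input) index.
\<close>

definition idx :: "nat \<Rightarrow> nat \<Rightarrow> nat list set" where
  "idx n d = {L. length L = d \<and> set L \<subseteq> {..<n}}"


section \<open>The bialgebra \<open>A\<^sub>q(n,n)\<close>\<close>

text \<open>\<open>R_coef q k l i j\<close> is the coefficient of \<open>v\<^sub>k \<otimes> v\<^sub>l\<close> in
  \<open>R\<^sub>n(v\<^sub>i \<otimes> v\<^sub>j)\<close>; it does not depend on \<open>n\<close>.\<close>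

definition R_coef :: "'k::field \<Rightarrow> nat \<Rightarrow> nat \<Rightarrow> nat \<Rightarrow> nat \<Rightarrow> 'k" where
  "R_coef q k l i j =
     (if i < j then of_bool (k = j \<and> l = i)
      else if i = j then q * of_bool (k = i \<and> l = i)
      else (q - inverse q) * of_bool (k = i \<and> l = j) + of_bool (k = j \<and> l = i))"

text \<open>Noncommutative monomials: the word \<open>[(i\<^sub>1,j\<^sub>1),\<dots>,(i\<^sub>s,j\<^sub>s)]\<close> stands for
  \<open>x\<^bsub>i\<^sub>1j\<^sub>1\<^esub> \<cdots> x\<^bsub>i\<^sub>sj\<^sub>s\<^esub>\<close>. As an additive monoid of exponents, words make
  \<^typ>\<open>'a \<Rightarrow>\<^sub>0 'b\<close> the free associative algebra, and pairs of words its tensor square.\<close>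

datatype monom_word = Word (letters: "(nat \<times> nat) list")

instantiation monom_word :: monoid_add
begin

definition zero_monom_word :: monom_word where "0 = Word []"

definition plus_monom_word :: "monom_word \<Rightarrow> monom_word \<Rightarrow> monom_word" where
  "u + v = Word (letters u @ letters v)"

instance
  by standard (simp_all add: zero_monom_word_def plus_monom_word_def)

end

type_synonym 'k free = "monom_word \<Rightarrow>\<^sub>0 'k"
type_synonym 'k free2 = "(monom_word \<times> monom_word) \<Rightarrow>\<^sub>0 'k"

definition words :: "nat \<Rightarrow> monom_word set" where
  "words n = {w. set (letters w) \<subseteq> {..<n} \<times> {..<n}}"

definition free_alg :: "nat \<Rightarrow> ('k::field) free ring" where
  "free_alg n =
     \<lparr>carrier = {f. Poly_Mapping.keys f \<subseteq> words n},
      mult = (*), one = 1, zero = 0, add = (+)\<rparr>"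

definition free_alg2 :: "nat \<Rightarrow> ('k::field) free2 ring" where
  "free_alg2 n =
     \<lparr>carrier = {f. Poly_Mapping.keys f \<subseteq> words n \<times> words n},
      mult = (*), one = 1, zero = 0, add = (+)\<rparr>"

definition free_gen :: "nat \<Rightarrow> nat \<Rightarrow> ('k::field) free" where
  "free_gen i j = Poly_Mapping.single (Word [(i, j)]) 1"

definition free_scale :: "'k::field \<Rightarrow> 'k free \<Rightarrow> 'k free" where
  "free_scale c f = Poly_Mapping.single 0 c * f"

definition free_tensor :: "('k::field) free \<Rightarrow> 'k free \<Rightarrow> 'k free2" where
  "free_tensor f g =
     (\<Sum>u\<in>Poly_Mapping.keys f. \<Sum>v\<in>Poly_Mapping.keys g.
        Poly_Mapping.single (u, v) (Poly_Mapping.lookup f u * Poly_Mapping.lookup g v))"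

definition frt_relation :: "'k::field \<Rightarrow> nat \<Rightarrow> nat \<Rightarrow> nat \<Rightarrow> nat \<Rightarrow> nat \<Rightarrow> 'k free" where
  "frt_relation q n p s i j =
     (\<Sum>k<n. \<Sum>l<n. free_scale (R_coef q p s k l) (free_gen k i * free_gen l j))
     - (\<Sum>k<n. \<Sum>l<n. free_scale (R_coef q k l i j) (free_gen p k * free_gen s l))"

definition frt_ideal :: "'k::field \<Rightarrow> nat \<Rightarrow> 'k free set" where
  "frt_ideal q n =
     Idl\<^bsub>free_alg n\<^esub> {frt_relation q n p s i j | p s i j. p < n \<and> s < n \<and> i < n \<and> j < n}"

definition aq :: "'k::field \<Rightarrow> nat \<Rightarrow> 'k free set ring" where
  "aq q n = free_alg n Quot frt_ideal q n"

definition aq_class :: "'k::field \<Rightarrow> nat \<Rightarrow> 'k free \<Rightarrow> 'k free set" where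
  "aq_class q n f = frt_ideal q n +>\<^bsub>free_alg n\<^esub> f"

definition aq_gen :: "'k::field \<Rightarrow> nat \<Rightarrow> nat \<Rightarrow> nat \<Rightarrow> 'k free set" where
  "aq_gen q n i j = aq_class q n (free_gen i j)"

definition aq_degree :: "'k::field \<Rightarrow> nat \<Rightarrow> nat \<Rightarrow> 'k free set set" where
  "aq_degree q n e =
     {aq_class q n f | f. f \<in> carrier (free_alg n) \<and>
        (\<forall>w\<in>Poly_Mapping.keys f. length (letters w) = e)}"

text \<open>\<open>A \<otimes> A\<close> is the quotient of \<open>F \<otimes> F\<close> (\<open>F\<close> the free algebra) by
  \<open>I \<otimes> F + F \<otimes> I\<close>, the ideal generated by \<open>I \<otimes> 1\<close> and \<open>1 \<otimes> I\<close>.\<close>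

definition frt_ideal2 :: "'k::field \<Rightarrow> nat \<Rightarrow> 'k free2 set" where
  "frt_ideal2 q n =
     Idl\<^bsub>free_alg2 n\<^esub> ((\<lambda>f. free_tensor f 1) ` frt_ideal q n \<union> free_tensor 1 ` frt_ideal q n)"

definition aq2 :: "'k::field \<Rightarrow> nat \<Rightarrow> 'k free2 set ring" where
  "aq2 q n = free_alg2 n Quot frt_ideal2 q n"

definition aq2_class :: "'k::field \<Rightarrow> nat \<Rightarrow> 'k free2 \<Rightarrow> 'k free2 set" where
  "aq2_class q n f = frt_ideal2 q n +>\<^bsub>free_alg2 n\<^esub> f"

text \<open>Maps out of \<open>A\<close> are given on the free algebra and descend to cosets; the
  value on a coset is the common value on all its representatives.\<close>

definition aq_tensor :: "'k::field \<Rightarrow> nat \<Rightarrow> 'k free set \<Rightarrow> 'k free set \<Rightarrow> 'k free2 set" where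
  "aq_tensor q n C D = the_elem ((\<lambda>(f, g). aq2_class q n (free_tensor f g)) ` (C \<times> D))"

text \<open>The multiplicative extension of \<open>\<Delta>(x\<^bsub>ij\<^esub>) = \<Sum>\<^sub>k x\<^bsub>ik\<^esub> \<otimes> x\<^bsub>kj\<^esub>\<close> sends
  \<open>x\<^bsub>i\<^sub>1j\<^sub>1\<^esub> \<cdots> x\<^bsub>i\<^sub>sj\<^sub>s\<^esub>\<close> to the product of the \<open>\<Delta>(x\<^bsub>i\<^sub>rj\<^sub>r\<^esub>)\<close> in this order.\<close>

definition free_comult_word :: "nat \<Rightarrow> monom_word \<Rightarrow> ('k::field) free2" where
  "free_comult_word n w =
     (\<Prod>(i, j)\<leftarrow>letters w. \<Sum>k<n. free_tensor (free_gen i k) (free_gen k j))"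

definition free_comult :: "nat \<Rightarrow> ('k::field) free \<Rightarrow> 'k free2" where
  "free_comult n f =
     (\<Sum>w\<in>Poly_Mapping.keys f.
        Poly_Mapping.single 0 (Poly_Mapping.lookup f w) * free_comult_word n w)"

definition aq_comult :: "'k::field \<Rightarrow> nat \<Rightarrow> 'k free set \<Rightarrow> 'k free2 set" where
  "aq_comult q n C = the_elem ((\<lambda>f. aq2_class q n (free_comult n f)) ` C)"

definition counit_word :: "(nat \<times> nat) list \<Rightarrow> 'k::field" where
  "counit_word w = (\<Prod>(i, j)\<leftarrow>w. of_bool (i = j))"

definition free_counit :: "('k::field) free \<Rightarrow> 'k" where
  "free_counit f =
     (\<Sum>w\<in>Poly_Mapping.keys f. Poly_Mapping.lookup f w * counit_word (letters w))"

definition aq_counit :: "('k::field) free set \<Rightarrow> 'k" where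
  "aq_counit C = the_elem (free_counit ` C)"


section \<open>The universal r-form\<close>

text \<open>
  The braiding has the form \<open>R\<^bsub>V,W\<^esub>(v \<otimes> w) = \<Sum> r(v\<^sub>1, w\<^sub>1) w\<^sub>0 \<otimes> v\<^sub>0\<close> for a
  bilinear form \<open>r\<close> on \<open>A\<^sub>q(n,n)\<close>. Under this formula
  \<open>R\<^bsub>V\<^sub>n,V\<^sub>n\<^esub> = R\<^sub>n\<close> says \<open>r(x\<^bsub>ki\<^esub>, x\<^bsub>lj\<^esub>) = R\<^sup>l\<^sup>k\<^bsub>ij\<^esub>\<close>, and the two hexagon identities
  \<open>R\<^bsub>V\<otimes>W,U\<^esub> = (R\<^bsub>V,U\<^esub> \<otimes> 1)(1 \<otimes> R\<^bsub>W,U\<^esub>)\<close> and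
  \<open>R\<^bsub>V,W\<otimes>U\<^esub> = (1 \<otimes> R\<^bsub>V,U\<^esub>)(R\<^bsub>V,W\<^esub> \<otimes> 1)\<close> say
  \<open>r(ab, c) = \<Sum> r(a, c\<^sub>1) r(b, c\<^sub>2)\<close> and \<open>r(a, bc) = \<Sum> r(a\<^sub>1, c) r(a\<^sub>2, b)\<close>,
  with \<open>r(1, a) = r(a, 1) = \<epsilon>(a)\<close>. These determine \<open>r\<close>: the two functions below
  implement them by recursion on the second and on the first argument.
\<close>

fun r_letter :: "'k::field \<Rightarrow> nat \<Rightarrow> nat \<times> nat \<Rightarrow> (nat \<times> nat) list \<Rightarrow> 'k" where
  "r_letter q n (k, i) [] = of_bool (k = i)"
| "r_letter q n (k, i) ((l, j) # b) = (\<Sum>m<n. r_letter q n (k, m) b * R_coef q l m i j)"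

fun r_word :: "'k::field \<Rightarrow> nat \<Rightarrow> (nat \<times> nat) list \<Rightarrow> (nat \<times> nat) list \<Rightarrow> 'k" where
  "r_word q n [] b = counit_word b"
| "r_word q n (x # a) b =
     (\<Sum>M\<in>idx n (length b).
        r_letter q n x (zip (map fst b) M) * r_word q n a (zip M (map snd b)))"

definition free_r :: "'k::field \<Rightarrow> nat \<Rightarrow> 'k free \<Rightarrow> 'k free \<Rightarrow> 'k" where
  "free_r q n f g =
     (\<Sum>a\<in>Poly_Mapping.keys f. \<Sum>b\<in>Poly_Mapping.keys g.
        Poly_Mapping.lookup f a * Poly_Mapping.lookup g b * r_word q n (letters a) (letters b))"

definition aq_r :: "'k::field \<Rightarrow> nat \<Rightarrow> 'k free set \<Rightarrow> 'k free set \<Rightarrow> 'k" where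
  "aq_r q n C D = the_elem ((\<lambda>(f, g). free_r q n f g) ` (C \<times> D))"


section \<open>Comodules and \<open>e\<close>-Hecke pairs\<close>

text \<open>
  A finite dimensional right \<open>A\<^sub>q(n,n)\<close>-comodule is given in coordinates: its underlying
  space is \<open>k\<^sup>N\<close> with standard basis \<open>u\<^sub>0, \<dots>, u\<^bsub>N-1\<^esub>\<close> and its coaction is
  \<open>u\<^sub>j \<mapsto> \<Sum>\<^sub>i u\<^sub>i \<otimes> coef i j\<close> with entries \<open>coef i j \<in> A\<^sub>q(n,n)\<close>. The integer \<open>n\<close>
  is part of the data. The entries outside the \<open>N \<times> N\<close> square are
  \<^const>\<open>undefined\<close>, so that a record is determined by the comodule.
\<close>

record (overloaded) 'k comod =
  level :: nat
  dimn :: nat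
  coef :: "nat \<Rightarrow> nat \<Rightarrow> 'k free set"

definition mk_comod :: "nat \<Rightarrow> nat \<Rightarrow> (nat \<Rightarrow> nat \<Rightarrow> ('k::field) free set) \<Rightarrow> 'k comod" where
  "mk_comod n N a =
     \<lparr>level = n, dimn = N, coef = (\<lambda>i j. if i < N \<and> j < N then a i j else undefined)\<rparr>"

text \<open>The last two conditions are coassociativity and the counit axiom, with
  coefficients compared at basis vectors.\<close>

definition comodule :: "'k::field \<Rightarrow> 'k comod \<Rightarrow> bool" where
  "comodule q V \<longleftrightarrow>
     level V \<ge> 1 \<and>
     (\<forall>i j. \<not> (i < dimn V \<and> j < dimn V) \<longrightarrow> coef V i j = undefined) \<and>
     (\<forall>i<dimn V. \<forall>j<dimn V. coef V i j \<in> carrier (aq q (level V))) \<and>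
     (\<forall>i<dimn V. \<forall>j<dimn V.
        aq_comult q (level V) (coef V i j) =
          finsum (aq2 q (level V))
            (\<lambda>k. aq_tensor q (level V) (coef V i k) (coef V k j)) {..<dimn V}) \<and>
     (\<forall>i<dimn V. \<forall>j<dimn V. aq_counit (coef V i j) = of_bool (i = j))"

definition hecke_pair :: "'k::field \<Rightarrow> nat \<Rightarrow> 'k comod \<Rightarrow> bool" where
  "hecke_pair q e V \<longleftrightarrow>
     comodule q V \<and>
     (\<forall>i<dimn V. \<forall>j<dimn V. coef V i j \<in> aq_degree q (level V) e)"

definition comod_std :: "'k::field \<Rightarrow> nat \<Rightarrow> 'k comod" where
  "comod_std q n = mk_comod n n (aq_gen q n)"

definition comod_unit :: "'k::field \<Rightarrow> nat \<Rightarrow> 'k comod" where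
  "comod_unit q n = mk_comod n 1 (\<lambda>_ _. \<one>\<^bsub>aq q n\<^esub>)"

text \<open>In \<open>k\<^sup>N \<otimes> k\<^sup>M\<close> the basis vector \<open>u\<^sub>i \<otimes> u\<^sub>j\<close> has number \<open>i * M + j\<close>. Only
  used for two comodules of the same level.\<close>

definition comod_tensor :: "'k::field \<Rightarrow> 'k comod \<Rightarrow> 'k comod \<Rightarrow> 'k comod" where
  "comod_tensor q V W =
     mk_comod (level V) (dimn V * dimn W)
       (\<lambda>i j. coef V (i div dimn W) (j div dimn W)
                \<otimes>\<^bsub>aq q (level V)\<^esub> coef W (i mod dimn W) (j mod dimn W))"

fun comod_power :: "'k::field \<Rightarrow> 'k comod \<Rightarrow> nat \<Rightarrow> 'k comod" where
  "comod_power q V 0 = comod_unit q (level V)"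
| "comod_power q V (Suc e) = comod_tensor q V (comod_power q V e)"

text \<open>Direct sum of \<open>d\<close> copies: number \<open>c * N + i\<close> is the \<open>i\<close>-th basis vector of
  copy \<open>c < d\<close>.\<close>

definition comod_copies :: "'k::field \<Rightarrow> nat \<Rightarrow> 'k comod \<Rightarrow> 'k comod" where
  "comod_copies q d V =
     mk_comod (level V) (d * dimn V)
       (\<lambda>i j. if i div dimn V = j div dimn V
               then coef V (i mod dimn V) (j mod dimn V) else \<zero>\<^bsub>aq q (level V)\<^esub>)"

definition W_pair :: "'k::field \<Rightarrow> nat \<Rightarrow> nat \<Rightarrow> nat \<Rightarrow> 'k comod" where
  "W_pair q e m d = comod_copies q d (comod_power q (comod_std q m) e)"

text \<open>The coefficient of \<open>w\<^sub>l \<otimes> v\<^sub>k\<close> in \<open>R\<^bsub>V,W\<^esub>(v\<^sub>i \<otimes> w\<^sub>j)\<close>.\<close>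

definition braiding :: "'k::field \<Rightarrow> 'k comod \<Rightarrow> 'k comod \<Rightarrow> nat \<Rightarrow> nat \<Rightarrow> nat \<Rightarrow> nat \<Rightarrow> 'k" where
  "braiding q V W l k i j = aq_r q (level V) (coef V k i) (coef W l j)"


section \<open>The category \<open>\<Gamma>\<^sup>d\<^bsub>q,e\<^esub>\<V>\<close>\<close>

text \<open>\<open>V\<^bsup>\<otimes>d\<^esup>\<close> has the basis \<open>u\<^bsub>L\<^esub> = u\<^bsub>L!0\<^esub> \<otimes> \<dots> \<otimes> u\<^bsub>L!(d-1)\<^esub>\<close>, \<open>L \<in> idx (dimn V) d\<close>. A
  linear map \<open>V\<^bsup>\<otimes>d\<^esup> \<rightarrow> W\<^bsup>\<otimes>d\<^esup>\<close> is the matrix whose entry at \<open>(K, L)\<close> is the coefficient of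
  \<open>u\<^bsub>K\<^esub>\<close> in the image of \<open>u\<^bsub>L\<^esub>\<close>, extended by zero.\<close>

type_synonym 'k tmat = "nat list \<times> nat list \<Rightarrow> 'k"

definition tmaps :: "nat \<Rightarrow> 'k comod \<Rightarrow> 'k comod \<Rightarrow> ('k::field) tmat set" where
  "tmaps d V W = {f. \<forall>K L. \<not> (K \<in> idx (dimn W) d \<and> L \<in> idx (dimn V) d) \<longrightarrow> f (K, L) = 0}"

definition tmat_comp :: "nat \<Rightarrow> 'k comod \<Rightarrow> ('k::field) tmat \<Rightarrow> 'k tmat \<Rightarrow> 'k tmat" where
  "tmat_comp d V g f = (\<lambda>(K, L). \<Sum>M\<in>idx (dimn V) d. g (K, M) * f (M, L))"

definition tmat_id :: "nat \<Rightarrow> 'k comod \<Rightarrow> ('k::field) tmat" where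
  "tmat_id d V = (\<lambda>(K, L). of_bool (K = L \<and> L \<in> idx (dimn V) d))"

text \<open>Action of the Artin generator: \<open>R\<^sub>V\<close> in the (0-based) tensor positions \<open>i, i + 1\<close>.\<close>

definition braid_act :: "'k::field \<Rightarrow> nat \<Rightarrow> 'k comod \<Rightarrow> nat \<Rightarrow> 'k tmat" where
  "braid_act q d V i =
     (\<lambda>(K, L).
        if K \<in> idx (dimn V) d \<and> L \<in> idx (dimn V) d \<and>
           (\<forall>p<d. p \<noteq> i \<and> p \<noteq> i + 1 \<longrightarrow> K ! p = L ! p)
        then braiding q V V (K ! i) (K ! (i + 1)) (L ! i) (L ! (i + 1)) else 0)"

text \<open>A linear map intertwines two representations of the Artin braid group on \<open>d\<close> strands
  iff it intertwines the actions of the \<open>d - 1\<close> generators.\<close>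

definition braid_hom :: "'k::field \<Rightarrow> nat \<Rightarrow> 'k comod \<Rightarrow> 'k comod \<Rightarrow> 'k tmat set" where
  "braid_hom q d V W =
     {f \<in> tmaps d V W. \<forall>i. i + 1 < d \<longrightarrow>
        tmat_comp d W (braid_act q d W i) f = tmat_comp d V f (braid_act q d V i)}"


section \<open>The category \<open>\<P>\<^sup>d\<^bsub>q,e\<^esub>\<close>\<close>

text \<open>Finite dimensional vector spaces are modelled as finite dimensional subspaces of the
  infinite dimensional space \<^typ>\<open>'k tmat\<close>. Every finite dimensional space is isomorphic
  to one of these, and the spaces \<^const>\<open>braid_hom\<close> are literally among them.\<close>

definition fscale :: "'k::field \<Rightarrow> ('x \<Rightarrow> 'k) \<Rightarrow> 'x \<Rightarrow> 'k" where
  "fscale c f = (\<lambda>x. c * f x)"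

global_interpretation fun_vs: vector_space "fscale :: 'k::field \<Rightarrow> ('x \<Rightarrow> 'k) \<Rightarrow> 'x \<Rightarrow> 'k"
  by standard (auto simp: fscale_def fun_eq_iff algebra_simps)

definition fd_space :: "('k::field) tmat set \<Rightarrow> bool" where
  "fd_space S \<longleftrightarrow> fun_vs.subspace S \<and> (\<exists>B. finite B \<and> S = fun_vs.span B)"

definition linear_map :: "('k::field) tmat set \<Rightarrow> 'k tmat set \<Rightarrow> ('k tmat \<Rightarrow> 'k tmat) \<Rightarrow> bool" where
  "linear_map S T h \<longleftrightarrow>
     h ` S \<subseteq> T \<and>
     (\<forall>x\<in>S. \<forall>y\<in>S. h (x + y) = h x + h y) \<and>
     (\<forall>c. \<forall>x\<in>S. h (fscale c x) = fscale c (h x))"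

text \<open>\<open>fob F U\<close> is \<open>F(U)\<close> and \<open>fmap F U V f\<close> is \<open>F(f) : F(U) \<rightarrow> F(V)\<close> for
  \<open>f : U \<rightarrow> V\<close>; only the values at \<open>e\<close>-Hecke pairs, morphisms and elements of \<open>F(U)\<close>
  matter.\<close>

record (overloaded) 'k pfunctor =
  fob :: "'k comod \<Rightarrow> 'k tmat set"
  fmap :: "'k comod \<Rightarrow> 'k comod \<Rightarrow> 'k tmat \<Rightarrow> 'k tmat \<Rightarrow> 'k tmat"

definition poly_functor :: "'k::field \<Rightarrow> nat \<Rightarrow> nat \<Rightarrow> 'k pfunctor \<Rightarrow> bool" where
  "poly_functor q d e F \<longleftrightarrow>
     (\<forall>U. hecke_pair q e U \<longrightarrow> fd_space (fob F U)) \<and>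
     (\<forall>U V f. hecke_pair q e U \<and> hecke_pair q e V \<and> f \<in> braid_hom q d U V \<longrightarrow>
        linear_map (fob F U) (fob F V) (fmap F U V f)) \<and>
     (\<forall>U. hecke_pair q e U \<longrightarrow> (\<forall>x\<in>fob F U. fmap F U U (tmat_id d U) x = x)) \<and>
     (\<forall>U V W f g. hecke_pair q e U \<and> hecke_pair q e V \<and> hecke_pair q e W \<and>
        f \<in> braid_hom q d U V \<and> g \<in> braid_hom q d V W \<longrightarrow>
        (\<forall>x\<in>fob F U. fmap F U W (tmat_comp d V g f) x = fmap F V W g (fmap F U V f x))) \<and>
     (\<forall>U V f g c. hecke_pair q e U \<and> hecke_pair q e V \<and>
        f \<in> braid_hom q d U V \<and> g \<in> braid_hom q d U V \<longrightarrow>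
        (\<forall>x\<in>fob F U.
           fmap F U V (f + g) x = fmap F U V f x + fmap F U V g x \<and>
           fmap F U V (fscale c f) x = fscale c (fmap F U V f x)))"

type_synonym 'k ntrans = "'k comod \<Rightarrow> 'k tmat \<Rightarrow> 'k tmat"

definition nat_trans ::
    "'k::field \<Rightarrow> nat \<Rightarrow> nat \<Rightarrow> 'k pfunctor \<Rightarrow> 'k pfunctor \<Rightarrow> 'k ntrans \<Rightarrow> bool" where
  "nat_trans q d e F G \<alpha> \<longleftrightarrow>
     (\<forall>U. hecke_pair q e U \<longrightarrow> linear_map (fob F U) (fob G U) (\<alpha> U)) \<and>
     (\<forall>U V f. hecke_pair q e U \<and> hecke_pair q e V \<and> f \<in> braid_hom q d U V \<longrightarrow>
        (\<forall>x\<in>fob F U. \<alpha> V (fmap F U V f x) = fmap G U V f (\<alpha> U x)))"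

text \<open>Equality of natural transformations with source \<open>F\<close>.\<close>

definition nt_eq ::
    "'k::field \<Rightarrow> nat \<Rightarrow> 'k pfunctor \<Rightarrow> 'k ntrans \<Rightarrow> 'k ntrans \<Rightarrow> bool" where
  "nt_eq q e F \<alpha> \<beta> \<longleftrightarrow> (\<forall>U. hecke_pair q e U \<longrightarrow> (\<forall>x\<in>fob F U. \<alpha> U x = \<beta> U x))"

definition nt_comp :: "'k ntrans \<Rightarrow> 'k ntrans \<Rightarrow> 'k ntrans" where
  "nt_comp \<beta> \<alpha> = (\<lambda>U x. \<beta> U (\<alpha> U x))"

definition nt_epi ::
    "'k::field \<Rightarrow> nat \<Rightarrow> nat \<Rightarrow> 'k pfunctor \<Rightarrow> 'k pfunctor \<Rightarrow> 'k ntrans \<Rightarrow> bool" where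
  "nt_epi q d e F G p \<longleftrightarrow>
     nat_trans q d e F G p \<and>
     (\<forall>H \<beta> \<gamma>. poly_functor q d e H \<and> nat_trans q d e G H \<beta> \<and> nat_trans q d e G H \<gamma> \<and>
        nt_eq q e F (nt_comp \<beta> p) (nt_comp \<gamma> p) \<longrightarrow> nt_eq q e G \<beta> \<gamma>)"

definition projective_functor :: "'k::field \<Rightarrow> nat \<Rightarrow> nat \<Rightarrow> 'k pfunctor \<Rightarrow> bool" where
  "projective_functor q d e P \<longleftrightarrow>
     poly_functor q d e P \<and>
     (\<forall>F G p \<alpha>. poly_functor q d e F \<and> poly_functor q d e G \<and>
        nt_epi q d e F G p \<and> nat_trans q d e P G \<alpha> \<longrightarrow>
        (\<exists>\<beta>. nat_trans q d e P F \<beta> \<and> nt_eq q e P (nt_comp p \<beta>) \<alpha>))"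

definition rep_functor :: "'k::field \<Rightarrow> nat \<Rightarrow> 'k comod \<Rightarrow> 'k pfunctor" where
  "rep_functor q d W =
     \<lparr>fob = (\<lambda>U. braid_hom q d W U), fmap = (\<lambda>U V f g. tmat_comp d U f g)\<rparr>"

text \<open>The second condition is the surjectivity of
  \<open>\<Gamma>\<^sup>d\<^sup>,\<^sup>W(U) \<otimes> F(W) \<rightarrow> F(U)\<close>: an element of the tensor product is a finite sum
  \<open>\<Sum>\<^sub>s f\<^sub>s \<otimes> v\<^sub>s\<close>, and its image is \<open>\<Sum>\<^sub>s F(f\<^sub>s)(v\<^sub>s)\<close>.\<close>

definition projective_generator :: "'k::field \<Rightarrow> nat \<Rightarrow> nat \<Rightarrow> 'k comod \<Rightarrow> bool" where
  "projective_generator q d e W \<longleftrightarrow>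
     hecke_pair q e W \<and>
     projective_functor q d e (rep_functor q d W) \<and>
     (\<forall>F U. poly_functor q d e F \<and> hecke_pair q e U \<longrightarrow>
        (\<forall>y\<in>fob F U. \<exists>(r::nat) f v.
           (\<forall>s<r. f s \<in> fob (rep_functor q d W) U \<and> v s \<in> fob F W) \<and>
           y = (\<Sum>s<r. fmap F W U (f s) (v s))))"

end

theory Submission
  imports Defs "HOL-Library.Multiset"
begin

text \<open>
  The theorem has three parts. First, a representable functor is projective by Yoneda's lemma, once it is known that
  an epimorphism of functors is surjective on every object; this follows by comparing the projection to
  the objectwise cokernel with zero (\<open>nt_epi_surj\<close>, \<open>rep_projective\<close>).

  For the generator property it suffices to write the identity of \<open>U\<^bsup>\<otimes>d\<^esup>\<close>, for every \<open>e\<close>-Hecke pair \<open>U\<close>, as a sum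
  of maps of braid group modules that factor through \<open>W\<^bsup>\<otimes>d\<^esup>\<close>, where \<open>W\<close> consists of \<open>d\<close> copies of \<open>V\<^sub>m\<^bsup>\<otimes>e\<^esup>\<close>
  (\<open>projective_generatorI\<close>). This is done in two steps.

  Step one replaces \<open>U\<close> by a sum of \<open>r\<close> copies of \<open>V\<^sub>n\<^bsup>\<otimes>e\<^esup>\<close>, where \<open>n\<close> is the level of \<open>U\<close>
  (\<open>hecke_pair_retract\<close>). A matrix that commutes with the braid group on \<open>V\<^sub>n\<^bsup>\<otimes>e\<^esup>\<close> defines a linear functional on
  \<open>A\<^sub>q(n,n)\<^sub>e\<close>, because the relations of \<open>A\<^sub>q(n,n)\<close> say just that (\<open>I1_annihilated\<close>). So \<open>U\<close> is a module
  over the commutant of the braid group. The commutant acts semisimply on tensor space, so every module over it is a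
  summand of a multiple of \<open>V\<^sub>n\<^bsup>\<otimes>e\<^esup>\<close> (\<open>module_summand\<close>). The r-form, which defines the braiding, is itself given by
  matrices in the commutant (\<open>r_word_X\<close>); hence the braiding is natural for module maps, and the tensor powers of
  inclusion and projection commute with the braid group (\<open>tp_braid_hom\<close>).

  Semisimplicity (\<open>tensor_space_semisimple\<close>) is proved by induction on \<open>e\<close> with highest weight vectors, called singular vectors
  here. If \<open>L\<close> is a simple summand in degree \<open>e\<close> with highest weight \<open>\<mu>\<close>, the singular vectors of \<open>L \<otimes> V\<^sub>n\<close> are determined
  by the box they add to \<open>\<mu>\<close>, and the Jucys--Murphy element acts on them by \<open>q\<close> to twice the content of that
  box. Highest weights are dominant, so these eigenvalues are distinct when \<open>q\<close> is not a root of unity. Together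
  with the symmetric form on tensor space, for which the Jucys--Murphy element is self-adjoint,
  this shows that each singular vector is not isotropic, and then that the submodules generated by singular vectors
  span \<open>L \<otimes> V\<^sub>n\<close>.

  Step two passes from \<open>r\<close> copies of \<open>V\<^sub>n\<^bsup>\<otimes>e\<^esup>\<close> to \<open>d\<close> copies of \<open>V\<^sub>m\<^bsup>\<otimes>e\<^esup>\<close> (\<open>W_reduce\<close>). A basis vector of the
  \<open>d\<close>-th tensor power involves at most \<open>d\<close> copies and at most \<open>e d \<le> m\<close> basis vectors of \<open>V\<^sub>n\<close>. The braid group preserves
  which copies and which basis vectors occur, and the R-matrix depends only on the order of
  the indices. So the span of the basis vectors of a given content is isomorphic to its image under an
  order preserving relabelling, which fits into \<open>W\<^bsup>\<otimes>d\<^esup>\<close>.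
\<close>

section \<open>The operators of the R-matrix\<close>

definition Rdiag :: "'k::field \<Rightarrow> nat \<Rightarrow> nat \<Rightarrow> 'k" where
  "Rdiag q i j = (if i < j then 0 else if i = j then q else q - inverse q)"

definition Roff :: "nat \<Rightarrow> nat \<Rightarrow> 'k::field" where
  "Roff i j = (if i = j then 0 else 1)"

lemma Roff_sym: "Roff i j = Roff j i"
  by (simp add: Roff_def)

text \<open>On the plane spanned by \<open>v\<^sub>i \<otimes> v\<^sub>j\<close> and \<open>v\<^sub>j \<otimes> v\<^sub>i\<close> the matrix \<open>R\<^sub>n\<close> has a diagonal part and a flip
part; the flip part is symmetric, hence so is \<open>R\<^sub>n\<close>. Nothing but the relative order of the two
indices enters, which is what later allows an order preserving change of letters.\<close>
lemma R_coef_split: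
  "R_coef q k l i j = Rdiag q i j * of_bool (k = i \<and> l = j) + Roff i j * of_bool (k = j \<and> l = i)"
  by (auto simp: R_coef_def Rdiag_def Roff_def)

definition swp :: "nat \<Rightarrow> nat list \<Rightarrow> nat list" where
  "swp i K = K[i := K ! (i + 1), i + 1 := K ! i]"

lemma length_swp [simp]: "length (swp i K) = length K"
  by (simp add: swp_def)

lemma swp_swp: "i + 1 < length K \<Longrightarrow> swp i (swp i K) = K"
  by (intro nth_equalityI) (auto simp: swp_def nth_list_update)

lemma swp_nth: "i + 1 < length K \<Longrightarrow> swp i K ! p = (if p = i then K ! (i+1) else if p = i + 1 then K ! i else K ! p)"
  by (auto simp: swp_def nth_list_update)

lemma mset_swp: "i + 1 < length K \<Longrightarrow> mset (swp i K) = mset K"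
  using mset_swap[of i K "i+1"] by (auto simp: swp_def list_update_swap)

lemma set_swp: "i + 1 < length K \<Longrightarrow> set (swp i K) = set K"
  using mset_swp mset_eq_setD by blast

lemma swp_Cons: "swp (Suc i) (l # K) = l # swp i K"
  by (simp add: swp_def)

lemma swp_append1: "i + 1 < length K \<Longrightarrow> swp i (K @ L) = swp i K @ L"
  by (auto simp: swp_def list_update_append nth_append)

lemma swp_append2: "length K = p \<Longrightarrow> swp (p + i) (K @ L) = K @ swp i L"
  by (auto simp: swp_def list_update_append nth_append)

lemma idx_swp: "i + 1 < length K \<Longrightarrow> swp i K \<in> idx n d \<longleftrightarrow> K \<in> idx n d"
  by (simp add: idx_def set_swp)

lemma finite_idx [simp]: "finite (idx n d)"
proof -
  have "idx n d = {L. set L \<subseteq> {..<n} \<and> length L = d}" by (auto simp: idx_def)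
  thus ?thesis by (simp add: finite_lists_length_eq)
qed

lemma idx_0: "idx n 0 = {[]}" by (auto simp: idx_def)

lemma idx_Suc_Cons: "idx n (Suc d) = (\<lambda>(a, K). a # K) ` ({..<n} \<times> idx n d)"
  by (auto simp: idx_def image_def length_Suc_conv)

lemma idx_Suc_snoc: "idx n (Suc d) = (\<lambda>(K, a). K @ [a]) ` (idx n d \<times> {..<n})"
  by (auto simp: idx_def image_def length_Suc_conv_rev) 

lemma Cons_idx [simp]: "a # K \<in> idx n (Suc d) \<longleftrightarrow> a < n \<and> K \<in> idx n d"
  by (auto simp: idx_def)

lemma snoc_idx [simp]: "K @ [a] \<in> idx n (Suc d) \<longleftrightarrow> a < n \<and> K \<in> idx n d"
  by (auto simp: idx_def)

lemma idx_length: "K \<in> idx n d \<Longrightarrow> length K = d" by (simp add: idx_def)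

lemma append_idx: "length K = d \<Longrightarrow> K @ L \<in> idx n (d + e) \<longleftrightarrow> K \<in> idx n d \<and> L \<in> idx n e"
  by (auto simp: idx_def)

lemma sum_idx_Cons: "(\<Sum>K\<in>idx n (Suc d). g K) = (\<Sum>a<n. \<Sum>K\<in>idx n d. g (a # K))"
proof -
  have "inj_on (\<lambda>(a, K). a # K) ({..<n} \<times> idx n d)" by (auto simp: inj_on_def)
  thus ?thesis unfolding idx_Suc_Cons
    by (simp add: sum.reindex sum.cartesian_product case_prod_unfold)
qed

lemma sum_idx_snoc: "(\<Sum>K\<in>idx n (Suc d). g K) = (\<Sum>a<n. \<Sum>K\<in>idx n d. g (K @ [a]))"
proof -
  have "inj_on (\<lambda>(K, a). K @ [a]) (idx n d \<times> {..<n})" by (auto simp: inj_on_def)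
  thus ?thesis unfolding idx_Suc_snoc
    by (subst sum.swap) (simp add: sum.reindex sum.cartesian_product case_prod_unfold)
qed

type_synonym 'k vec = "nat list \<Rightarrow> 'k"
type_synonym 'k mat = "nat list \<Rightarrow> nat list \<Rightarrow> 'k"

declare plus_fun_def [simp del]

abbreviation lin :: "(('a \<Rightarrow> 'k::field) \<Rightarrow> ('b \<Rightarrow> 'k)) \<Rightarrow> bool" where
  "lin f \<equiv> Vector_Spaces.linear fscale fscale f"

lemma linI: "(\<And>x y. f (x + y) = f x + f y) \<Longrightarrow> (\<And>c x. f (fscale c x) = fscale c (f x)) \<Longrightarrow> lin f"
  by unfold_locales (auto simp: fscale_def fun_eq_iff algebra_simps)

lemma lin_add: "lin f \<Longrightarrow> f (x + y) = f x + f y"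
  and lin_scale: "lin f \<Longrightarrow> f (fscale c x) = fscale c (f x)"
  by (auto simp: Vector_Spaces.linear_def module_hom_def module_hom_axioms_def)

lemma lin_module_hom: "lin f \<Longrightarrow> module_hom fscale fscale f"
  by (simp add: module_hom_iff_linear)

lemma lin_0: "lin f \<Longrightarrow> f 0 = 0" by (rule module_hom.zero[OF lin_module_hom])
lemma lin_sum: "lin f \<Longrightarrow> f (\<Sum>a\<in>A. g a) = (\<Sum>a\<in>A. f (g a))" by (rule module_hom.sum[OF lin_module_hom])
lemma lin_diff: "lin f \<Longrightarrow> f (x - y) = f x - f y" by (rule module_hom.diff[OF lin_module_hom])
lemma lin_compo: "lin f \<Longrightarrow> lin g \<Longrightarrow> lin (f \<circ> g)"
  by (rule Vector_Spaces.linear_compose)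
lemma lin_comp: "lin f \<Longrightarrow> lin g \<Longrightarrow> lin (\<lambda>x. f (g x))"
  using lin_compo by (auto simp: o_def)

lemma sum_fun_apply: "(\<Sum>a\<in>A. g a) x = (\<Sum>a\<in>A. g a x)"
  by (induction A rule: infinite_finite_induct) auto

definition delta :: "'a \<Rightarrow> 'a \<Rightarrow> 'k::field" where
  "delta L = (\<lambda>K. of_bool (K = L))"

lemma delta_expand:
  assumes "finite A" "\<And>K. K \<notin> A \<Longrightarrow> x K = 0"
  shows "x = (\<Sum>L\<in>A. fscale (x L) (delta L))"
proof
  fix K
  have "(\<Sum>L\<in>A. fscale (x L) (delta L)) K = (\<Sum>L\<in>A. if L = K then x K else 0)"
    unfolding sum_fun_apply by (rule sum.cong) (auto simp: fscale_def delta_def)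
  also have "\<dots> = x K" using assms by (auto simp: sum.delta)
  finally show "x K = (\<Sum>L\<in>A. fscale (x L) (delta L)) K" by simp
qed

locale hecke =
  fixes q :: "'k::field"
  assumes q0: "q \<noteq> 0"
begin

text \<open>\<open>R\<^sub>n\<close> in the positions \<open>i\<close>, \<open>i + 1\<close>, acting on coordinate functions of tensors of every degree and
every \<open>n\<close> at once. Outside its range the operator is \<open>0\<close> instead of the identity, which keeps the
braid relations true without side conditions.\<close>
definition T :: "nat \<Rightarrow> 'k vec \<Rightarrow> 'k vec" where
  "T i x = (\<lambda>K. if i + 1 < length K then Rdiag q (K ! i) (K ! (i + 1)) * x K
              + Roff (K ! i) (K ! (i + 1)) * x (swp i K) else 0)"

lemma lin_T: "lin (T i)"
  by (rule linI) (auto simp: T_def fscale_def fun_eq_iff algebra_simps)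

lemma T_far: assumes "i + 1 < j" shows "T i (T j x) = T j (T i x)"
proof
  fix K
  show "T i (T j x) K = T j (T i x) K"
  proof (cases "j + 1 < length K")
    case True
    have "swp i (swp j K) = swp j (swp i K)" using True assms
      by (intro nth_equalityI) (auto simp: swp_nth)
    thus ?thesis using True assms by (simp add: T_def swp_nth algebra_simps)
  next
    case False thus ?thesis by (auto simp: T_def)
  qed
qed

text \<open>The Yang--Baxter equation. Only the three letters in positions \<open>i\<close>, \<open>i + 1\<close>, \<open>i + 2\<close> matter, so
it is a finite check over their relative orders.\<close>
lemma T_braid: "T i (T (i+1) (T i x)) = T (i+1) (T i (T (i+1) x))"
proof
  fix K
  show "T i (T (i+1) (T i x)) K = T (i+1) (T i (T (i+1) x)) K"
  proof (cases "i + 2 < length K")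
    case True
    define a b c where "a = K ! i" and "b = K ! (i+1)" and "c = K ! (i+2)"
    define z where "z u v w = K[i := u, i+1 := v, i+2 := w]" for u v w
    have zn: "z u v w ! i = u" "z u v w ! (Suc i) = v" "z u v w ! (Suc (Suc i)) = w" "length (z u v w) = length K" for u v w
      using True by (auto simp: z_def nth_list_update)
    have s1: "swp i (z u v w) = z v u w" "swp (Suc i) (z u v w) = z u w v" for u v w
      using True by (auto simp: swp_def z_def nth_list_update intro!: nth_equalityI)
    have Kz: "K = z a b c" using True by (auto simp: a_def b_def c_def z_def)
    have T1: "T i y (z u v w) = Rdiag q u v * y (z u v w) + Roff u v * y (z v u w)"
     and T2: "T (i+1) y (z u v w) = Rdiag q v w * y (z u v w) + Roff v w * y (z u w v)" for y u v w
      using True zn by (auto simp: T_def s1)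
    show ?thesis unfolding Kz T1 T2
      using q0
      by (cases a b rule: linorder_cases; cases b c rule: linorder_cases; cases a c rule: linorder_cases)
         (auto simp: Rdiag_def Roff_def field_simps)
  next
    case False thus ?thesis by (auto simp: T_def)
  qed
qed

lemma T_delta: "T i (delta L) = (if i + 1 < length L then
    fscale (Rdiag q (L ! i) (L ! (i+1))) (delta L) + fscale (Roff (L ! i) (L ! (i+1))) (delta (swp i L)) else 0)"
proof
  fix K
  have 1: "swp i K = L \<longleftrightarrow> swp i L = K" if "i + 1 < length K" "length K = length L"
    using that swp_swp[of i K] swp_swp[of i L] by auto
  show "T i (delta L) K = (if i + 1 < length L then
    fscale (Rdiag q (L ! i) (L ! (i+1))) (delta L) + fscale (Roff (L ! i) (L ! (i+1))) (delta (swp i L)) else 0) K"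
  proof (cases "length K = length L \<and> i + 1 < length K")
    case True
    have "L ! i = L ! Suc i" if "swp i L = L"
      using swp_nth[of i L i] True that by simp
    thus ?thesis using 1 True by (auto simp: T_def delta_def fscale_def swp_nth Roff_sym)
  next
    case False
    note length_swp[of i K] length_swp[of i L]
    with False have "K \<noteq> L \<or> \<not> i + 1 < length L" "swp i K \<noteq> L \<or> \<not> i + 1 < length L" "K \<noteq> swp i L \<or> \<not> i + 1 < length L" "i + 1 < length K \<Longrightarrow> length K \<noteq> length L"
      by metis+
    thus ?thesis using False by (auto simp: T_def delta_def fscale_def)
  qed
qed

text \<open>\<open>C p s\<close> carries the strand in position \<open>p\<close> to the right over \<open>s\<close> strands, and \<open>D p s\<close> carries the
strand in position \<open>p + s\<close> to the left. Every braid that is needed is composed of these two.\<close>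
primrec C :: "nat \<Rightarrow> nat \<Rightarrow> 'k vec \<Rightarrow> 'k vec" where
  "C p 0 x = x"
| "C p (Suc s) x = T (p + s) (C p s x)"

primrec D :: "nat \<Rightarrow> nat \<Rightarrow> 'k vec \<Rightarrow> 'k vec" where
  "D p 0 x = x"
| "D p (Suc s) x = D p s (T (p + s) x)"

lemma lin_C: "lin (C p s)"
proof (induction s)
  case 0 show ?case by (rule linI) auto
next
  case (Suc s) thus ?case using lin_comp[OF lin_T Suc.IH] by simp
qed

lemma lin_D: "lin (D p s)"
proof (induction s)
  case 0 show ?case by (rule linI) auto
next
  case (Suc s) thus ?case using lin_comp[OF Suc.IH lin_T] by simp
qed

lemma C_front: "C p (Suc s) x = C (Suc p) s (T p x)"
  by (induction s) auto

lemma C_far: "i + 1 < p \<or> p + s < i \<Longrightarrow> C p s (T i x) = T i (C p s x)"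
proof (induction s)
  case (Suc s)
  hence "T (p+s) (T i y) = T i (T (p+s) y)" for y
    using T_far[of i "p+s"] T_far[of "p+s" i] by fastforce
  thus ?case using Suc by auto
qed simp

lemma D_far: "i + 1 < p \<or> p + s < i \<Longrightarrow> D p s (T i x) = T i (D p s x)"
proof (induction s arbitrary: x)
  case (Suc s)
  hence "T (p+s) (T i y) = T i (T (p+s) y)" for y
    using T_far[of i "p+s"] T_far[of "p+s" i] by fastforce
  thus ?case using Suc by auto
qed simp

text \<open>A crossing of two strands slides through a strand that passes over both of them; the crossing
moves by one position. This and \<open>D_shift\<close> are the Yang--Baxter equation for long strands.\<close>
lemma C_shift: "p \<le> i \<Longrightarrow> i + 1 < p + s \<Longrightarrow> C p s (T (Suc i) x) = T i (C p s x)"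
proof (induction s)
  case (Suc s)
  show ?case
  proof (cases "i + 1 < p + s")
    case True
    thus ?thesis using Suc T_far[of i "p+s"] by auto
  next
    case False
    hence i: "p + s = Suc i" using Suc by auto
    then obtain s' where s': "s = Suc s'" "p + s' = i" using Suc by (cases s) auto
    have "C p s' (T (Suc i) x) = T (Suc i) (C p s' x)" using s' by (intro C_far) auto
    thus ?thesis using i s' T_braid[of i "C p s' x"] by auto
  qed
qed simp

lemma D_shift: "p \<le> i \<Longrightarrow> i + 1 < p + s \<Longrightarrow> D p s (T i x) = T (Suc i) (D p s x)"
proof (induction s arbitrary: x)
  case (Suc s)
  show ?case
  proof (cases "i + 1 < p + s")
    case True
    thus ?thesis using Suc T_far[of i "p+s", symmetric] by auto
  next
    case False
    hence i: "p + s = Suc i" using Suc by auto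
    then obtain s' where s': "s = Suc s'" "p + s' = i" using Suc by (cases s) auto
    have "D p s' (T (Suc i) y) = T (Suc i) (D p s' y)" for y using s' by (intro D_far) auto
    thus ?thesis using i s' T_braid[of i x] by simp
  qed
qed simp

text \<open>The full crossing of the \<open>e1\<close> strands that start at position \<open>p\<close> with the next \<open>e2\<close> strands. It is
the braiding of \<open>V\<^bsup>\<otimes>e1\<^esup>\<close> with \<open>V\<^bsup>\<otimes>e2\<^esup>\<close>.\<close>
primrec X :: "nat \<Rightarrow> nat \<Rightarrow> nat \<Rightarrow> 'k vec \<Rightarrow> 'k vec" where
  "X p 0 e2 x = x"
| "X p (Suc e1) e2 x = C p e2 (X (Suc p) e1 e2 x)"

lemma lin_X: "lin (X p e1 e2)"
proof (induction e1 arbitrary: p)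
  case 0 show ?case by (rule linI) auto
next
  case (Suc s) thus ?case using lin_comp[OF lin_C Suc.IH] by simp
qed

lemma X_far: "i + 1 < p \<Longrightarrow> X p e1 e2 (T i x) = T i (X p e1 e2 x)"
  by (induction e1 arbitrary: p) (auto simp: C_far)

lemma X_shift_right: "i + 1 < e2 \<Longrightarrow> X p e1 e2 (T (p + e1 + i) x) = T (p + i) (X p e1 e2 x)"
proof (induction e1 arbitrary: p)
  case (Suc e1)
  have "X (Suc p) e1 e2 (T (p + Suc e1 + i) x) = T (Suc p + i) (X (Suc p) e1 e2 x)"
    using Suc.IH[of "Suc p"] Suc.prems by simp
  thus ?case using C_shift[of p "p+i" e2] Suc.prems by simp
qed simp

lemma CC_T: "C p s (C (Suc p) s (T p x)) = T (p + s) (C p s (C (Suc p) s x))"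
proof (induction s)
  case (Suc s)
  have c: "C p s (T (Suc (p + s)) y) = T (Suc (p+s)) (C p s y)" for y by (rule C_far) auto
  show ?case using T_braid[of "p+s"] by (simp add: c Suc.IH)
qed simp

lemma X_shift_left: "i + 1 < e1 \<Longrightarrow> X p e1 e2 (T (p + i) x) = T (p + e2 + i) (X p e1 e2 x)"
proof (induction e1 arbitrary: p i)
  case (Suc e1)
  show ?case
  proof (cases i)
    case 0
    then obtain e where e: "e1 = Suc e" using Suc.prems by (cases e1) auto
    show ?thesis using 0 e CC_T[of p e2] X_far[of p "Suc (Suc p)" e e2 x] by simp
  next
    case (Suc j)
    have "X (Suc p) e1 e2 (T (Suc p + j) x) = T (Suc p + e2 + j) (X (Suc p) e1 e2 x)"
      using Suc.IH[of j "Suc p"] Suc.prems \<open>i = Suc j\<close> by simp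
    thus ?thesis using Suc C_far[of "Suc p + e2 + j" p e2] by simp
  qed
qed simp

end

section \<open>Tensor space and the commutant of the braid group\<close>

text \<open>\<open>sp n e\<close> is \<open>V\<^sub>n\<^bsup>\<otimes>e\<^esup>\<close> in coordinates. \<open>emb j\<close> is \<open>w \<mapsto> w \<otimes> v\<^sub>j\<close>, and \<open>cmp k\<close> extracts the component at
\<open>v\<^sub>k\<close> in the last tensor factor; \<open>ip\<close> is the symmetric form with the standard basis orthonormal,
and \<open>wtv \<mu> x\<close> says that \<open>x\<close> is a weight vector whose weight is the multiset \<open>\<mu>\<close> of letters.\<close>
definition sp :: "nat \<Rightarrow> nat \<Rightarrow> ('k::field) vec set" where
  "sp n e = {x. \<forall>K. K \<notin> idx n e \<longrightarrow> x K = 0}"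

definition app :: "nat \<Rightarrow> nat \<Rightarrow> ('k::field) mat \<Rightarrow> 'k vec \<Rightarrow> 'k vec" where
  "app n e M x = (\<lambda>K. if K \<in> idx n e then (\<Sum>L\<in>idx n e. M K L * x L) else 0)"

definition ip :: "nat \<Rightarrow> nat \<Rightarrow> ('k::field) vec \<Rightarrow> 'k vec \<Rightarrow> 'k" where
  "ip n e x y = (\<Sum>K\<in>idx n e. x K * y K)"

definition mm :: "nat \<Rightarrow> nat \<Rightarrow> ('k::field) mat \<Rightarrow> 'k mat \<Rightarrow> 'k mat" where
  "mm n e M N = (\<lambda>K L. \<Sum>P\<in>idx n e. M K P * N P L)"

definition emb :: "nat \<Rightarrow> ('k::field) vec \<Rightarrow> 'k vec" where
  "emb j w = (\<lambda>K. if K \<noteq> [] \<and> last K = j then w (butlast K) else 0)"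

definition cmp :: "nat \<Rightarrow> ('k::field) vec \<Rightarrow> 'k vec" where
  "cmp k x = (\<lambda>K. x (K @ [k]))"

definition wtv :: "nat multiset \<Rightarrow> ('k::field) vec \<Rightarrow> bool" where
  "wtv \<mu> x \<longleftrightarrow> (\<forall>K. x K \<noteq> 0 \<longrightarrow> mset K = \<mu>)"

lemma subspaceI: "0 \<in> S \<Longrightarrow> (\<And>x y. x \<in> S \<Longrightarrow> y \<in> S \<Longrightarrow> x + y \<in> S) \<Longrightarrow>
    (\<And>c x. x \<in> S \<Longrightarrow> fscale c x \<in> S) \<Longrightarrow> fun_vs.subspace S"
  by (simp add: fun_vs.subspace_def)

lemma subspace_sp: "fun_vs.subspace (sp n e)"
  by (rule subspaceI) (auto simp: sp_def fscale_def)

lemma sp_0 [simp]: "0 \<in> sp n e" by (auto simp: sp_def)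
lemma sp_add: "x \<in> sp n e \<Longrightarrow> y \<in> sp n e \<Longrightarrow> x + y \<in> sp n e" by (auto simp: sp_def)
lemma sp_scale: "x \<in> sp n e \<Longrightarrow> fscale c x \<in> sp n e" by (auto simp: sp_def fscale_def)
lemma sp_delta: "L \<in> idx n e \<Longrightarrow> delta L \<in> sp n e" by (auto simp: sp_def delta_def)
lemma sp_expand: "x \<in> sp n e \<Longrightarrow> x = (\<Sum>L\<in>idx n e. fscale (x L) (delta L))"
  by (rule delta_expand) (auto simp: sp_def)

lemma sp_eqI: "x \<in> sp n e \<Longrightarrow> y \<in> sp n e \<Longrightarrow> (\<And>K. K \<in> idx n e \<Longrightarrow> x K = y K) \<Longrightarrow> x = y"
proof
  fix K assume "x \<in> sp n e" "y \<in> sp n e" "\<And>K. K \<in> idx n e \<Longrightarrow> x K = y K"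
  thus "x K = y K" by (cases "K \<in> idx n e") (auto simp: sp_def)
qed

lemma lin_app: "lin (app n e M)"
  by (rule linI) (auto simp: app_def fscale_def fun_eq_iff sum.distrib algebra_simps sum_distrib_left)

lemma app_sp [simp]: "app n e M x \<in> sp n e"
  by (auto simp: app_def sp_def)

lemma lin_emb: "lin (emb j)"
  by (rule linI) (auto simp: emb_def fscale_def fun_eq_iff)

lemma lin_cmp: "lin (cmp k)"
  by (rule linI) (auto simp: cmp_def fscale_def fun_eq_iff)

lemma emb_snoc: "emb j w (K @ [k]) = (if k = j then w K else 0)" by (simp add: emb_def)

lemma emb_sp: "w \<in> sp n e \<Longrightarrow> j < n \<Longrightarrow> emb j w \<in> sp n (Suc e)"
proof -
  assume w: "w \<in> sp n e" and j: "j < n"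
  have "emb j w K = 0" if "K \<notin> idx n (Suc e)" for K
  proof (cases K rule: rev_cases)
    case (snoc K' k)
    thus ?thesis using that w j by (auto simp: emb_snoc sp_def)
  qed (simp add: emb_def)
  thus ?thesis by (auto simp: sp_def)
qed

lemma cmp_sp: "x \<in> sp n (Suc e) \<Longrightarrow> cmp k x \<in> sp n e"
  by (auto simp: cmp_def sp_def)

lemma cmp_big: "x \<in> sp n (Suc e) \<Longrightarrow> \<not> k < n \<Longrightarrow> cmp k x = 0"
  by (auto simp: cmp_def sp_def fun_eq_iff)

lemma cmp_emb: "cmp k (emb j w) = (if k = j then w else 0)"
  by (auto simp: cmp_def emb_snoc fun_eq_iff)

lemma emb_cmp_expand: assumes "x \<in> sp n (Suc e)" shows "x = (\<Sum>j<n. emb j (cmp j x))"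
proof
  fix K
  show "x K = (\<Sum>j<n. emb j (cmp j x)) K"
  proof (cases K rule: rev_cases)
    case Nil
    thus ?thesis using assms by (auto simp: sum_fun_apply emb_def sp_def idx_def)
  next
    case (snoc K' k)
    thus ?thesis using assms unfolding sum_fun_apply
      by (auto simp: emb_snoc cmp_def sp_def)
  qed
qed

lemma cmp_ext: "x \<in> sp n (Suc e) \<Longrightarrow> y \<in> sp n (Suc e) \<Longrightarrow> (\<And>k. k < n \<Longrightarrow> cmp k x = cmp k y) \<Longrightarrow> x = y"
proof -
  assume x: "x \<in> sp n (Suc e)" and y: "y \<in> sp n (Suc e)" and e: "\<And>k. k < n \<Longrightarrow> cmp k x = cmp k y"
  have "(\<Sum>j<n. emb j (cmp j x)) = (\<Sum>j<n. emb j (cmp j y))" by (rule sum.cong) (simp_all add: e)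
  thus "x = y" using emb_cmp_expand[OF x] emb_cmp_expand[OF y] by simp
qed

lemma ip_snoc: "ip n (Suc e) x y = (\<Sum>k<n. ip n e (cmp k x) (cmp k y))"
  by (simp add: ip_def sum_idx_snoc cmp_def)

lemma ip_sym: "ip n e x y = ip n e y x" by (simp add: ip_def mult.commute)
lemma ip_add_left: "ip n e (x + y) z = ip n e x z + ip n e y z"
  by (simp add: ip_def algebra_simps sum.distrib)
lemma ip_scale_left: "ip n e (fscale c x) z = c * ip n e x z"
  by (simp add: ip_def algebra_simps sum_distrib_left fscale_def)
lemma ip_add_right: "ip n e z (x + y) = ip n e z x + ip n e z y"
  by (simp add: ip_def algebra_simps sum.distrib)
lemma ip_scale_right: "ip n e z (fscale c x) = c * ip n e z x"
  by (simp add: ip_def algebra_simps sum_distrib_left fscale_def)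
lemma ip_0_left [simp]: "ip n e 0 z = 0" and ip_0_right [simp]: "ip n e z 0 = 0"
  by (simp_all add: ip_def)
lemma ip_delta: "K \<in> idx n e \<Longrightarrow> ip n e x (delta K) = x K"
  by (simp add: ip_def delta_def of_bool_def if_distrib[of "\<lambda>a. _ * a"] sum.delta cong: if_cong)

lemma ip_app: "ip n e (app n e M x) y = ip n e x (app n e (\<lambda>K L. M L K) y)"
proof -
  have "ip n e (app n e M x) y = (\<Sum>K\<in>idx n e. \<Sum>L\<in>idx n e. M K L * x L * y K)"
    by (simp add: ip_def app_def sum_distrib_right)
  also have "\<dots> = (\<Sum>L\<in>idx n e. \<Sum>K\<in>idx n e. M K L * x L * y K)" by (rule sum.swap)
  also have "\<dots> = ip n e x (app n e (\<lambda>K L. M L K) y)"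
    by (simp add: ip_def app_def sum_distrib_left algebra_simps)
  finally show ?thesis .
qed

lemma app_mm: "app n e (mm n e M N) x = app n e M (app n e N x)"
proof
  fix K
  show "app n e (mm n e M N) x K = app n e M (app n e N x) K"
  proof (cases "K \<in> idx n e")
    case True
    have "app n e (mm n e M N) x K = (\<Sum>L\<in>idx n e. \<Sum>P\<in>idx n e. M K P * N P L * x L)"
      using True by (simp add: app_def mm_def sum_distrib_right)
    also have "\<dots> = (\<Sum>P\<in>idx n e. \<Sum>L\<in>idx n e. M K P * N P L * x L)" by (rule sum.swap)
    also have "\<dots> = app n e M (app n e N x) K"
      using True by (simp add: app_def sum_distrib_left mult.assoc)
    finally show ?thesis .
  qed (simp add: app_def)
qed

lemma app_delta: "K \<in> idx n e \<Longrightarrow> L \<in> idx n e \<Longrightarrow> app n e M (delta L) K = M K L"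
  by (simp add: app_def delta_def of_bool_def if_distrib[of "\<lambda>a. _ * a"] sum.delta cong: if_cong)

lemma wtv_add: "wtv \<mu> x \<Longrightarrow> wtv \<mu> y \<Longrightarrow> wtv \<mu> (x + y)"
  unfolding wtv_def by (metis add.right_neutral plus_fun_apply)
lemma wtv_scale: "wtv \<mu> x \<Longrightarrow> wtv \<mu> (fscale c x)"
  unfolding wtv_def by (simp add: fscale_def)
lemma wtv_0 [simp]: "wtv \<mu> 0" by (simp add: wtv_def)
lemma wtv_emb: "wtv \<mu> w \<Longrightarrow> wtv (add_mset j \<mu>) (emb j w)"
proof -
  assume w: "wtv \<mu> w"
  have "mset K = add_mset j \<mu>" if "emb j w K \<noteq> 0" for K
    using that w by (cases K rule: rev_cases) (auto simp: emb_def wtv_def split: if_splits)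
  thus ?thesis by (auto simp: wtv_def)
qed
lemma wtv_cmp: "wtv \<mu> x \<Longrightarrow> wtv (\<mu> - {#k#}) (cmp k x)"
  unfolding wtv_def cmp_def by (metis add_diff_cancel_right' mset.simps mset_append add_mset_add_single)
lemma wtv_cmp_in: "wtv \<mu> x \<Longrightarrow> cmp k x \<noteq> 0 \<Longrightarrow> k \<in># \<mu>"
proof -
  assume w: "wtv \<mu> x" "cmp k x \<noteq> 0"
  then obtain K where "x (K @ [k]) \<noteq> 0" by (auto simp: cmp_def fun_eq_iff)
  hence "mset (K @ [k]) = \<mu>" using w by (auto simp: wtv_def)
  thus ?thesis by auto
qed

context hecke begin

text \<open>The matrices on \<open>V\<^sub>n\<^bsup>\<otimes>e\<^esup>\<close> that commute with the braid generators. As each \<open>T i\<close> is symmetric, the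
condition can be written as an equality between \<open>T i\<close> applied to a column and \<open>T i\<close> applied to a
row. This algebra is the linear dual of \<open>A\<^sub>q(n,n)\<^sub>e\<close>, the \<open>q\<close>-Schur algebra.\<close>
definition comm :: "nat \<Rightarrow> nat \<Rightarrow> 'k mat \<Rightarrow> bool" where
  "comm n e M \<longleftrightarrow> (\<forall>i K L. i + 1 < e \<longrightarrow> K \<in> idx n e \<longrightarrow> L \<in> idx n e \<longrightarrow>
      T i (\<lambda>P. M P L) K = T i (\<lambda>P. M K P) L)"

lemma commD: "comm n e M \<Longrightarrow> i + 1 < e \<Longrightarrow> K \<in> idx n e \<Longrightarrow> L \<in> idx n e \<Longrightarrow>
      T i (\<lambda>P. M P L) K = T i (\<lambda>P. M K P) L"
  by (auto simp: comm_def)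

lemma T_cong: "(\<And>R. length R = length K \<Longrightarrow> x R = y R) \<Longrightarrow> T i x K = T i y K"
  by (simp add: T_def)

lemma T_idx_cong: "(\<And>R. R \<in> idx n e \<Longrightarrow> x R = y R) \<Longrightarrow> K \<in> idx n e \<Longrightarrow> T i x K = T i y K"
  by (simp add: T_def idx_swp)

lemma T_sp: "x \<in> sp n e \<Longrightarrow> T i x \<in> sp n e"
  by (auto simp: sp_def T_def idx_swp)

lemma ip_T: assumes "i + 1 < e" shows "ip n e (T i x) y = ip n e x (T i y)"
proof -
  have b: "bij_betw (swp i) (idx n e) (idx n e)"
  proof (rule bij_betwI[where g = "swp i"])
    show "swp i \<in> idx n e \<rightarrow> idx n e" using assms by (auto simp: idx_swp idx_length)
    thus "swp i \<in> idx n e \<rightarrow> idx n e" .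
  qed (use assms in \<open>auto simp: swp_swp idx_length\<close>)
  have "(\<Sum>K\<in>idx n e. Roff (K ! i) (K ! (i+1)) * x (swp i K) * y K)
      = (\<Sum>K\<in>idx n e. Roff (swp i K ! i) (swp i K ! (i+1)) * x (swp i (swp i K)) * y (swp i K))"
    by (rule sum.reindex_bij_betw[OF b, symmetric])
  also have "\<dots> = (\<Sum>K\<in>idx n e. Roff (K ! i) (K ! (i+1)) * x K * y (swp i K))"
    using assms by (intro sum.cong) (auto simp: swp_swp idx_length swp_nth Roff_sym)
  finally have 1: "(\<Sum>K\<in>idx n e. Roff (K ! i) (K ! (i+1)) * x (swp i K) * y K)
      = (\<Sum>K\<in>idx n e. Roff (K ! i) (K ! (i+1)) * x K * y (swp i K))" .
  have "ip n e (T i x) y = (\<Sum>K\<in>idx n e. Rdiag q (K ! i) (K ! (i+1)) * x K * y K)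
     + (\<Sum>K\<in>idx n e. Roff (K ! i) (K ! (i+1)) * x (swp i K) * y K)"
    unfolding ip_def sum.distrib[symmetric]
    by (rule sum.cong) (use assms in \<open>auto simp: T_def algebra_simps idx_length\<close>)
  also have "\<dots> = ip n e x (T i y)"
    unfolding ip_def sum.distrib[symmetric] 1
    by (rule sum.cong) (use assms in \<open>auto simp: T_def algebra_simps idx_length\<close>)
  finally show ?thesis .
qed

lemma T_sum: "T i (\<lambda>P. \<Sum>a\<in>A. g a P * c a) K = (\<Sum>a\<in>A. T i (g a) K * c a)"
  by (simp add: T_def sum_distrib_left sum.distrib distrib_right mult.assoc)

lemma app_T: assumes "comm n e M" "i + 1 < e" shows "app n e M (T i x) = T i (app n e M x)"
proof (rule sp_eqI[of _ n e])
  fix K assume K: "K \<in> idx n e"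
  have "app n e M (T i x) K = ip n e (M K) (T i x)" using K by (simp add: app_def ip_def)
  also have "\<dots> = ip n e (T i (M K)) x" using assms by (simp only: ip_T)
  also have "\<dots> = (\<Sum>L\<in>idx n e. T i (\<lambda>P. M P L) K * x L)"
    unfolding ip_def using commD[OF assms K] by (intro sum.cong) auto
  also have "\<dots> = T i (\<lambda>P. \<Sum>L\<in>idx n e. M P L * x L) K" by (rule T_sum[symmetric])
  also have "\<dots> = T i (app n e M x) K" by (rule T_idx_cong[OF _ K]) (auto simp: app_def)
  finally show "app n e M (T i x) K = T i (app n e M x) K" .
qed (auto intro: T_sp)

lemma comm_transpose: "comm n e M \<Longrightarrow> comm n e (\<lambda>K L. M L K)"
  by (auto simp: comm_def)

lemma comm_mm: assumes "comm n e M" "comm n e N" shows "comm n e (mm n e M N)"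
  unfolding comm_def
proof (intro allI impI)
  fix i K L assume i: "i + 1 < e" and K: "K \<in> idx n e" and L: "L \<in> idx n e"
  have "T i (\<lambda>P. mm n e M N P L) K = T i (app n e M (\<lambda>P. N P L)) K"
    by (rule T_idx_cong[OF _ K]) (auto simp: app_def mm_def)
  also have "\<dots> = app n e M (T i (\<lambda>P. N P L)) K" by (simp only: app_T[OF assms(1) i])
  also have "\<dots> = (\<Sum>P\<in>idx n e. T i (\<lambda>R. N P R) L * M K P)"
    using K commD[OF assms(2) i _ L] by (auto simp: app_def intro!: sum.cong)
  also have "\<dots> = T i (\<lambda>R. \<Sum>P\<in>idx n e. N P R * M K P) L" by (rule T_sum[symmetric])
  finally show "T i (\<lambda>P. mm n e M N P L) K = T i (\<lambda>P. mm n e M N K P) L"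
    by (simp add: mm_def mult.commute)
qed

lemma comm_scalar: assumes "\<And>i K. i + 1 < length K \<Longrightarrow> c (swp i K) = c K"
  shows "comm n e (\<lambda>K L. of_bool (K = L) * c K)"
  unfolding comm_def
proof (intro allI impI)
  fix i K L assume i: "i + 1 < e" and K: "K \<in> idx n e" and L: "L \<in> idx n e"
  have l: "i + 1 < length K" "i + 1 < length L" using i K L by (auto simp: idx_length)
  have s: "swp i K = L \<longleftrightarrow> swp i L = K" using swp_swp[OF l(1)] swp_swp[OF l(2)] by auto
  have nn: "L ! i = L ! Suc i" if "swp i L = L" using swp_nth[OF l(2), of i] that by simp
  show "T i (\<lambda>P. of_bool (P = L) * c P) K = T i (\<lambda>P. of_bool (K = P) * c K) L"
    using l s assms[OF l(1)] nn by (auto simp: T_def swp_nth Roff_sym)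
qed

lemma comm_id: "comm n e (\<lambda>K L. of_bool (K = L))"
  using comm_scalar[of "\<lambda>_. 1" n e] by simp

lemma comm_wt: "comm n e (\<lambda>K L. of_bool (K = L) * of_bool (mset K = \<mu>))"
  by (rule comm_scalar) (simp add: mset_swp)

lemma comm_add: "comm n e M \<Longrightarrow> comm n e N \<Longrightarrow> comm n e (\<lambda>K L. M K L + N K L)"
proof -
  have "T i (\<lambda>P. x P + y P) K = T i x K + T i y K" for i x y K by (simp add: T_def algebra_simps)
  thus "comm n e M \<Longrightarrow> comm n e N \<Longrightarrow> ?thesis" by (simp add: comm_def)
qed

lemma comm_scale: "comm n e M \<Longrightarrow> comm n e (\<lambda>K L. c * M K L)"
proof -
  have "T i (\<lambda>P. c * x P) K = c * T i x K" for i x K by (simp add: T_def algebra_simps)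
  thus "comm n e M \<Longrightarrow> ?thesis" by (simp add: comm_def)
qed

lemma comm_zero: "comm n e (\<lambda>K L. 0)" by (simp add: comm_def T_def)

lemma comm_sum: "(\<And>a. a \<in> A \<Longrightarrow> comm n e (M a)) \<Longrightarrow> comm n e (\<lambda>K L. \<Sum>a\<in>A. M a K L)"
  by (induction A rule: infinite_finite_induct) (auto simp: comm_zero comm_add)

lemma app_id: "x \<in> sp n e \<Longrightarrow> app n e (\<lambda>K L. of_bool (K = L)) x = x"
  by (rule sp_eqI[of _ n e])
     (simp_all, simp add: app_def sum.delta of_bool_def if_distrib[of "\<lambda>a. a * _"] cong: if_cong)

lemma app_wt: "app n e (\<lambda>K L. of_bool (K = L) * of_bool (mset K = \<mu>)) x
   = (\<lambda>K. if K \<in> idx n e \<and> mset K = \<mu> then x K else 0)"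
  by (auto simp: app_def fun_eq_iff of_bool_def if_distrib[of "\<lambda>a. a * _"] sum.delta cong: if_cong)

definition matop :: "('k vec \<Rightarrow> 'k vec) \<Rightarrow> 'k mat" where
  "matop f = (\<lambda>K L. f (delta L) K)"

lemma comm_matop: assumes "lin f" "\<And>i x. i + 1 < e \<Longrightarrow> x \<in> sp n e \<Longrightarrow> f (T i x) = T i (f x)"
  shows "comm n e (matop f)"
  unfolding comm_def
proof (intro allI impI)
  fix i K L assume i: "i + 1 < e" and K: "K \<in> idx n e" and L: "L \<in> idx n e"
  have "T i (\<lambda>P. matop f P L) K = T i (f (delta L)) K" by (simp add: matop_def)
  also have "\<dots> = f (T i (delta L)) K" using assms(2)[OF i sp_delta[OF L]] by simp
  also have "\<dots> = T i (\<lambda>P. matop f K P) L"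
    using i L unfolding T_delta
    by (simp add: idx_length lin_add[OF assms(1)] lin_scale[OF assms(1)]) (simp add: idx_length matop_def T_def fscale_def)
  finally show "T i (\<lambda>P. matop f P L) K = T i (\<lambda>P. matop f K P) L" .
qed

lemma app_matop: assumes "lin f" "x \<in> sp n e" "f x \<in> sp n e"
  shows "app n e (matop f) x = f x"
proof (rule sp_eqI[of _ n e])
  fix K assume K: "K \<in> idx n e"
  have "f x K = f (\<Sum>L\<in>idx n e. fscale (x L) (delta L)) K" using sp_expand[OF assms(2)] by simp
  also have "\<dots> = (\<Sum>L\<in>idx n e. x L * f (delta L) K)"
    by (simp add: lin_sum[OF assms(1)] lin_scale[OF assms(1)] sum_fun_apply) (simp add: fscale_def)
  finally show "app n e (matop f) x K = f x K" using K by (simp add: app_def matop_def mult.commute)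
qed (use assms in auto)

lemma T_wtv: "wtv \<mu> x \<Longrightarrow> wtv \<mu> (T i x)"
proof -
  assume w: "wtv \<mu> x"
  have "mset K = \<mu>" if "T i x K \<noteq> 0" for K
  proof -
    have l: "i + 1 < length K" using that by (auto simp: T_def split: if_splits)
    have "x K \<noteq> 0 \<or> x (swp i K) \<noteq> 0" using that by (auto simp: T_def split: if_splits)
    thus ?thesis using w mset_swp[OF l] by (auto simp: wtv_def)
  qed
  thus ?thesis by (auto simp: wtv_def)
qed

lemma D_sp: "x \<in> sp n e \<Longrightarrow> D p s x \<in> sp n e" by (induction s arbitrary: x) (auto intro: T_sp)
lemma C_sp: "x \<in> sp n e \<Longrightarrow> C p s x \<in> sp n e" by (induction s arbitrary: x) (auto intro: T_sp)
lemma D_wtv: "wtv \<mu> x \<Longrightarrow> wtv \<mu> (D p s x)" by (induction s arbitrary: x) (auto intro: T_wtv)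
lemma C_wtv: "wtv \<mu> x \<Longrightarrow> wtv \<mu> (C p s x)" by (induction s arbitrary: x) (auto intro: T_wtv)

lemma D_cong: "(\<And>R. length R = length K \<Longrightarrow> x R = y R) \<Longrightarrow> D p s x K = D p s y K"
proof (induction s arbitrary: x y)
  case (Suc s)
  have "T (p+s) x R = T (p+s) y R" if "length R = length K" for R
    by (rule T_cong) (use Suc.prems that in auto)
  thus ?case using Suc.IH[of "T (p+s) x" "T (p+s) y"] by simp
qed simp

lemma C_cong: "(\<And>R. length R = length K \<Longrightarrow> x R = y R) \<Longrightarrow> C p s x K = C p s y K"
proof (induction s arbitrary: K)
  case (Suc s)
  have "C p s x R = C p s y R" if "length R = length K" for R
    by (rule Suc.IH) (use Suc.prems that in auto)
  thus ?case by (auto intro: T_cong)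
qed simp

lemma T_append: "i + 1 < length P \<Longrightarrow> T i y (P @ Q) = T i (\<lambda>R. y (R @ Q)) P"
  by (auto simp: T_def nth_append swp_append1)

lemma D_append: "p + s < length P \<Longrightarrow> D p s y (P @ Q) = D p s (\<lambda>R. y (R @ Q)) P"
proof (induction s arbitrary: y)
  case (Suc s)
  have "D p (Suc s) y (P @ Q) = D p s (\<lambda>R. T (p + s) y (R @ Q)) P" using Suc by simp
  also have "\<dots> = D p s (T (p+s) (\<lambda>R. y (R @ Q))) P"
    by (rule D_cong) (use Suc.prems in \<open>simp add: T_append\<close>)
  finally show ?case by simp
qed simp

lemma C_append: "p + s < length P \<Longrightarrow> C p s y (P @ Q) = C p s (\<lambda>R. y (R @ Q)) P"
proof (induction s arbitrary: P)
  case (Suc s)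
  have "C p (Suc s) y (P @ Q) = T (p+s) (\<lambda>R. C p s y (R @ Q)) P" using Suc.prems by (simp add: T_append)
  also have "\<dots> = T (p+s) (C p s (\<lambda>R. y (R @ Q))) P"
    by (rule T_cong) (use Suc in simp)
  finally show ?case by simp
qed simp

lemma T_hd: "T (Suc i) y (l # K) = T i (\<lambda>R. y (l # R)) K"
  by (simp add: T_def swp_Cons)

lemma app_D: "comm n e M \<Longrightarrow> p + s < e \<Longrightarrow> app n e M (D p s x) = D p s (app n e M x)"
  by (induction s arbitrary: x) (auto simp: app_T)
lemma app_C: "comm n e M \<Longrightarrow> p + s < e \<Longrightarrow> app n e M (C p s x) = C p s (app n e M x)"
  by (induction s arbitrary: x) (auto simp: app_T)

lemma ip_C: "p + s < e \<Longrightarrow> ip n e (C p s x) y = ip n e x (D p s y)"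
  by (induction s arbitrary: y) (auto simp: ip_T)

lemma T_emb: assumes "w \<in> sp n e" "i + 1 < e" shows "emb j (T i w) = T i (emb j w)"
proof
  fix K
  show "emb j (T i w) K = T i (emb j w) K"
  proof (cases K rule: rev_cases)
    case (snoc P k)
    show ?thesis
    proof (cases "length P = e")
      case True
      thus ?thesis using snoc assms(2) T_append[of i P "emb j w" "[k]"]
        by (auto simp: emb_snoc T_def)
    next
      case False
      hence 0: "w R = 0" if "length R = length P" for R using assms that by (auto simp: sp_def idx_def)
      have "T i w P = 0" using 0 by (simp add: T_def)
      moreover have "emb j w R = 0" if "length R = length K" for R
        using 0 that snoc by (cases R rule: rev_cases) (auto simp: emb_snoc emb_def)
      ultimately show ?thesis using snoc by (simp add: emb_snoc) (simp add: T_def)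
    qed
  qed (auto simp: emb_def T_def)
qed

lemma T_cmp: assumes "x \<in> sp n (Suc e)" "i + 1 < e" shows "cmp k (T i x) = T i (cmp k x)"
proof
  fix P
  show "cmp k (T i x) P = T i (cmp k x) P"
  proof (cases "length P = e")
    case True
    thus ?thesis using assms(2) T_append[of i P x "[k]"] by (simp add: cmp_def)
  next
    case False
    hence 0: "x R = 0" if "length R = Suc (length P)" for R using assms that by (auto simp: sp_def idx_def)
    thus ?thesis by (simp add: cmp_def T_def)
  qed
qed

text \<open>An operator on \<open>e + 1\<close> factors that commutes with the braids on the first \<open>e\<close> factors has, with respect
to the last factor, blocks in the commutant of degree \<open>e\<close>; the next lemma recovers the
operator from its blocks. Subspaces that are stable under the commutant of degree \<open>e\<close> thereby give
subspaces stable under the commutant of degree \<open>e + 1\<close>.\<close>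
lemma block_comm:
  assumes f: "lin f" "\<And>x. x \<in> sp n (Suc e) \<Longrightarrow> f x \<in> sp n (Suc e)"
    "\<And>i x. i + 1 < e \<Longrightarrow> x \<in> sp n (Suc e) \<Longrightarrow> f (T i x) = T i (f x)" and j: "j < n"
  shows "comm n e (matop (\<lambda>w. cmp k (f (emb j w))))"
proof (rule comm_matop)
  show "lin (\<lambda>w. cmp k (f (emb j w)))"
    by (intro lin_comp[OF lin_cmp] lin_comp[OF f(1)] lin_emb)
  fix i and x :: "'k vec" assume "i + 1 < e" and x: "x \<in> sp n e"
  thus "cmp k (f (emb j (T i x))) = T i (cmp k (f (emb j x)))"
    using f(3)[of i "emb j x"] emb_sp[OF x j] T_emb[of x n e i j] T_cmp[OF f(2)] by metis
qed

lemma block_expand: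
  assumes f: "lin f" "\<And>x. x \<in> sp n (Suc e) \<Longrightarrow> f x \<in> sp n (Suc e)" and x: "x \<in> sp n (Suc e)"
  shows "cmp k (f x) = (\<Sum>j<n. app n e (matop (\<lambda>w. cmp k (f (emb j w)))) (cmp j x))"
proof -
  have l: "lin (\<lambda>w. cmp k (f (emb j w)))" for j
    by (intro lin_comp[OF lin_cmp] lin_comp[OF f(1)] lin_emb)
  have "cmp k (f x) = cmp k (f (\<Sum>j<n. emb j (cmp j x)))" using emb_cmp_expand[OF x] by simp
  also have "\<dots> = (\<Sum>j<n. cmp k (f (emb j (cmp j x))))"
    by (simp add: lin_sum[OF f(1)] lin_sum[OF lin_cmp])
  also have "\<dots> = (\<Sum>j<n. app n e (matop (\<lambda>w. cmp k (f (emb j w)))) (cmp j x))"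
    by (intro sum.cong refl) (simp add: app_matop[OF l] cmp_sp emb_sp f x)
  finally show ?thesis .
qed

text \<open>Carry a new last factor \<open>v\<^sub>j\<close> to the front and read off the coefficient of \<open>v\<^sub>l\<close> there. These are the
entries of the \<open>L\<close>-operator of \<open>U\<^sub>q(gl\<^sub>n)\<close>: lower indices \<open>l < j\<close> give \<open>0\<close>, the diagonal
acts by the weight, and \<open>j < l\<close> gives the operators that raise weights. Being defined
through braids, they lie in the commutant (\<open>opA_comm\<close>).\<close>
definition opA :: "nat \<Rightarrow> nat \<Rightarrow> nat \<Rightarrow> 'k vec \<Rightarrow> 'k vec" where
  "opA e l j w = (\<lambda>K. D 0 e (emb j w) (l # K))"

lemma lin_opA: "lin (opA e l j)"
  by (rule linI, simp_all add: opA_def lin_add[OF lin_emb] lin_add[OF lin_D] lin_scale[OF lin_emb] lin_scale[OF lin_D])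
     (simp_all add: fun_eq_iff fscale_def)

lemma opA_sp: "w \<in> sp n e \<Longrightarrow> j < n \<Longrightarrow> opA e l j w \<in> sp n e"
proof -
  assume "w \<in> sp n e" "j < n"
  hence "D 0 e (emb j w) \<in> sp n (Suc e)" by (intro D_sp emb_sp)
  thus ?thesis by (auto simp: opA_def sp_def)
qed

lemma opA_T: assumes "i + 1 < e" "w \<in> sp n e" shows "opA e l j (T i w) = T i (opA e l j w)"
proof
  fix K
  have "opA e l j (T i w) K = D 0 e (T i (emb j w)) (l # K)" using assms by (simp add: opA_def T_emb)
  also have "\<dots> = T (Suc i) (D 0 e (emb j w)) (l # K)" using assms by (simp add: D_shift)
  also have "\<dots> = T i (opA e l j w) K" by (simp add: T_hd opA_def)
  finally show "opA e l j (T i w) K = T i (opA e l j w) K" .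
qed

lemma opA_comm: "comm n e (matop (opA e l j))"
  by (rule comm_matop[OF lin_opA opA_T])

lemma opA_app: "w \<in> sp n e \<Longrightarrow> j < n \<Longrightarrow> opA e l j w = app n e (matop (opA e l j)) w"
  by (simp add: app_matop lin_opA opA_sp)

lemma opA_wtv: "wtv \<mu> w \<Longrightarrow> opA e l j w K \<noteq> 0 \<Longrightarrow> add_mset l (mset K) = add_mset j \<mu>"
  using D_wtv[OF wtv_emb[of \<mu> w j], of 0 e] by (auto simp: opA_def wtv_def)

lemma opA_0: "opA 0 l j w [] = of_bool (l = j) * w []"
  by (simp add: opA_def emb_def)

text \<open>The coproduct of the \<open>L\<close>-operator, with the action on the last factor written out.\<close>
lemma opA_Suc: assumes w: "w \<in> sp n (Suc e)" and K: "length K = e"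
  shows "opA (Suc e) l j w (K @ [k]) =
    (if k = j then \<Sum>b<n. Rdiag q b j * opA e l b (cmp b w) K else opA e l j (cmp k w) K)"
proof -
  let ?y = "\<lambda>R. T e (emb j w) (R @ [k])"
  let ?z = "if k = j then \<Sum>b<n. fscale (Rdiag q b j) (emb b (cmp b w)) else emb j (cmp k w)"
  have yz: "?y R = ?z R" if R: "length R = Suc e" for R
  proof -
    obtain Q m where Q: "R = Q @ [m]" "length Q = e" using R by (auto simp: length_Suc_conv_rev)
    have s: "swp e (Q @ [m, k]) = Q @ [k, m]" using Q(2) swp_append2[of Q e 0 "[m,k]"]
      by (simp add: swp_def)
    have "?y R = Rdiag q m k * emb j w (Q @ [m, k]) + Roff m k * emb j w (Q @ [k, m])"
      using Q s by (simp add: T_def nth_append)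
    also have "emb j w (Q @ [m,k]) = (if k = j then w (Q @ [m]) else 0)"
      using emb_snoc[of j w "Q @ [m]" k] by simp
    also have "emb j w (Q @ [k,m]) = (if m = j then w (Q @ [k]) else 0)"
      using emb_snoc[of j w "Q @ [k]" m] by simp
    finally have 1: "?y R = (if k = j then Rdiag q m j * w (Q @ [m]) else 0) + (if m = j then Roff j k * w (Q @ [k]) else 0)"
      by auto
    have 2: "?z R = (if k = j then (if m < n then Rdiag q m j * w (Q @ [m]) else 0) else (if m = j then w (Q @ [k]) else 0))"
      using Q by (auto simp: sum_fun_apply fscale_def emb_snoc cmp_def if_distrib[of "\<lambda>a. _ * a"] sum.delta cong: if_cong)
    have 3: "w (Q @ [m]) = 0" if "\<not> m < n" using that w by (auto simp: sp_def)
    show ?thesis unfolding 1 2 using 3 by (auto simp: Roff_def)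
  qed
  have "opA (Suc e) l j w (K @ [k]) = D 0 e (T e (emb j w)) ((l # K) @ [k])"
    by (simp add: opA_def)
  also have "\<dots> = D 0 e ?y (l # K)" using K by (subst D_append) auto
  also have "\<dots> = D 0 e ?z (l # K)" by (rule D_cong) (use K yz in auto)
  also have "\<dots> = (if k = j then \<Sum>b<n. Rdiag q b j * opA e l b (cmp b w) K else opA e l j (cmp k w) K)"
    by (simp add: opA_def lin_sum[OF lin_D] lin_scale[OF lin_D] sum_fun_apply) (simp add: fscale_def)
  finally show ?thesis .
qed

lemma opA_tri: "l < j \<Longrightarrow> w \<in> sp n e \<Longrightarrow> length K = e \<Longrightarrow> opA e l j w K = 0"
proof (induction e arbitrary: w K j)
  case 0 thus ?case by (simp add: opA_0)
next
  case (Suc e)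
  then obtain P k where K: "K = P @ [k]" "length P = e" by (auto simp: length_Suc_conv_rev)
  have z: "Rdiag q b j * opA e l b (cmp b w) P = 0" for b
    using Suc.IH[of b "cmp b w" P] Suc.prems K cmp_sp[OF Suc.prems(2)] by (cases "b < j") (auto simp: Rdiag_def)
  show ?case using K Suc unfolding K(1) by (subst opA_Suc[of _ n]) (auto simp: cmp_sp z sum.neutral)
qed

lemma opA_diag: "j < n \<Longrightarrow> w \<in> sp n e \<Longrightarrow> length K = e \<Longrightarrow> opA e j j w K = q ^ count (mset K) j * w K"
proof (induction e arbitrary: w K)
  case 0 thus ?case by (simp add: opA_0)
next
  case (Suc e)
  then obtain P k where K: "K = P @ [k]" "length P = e" by (auto simp: length_Suc_conv_rev)
  have "(\<Sum>b<n. Rdiag q b j * opA e j b (cmp b w) P) = (\<Sum>b<n. if b = j then q * opA e j j (cmp j w) P else 0)"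
    using opA_tri[OF _ cmp_sp[OF Suc.prems(2)] K(2)]
    by (intro sum.cong) (auto simp: Rdiag_def)
  also have "\<dots> = q * opA e j j (cmp j w) P" using Suc by simp
  finally show ?case using K Suc by (simp add: opA_Suc cmp_sp) (simp add: cmp_def)
qed

text \<open>The Jucys--Murphy element: the last strand winds once around the \<open>e\<close> others. It is central enough
for the induction below: it commutes with the braids on the first \<open>e\<close> strands and with the
commutant of degree \<open>e + 1\<close>, and it is self-adjoint for \<open>ip\<close>.\<close>
definition J :: "nat \<Rightarrow> 'k vec \<Rightarrow> 'k vec" where
  "J e x = C 0 e (D 0 e x)"

lemma lin_J: "lin (J e)"
  unfolding J_def by (rule lin_comp[OF lin_C lin_D])

lemma J_sp: "x \<in> sp n d \<Longrightarrow> J e x \<in> sp n d" by (simp add: J_def C_sp D_sp)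
lemma J_wtv: "wtv \<mu> x \<Longrightarrow> wtv \<mu> (J e x)" by (simp add: J_def C_wtv D_wtv)

lemma J_T: "i + 1 < e \<Longrightarrow> J e (T i x) = T i (J e x)"
  by (simp add: J_def D_shift C_shift)

lemma J_app: "comm n (Suc e) M \<Longrightarrow> app n (Suc e) M (J e x) = J e (app n (Suc e) M x)"
  by (simp add: J_def app_C app_D)

lemma ip_J_D: "ip n (Suc e) (J e x) y = ip n (Suc e) (D 0 e x) (D 0 e y)"
  by (simp add: J_def ip_C)

lemma ip_J: "ip n (Suc e) (J e x) y = ip n (Suc e) x (J e y)"
  by (metis ip_J_D ip_sym)

lemma D_opA: "x \<in> sp n (Suc e) \<Longrightarrow> D 0 e x (l # K) = (\<Sum>j<n. opA e l j (cmp j x) K)"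
proof -
  assume x: "x \<in> sp n (Suc e)"
  have "D 0 e x (l # K) = D 0 e (\<Sum>j<n. emb j (cmp j x)) (l # K)" using emb_cmp_expand[OF x] by simp
  thus ?thesis by (simp add: lin_sum[OF lin_D] sum_fun_apply opA_def)
qed

end

section \<open>Dimension arguments\<close>

lemma sp_span: "sp n e \<subseteq> fun_vs.span (delta ` idx n e)"
proof
  fix x :: "'a vec" assume "x \<in> sp n e"
  hence "x = (\<Sum>L\<in>idx n e. fscale (x L) (delta L))" by (rule sp_expand)
  also have "\<dots> \<in> fun_vs.span (delta ` idx n e)"
    by (intro fun_vs.span_sum fun_vs.span_scale fun_vs.span_base) auto
  finally show "x \<in> fun_vs.span (delta ` idx n e)" .
qed

lemma sp_independent: assumes "fun_vs.independent B" "B \<subseteq> sp n e"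
  shows "finite B" "card B \<le> card (idx n e)"
proof -
  have "finite B \<and> card B \<le> card ((delta :: _ \<Rightarrow> 'a vec) ` idx n e)"
    using assms sp_span by (intro fun_vs.independent_span_bound) auto
  thus "finite B" "card B \<le> card (idx n e)" using card_image_le[OF finite_idx, of "delta :: _ \<Rightarrow> 'a vec" n e] by auto
qed

lemma lin_pow:
  fixes g :: "('a \<Rightarrow> 'k::field) \<Rightarrow> ('a \<Rightarrow> 'k)"
  assumes "lin g" shows "lin (g ^^ m)"
proof (induction m)
  case 0 show ?case by (rule linI) (simp_all add: plus_fun_def fscale_def)
next
  case (Suc m)
  show ?case unfolding funpow.simps by (rule lin_compo[OF assms Suc])
qed

text \<open>Otherwise the kernels would increase with every power, and the finite dimensional space \<open>sp n e\<close> would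
contain arbitrarily many independent vectors.\<close>
lemma kernel_stationary:
  fixes g :: "('k::field) vec \<Rightarrow> 'k vec"
  assumes g: "lin g"
  shows "\<exists>m. \<forall>x\<in>sp n e. (g ^^ Suc m) x = 0 \<longrightarrow> (g ^^ m) x = 0"
proof (rule ccontr)
  assume "\<not> ?thesis"
  then obtain x where x: "\<And>m. x m \<in> sp n e" "\<And>m. (g ^^ Suc m) (x m) = 0" "\<And>m. (g ^^ m) (x m) \<noteq> 0"
    by metis
  have later: "(g ^^ m) (x i) = 0" if "i < m" for i m
  proof -
    have m: "m = (m - Suc i) + Suc i" using that by simp
    have "(g ^^ m) (x i) = (g ^^ (m - Suc i)) ((g ^^ Suc i) (x i))"
      by (subst m) (simp only: funpow_add o_apply)
    thus ?thesis using x(2)[of i] lin_0[OF lin_pow[OF g, of "m - Suc i"]] by simp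
  qed
  have "fun_vs.independent (x ` {..<m}) \<and> card (x ` {..<m}) = m" for m
  proof (induction m)
    case 0 show ?case using fun_vs.independent_empty by simp
  next
    case (Suc m)
    note lg = lin_pow[OF g, of m]
    have "fun_vs.span (x ` {..<m}) \<subseteq> {y. (g ^^ m) y = 0}"
    proof (rule fun_vs.span_minimal)
      show "fun_vs.subspace {y. (g ^^ m) y = 0}"
        by (rule module_hom.subspace_kernel[OF lin_module_hom[OF lg]])
    qed (use later in auto)
    hence n: "x m \<notin> fun_vs.span (x ` {..<m})" using x(3) by blast
    hence "fun_vs.independent (insert (x m) (x ` {..<m}))" using Suc fun_vs.independent_insertI by blast
    moreover have "x m \<notin> x ` {..<m}" using n fun_vs.span_base[of "x m"] by metis
    ultimately show ?case using Suc by (simp add: lessThan_Suc)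
  qed
  from this[of "Suc (card (idx n e))"]
  have "Suc (card (idx n e)) \<le> card (idx n e)"
    using sp_independent(2)[of "x ` {..<Suc (card (idx n e))}" n e] x(1) by (simp add: image_subset_iff)
  thus False by simp
qed

text \<open>If \<open>G\<close> spanned less than \<open>N\<close>, pairing with a basis of the span of \<open>G\<close> would map a space of larger
dimension injectively to one of smaller dimension.\<close>
lemma span_if_no_perp:
  assumes N: "fun_vs.subspace N" "N \<subseteq> sp n e" and G: "G \<subseteq> N"
    and perp: "\<And>x. x \<in> N \<Longrightarrow> (\<And>y. y \<in> G \<Longrightarrow> ip n e x y = 0) \<Longrightarrow> x = 0"
  shows "N \<subseteq> fun_vs.span G"
proof
  fix x assume xN: "x \<in> N"
  obtain B where B: "B \<subseteq> G" "fun_vs.independent B" "G \<subseteq> fun_vs.span B"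
    using fun_vs.maximal_independent_subset[of G] by blast
  have BN: "B \<subseteq> N" and fB: "finite B" using B G N sp_independent(1)[of B n e] by auto
  show "x \<in> fun_vs.span G"
  proof (rule ccontr)
    assume "x \<notin> fun_vs.span G"
    hence xB: "x \<notin> fun_vs.span B" using B(1) fun_vs.span_mono by blast
    hence ind: "fun_vs.independent (insert x B)" using B(2) fun_vs.independent_insertI by blast
    \<comment> \<open>the values of \<open>ip n e y\<close> on the basis \<open>B\<close>\<close>
    define h :: "'a vec \<Rightarrow> 'a vec \<Rightarrow> 'a" where "h y = (\<lambda>b. if b \<in> B then ip n e y b else 0)" for y
    have lh: "lin h" by (rule linI) (simp_all add: h_def fun_eq_iff ip_add_left ip_scale_left, simp add: fscale_def)
    have spN: "fun_vs.span (insert x B) \<subseteq> N" by (rule fun_vs.span_minimal) (use xN BN N(1) in \<open>simp_all\<close>)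
    have zero: "y = 0" if "y \<in> N" "h y = 0" for y
    proof (rule perp[OF that(1)])
      fix z assume "z \<in> G"
      moreover have "fun_vs.span B \<subseteq> {z. ip n e y z = 0}"
      proof (rule fun_vs.span_minimal)
        show "B \<subseteq> {z. ip n e y z = 0}"
          using that(2) by (auto simp: h_def fun_eq_iff split: if_splits)
        show "fun_vs.subspace {z. ip n e y z = 0}"
          by (rule subspaceI) (auto simp: ip_add_right ip_scale_right)
      qed
      ultimately show "ip n e y z = 0" using B by auto
    qed
    have inj: "inj_on h (fun_vs.span (insert x B))"
    proof (rule inj_onI)
      fix u v assume u: "u \<in> fun_vs.span (insert x B)" "v \<in> fun_vs.span (insert x B)" "h u = h v"
      have "u - v \<in> N" using u spN fun_vs.subspace_diff[OF N(1)] by blast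
      hence "u - v = 0" by (rule zero) (simp add: lin_diff[OF lh] u)
      thus "u = v" by simp
    qed
    have ind': "fun_vs.independent (h ` insert x B)"
    proof -
      interpret vp: vector_space_pair "fscale :: 'a \<Rightarrow> 'a vec \<Rightarrow> 'a vec" "fscale :: 'a \<Rightarrow> ('a vec \<Rightarrow> 'a) \<Rightarrow> ('a vec \<Rightarrow> 'a)" ..
      show ?thesis by (rule vp.linear_independent_injective_image[OF lh ind inj])
    qed
    have "h ` insert x B \<subseteq> fun_vs.span (delta ` B)"
    proof
      fix w assume "w \<in> h ` insert x B"
      then obtain y where y: "w = h y" by blast
      have "w = (\<Sum>b\<in>B. fscale (w b) (delta b))" by (rule delta_expand[OF fB]) (auto simp: y h_def)
      also have "\<dots> \<in> fun_vs.span (delta ` B)"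
        by (intro fun_vs.span_sum fun_vs.span_scale fun_vs.span_base) auto
      finally show "w \<in> fun_vs.span (delta ` B)" .
    qed
    hence "card (h ` insert x B) \<le> card ((delta :: 'a vec \<Rightarrow> 'a vec \<Rightarrow> 'a) ` B)"
      using fun_vs.independent_span_bound[OF finite_imageI[OF fB] ind'] by simp
    also have "\<dots> \<le> card B" by (rule card_image_le[OF fB])
    finally have "card (h ` insert x B) \<le> card B" .
    moreover have "inj_on h (insert x B)" by (rule inj_on_subset[OF inj fun_vs.span_superset])
    moreover have "x \<notin> B" using xB fun_vs.span_base[of x B] by metis
    ultimately show False using fB by (simp add: card_image)
  qed
qed

definition Kop :: "'k::field \<Rightarrow> nat \<Rightarrow> 'k vec \<Rightarrow> 'k vec" where
  "Kop q a w = (\<lambda>K. q ^ count (mset K) a * w K)"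

section \<open>Dominance of highest weights\<close>

text \<open>The parameter \<open>q\<close> is not a root of unity.\<close>
locale generic_hecke = hecke q for q :: "'k::field" +
  assumes generic: "l > 0 \<Longrightarrow> q ^ l \<noteq> 1"
begin

lemma q_pow_inj: "q ^ a = q ^ b \<Longrightarrow> a = b"
proof (rule ccontr)
  assume e: "q ^ a = q ^ b" and n: "a \<noteq> b"
  have *: False if "a < b" "q ^ a = q ^ b" for a b
  proof -
    have "q ^ b = q ^ a * q ^ (b - a)" using that(1) by (metis le_add_diff_inverse less_imp_le power_add)
    hence "q ^ (b - a) = 1" using that q0 by simp
    thus False using generic[of "b - a"] that by simp
  qed
  show False using *[of a b] *[of b a] e n by (cases "a < b") auto
qed

abbreviation "\<kappa> \<equiv> q - inverse q"

abbreviation Eop :: "nat \<Rightarrow> nat \<Rightarrow> 'k vec \<Rightarrow> 'k vec" where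
  "Eop e j \<equiv> opA e (Suc j) j"

text \<open>A lowering operator opposite to the raising operator \<open>Eop\<close>, written by recursion on the last
tensor factor, i.e. by its coproduct. It serves for the \<open>sl\<^sub>2\<close> computation in
\<open>dominant_step\<close>.\<close>
primrec F :: "nat \<Rightarrow> nat \<Rightarrow> 'k vec \<Rightarrow> 'k vec" where
  "F 0 j w = 0"
| "F (Suc e) j w = (\<lambda>K. if K = [] then 0 else
      if last K = j then q * F e j (cmp j w) (butlast K)
      else F e j (cmp (last K) w) (butlast K)
         + (if last K = Suc j then \<kappa> * Kop q (Suc j) (cmp j w) (butlast K) else 0))"

lemma cmp_F: "cmp k (F (Suc e) j w) = (if k = j then fscale q (F e j (cmp j w))
   else if k = Suc j then F e j (cmp k w) + fscale \<kappa> (Kop q (Suc j) (cmp j w)) else F e j (cmp k w))"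
  by (auto simp: fun_eq_iff fscale_def) (auto simp: cmp_def)

lemma lin_Kop: "lin (Kop q a)"
  by (rule linI) (auto simp: Kop_def fun_eq_iff fscale_def algebra_simps)
lemma Kop_sp: "w \<in> sp n e \<Longrightarrow> Kop q a w \<in> sp n e" by (auto simp: Kop_def sp_def)
lemma cmp_Kop: "cmp k (Kop q a w) = fscale (if k = a then q else 1) (Kop q a (cmp k w))"
  by (auto simp: cmp_def Kop_def fun_eq_iff fscale_def)

lemma F_sp: "w \<in> sp n e \<Longrightarrow> Suc j < n \<Longrightarrow> F e j w \<in> sp n e"
proof (induction e arbitrary: w)
  case (Suc e)
  have "F (Suc e) j w K = 0" if "K \<notin> idx n (Suc e)" for K
  proof (cases K rule: rev_cases)
    case (snoc P k)
    hence "F (Suc e) j w K = cmp k (F (Suc e) j w) P" by (simp add: cmp_def)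
    also have "\<dots> = 0"
    proof (cases "k < n")
      case True
      hence "P \<notin> idx n e" using that snoc by simp
      thus ?thesis using Suc.IH[OF cmp_sp[OF Suc.prems(1)] Suc.prems(2)]
          Kop_sp[OF cmp_sp[OF Suc.prems(1)]] unfolding cmp_F by (auto simp: sp_def fscale_def)
    next
      case False
      have F0: "F e j 0 = 0" by (induction e) (auto simp: fun_eq_iff cmp_def zero_fun_def Kop_def)
      have k: "k \<noteq> j" "k \<noteq> Suc j" using False Suc.prems(2) by auto
      show ?thesis unfolding cmp_F using k F0 cmp_big[OF Suc.prems(1) False] by simp
    qed
    finally show ?thesis .
  qed simp
  thus ?case by (auto simp: sp_def)
qed simp

lemma lin_F: "lin (F e j)"
proof (induction e)
  case 0 show ?case by (rule linI) (auto simp: fscale_def fun_eq_iff)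
next
  case (Suc e)
  show ?case
  proof (rule linI)
    fix x y
    show "F (Suc e) j (x + y) = F (Suc e) j x + F (Suc e) j y"
      by (simp only: F.simps lin_add[OF lin_cmp] lin_add[OF Suc] lin_add[OF lin_Kop])
         (auto simp: fun_eq_iff algebra_simps)
    fix c
    show "F (Suc e) j (fscale c x) = fscale c (F (Suc e) j x)"
      by (simp only: F.simps lin_scale[OF lin_cmp] lin_scale[OF Suc] lin_scale[OF lin_Kop])
         (auto simp: fun_eq_iff algebra_simps fscale_def)
  qed
qed

lemma cmp_E: assumes w: "w \<in> sp n (Suc e)" and j: "Suc j < n"
  shows "cmp k (Eop (Suc e) j w) = (if k = j then fscale q (Eop e j (cmp j w)) + fscale \<kappa> (Kop q (Suc j) (cmp (Suc j) w))
    else Eop e j (cmp k w))"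
proof -
  have s: "cmp i w \<in> sp n e" for i using w by (rule cmp_sp)
  have "(\<Sum>b<n. Rdiag q b j * opA e (Suc j) b (cmp b w) K) =
     q * Eop e j (cmp j w) K + \<kappa> * Kop q (Suc j) (cmp (Suc j) w) K" if K: "length K = e" for K
  proof -
    have "(\<Sum>b<n. Rdiag q b j * opA e (Suc j) b (cmp b w) K) =
       (\<Sum>b<n. (if b = j then q * Eop e j (cmp j w) K else 0) +
          (if b = Suc j then \<kappa> * Kop q (Suc j) (cmp (Suc j) w) K else 0))"
      using opA_tri[OF _ s K] opA_diag[OF j s K]
      by (intro sum.cong) (auto simp: Rdiag_def Kop_def)
    thus ?thesis using j by (simp add: sum.distrib)
  qed
  hence 1: "cmp k (Eop (Suc e) j w) K = (if k = j then fscale q (Eop e j (cmp j w)) + fscale \<kappa> (Kop q (Suc j) (cmp (Suc j) w))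
    else Eop e j (cmp k w)) K" if "length K = e" for K
    using opA_Suc[OF w that, of "Suc j" j k] that by (auto simp: cmp_def[of k] fscale_def)
  have j': "j < n" using j by simp
  show ?thesis
  proof (rule sp_eqI[of _ n e])
    show "cmp k (Eop (Suc e) j w) \<in> sp n e" by (intro cmp_sp opA_sp w j')
    show "(if k = j then fscale q (Eop e j (cmp j w)) + fscale \<kappa> (Kop q (Suc j) (cmp (Suc j) w))
      else Eop e j (cmp k w)) \<in> sp n e" by (auto intro!: sp_add sp_scale opA_sp Kop_sp s j')
  qed (rule 1, simp add: idx_length)
qed

lemma F_snoc: "F (Suc e) j w (P @ [k]) = cmp k (F (Suc e) j w) P" by (simp add: cmp_def)

declare F.simps(2) [simp del]

lemma Kop_F: "w \<in> sp n e \<Longrightarrow> Suc j < n \<Longrightarrow> Kop q (Suc j) (F e j w) = fscale q (F e j (Kop q (Suc j) w))"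
proof (induction e arbitrary: w)
  case 0 show ?case by (simp add: Kop_def fscale_def fun_eq_iff)
next
  case (Suc e)
  note s = cmp_sp[OF Suc.prems(1)]
  show ?case
  proof (rule cmp_ext[of _ n e])
    fix k
    show "cmp k (Kop q (Suc j) (F (Suc e) j w)) = cmp k (fscale q (F (Suc e) j (Kop q (Suc j) w)))"
      by (simp add: cmp_Kop cmp_F lin_scale[OF lin_cmp] lin_add[OF lin_Kop] lin_scale[OF lin_Kop]
          Suc.IH[OF s Suc.prems(2)] lin_scale[OF lin_F])
         (auto simp: fun_eq_iff fscale_def algebra_simps)?
  qed (auto intro!: Kop_sp F_sp sp_scale Suc.prems)
qed

lemma E_Kop: "w \<in> sp n e \<Longrightarrow> Suc j < n \<Longrightarrow> Eop e j (Kop q (Suc j) w) = fscale q (Kop q (Suc j) (Eop e j w))"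
proof (induction e arbitrary: w)
  case 0 
  have z: "Eop 0 j v = 0" if "v \<in> sp n 0" for v
    by (rule sp_eqI[of _ n 0]) (use 0 that in \<open>auto intro!: opA_sp simp: idx_0 opA_0\<close>)
  show ?case using z[OF 0(1)] z[OF Kop_sp[OF 0(1)]] by (simp add: Kop_def fscale_def fun_eq_iff)
next
  case (Suc e)
  note s = cmp_sp[OF Suc.prems(1)]
  show ?case
  proof (rule cmp_ext[of _ n e])
    fix k
    show "cmp k (Eop (Suc e) j (Kop q (Suc j) w)) = cmp k (fscale q (Kop q (Suc j) (Eop (Suc e) j w)))"
      by (simp add: cmp_Kop cmp_E[OF Suc.prems] cmp_E[OF Kop_sp[OF Suc.prems(1)] Suc.prems(2)] lin_scale[OF lin_cmp] lin_add[OF lin_Kop] lin_scale[OF lin_Kop]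
          Suc.IH[OF s Suc.prems(2)] lin_scale[OF lin_opA])
         (auto simp: fun_eq_iff fscale_def algebra_simps)
  qed (use Suc.prems in \<open>auto intro!: Kop_sp opA_sp sp_scale\<close>)
qed

text \<open>The commutator relation of \<open>U\<^sub>q(sl\<^sub>2)\<close>, by induction on the degree from the coproduct formulas.\<close>
lemma E_F: "w \<in> sp n e \<Longrightarrow> Suc j < n \<Longrightarrow> Eop e j (F e j w) = F e j (Eop e j w)
   + fscale (1 - inverse q ^ 2) (Kop q j (Kop q j w) - Kop q (Suc j) (Kop q (Suc j) w))"
proof (induction e arbitrary: w)
  case 0 
  show ?case
  proof (rule sp_eqI[of _ n 0])
    fix K :: "nat list" assume "K \<in> idx n 0"
    thus "Eop 0 j (F 0 j w) K = (F 0 j (Eop 0 j w)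
   + fscale (1 - inverse q ^ 2) (Kop q j (Kop q j w) - Kop q (Suc j) (Kop q (Suc j) w))) K"
      by (simp add: idx_0 opA_0 Kop_def fscale_def)
  next
    show "Eop 0 j (F 0 j w) \<in> sp n 0" using 0 by (auto intro!: opA_sp)
    show "F 0 j (Eop 0 j w) + fscale (1 - inverse q ^ 2) (Kop q j (Kop q j w) - Kop q (Suc j) (Kop q (Suc j) w)) \<in> sp n 0"
      using 0 by (auto simp: sp_def Kop_def fscale_def)
  qed
next
  case (Suc e)
  note s = cmp_sp[OF Suc.prems(1)]
  have w: "Eop (Suc e) j w \<in> sp n (Suc e)" "F (Suc e) j w \<in> sp n (Suc e)"
    using Suc.prems by (auto intro!: opA_sp F_sp)
  show ?case
  proof (rule cmp_ext[of _ n e])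
    fix k
    show "cmp k (Eop (Suc e) j (F (Suc e) j w)) = cmp k (F (Suc e) j (Eop (Suc e) j w)
       + fscale (1 - inverse q ^ 2) (Kop q j (Kop q j w) - Kop q (Suc j) (Kop q (Suc j) w)))"
      unfolding lin_add[OF lin_cmp] lin_scale[OF lin_cmp] lin_diff[OF lin_cmp] cmp_E[OF w(2) Suc.prems(2)]
        cmp_F cmp_Kop cmp_E[OF Suc.prems]
      using q0
      by (simp add: lin_add[OF lin_Kop] lin_scale[OF lin_Kop] lin_add[OF lin_F] lin_add[OF lin_opA]
          Suc.IH[OF s Suc.prems(2)] lin_scale[OF lin_opA] lin_scale[OF lin_F] Kop_F[OF s Suc.prems(2)] E_Kop[OF s Suc.prems(2)])
         (auto simp: fun_eq_iff fscale_def field_simps power2_eq_square)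
  next
    show "F (Suc e) j (Eop (Suc e) j w)
       + fscale (1 - inverse q ^ 2) (Kop q j (Kop q j w) - Kop q (Suc j) (Kop q (Suc j) w)) \<in> sp n (Suc e)"
      by (intro sp_add sp_scale F_sp w Suc.prems fun_vs.subspace_diff[OF subspace_sp] Kop_sp)
  qed (use Suc.prems w in \<open>auto intro!: opA_sp\<close>)
qed

lemma F_wt: "F e j w K \<noteq> 0 \<Longrightarrow> \<exists>K'. w K' \<noteq> 0 \<and> add_mset j (mset K) = add_mset (Suc j) (mset K')"
proof (induction e arbitrary: w K)
  case (Suc e)
  then obtain P k where K: "K = P @ [k]" by (cases K rule: rev_cases) (auto simp: F.simps)
  have *: ?case if nz: "F e j (cmp k w) P \<noteq> 0"
  proof -
    obtain K' where K': "cmp k w K' \<noteq> 0" "add_mset j (mset P) = add_mset (Suc j) (mset K')"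
      using Suc.IH[OF nz] by auto
    have "add_mset j (mset K) = add_mset k (add_mset j (mset P))" using K by simp
    also have "\<dots> = add_mset (Suc j) (mset (K' @ [k]))" unfolding K' by simp
    finally show ?thesis using K' by (auto simp: cmp_def)
  qed
  have "F e j (cmp k w) P \<noteq> 0 \<or> (k = Suc j \<and> cmp j w P \<noteq> 0)"
    using Suc.prems unfolding K F_snoc cmp_F by (auto simp: Kop_def fscale_def split: if_splits)
  thus ?case
  proof
    assume "k = Suc j \<and> cmp j w P \<noteq> 0"
    thus ?thesis using K by (intro exI[of _ "P @ [j]"]) (auto simp: cmp_def)
  qed (rule *)
qed simp

text \<open>The classical \<open>sl\<^sub>2\<close> argument. If \<open>\<mu>\<close> had fewer letters \<open>j\<close> than letters \<open>j + 1\<close>, then \<open>E F\<^bsup>m+1\<^esup> s\<close> would be a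
multiple of \<open>F\<^sup>m s\<close> by a scalar that never vanishes when \<open>q\<close> is not a root of unity. So no
\<open>F\<^sup>m s\<close> would vanish, although each application of \<open>F\<close> uses up a letter \<open>j\<close>.\<close>
lemma dominant_step:
  assumes s: "s \<in> sp n e" "s \<noteq> 0" "wtv \<mu> s" "Eop e j s = 0" and j: "Suc j < n"
  shows "count \<mu> (Suc j) \<le> count \<mu> j"
proof (rule ccontr)
  define a b where "a = count \<mu> j" and "b = count \<mu> (Suc j)"
  assume "\<not> ?thesis" hence ab: "a < b" by (simp add: a_def b_def)
  define f where "f m = (F e j ^^ m) s" for m
  define p where "p = q ^ 2"
  have p0: "p \<noteq> 0" using q0 by (simp add: p_def)
  \<comment> \<open>the scalar in \<open>E (F\<^sup>m s) = c m F\<^bsup>m-1\<^esup> s\<close>; \<open>E_F\<close> gives it as a geometric sum\<close>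
  define c where "c m = (1 - inverse p ^ m) * (p ^ a - p ^ b * p ^ m * inverse p)" for m
  have fsp: "f m \<in> sp n e" for m unfolding f_def by (induction m) (auto intro: s F_sp j)
  have fwt: "f m K \<noteq> 0 \<longrightarrow> count (mset K) j + m = a \<and> count (mset K) (Suc j) = b + m" for m K
  proof (induction m arbitrary: K)
    case 0 show ?case using s(3) by (auto simp: f_def wtv_def a_def b_def)
  next
    case (Suc m)
    show ?case
    proof
      assume "f (Suc m) K \<noteq> 0"
      then obtain K' where K': "f m K' \<noteq> 0" "add_mset j (mset K) = add_mset (Suc j) (mset K')"
        using F_wt[of e j "f m" K] by (auto simp: f_def)
      have "count (add_mset j (mset K)) i = count (add_mset (Suc j) (mset K')) i" for i using K'(2) by simp
      from this[of j] this[of "Suc j"]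
      show "count (mset K) j + Suc m = a \<and> count (mset K) (Suc j) = b + Suc m" using Suc[of K'] K'(1) by auto
    qed
  qed
  have Kf: "Kop q j (Kop q j (f m)) = fscale (p ^ a * inverse p ^ m) (f m)"
           "Kop q (Suc j) (Kop q (Suc j) (f m)) = fscale (p ^ b * p ^ m) (f m)" for m
  proof -
    have k1: "q ^ count (mset K) j * (q ^ count (mset K) j * f m K) = p ^ a * inverse p ^ m * f m K" for K
    proof (cases "f m K = 0")
      case False
      hence "a = count (mset K) j + m" using fwt by auto
      thus ?thesis using p0 by (simp add: p_def power_add field_simps flip: power_mult) (simp add: power2_eq_square power_mult_distrib power_mult)
    qed simp
    show "Kop q j (Kop q j (f m)) = fscale (p ^ a * inverse p ^ m) (f m)"
      by (intro ext, unfold Kop_def fscale_def) (rule k1)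
    have k2: "q ^ count (mset K) (Suc j) * (q ^ count (mset K) (Suc j) * f m K) = p ^ b * p ^ m * f m K" for K
    proof (cases "f m K = 0")
      case False
      hence "count (mset K) (Suc j) = b + m" using fwt by auto
      thus ?thesis by (simp add: p_def power_add power2_eq_square power_mult_distrib)
    qed simp
    show "Kop q (Suc j) (Kop q (Suc j) (f m)) = fscale (p ^ b * p ^ m) (f m)"
      by (intro ext, unfold Kop_def fscale_def) (rule k2)
  qed
  have Ef: "Eop e j (f (Suc m)) = fscale (c (Suc m)) (f m)" for m
  proof (induction m)
    case 0
    have "Eop e j (f (Suc 0)) = F e j (Eop e j s) + fscale (1 - inverse q ^ 2) (Kop q j (Kop q j (f 0)) - Kop q (Suc j) (Kop q (Suc j) (f 0)))"
      using E_F[OF s(1) j] by (simp add: f_def)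
    also have "\<dots> = fscale (c (Suc 0)) (f 0)"
    proof -
      have i: "inverse q ^ 2 = inverse p" by (simp add: p_def power_inverse)
      have "(1 - inverse p) * (p ^ a * inverse p ^ 0 - p ^ b * p ^ 0) = c (Suc 0)"
        using p0 by (simp add: c_def field_simps)
      thus ?thesis unfolding Kf i s(4) lin_0[OF lin_F]
        by (simp add: fscale_def fun_eq_iff flip: left_diff_distrib)
    qed
    finally show ?case .
  next
    case (Suc m)
    have "Eop e j (f (Suc (Suc m))) = F e j (Eop e j (f (Suc m))) + fscale (1 - inverse q ^ 2) (Kop q j (Kop q j (f (Suc m))) - Kop q (Suc j) (Kop q (Suc j) (f (Suc m))))"
      using E_F[OF fsp j, of "Suc m"] by (simp add: f_def)
    also have "\<dots> = fscale (c (Suc m)) (f (Suc m)) + fscale (1 - inverse q ^ 2) (Kop q j (Kop q j (f (Suc m))) - Kop q (Suc j) (Kop q (Suc j) (f (Suc m))))"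
      by (simp add: Suc lin_scale[OF lin_F]) (simp add: f_def)
    also have "\<dots> = fscale (c (Suc (Suc m))) (f (Suc m))"
    proof -
      have i: "inverse q ^ 2 = inverse p" by (simp add: p_def power_inverse)
      have "c (Suc m) + (1 - inverse p) * (p ^ a * inverse p ^ Suc m - p ^ b * p ^ Suc m) = c (Suc (Suc m))"
        using p0 by (simp add: c_def field_simps)
      thus ?thesis unfolding Kf i by (simp add: fscale_def fun_eq_iff flip: left_diff_distrib) (metis distrib_right mult.assoc left_diff_distrib)
    qed
    finally show ?case .
  qed
  have c0: "c (Suc m) \<noteq> 0" for m
  proof -
    have "p ^ Suc m \<noteq> 1" using generic[of "2 * Suc m"] unfolding p_def power_mult by simp
    hence 1: "1 - inverse p ^ Suc m \<noteq> 0" using p0 by (simp add: power_inverse del: power_Suc)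
    have "p ^ a \<noteq> p ^ b * p ^ m"
    proof
      assume "p ^ a = p ^ b * p ^ m"
      hence "q ^ (2 * a) = q ^ (2 * (b + m))" by (simp add: p_def power_mult power_add)
      hence "2 * a = 2 * (b + m)" by (rule q_pow_inj)
      thus False using ab by simp
    qed
    moreover have "p ^ b * p ^ Suc m * inverse p = p ^ b * p ^ m" using p0 by simp
    ultimately show ?thesis using 1 by (metis c_def mult_eq_0_iff right_minus_eq)
  qed
  have "f m \<noteq> 0" for m
  proof (induction m)
    case 0 show ?case using s(2) by (simp add: f_def zero_fun_def)
  next
    case (Suc m)
    show ?case
    proof
      assume "f (Suc m) = 0"
      hence "fscale (c (Suc m)) (f m) = 0" using Ef[of m] by (simp add: lin_0[OF lin_opA])
      thus False using Suc c0 by (auto simp: fscale_def fun_eq_iff)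
    qed
  qed
  then obtain K where "f (Suc a) K \<noteq> 0" by (metis ext zero_fun_apply)
  thus False using fwt by fastforce
qed

end

section \<open>Singular vectors and good submodules\<close>

lemma fscale_0 [simp]: "fscale c 0 = 0" by (simp add: fscale_def fun_eq_iff)
lemma fscale_eq_0: "fscale c x = 0 \<longleftrightarrow> c = 0 \<or> x = 0" by (auto simp: fscale_def fun_eq_iff)
lemma fscale_fscale: "fscale a (fscale b x) = fscale (a * b) x" by (simp add: fscale_def fun_eq_iff mult.assoc)

context hecke begin

text \<open>\<open>stable\<close> means a submodule of \<open>V\<^sub>n\<^bsup>\<otimes>e\<^esup>\<close> over the commutant, and \<open>sing\<close> means killed by all raising operators.
A \<open>good\<close> submodule is generated by a singular vector that is not isotropic and that spans all the
singular weight vectors of the submodule. Such a module is simple, and the three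
properties are strong enough to be carried from degree \<open>e\<close> to degree \<open>e + 1\<close>.\<close>
definition stable :: "nat \<Rightarrow> nat \<Rightarrow> 'k vec set \<Rightarrow> bool" where
  "stable n e Y \<longleftrightarrow> fun_vs.subspace Y \<and> Y \<subseteq> sp n e \<and> (\<forall>M x. comm n e M \<longrightarrow> x \<in> Y \<longrightarrow> app n e M x \<in> Y)"

definition sing :: "nat \<Rightarrow> nat \<Rightarrow> 'k vec \<Rightarrow> bool" where
  "sing n e x \<longleftrightarrow> (\<forall>l<n. \<forall>j<l. opA e l j x = 0)"

definition good :: "nat \<Rightarrow> nat \<Rightarrow> 'k vec set \<Rightarrow> bool" where
  "good n e L \<longleftrightarrow> stable n e L \<and> (\<exists>s \<mu>. s \<in> L \<and> s \<noteq> 0 \<and> wtv \<mu> s \<and> sing n e s \<and> ip n e s s \<noteq> 0 \<and>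
     (\<forall>x\<in>L. \<exists>M. comm n e M \<and> x = app n e M s) \<and>
     (\<forall>t \<nu>. t \<in> L \<longrightarrow> wtv \<nu> t \<longrightarrow> sing n e t \<longrightarrow> (\<exists>c. t = fscale c s)))"

lemma stableD:
  assumes "stable n e Y"
  shows "fun_vs.subspace Y" "Y \<subseteq> sp n e" "\<And>M x. comm n e M \<Longrightarrow> x \<in> Y \<Longrightarrow> app n e M x \<in> Y"
    "0 \<in> Y" "\<And>x y. x \<in> Y \<Longrightarrow> y \<in> Y \<Longrightarrow> x + y \<in> Y" "\<And>c x. x \<in> Y \<Longrightarrow> fscale c x \<in> Y"
    "\<And>x. x \<in> Y \<Longrightarrow> x \<in> sp n e"
  using assms by (auto simp: stable_def fun_vs.subspace_def)

lemma stableI: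
  assumes "0 \<in> Y" "\<And>x y. x \<in> Y \<Longrightarrow> y \<in> Y \<Longrightarrow> x + y \<in> Y" "\<And>c x. x \<in> Y \<Longrightarrow> fscale c x \<in> Y"
    "\<And>x. x \<in> Y \<Longrightarrow> x \<in> sp n e" "\<And>M x. comm n e M \<Longrightarrow> x \<in> Y \<Longrightarrow> app n e M x \<in> Y"
  shows "stable n e Y"
  using assms by (auto simp: stable_def fun_vs.subspace_def)

lemma stable_opA: "stable n e Y \<Longrightarrow> x \<in> Y \<Longrightarrow> j < n \<Longrightarrow> opA e l j x \<in> Y"
  using stableD(3)[OF _ opA_comm, of n e Y x l j] opA_app[OF stableD(7), of n e Y x j l] by simp

lemma sing_add: "sing n e x \<Longrightarrow> sing n e y \<Longrightarrow> sing n e (x + y)" by (simp add: sing_def lin_add[OF lin_opA])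
lemma sing_scale: "sing n e x \<Longrightarrow> sing n e (fscale c x)" by (simp add: sing_def lin_scale[OF lin_opA])

text \<open>The projection to a weight space lies in the commutant.\<close>
lemma weight_component:
  assumes Y: "stable n e Y" and x: "x \<in> Y" "x \<noteq> 0"
  shows "\<exists>y \<nu>. y \<in> Y \<and> y \<noteq> 0 \<and> wtv \<nu> y"
proof -
  obtain K where K: "x K \<noteq> 0" using x(2) by (auto simp: fun_eq_iff)
  have Ki: "K \<in> idx n e" using stableD(7)[OF Y x(1)] K by (auto simp: sp_def)
  define y where "y = app n e (\<lambda>P L. of_bool (P = L) * of_bool (mset P = mset K)) x"
  have "y \<in> Y" unfolding y_def by (rule stableD(3)[OF Y comm_wt x(1)])
  moreover have "y K \<noteq> 0" using K Ki by (simp add: y_def app_wt)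
  hence "y \<noteq> 0" by auto
  moreover have "wtv (mset K) y" by (auto simp: y_def app_wt wtv_def)
  ultimately show ?thesis by blast
qed

text \<open>A raising operator replaces a letter by a smaller one, so the sum of the letters drops. The last
disjunct records that either nothing was raised or the weight became strictly higher.\<close>
lemma sing_exists:
  assumes Y: "stable n e Y"
  shows "x \<in> Y \<Longrightarrow> x \<noteq> 0 \<Longrightarrow> wtv \<nu> x \<Longrightarrow>
    \<exists>t \<nu>'. t \<in> Y \<and> t \<noteq> 0 \<and> wtv \<nu>' t \<and> sing n e t \<and> (t = x \<or> sum_mset \<nu>' < sum_mset \<nu>)"
proof (induction "sum_mset \<nu>" arbitrary: x \<nu> rule: less_induct)
  case less
  show ?case
  proof (cases "sing n e x")
    case True thus ?thesis using less.prems by blast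
  next
    case False
    then obtain l j where lj: "l < n" "j < l" "opA e l j x \<noteq> 0" by (auto simp: sing_def)
    define y where "y = opA e l j x"
    obtain K where K: "y K \<noteq> 0" using lj by (auto simp: y_def fun_eq_iff)
    have w: "add_mset l (mset P) = add_mset j \<nu>" if "y P \<noteq> 0" for P
      using opA_wtv[OF less.prems(3)] that by (simp add: y_def)
    have wy: "wtv (mset K) y" unfolding wtv_def
    proof (intro allI impI)
      fix P assume "y P \<noteq> 0"
      hence "add_mset l (mset P) = add_mset l (mset K)" using w K by metis
      thus "mset P = mset K" by simp
    qed
    have "sum_mset (add_mset l (mset K)) = sum_mset (add_mset j \<nu>)" using w[OF K] by simp
    hence lt: "sum_mset (mset K) < sum_mset \<nu>" using lj(2) by simp
    have "y \<in> Y" using stable_opA[OF Y less.prems(1)] lj by (simp add: y_def)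
    moreover have "y \<noteq> 0" using K by auto
    ultimately obtain t \<nu>' where "t \<in> Y" "t \<noteq> 0" "wtv \<nu>' t" "sing n e t" "t = y \<or> sum_mset \<nu>' < sum_mset (mset K)"
      using less.hyps[OF lt _ _ wy] by blast
    moreover have "sum_mset \<nu>' < sum_mset \<nu>"
    proof -
      have "\<nu>' = mset K" if "t = y"
      proof -
        have "y K \<noteq> 0 \<Longrightarrow> mset K = \<nu>'" using \<open>wtv \<nu>' t\<close> that by (auto simp: wtv_def)
        thus ?thesis using K by simp
      qed
      thus ?thesis using lt calculation(5) by auto
    qed
    ultimately show ?thesis by blast
  qed
qed

lemma wtv_unique: "wtv \<mu> x \<Longrightarrow> wtv \<nu> x \<Longrightarrow> x \<noteq> 0 \<Longrightarrow> \<mu> = \<nu>"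
  by (auto simp: wtv_def fun_eq_iff)

end

context generic_hecke begin

text \<open>A singular vector has dominant weight, by adding up the steps between neighbouring letters.\<close>
lemma dominant:
  assumes s: "s \<in> sp n e" "s \<noteq> 0" "wtv \<mu> s" "sing n e s" and ij: "i \<le> j" "j < n"
  shows "count \<mu> j \<le> count \<mu> i"
  using ij
proof (induction j rule: dec_induct)
  case (step j)
  have "Eop e j s = 0" using s(4) step by (simp add: sing_def)
  from dominant_step[OF s(1-3) this] step show ?case by fastforce
qed simp

end

section \<open>Tensoring a good submodule with the standard module\<close>

text \<open>A submodule \<open>L\<close> of \<open>V\<^sub>n\<^bsup>\<otimes>e\<^esup>\<close> with essentially one singular vector \<open>s\<close>, of weight \<open>\<mu>\<close>. The object of study
is \<open>N = L \<otimes> V\<^sub>n\<close>, a submodule in degree \<open>e + 1\<close>.\<close>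
locale hw_module = generic_hecke q for q :: "'k::field" +
  fixes n e :: nat and L :: "'k vec set" and s :: "'k vec" and \<mu> :: "nat multiset"
  assumes L: "stable n e L" and sL: "s \<in> L" and s0: "s \<noteq> 0" and sw: "wtv \<mu> s" and ss: "sing n e s"
    and sip: "ip n e s s \<noteq> 0"
    and suniq: "\<And>t \<nu>. t \<in> L \<Longrightarrow> wtv \<nu> t \<Longrightarrow> sing n e t \<Longrightarrow> \<exists>c. t = fscale c s"
begin

definition N :: "'k vec set" where "N = {x \<in> sp n (Suc e). \<forall>k<n. cmp k x \<in> L}"

lemma N_sp: "x \<in> N \<Longrightarrow> x \<in> sp n (Suc e)" by (simp add: N_def)

lemma N_cmp: "x \<in> N \<Longrightarrow> cmp k x \<in> L"
  using cmp_big[of x n e k] stableD(4)[OF L] by (cases "k < n") (auto simp: N_def)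

lemma N_invariant:
  assumes f: "lin f" "\<And>x. x \<in> sp n (Suc e) \<Longrightarrow> f x \<in> sp n (Suc e)"
    "\<And>i x. i + 1 < e \<Longrightarrow> x \<in> sp n (Suc e) \<Longrightarrow> f (T i x) = T i (f x)" and x: "x \<in> N"
  shows "f x \<in> N"
proof -
  have "cmp k (f x) \<in> L" for k
  proof -
    have "(\<Sum>j<n. app n e (matop (\<lambda>w. cmp k (f (emb j w)))) (cmp j x)) \<in> L"
      by (intro fun_vs.subspace_sum[OF stableD(1)[OF L]] stableD(3)[OF L] block_comm[OF f] N_cmp[OF x]) auto
    thus ?thesis using block_expand[OF f(1,2) N_sp[OF x], of k] by simp
  qed
  thus ?thesis using f(2)[OF N_sp[OF x]] by (auto simp: N_def)
qed

lemma N_stable: "stable n (Suc e) N"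
proof (rule stableI)
  fix M x assume M: "comm n (Suc e) M" and x: "x \<in> N"
  show "app n (Suc e) M x \<in> N"
    by (rule N_invariant[OF lin_app _ _ x]) (auto simp: app_T[OF M])
qed (auto simp: N_def lin_add[OF lin_cmp] lin_scale[OF lin_cmp] lin_0[OF lin_cmp] stableD(4-6)[OF L] sp_add sp_scale)

lemma J_N: "x \<in> N \<Longrightarrow> J e x \<in> N"
  by (rule N_invariant[OF lin_J]) (auto simp: J_sp J_T)

lemma sing_N_rel:
  assumes t: "t \<in> N" "sing n (Suc e) t" and p: "p < n" "j < p"
  shows "k \<noteq> j \<Longrightarrow> opA e p j (cmp k t) = 0"
    and "length K = e \<Longrightarrow> (\<Sum>b<n. Rdiag q b j * opA e p b (cmp b t) K) = 0"
proof -
  have z: "opA (Suc e) p j t = 0" using t p by (simp add: sing_def)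
  have sp: "cmp k t \<in> sp n e" using N_cmp[OF t(1)] stableD(7)[OF L] by blast
  show "opA e p j (cmp k t) = 0" if k: "k \<noteq> j"
  proof (rule sp_eqI[of _ n e])
    show "opA e p j (cmp k t) \<in> sp n e" using sp p by (intro opA_sp) auto
    fix K assume "K \<in> idx n e"
    hence "length K = e" by (simp add: idx_length)
    from opA_Suc[OF N_sp[OF t(1)] this, of p j k] z k
    show "opA e p j (cmp k t) K = 0 K" by simp
  qed simp
  show "(\<Sum>b<n. Rdiag q b j * opA e p b (cmp b t) K) = 0" if "length K = e"
    using opA_Suc[OF N_sp[OF t(1)] that, of p j j] z by simp
qed

text \<open>The component of \<open>t\<close> at the largest letter that occurs in its last factor is itself singular, hence a multiple of
\<open>s\<close>. So the weight of \<open>t\<close> is \<open>\<mu>\<close> with one letter added (a box added to a Young diagram), and by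
\<open>leading_unique\<close> that letter determines \<open>t\<close> up to a scalar (the Pieri rule).\<close>
lemma leading:
  assumes t: "t \<in> N" "t \<noteq> 0" "wtv \<nu> t" "sing n (Suc e) t"
  obtains i c where "i < n" "c \<noteq> 0" "cmp i t = fscale c s" "\<And>k. i < k \<Longrightarrow> cmp k t = 0" "\<nu> = add_mset i \<mu>"
proof -
  define A where "A = {k. k < n \<and> cmp k t \<noteq> 0}"
  have "A \<noteq> {}"
  proof
    assume "A = {}"
    hence "t = 0" using cmp_ext[OF N_sp[OF t(1)], of 0] by (auto simp: A_def lin_0[OF lin_cmp])
    thus False using t by simp
  qed
  moreover have fA: "finite A" by (simp add: A_def)
  ultimately have "Max A \<in> A" by simp
  define i where "i = Max A"
  have i: "i < n" "cmp i t \<noteq> 0" using \<open>Max A \<in> A\<close> by (auto simp: i_def A_def)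
  have top: "cmp k t = 0" if "i < k" for k
  proof (rule ccontr)
    assume nz: "cmp k t \<noteq> 0"
    hence "k \<in> A" using cmp_big[OF N_sp[OF t(1)], of k] by (auto simp: A_def)
    thus False using Max_ge[OF fA, of k] that by (simp add: i_def)
  qed
  have sp: "cmp k t \<in> sp n e" for k using N_cmp[OF t(1)] stableD(7)[OF L] by blast
  have "sing n e (cmp i t)" unfolding sing_def
  proof (intro allI impI)
    fix p j assume pj: "p < n" "j < p"
    show "opA e p j (cmp i t) = 0"
    proof (cases "i = j")
      case False thus ?thesis using sing_N_rel(1)[OF t(1,4) pj] by simp
    next
      case True
      show ?thesis
      proof (rule sp_eqI[of _ n e])
        show "opA e p j (cmp i t) \<in> sp n e" using sp pj by (intro opA_sp) auto
        fix K assume "K \<in> idx n e"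
        hence K: "length K = e" by (simp add: idx_length)
        have "(\<Sum>b<n. Rdiag q b j * opA e p b (cmp b t) K) = (\<Sum>b<n. if b = i then q * opA e p i (cmp i t) K else 0)"
          using top True by (intro sum.cong) (auto simp: Rdiag_def lin_0[OF lin_opA])
        hence "q * opA e p i (cmp i t) K = 0" using sing_N_rel(2)[OF t(1,4) pj K] i by simp
        thus "opA e p j (cmp i t) K = 0 K" using q0 True by simp
      qed simp
    qed
  qed
  then obtain c where c: "cmp i t = fscale c s" using suniq[OF N_cmp[OF t(1)] wtv_cmp[OF t(3)]] by blast
  have c0: "c \<noteq> 0" using c i(2) by (auto simp: fscale_eq_0)
  have "wtv \<mu> (cmp i t)" unfolding c by (rule wtv_scale[OF sw])
  hence "\<nu> - {#i#} = \<mu>" using wtv_unique[OF wtv_cmp[OF t(3)] _ i(2)] by blast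
  moreover have "i \<in># \<nu>" using wtv_cmp_in[OF t(3) i(2)] .
  ultimately have "\<nu> = add_mset i \<mu>" by auto
  thus ?thesis using that i(1) c0 c top by blast
qed

text \<open>Subtract the multiple of \<open>t\<close> that removes the leading component; a nonzero difference would be singular of the same
weight without a leading component.\<close>
lemma leading_unique:
  assumes t: "t \<in> N" "t \<noteq> 0" "wtv \<nu> t" "sing n (Suc e) t" and t': "t' \<in> N" "wtv \<nu> t'" "sing n (Suc e) t'"
  shows "\<exists>c. t' = fscale c t"
proof -
  from leading[OF t] obtain i c where i: "i < n" "c \<noteq> 0" "cmp i t = fscale c s" "\<nu> = add_mset i \<mu>" by metis
  show ?thesis
  proof (cases "t' = 0")
    case True thus ?thesis by (intro exI[of _ 0]) (simp add: fscale_def fun_eq_iff)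
  next
    case False
    from leading[OF t'(1) False t'(2,3)] obtain i' c' where i': "c' \<noteq> 0" "cmp i' t' = fscale c' s" "\<nu> = add_mset i' \<mu>" by metis
    have ii: "i' = i" using i(4) i'(3) by simp
    \<comment> \<open>the combination without a leading component\<close>
    define u where "u = t' + fscale (- (c' / c)) t"
    have u: "u \<in> N" "wtv \<nu> u" "sing n (Suc e) u"
      unfolding u_def
      by (intro stableD(5)[OF N_stable] stableD(6)[OF N_stable] wtv_add wtv_scale sing_add sing_scale t t')+
    have "u = 0"
    proof (rule ccontr)
      assume "u \<noteq> 0"
      from leading[OF u(1) this u(2,3)] obtain i'' d where d: "d \<noteq> 0" "cmp i'' u = fscale d s" "\<nu> = add_mset i'' \<mu>" by metis
      have "i'' = i" using i(4) d(3) by simp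
      moreover have "cmp i u = 0" unfolding u_def lin_add[OF lin_cmp] lin_scale[OF lin_cmp]
        using i i' ii by (simp add: fscale_def fun_eq_iff)
      ultimately show False using d s0 by (simp add: fscale_eq_0)
    qed
    hence "t' = fscale (c' / c) t" by (simp add: u_def fun_eq_iff fscale_def)
    thus ?thesis by blast
  qed
qed

text \<open>\<open>q\<close> to twice the content of the box that is added to row \<open>i\<close>.\<close>
definition ev :: "nat \<Rightarrow> 'k" where "ev i = q ^ (2 * count \<mu> i) / q ^ (2 * i)"

text \<open>The contents \<open>\<mu>\<^sub>i - i\<close> strictly decrease because \<open>\<mu>\<close> is dominant, and \<open>q\<close> is not a root of unity.\<close>
lemma ev_inj: assumes "i < n" "j < n" "ev i = ev j" shows "i = j"
proof -
  have *: False if "i < j" "j < n" "ev i = ev j" for i j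
  proof -
    have "count \<mu> j \<le> count \<mu> i" using dominant[OF stableD(7)[OF L sL] s0 sw ss, of i j] that by simp
    moreover have "q ^ (2 * count \<mu> i + 2 * j) = q ^ (2 * count \<mu> j + 2 * i)"
      using that(3) q0 by (simp add: ev_def field_simps power_add)
    hence "2 * count \<mu> i + 2 * j = 2 * count \<mu> j + 2 * i" by (rule q_pow_inj)
    ultimately show False using that by simp
  qed
  show ?thesis using *[of i j] *[of j i] assms by (cases i j rule: linorder_cases) auto
qed

text \<open>The singular vector equations for \<open>t\<close> form a triangular recursion that expresses the sum
\<open>D 0 e t\<close> through its last summand; each step costs a factor \<open>q\<^bsup>-2\<^esup>\<close>.\<close>
lemma D_sing:
  assumes t: "t \<in> N" "sing n (Suc e) t" and l: "l < n" and K: "K \<in> idx n e"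
  shows "D 0 e t (l # K) = inverse q ^ (2 * l) * (q ^ count (mset K) l * cmp l t K)"
proof -
  have Kl: "length K = e" using K by (rule idx_length)
  have sp: "cmp k t \<in> sp n e" for k using N_cmp[OF t(1)] stableD(7)[OF L] by blast
  \<comment> \<open>tails of the sum for \<open>D 0 e t\<close>; \<open>S 0\<close> is the whole sum and \<open>S l\<close> its diagonal term\<close>
  define S where "S m = (\<Sum>b\<in>{m..l}. opA e l b (cmp b t) K)" for m
  have rec: "S m = inverse q ^ 2 * S (Suc m)" if m: "m < l" for m
  proof -
    have "(\<Sum>b<n. Rdiag q b m * opA e l b (cmp b t) K) = (\<Sum>b\<in>{m..l}. Rdiag q b m * opA e l b (cmp b t) K)"
      using l opA_tri[OF _ sp Kl] by (intro sum.mono_neutral_right) (auto simp: Rdiag_def)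
    also have "\<dots> = Rdiag q m m * opA e l m (cmp m t) K + (\<Sum>b\<in>{Suc m..l}. Rdiag q b m * opA e l b (cmp b t) K)"
      using m by (simp add: sum.atLeast_Suc_atMost)
    also have "\<dots> = q * opA e l m (cmp m t) K + \<kappa> * S (Suc m)"
      unfolding S_def sum_distrib_left by (simp add: Rdiag_def)
    finally have 0: "q * opA e l m (cmp m t) K + \<kappa> * S (Suc m) = 0"
      using sing_N_rel(2)[OF t l m Kl] by simp
    have "q * S m = q * opA e l m (cmp m t) K + q * S (Suc m)"
      using m by (simp add: S_def sum.atLeast_Suc_atMost algebra_simps)
    also have "\<dots> = q * S (Suc m) - \<kappa> * S (Suc m)" using 0 by (simp add: algebra_simps eq_neg_iff_add_eq_0)
    also have "\<dots> = inverse q * S (Suc m)" by (simp add: algebra_simps)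
    finally show ?thesis using q0 by (simp add: field_simps power2_eq_square)
  qed
  have "S (l - d) = inverse q ^ (2 * d) * S l" if "d \<le> l" for d
    using that
  proof (induction d)
    case (Suc d)
    have "S (l - Suc d) = inverse q ^ 2 * S (l - d)" using rec[of "l - Suc d"] Suc.prems by (simp add: Suc_diff_Suc)
    thus ?case using Suc by (simp add: power_add power2_eq_square)
  qed simp
  from this[of l] have "S 0 = inverse q ^ (2 * l) * S l" by simp
  moreover have "D 0 e t (l # K) = S 0"
  proof -
    have "D 0 e t (l # K) = (\<Sum>j<n. opA e l j (cmp j t) K)" by (rule D_opA[OF N_sp[OF t(1)]])
    also have "\<dots> = S 0" unfolding S_def
      using l opA_tri[OF _ sp Kl] by (intro sum.mono_neutral_right) auto
    finally show ?thesis .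
  qed
  ultimately show ?thesis using opA_diag[OF l sp Kl] by (simp add: S_def)
qed

text \<open>\<open>J e t\<close> is again singular of the same weight, hence a multiple of \<open>t\<close>. The factor is found by
pairing with \<open>emb i (delta K0)\<close>, where \<open>J = C D\<close> and the adjointness of \<open>C\<close> and \<open>D\<close> reduce
everything to \<open>D_sing\<close>.\<close>
lemma J_sing:
  assumes t: "t \<in> N" "t \<noteq> 0" "wtv \<nu> t" "sing n (Suc e) t" and i: "\<nu> = add_mset i \<mu>"
  shows "J e t = fscale (ev i) t"
proof -
  obtain i' c where i': "i' < n" "c \<noteq> 0" "cmp i' t = fscale c s" "\<And>k. i' < k \<Longrightarrow> cmp k t = 0" "\<nu> = add_mset i' \<mu>"
    using leading[OF t] by blast
  have "i' = i" using i i'(5) by simp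
  note iN = i'(1)[unfolded this] and c = i'(2,3)[unfolded this] and top = i'(4)[unfolded this]
  have sp: "cmp k t \<in> sp n e" for k using N_cmp[OF t(1)] stableD(7)[OF L] by blast
  have sJ: "sing n (Suc e) (J e t)" unfolding sing_def
  proof (intro allI impI)
    fix l j assume lj: "l < n" "j < l"
    have "opA (Suc e) l j (J e t) = app n (Suc e) (matop (opA (Suc e) l j)) (J e t)"
      using lj by (intro opA_app J_sp N_sp t) auto
    also have "\<dots> = J e (app n (Suc e) (matop (opA (Suc e) l j)) t)" by (rule J_app[OF opA_comm])
    also have "app n (Suc e) (matop (opA (Suc e) l j)) t = opA (Suc e) l j t"
      using lj by (intro opA_app[symmetric] N_sp t) auto
    also have "opA (Suc e) l j t = 0" using t(4) lj by (simp add: sing_def)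
    also note lin_0[OF lin_J]
    finally show "opA (Suc e) l j (J e t) = 0" .
  qed
  obtain a where a: "J e t = fscale a t" using leading_unique[OF t J_N[OF t(1)] J_wtv[OF t(3)] sJ] by blast
  obtain K0 where K0: "cmp i t K0 \<noteq> 0" using c s0 by (auto simp: fun_eq_iff fscale_def)
  have K0i: "K0 \<in> idx n e" using K0 sp[of i] by (auto simp: sp_def)
  define y :: "'k vec" where "y = delta K0"
  have y: "y \<in> sp n e" unfolding y_def by (rule sp_delta[OF K0i])
  have "ip n (Suc e) (J e t) (emb i y) = (\<Sum>l<n. \<Sum>K\<in>idx n e. D 0 e t (l # K) * D 0 e (emb i y) (l # K))"
    unfolding ip_J_D by (simp add: ip_def sum_idx_Cons)
  also have "\<dots> = (\<Sum>l<n. if l = i then (\<Sum>K\<in>idx n e. ev i * (cmp i t K * y K)) else 0)"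
  proof (rule sum.cong[OF refl])
    fix l assume "l \<in> {..<n}" hence l: "l < n" by simp
    have D2: "D 0 e (emb i y) (l # K) = opA e l i y K" for K by (simp add: opA_def)
    show "(\<Sum>K\<in>idx n e. D 0 e t (l # K) * D 0 e (emb i y) (l # K)) = (if l = i then (\<Sum>K\<in>idx n e. ev i * (cmp i t K * y K)) else 0)"
    proof (cases "l = i")
      case True
      have "D 0 e t (l # K) * D 0 e (emb i y) (l # K) = ev i * (cmp i t K * y K)" if K: "K \<in> idx n e" for K
      proof (cases "cmp i t K = 0")
        case False
        hence "s K \<noteq> 0" using c by (auto simp: fscale_def)
        hence "mset K = \<mu>" using sw by (auto simp: wtv_def)
        hence "D 0 e t (l # K) * D 0 e (emb i y) (l # K)
          = inverse q ^ (2 * i) * (q ^ count \<mu> i * cmp i t K) * (q ^ count \<mu> i * y K)"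
          using True D_sing[OF t(1,4) iN K] opA_diag[OF iN y idx_length[OF K]] D2 by simp
        thus ?thesis using q0 by (simp add: ev_def power_inverse divide_inverse mult_2 power_add)
      qed (use True in \<open>simp add: D_sing[OF t(1,4) iN K]\<close>)
      thus ?thesis using True by (auto intro!: sum.cong)
    next
      case False
      have "D 0 e t (l # K) * D 0 e (emb i y) (l # K) = 0" if K: "K \<in> idx n e" for K
        using False D_sing[OF t(1,4) l K] top[of l] opA_tri[of l i y n e K] y idx_length[OF K]
        by (cases "l < i") (auto simp: D2)
      thus ?thesis using False by (simp add: sum.neutral)
    qed
  qed
  also have "\<dots> = ev i * cmp i t K0"
    using iN ip_delta[OF K0i, of "cmp i t"] by (simp add: y_def ip_def flip: sum_distrib_left)
  finally have 1: "ip n (Suc e) (J e t) (emb i y) = ev i * cmp i t K0" .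
  have "ip n (Suc e) t (emb i y) = (\<Sum>k<n. if k = i then ip n e (cmp i t) y else 0)"
    unfolding ip_snoc by (rule sum.cong) (auto simp: cmp_emb)
  also have "\<dots> = cmp i t K0" using iN ip_delta[OF K0i] by (simp add: y_def)
  finally have "a * cmp i t K0 = ev i * cmp i t K0" using 1 by (simp add: a ip_scale_left)
  thus ?thesis using a K0 by simp
qed

end

context hw_module begin

text \<open>\<open>J e\<close> may fail to be diagonalisable at this stage, so eigenvectors are separated with powers of \<open>J e - ev a\<close> that
exceed the length of the chain of generalised eigenspaces. \<open>purge as\<close> kills the generalised eigenspaces for all letters in
\<open>as\<close>.\<close>
definition shift :: "nat \<Rightarrow> 'k vec \<Rightarrow> 'k vec" where
  "shift a x = J e x - fscale (ev a) x"

lemma lin_shift: "lin (shift a)"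
  unfolding shift_def
  by (rule linI) (simp_all add: lin_add[OF lin_J] lin_scale[OF lin_J], simp_all add: fun_eq_iff fscale_def algebra_simps)

lemma shift_comm: "shift a (shift b x) = shift b (shift a x)"
  by (simp add: shift_def lin_diff[OF lin_J] lin_scale[OF lin_J]) (simp add: fun_eq_iff fscale_def algebra_simps)

lemma shift_pow_comm: "(shift a ^^ k) ((shift b ^^ m) x) = (shift b ^^ m) ((shift a ^^ k) x)"
proof -
  have 1: "shift a ((shift b ^^ m) x) = (shift b ^^ m) (shift a x)" for x
  proof (induction m)
    case (Suc m)
    have "shift a ((shift b ^^ Suc m) x) = shift b (shift a ((shift b ^^ m) x))" by (simp add: shift_comm[of a b])
    thus ?case by (simp add: Suc)
  qed simp
  show ?thesis by (induction k) (simp_all add: 1)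
qed

lemma shift_app: "comm n (Suc e) M \<Longrightarrow> app n (Suc e) M (shift a x) = shift a (app n (Suc e) M x)"
  by (simp add: shift_def lin_diff[OF lin_app] lin_scale[OF lin_app] J_app)

lemma shift_N: "x \<in> N \<Longrightarrow> shift a x \<in> N"
  unfolding shift_def by (intro fun_vs.subspace_diff stableD(1)[OF N_stable] stableD(6)[OF N_stable] J_N)

lemma shift_wtv: "wtv \<nu> x \<Longrightarrow> wtv \<nu> (shift a x)"
proof -
  assume "wtv \<nu> x"
  hence "wtv \<nu> (J e x + fscale (- ev a) x)" by (intro wtv_add wtv_scale J_wtv)
  thus ?thesis by (simp add: shift_def fscale_def fun_diff_def plus_fun_def)
qed

lemma ip_shift: "J e t = fscale (ev i) t \<Longrightarrow> ip n (Suc e) (shift a x) t = (ev i - ev a) * ip n (Suc e) x t"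
proof -
  assume t: "J e t = fscale (ev i) t"
  have "ip n (Suc e) (shift a x) t = ip n (Suc e) (J e x) t - ev a * ip n (Suc e) x t"
    by (simp add: shift_def ip_def fscale_def algebra_simps sum_subtractf sum_distrib_left)
  also have "ip n (Suc e) (J e x) t = ev i * ip n (Suc e) x t"
    unfolding ip_J t by (rule ip_scale_right)
  finally show ?thesis by (simp add: algebra_simps)
qed

definition stat :: "nat \<Rightarrow> nat" where
  "stat a = (SOME m. \<forall>x\<in>sp n (Suc e). (shift a ^^ Suc m) x = 0 \<longrightarrow> (shift a ^^ m) x = 0)"

lemma stat: "x \<in> sp n (Suc e) \<Longrightarrow> (shift a ^^ Suc (stat a)) x = 0 \<Longrightarrow> (shift a ^^ stat a) x = 0"
  using someI_ex[OF kernel_stationary[OF lin_shift, of n "Suc e" a], folded stat_def] by blast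

primrec purge :: "nat list \<Rightarrow> 'k vec \<Rightarrow> 'k vec" where
  "purge [] x = x"
| "purge (a # as) x = (shift a ^^ stat a) (purge as x)"

lemma lin_purge: "lin (purge as)"
proof (induction as)
  case Nil show ?case by (rule linI) (simp_all add: plus_fun_def fscale_def)
next
  case (Cons a as)
  show ?case unfolding purge.simps by (rule lin_comp[OF lin_pow[OF lin_shift] Cons])
qed

lemma pow_invariant: "(\<And>x. P x \<Longrightarrow> P (f x)) \<Longrightarrow> P x \<Longrightarrow> P ((f ^^ m) x)"
  by (induction m) auto

lemma purge_N: "x \<in> N \<Longrightarrow> purge as x \<in> N"
  by (induction as) (auto intro: pow_invariant[of "\<lambda>x. x \<in> N"] shift_N)

lemma purge_wtv: "wtv \<nu> x \<Longrightarrow> wtv \<nu> (purge as x)"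
  by (induction as) (auto intro: pow_invariant[of "wtv \<nu>"] shift_wtv)

lemma purge_app: "comm n (Suc e) M \<Longrightarrow> app n (Suc e) M (purge as x) = purge as (app n (Suc e) M x)"
proof (induction as)
  case (Cons a as)
  have "app n (Suc e) M ((shift a ^^ m) y) = (shift a ^^ m) (app n (Suc e) M y)" for m y
    by (induction m) (simp_all add: shift_app Cons.prems)
  thus ?case using Cons by simp
qed simp

lemma purge_factor: "a \<in> set as \<Longrightarrow> x \<in> N \<Longrightarrow> \<exists>y\<in>N. purge as x = (shift a ^^ stat a) y"
proof (induction as)
  case (Cons b as)
  show ?case
  proof (cases "a = b")
    case True thus ?thesis using purge_N[OF Cons.prems(2)] by auto
  next
    case False
    then obtain y where y: "y \<in> N" "purge as x = (shift a ^^ stat a) y" using Cons by auto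
    have "purge (b # as) x = (shift a ^^ stat a) ((shift b ^^ stat b) y)"
      by (simp add: y(2) shift_pow_comm)
    moreover have "(shift b ^^ stat b) y \<in> N" using y(1) by (auto intro: pow_invariant[of "\<lambda>x. x \<in> N"] shift_N)
    ultimately show ?thesis by blast
  qed
qed simp

lemma ip_purge: assumes t: "J e t = fscale (ev i) t" and "i < n" "\<And>a. a \<in> set as \<Longrightarrow> a < n \<and> a \<noteq> i" "ip n (Suc e) x t \<noteq> 0"
  shows "ip n (Suc e) (purge as x) t \<noteq> 0"
  using assms(3)
proof (induction as)
  case (Cons a as)
  have "ev i \<noteq> ev a" using ev_inj assms(2) Cons.prems[of a] by auto
  moreover have "ip n (Suc e) ((shift a ^^ m) y) t = (ev i - ev a) ^ m * ip n (Suc e) y t" for m y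
    by (induction m) (simp_all add: ip_shift[OF t])
  ultimately show ?case using Cons by simp
qed (use assms in simp)

text \<open>Over an arbitrary field a form that pairs the standard basis may have isotropic vectors, so this
needs an argument. The vector \<open>s \<otimes> v\<^sub>i\<close> has nonzero pairing with \<open>t\<close>, and so has its image \<open>x'\<close> after all
other generalised eigenspaces of \<open>J\<close> are purged, because \<open>J\<close> is self-adjoint. Raising \<open>x'\<close> leads to
a singular vector in the purged module, whose eigenvalue must be \<open>ev i\<close>; by weight nothing was
raised, so \<open>x'\<close> is singular itself and a multiple of \<open>t\<close>.\<close>
lemma sing_nonisotropic:
  assumes t: "t \<in> N" "t \<noteq> 0" "wtv \<nu> t" "sing n (Suc e) t"
  shows "ip n (Suc e) t t \<noteq> 0"
proof -
  obtain i c where i: "i < n" "c \<noteq> 0" "cmp i t = fscale c s" "\<nu> = add_mset i \<mu>"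
    using leading[OF t] by metis
  note Jt = J_sing[OF t i(4)]
  define as where "as = filter (\<lambda>a. a \<noteq> i) [0..<n]"
  have as: "set as = {..<n} - {i}" by (auto simp: as_def)
  have s_sp: "s \<in> sp n e" by (rule stableD(7)[OF L sL])
  have x: "emb i s \<in> N" using emb_sp[OF s_sp i(1)] sL stableD(4)[OF L] by (auto simp: N_def cmp_emb)
  have xw: "wtv \<nu> (emb i s)" using wtv_emb[OF sw] i(4) by simp
  have "ip n (Suc e) (emb i s) t = (\<Sum>k<n. if k = i then ip n e s (cmp i t) else 0)"
    unfolding ip_snoc by (rule sum.cong) (auto simp: cmp_emb)
  also have "\<dots> = c * ip n e s s" using i by (simp add: ip_scale_right)
  finally have ixt: "ip n (Suc e) (emb i s) t \<noteq> 0" using sip i(2) by simp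
  \<comment> \<open>the part of \<open>s \<otimes> v\<^sub>i\<close> in the generalised eigenspace of \<open>t\<close>\<close>
  define x' where "x' = purge as (emb i s)"
  define W where "W = purge as ` N"
  have W: "stable n (Suc e) W"
  proof (rule stableI)
    show "0 \<in> W" using stableD(4)[OF N_stable] lin_0[OF lin_purge] unfolding W_def by (metis imageI)
    show "x + y \<in> W" if "x \<in> W" "y \<in> W" for x y
      using that stableD(5)[OF N_stable] unfolding W_def by (auto simp flip: lin_add[OF lin_purge])
    show "fscale c x \<in> W" if "x \<in> W" for c x
      using that stableD(6)[OF N_stable] unfolding W_def by (auto simp flip: lin_scale[OF lin_purge])
    show "x \<in> sp n (Suc e)" if "x \<in> W" for x using that purge_N N_sp unfolding W_def by blast
    show "app n (Suc e) M x \<in> W" if "comm n (Suc e) M" "x \<in> W" for M x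
      using that stableD(3)[OF N_stable] unfolding W_def by (auto simp: purge_app)
  qed
  have x'W: "x' \<in> W" and x'w: "wtv \<nu> x'" and x't: "ip n (Suc e) x' t \<noteq> 0" and x'N: "x' \<in> N"
    using x ip_purge[OF Jt i(1) _ ixt, of as] as purge_wtv[OF xw] purge_N by (auto simp: x'_def W_def)
  have x'0: "x' \<noteq> 0" using x't by auto
  obtain t' \<nu>' where t': "t' \<in> W" "t' \<noteq> 0" "wtv \<nu>' t'" "sing n (Suc e) t'" "t' = x' \<or> sum_mset \<nu>' < sum_mset \<nu>"
    using sing_exists[OF W x'W x'0 x'w] by blast
  have t'N: "t' \<in> N" using t'(1) purge_N by (auto simp: W_def)
  obtain i' c' where i': "i' < n" "\<nu>' = add_mset i' \<mu>" using leading[OF t'N t'(2-4)] by metis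
  have "i' = i"
  proof (rule ccontr)
    assume "i' \<noteq> i"
    hence "i' \<in> set as" using as i' by auto
    then obtain y where y: "y \<in> N" "t' = (shift i' ^^ stat i') y" using purge_factor t'(1) unfolding W_def by blast
    have "shift i' t' = 0" using J_sing[OF t'N t'(2-4) i'(2)] by (simp add: shift_def)
    hence "(shift i' ^^ Suc (stat i')) y = 0" using y(2) by simp
    hence "t' = 0" using stat[OF N_sp[OF y(1)]] y(2) by blast
    thus False using t' by simp
  qed
  hence "\<nu>' = \<nu>" using i' i by simp
  \<comment> \<open>equal weights, so nothing was raised\<close>
  hence "t' = x'" using t'(5) by simp
  then obtain a where "x' = fscale a t" using leading_unique[OF t x'N x'w] t'(4) by blast
  thus ?thesis using x't by (auto simp: ip_scale_left)
qed

definition gen :: "'k vec \<Rightarrow> 'k vec set" where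
  "gen t = {app n (Suc e) M t |M. comm n (Suc e) M}"

lemma gen_stable: assumes t: "t \<in> N" shows "stable n (Suc e) (gen t)"
proof (rule stableI)
  have "app n (Suc e) (\<lambda>K L. 0) t = 0" by (auto simp: app_def fun_eq_iff)
  thus "0 \<in> gen t" using comm_zero unfolding gen_def by (metis (mono_tags, lifting) mem_Collect_eq)
next
  fix x y assume "x \<in> gen t" "y \<in> gen t"
  then obtain M P where M: "comm n (Suc e) M" "comm n (Suc e) P" "x = app n (Suc e) M t" "y = app n (Suc e) P t"
    by (auto simp: gen_def)
  have "x + y = app n (Suc e) (\<lambda>K L. M K L + P K L) t"
    unfolding M by (auto simp: app_def fun_eq_iff sum.distrib algebra_simps)
  thus "x + y \<in> gen t" using comm_add[OF M(1,2)] unfolding gen_def by blast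
next
  fix c x assume "x \<in> gen t"
  then obtain M where M: "comm n (Suc e) M" "x = app n (Suc e) M t" by (auto simp: gen_def)
  have "fscale c x = app n (Suc e) (\<lambda>K L. c * M K L) t"
    unfolding M by (auto simp: app_def fun_eq_iff fscale_def sum_distrib_left algebra_simps)
  thus "fscale c x \<in> gen t" using comm_scale[OF M(1)] unfolding gen_def by blast
next
  fix M x assume M: "comm n (Suc e) M" and "x \<in> gen t"
  then obtain P where P: "comm n (Suc e) P" "x = app n (Suc e) P t" by (auto simp: gen_def)
  thus "app n (Suc e) M x \<in> gen t" using comm_mm[OF M P(1)] unfolding gen_def by (auto simp flip: app_mm)
qed (auto simp: gen_def)

lemma gen_self: "t \<in> N \<Longrightarrow> t \<in> gen t"
  unfolding gen_def using comm_id app_id[OF N_sp] by (metis (mono_tags, lifting) mem_Collect_eq)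

lemma gen_N: "t \<in> N \<Longrightarrow> gen t \<subseteq> N"
  using stableD(3)[OF N_stable] by (auto simp: gen_def)

text \<open>Two singular vectors in one cyclic module have the same \<open>J\<close>-eigenvalue, since \<open>J\<close> commutes with the
commutant; by \<open>ev_inj\<close> they have the same leading letter, and \<open>leading_unique\<close> applies.\<close>
lemma gen_good:
  assumes t: "t \<in> N" "t \<noteq> 0" "wtv \<nu> t" "sing n (Suc e) t"
  shows "good n (Suc e) (gen t)"
proof -
  obtain i where i: "i < n" "\<nu> = add_mset i \<mu>" using leading[OF t] by metis
  have u: "\<exists>c. t' = fscale c t" if t': "t' \<in> gen t" "wtv \<nu>' t'" "sing n (Suc e) t'" for t' \<nu>'
  proof (cases "t' = 0")
    case True thus ?thesis by (intro exI[of _ 0]) (simp add: fscale_def fun_eq_iff)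
  next
    case False
    have t'N: "t' \<in> N" using gen_N t t' by blast
    obtain i' where i': "i' < n" "\<nu>' = add_mset i' \<mu>" using leading[OF t'N False t'(2,3)] by metis
    obtain M where M: "comm n (Suc e) M" "t' = app n (Suc e) M t" using t'(1) by (auto simp: gen_def)
    have "J e t' = fscale (ev i) t'"
      unfolding M(2) J_app[OF M(1), symmetric] J_sing[OF t i(2)] by (rule lin_scale[OF lin_app])
    moreover have "J e t' = fscale (ev i') t'" by (rule J_sing[OF t'N False t'(2,3) i'(2)])
    moreover obtain K where "t' K \<noteq> 0" using False by (auto simp: fun_eq_iff)
    ultimately have "ev i = ev i'" by (metis fscale_def mult_cancel_right)
    hence "i = i'" using ev_inj i i' by blast
    thus ?thesis using leading_unique[OF t t'N _ t'(3)] t'(2) i i' by blast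
  qed
  have "\<forall>x\<in>gen t. \<exists>M. comm n (Suc e) M \<and> x = app n (Suc e) M t" unfolding gen_def by blast
  thus ?thesis unfolding good_def
    by (intro conjI gen_stable[OF t(1)] exI[of _ t] exI[of _ \<nu>] gen_self[OF t(1)] t(2-4) sing_nonisotropic[OF t])
       (use u in blast)+
qed

text \<open>The orthogonal complement in \<open>N\<close> of all the submodules \<open>gen t\<close> is a submodule. If it were nonzero it would contain
a singular vector \<open>t\<close>, which would be orthogonal to itself.\<close>
lemma N_span: "N \<subseteq> fun_vs.span (\<Union>{G. good n (Suc e) G})"
proof -
  define S where "S = {t \<in> N. t \<noteq> 0 \<and> sing n (Suc e) t \<and> (\<exists>\<nu>. wtv \<nu> t)}"
  have SN: "\<Union>(gen ` S) \<subseteq> N" using gen_N by (auto simp: S_def)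
  have "N \<subseteq> fun_vs.span (\<Union>(gen ` S))"
  proof (rule span_if_no_perp[of N n "Suc e"])
    fix x assume x: "x \<in> N" "\<And>y. y \<in> \<Union>(gen ` S) \<Longrightarrow> ip n (Suc e) x y = 0"
    define Z where "Z = {x \<in> N. \<forall>y\<in>\<Union>(gen ` S). ip n (Suc e) x y = 0}"
    have Z: "stable n (Suc e) Z"
    proof (rule stableI)
      fix M x assume M: "comm n (Suc e) M" and x: "x \<in> Z"
      have "ip n (Suc e) (app n (Suc e) M x) y = 0" if y: "y \<in> gen t" "t \<in> S" for y t
      proof -
        have "app n (Suc e) (\<lambda>K L. M L K) y \<in> gen t"
          by (rule stableD(3)[OF gen_stable comm_transpose[OF M] y(1)]) (use y in \<open>auto simp: S_def\<close>)
        thus ?thesis unfolding ip_app using x y(2) by (auto simp: Z_def)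
      qed
      thus "app n (Suc e) M x \<in> Z" using x stableD(3)[OF N_stable M] by (auto simp: Z_def)
    qed (auto simp: Z_def ip_add_left ip_scale_left stableD(4-6)[OF N_stable] N_sp)
    show "x = 0"
    proof (rule ccontr)
      assume "x \<noteq> 0"
      then obtain y \<nu> where y: "y \<in> Z" "y \<noteq> 0" "wtv \<nu> y" using weight_component[OF Z, of x] x by (auto simp: Z_def)
      then obtain t \<nu>' where t: "t \<in> Z" "t \<noteq> 0" "wtv \<nu>' t" "sing n (Suc e) t" using sing_exists[OF Z] by blast
      have tN: "t \<in> N" using t by (simp add: Z_def)
      hence "t \<in> S" using t by (auto simp: S_def)
      hence "ip n (Suc e) t t = 0" using t(1) gen_self[OF tN] by (auto simp: Z_def)
      thus False using sing_nonisotropic[OF tN t(2-4)] by simp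
    qed
  qed (rule stableD(1,2)[OF N_stable] SN)+
  also have "\<dots> \<subseteq> fun_vs.span (\<Union>{G. good n (Suc e) G})"
    by (rule fun_vs.span_mono) (auto simp: S_def dest: gen_good)
  finally show ?thesis .
qed

end

context generic_hecke begin

lemma good_0: "good n 0 (sp n 0)"
proof -
  have st: "stable n 0 (sp n 0)" by (rule stableI) (auto intro: sp_add sp_scale)
  have c: "x = fscale (x []) (delta [])" if "x \<in> sp n 0" for x :: "'k vec"
    using sp_expand[OF that] by (simp add: idx_0)
  have d: "delta [] \<in> sp n 0" by (rule sp_delta) (simp add: idx_0)
  have cm: "comm n 0 M" for M by (simp add: comm_def)
  have "\<exists>M. comm n 0 M \<and> x = app n 0 M (delta [])" if "x \<in> sp n 0" for x
    using cm that by (intro exI[of _ "\<lambda>K L. x K"]) (auto simp: fun_eq_iff app_def idx_0 delta_def sp_def)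
  moreover have "sing n 0 (delta [])" unfolding sing_def
  proof (intro allI impI)
    fix l j assume "l < n" "j < l"
    thus "opA 0 l j (delta []) = 0"
      using d by (intro sp_eqI[of _ n 0] opA_sp) (auto simp: idx_0 opA_0)
  qed
  moreover have "ip n 0 (delta []) (delta []) \<noteq> (0::'k)" by (simp add: ip_def idx_0 delta_def)
  moreover have "wtv {#} (delta [] :: 'k vec)" by (auto simp: wtv_def delta_def)
  moreover have "delta [] \<noteq> (0 :: 'k vec)" by (auto simp: delta_def fun_eq_iff)
  ultimately show ?thesis unfolding good_def using st d c by blast
qed

text \<open>Tensor space is the sum of its good, in particular simple, submodules: by induction each good
submodule \<open>L\<close> of degree \<open>e\<close> contributes \<open>L \<otimes> V\<^sub>n\<close>, which \<open>N_span\<close> decomposes.\<close>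
theorem tensor_space_semisimple: "sp n e \<subseteq> fun_vs.span (\<Union>{G. good n e G})"
proof (induction e)
  case 0
  have "sp n 0 \<subseteq> \<Union>{G. good n 0 G}" using good_0 by blast
  thus ?case by (rule order_trans[OF _ fun_vs.span_superset])
next
  case (Suc e)
  let ?R = "fun_vs.span (\<Union>{G. good n (Suc e) G})"
  have e: "emb j x \<in> ?R" if j: "j < n" and x: "x \<in> sp n e" for j x
  proof -
    have "fun_vs.span (\<Union>{G. good n e G}) \<subseteq> {y. emb j y \<in> ?R}"
    proof (rule fun_vs.span_minimal)
      show "fun_vs.subspace {y. emb j y \<in> ?R}"
        by (rule subspaceI) (simp_all add: lin_add[OF lin_emb] lin_scale[OF lin_emb] lin_0[OF lin_emb] fun_vs.span_zero fun_vs.span_add fun_vs.span_scale)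
      show "\<Union>{G. good n e G} \<subseteq> {y. emb j y \<in> ?R}"
      proof
        fix y assume "y \<in> \<Union>{G. good n e G}"
        then obtain G where G: "good n e G" "y \<in> G" by blast
        obtain s \<mu> where s: "s \<in> G" "s \<noteq> 0" "wtv \<mu> s" "sing n e s" "ip n e s s \<noteq> 0"
            "\<forall>t \<nu>. t \<in> G \<longrightarrow> wtv \<nu> t \<longrightarrow> sing n e t \<longrightarrow> (\<exists>c. t = fscale c s)" and st: "stable n e G"
          using G(1) unfolding good_def by metis
        interpret hw: hw_module q n e G s \<mu> by unfold_locales (rule st s(1-5) | erule (2) s(6)[rule_format])+
        have "emb j y \<in> hw.N" unfolding hw.N_def
          using emb_sp[OF stableD(7)[OF st G(2)] j] G(2) stableD(4)[OF st] by (auto simp: cmp_emb)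
        hence "emb j y \<in> ?R" by (rule subsetD[OF hw.N_span])
        thus "y \<in> {y. emb j y \<in> ?R}" by simp
      qed
    qed
    hence "x \<in> {y. emb j y \<in> ?R}" using subsetD[OF Suc x] by (rule subsetD)
    thus ?thesis by simp
  qed
  show ?case
  proof
    fix x :: "'k vec" assume x: "x \<in> sp n (Suc e)"
    have "(\<Sum>j<n. emb j (cmp j x)) \<in> ?R" by (intro fun_vs.span_sum e cmp_sp[OF x]) auto
    thus "x \<in> ?R" by (subst emb_cmp_expand[OF x])
  qed
qed

end

section \<open>Complete reducibility\<close>

text \<open>\<open>V\<^sub>n\<^bsup>\<otimes>e\<^esup>\<close> with multiplicity space indexed by \<open>Q\<close>; the commutant acts on each slice.\<close>
definition spQ :: "nat \<Rightarrow> nat \<Rightarrow> 'p set \<Rightarrow> (nat list \<times> 'p \<Rightarrow> 'k::field) set" where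
  "spQ n e Q = {F. \<forall>z. z \<notin> idx n e \<times> Q \<longrightarrow> F z = 0}"

definition slice :: "'p \<Rightarrow> (nat list \<times> 'p \<Rightarrow> 'k::field) \<Rightarrow> 'k vec" where
  "slice p F = (\<lambda>K. F (K, p))"

definition put :: "'p \<Rightarrow> 'k::field vec \<Rightarrow> (nat list \<times> 'p \<Rightarrow> 'k)" where
  "put p y = (\<lambda>(K, r). if r = p then y K else 0)"

definition appQ :: "nat \<Rightarrow> nat \<Rightarrow> 'k::field mat \<Rightarrow> (nat list \<times> 'p \<Rightarrow> 'k) \<Rightarrow> (nat list \<times> 'p \<Rightarrow> 'k)" where
  "appQ n e M F = (\<lambda>(K, p). app n e M (slice p F) K)"

lemma slice_spQ: "F \<in> spQ n e Q \<Longrightarrow> slice p F \<in> sp n e" by (auto simp: spQ_def slice_def sp_def)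
lemma lin_slice: "lin (slice p)" by (rule linI) (auto simp: slice_def fscale_def fun_eq_iff)
lemma lin_put: "lin (put p)" by (rule linI) (auto simp: put_def fscale_def fun_eq_iff)
lemma lin_appQ: "lin (appQ n e M)"
  by (rule linI; simp add: appQ_def lin_add[OF lin_slice] lin_add[OF lin_app] lin_scale[OF lin_slice] lin_scale[OF lin_app])
     (auto simp: fun_eq_iff fscale_def)
lemma put_spQ: "y \<in> sp n e \<Longrightarrow> p \<in> Q \<Longrightarrow> put p y \<in> spQ n e Q" by (auto simp: spQ_def put_def sp_def)
lemma appQ_put: "appQ n e M (put p y) = put p (app n e M y)"
proof -
  have "slice r (put p y) = (if r = p then y else 0)" for r by (auto simp: slice_def put_def fun_eq_iff)
  hence "appQ n e M (put p y) (K, r) = put p (app n e M y) (K, r)" for K r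
    by (simp add: appQ_def lin_0[OF lin_app]) (simp add: put_def)
  thus ?thesis by auto
qed
lemma appQ_spQ: "F \<in> spQ n e Q \<Longrightarrow> appQ n e M F \<in> spQ n e Q"
proof -
  assume F: "F \<in> spQ n e Q"
  hence "slice p F = 0" if "p \<notin> Q" for p using that by (auto simp: spQ_def slice_def fun_eq_iff)
  moreover have "app n e M x K = 0" if "K \<notin> idx n e" for x K using that by (simp add: app_def)
  ultimately show ?thesis by (auto simp: spQ_def appQ_def lin_0[OF lin_app])
qed

lemma spQ_expand: fixes F :: "nat list \<times> 'a \<Rightarrow> 'k::field" assumes "finite Q" "F \<in> spQ n e Q" shows "F = (\<Sum>p\<in>Q. put p (slice p F))"
proof
  fix z :: "nat list \<times> 'a"
  obtain K p where z: "z = (K, p)" by (cases z)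
  have "(\<Sum>p\<in>Q. put p (slice p F)) z = (\<Sum>r\<in>Q. if r = p then F (K, p) else 0)"
    unfolding sum_fun_apply z by (rule sum.cong) (auto simp: put_def slice_def)
  thus "F z = (\<Sum>p\<in>Q. put p (slice p F)) z" using assms by (auto simp: z spQ_def)
qed

context hecke begin

definition stableQ :: "nat \<Rightarrow> nat \<Rightarrow> 'p set \<Rightarrow> (nat list \<times> 'p \<Rightarrow> 'k) set \<Rightarrow> bool" where
  "stableQ n e Q Y \<longleftrightarrow> fun_vs.subspace Y \<and> Y \<subseteq> spQ n e Q \<and> (\<forall>M x. comm n e M \<longrightarrow> x \<in> Y \<longrightarrow> appQ n e M x \<in> Y)"

lemma stableQD:
  assumes "stableQ n e Q Y"
  shows "fun_vs.subspace Y" "Y \<subseteq> spQ n e Q" "\<And>M x. comm n e M \<Longrightarrow> x \<in> Y \<Longrightarrow> appQ n e M x \<in> Y"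
    "0 \<in> Y" "\<And>x y. x \<in> Y \<Longrightarrow> y \<in> Y \<Longrightarrow> x + y \<in> Y" "\<And>c x. x \<in> Y \<Longrightarrow> fscale c x \<in> Y"
    "\<And>x. x \<in> Y \<Longrightarrow> x \<in> spQ n e Q"
  using assms by (auto simp: stableQ_def fun_vs.subspace_def)

lemma stableQI:
  assumes "0 \<in> Y" "\<And>x y. x \<in> Y \<Longrightarrow> y \<in> Y \<Longrightarrow> x + y \<in> Y" "\<And>c x. x \<in> Y \<Longrightarrow> fscale c x \<in> Y"
    "\<And>x. x \<in> Y \<Longrightarrow> x \<in> spQ n e Q" "\<And>M x. comm n e M \<Longrightarrow> x \<in> Y \<Longrightarrow> appQ n e M x \<in> Y"
  shows "stableQ n e Q Y"
  using assms by (auto simp: stableQ_def fun_vs.subspace_def)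

text \<open>A nonzero submodule contains a singular weight vector, hence a multiple of the generator.\<close>
lemma good_simple:
  assumes G: "good n e G" and Z: "stable n e Z" "Z \<subseteq> G" and x: "x \<in> Z" "x \<noteq> 0"
  shows "G \<subseteq> Z"
proof
  fix y assume y: "y \<in> G"
  obtain s \<mu> where s: "s \<in> G" "\<forall>x\<in>G. \<exists>M. comm n e M \<and> x = app n e M s"
     "\<forall>t \<nu>. t \<in> G \<longrightarrow> wtv \<nu> t \<longrightarrow> sing n e t \<longrightarrow> (\<exists>c. t = fscale c s)"
    using G unfolding good_def by metis
  obtain w \<nu> where w: "w \<in> Z" "w \<noteq> 0" "wtv \<nu> w" using weight_component[OF Z(1) x] by metis
  obtain t \<nu>' where t: "t \<in> Z" "t \<noteq> 0" "wtv \<nu>' t" "sing n e t" using sing_exists[OF Z(1) w] by metis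
  obtain c where c: "t = fscale c s" using s(3) t Z(2) by (meson subsetD)
  have "c \<noteq> 0" using c t(2) by (auto simp: fscale_eq_0)
  hence "s = fscale (inverse c) t" unfolding c fscale_fscale by (simp add: fscale_def)
  hence "s \<in> Z" using stableD(6)[OF Z(1) t(1)] by metis
  thus "y \<in> Z" using s(2) y stableD(3)[OF Z(1)] by metis
qed

lemma stableQ_sum:
  assumes "stableQ n e Q A" "stableQ n e Q Y" shows "stableQ n e Q {x + y |x y. x \<in> A \<and> y \<in> Y}"
proof (rule stableQI)
  show "0 \<in> {x + y |x y. x \<in> A \<and> y \<in> Y}"
    using stableQD(4)[OF assms(1)] stableQD(4)[OF assms(2)] by (intro CollectI exI[of _ 0]) auto
next
  fix u v assume "u \<in> {x + y |x y. x \<in> A \<and> y \<in> Y}" "v \<in> {x + y |x y. x \<in> A \<and> y \<in> Y}"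
  then obtain x y x' y' where u: "x \<in> A" "y \<in> Y" "u = x + y" "x' \<in> A" "y' \<in> Y" "v = x' + y'" by auto
  have "u + v = (x + x') + (y + y')" by (simp add: u algebra_simps)
  thus "u + v \<in> {x + y |x y. x \<in> A \<and> y \<in> Y}"
    using stableQD(5)[OF assms(1) u(1,4)] stableQD(5)[OF assms(2) u(2,5)] by blast
next
  fix c u assume "u \<in> {x + y |x y. x \<in> A \<and> y \<in> Y}"
  then obtain x y where u: "x \<in> A" "y \<in> Y" "u = x + y" by auto
  have "fscale c u = fscale c x + fscale c y" by (simp add: u fscale_def fun_eq_iff algebra_simps)
  thus "fscale c u \<in> {x + y |x y. x \<in> A \<and> y \<in> Y}"
    using stableQD(6)[OF assms(1) u(1)] stableQD(6)[OF assms(2) u(2)] by blast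
next
  fix u assume "u \<in> {x + y |x y. x \<in> A \<and> y \<in> Y}"
  then obtain x y where u: "x \<in> A" "y \<in> Y" "u = x + y" by auto
  thus "u \<in> spQ n e Q" using stableQD(7)[OF assms(1) u(1)] stableQD(7)[OF assms(2) u(2)] by (auto simp: spQ_def)
next
  fix M u assume M: "comm n e M" and "u \<in> {x + y |x y. x \<in> A \<and> y \<in> Y}"
  then obtain x y where u: "x \<in> A" "y \<in> Y" "u = x + y" by auto
  have "appQ n e M u = appQ n e M x + appQ n e M y" by (simp add: u lin_add[OF lin_appQ])
  thus "appQ n e M u \<in> {x + y |x y. x \<in> A \<and> y \<in> Y}"
    using stableQD(3)[OF assms(1) M u(1)] stableQD(3)[OF assms(2) M u(2)] by blast
qed

lemma stableQ_put: assumes "stable n e G" "p \<in> Q" shows "stableQ n e Q (put p ` G)"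
proof (rule stableQI)
  show "0 \<in> put p ` G" using stableD(4)[OF assms(1)] lin_0[OF lin_put, of p] by (metis imageI)
  show "x + y \<in> put p ` G" if "x \<in> put p ` G" "y \<in> put p ` G" for x y
    using that stableD(5)[OF assms(1)] by (auto simp flip: lin_add[OF lin_put])
  show "fscale c x \<in> put p ` G" if "x \<in> put p ` G" for c x
    using that stableD(6)[OF assms(1)] by (auto simp flip: lin_scale[OF lin_put])
  show "x \<in> spQ n e Q" if "x \<in> put p ` G" for x using that put_spQ[OF stableD(7)[OF assms(1)] assms(2)] by auto
  show "appQ n e M x \<in> put p ` G" if "comm n e M" "x \<in> put p ` G" for M x
    using that stableD(3)[OF assms(1)] by (auto simp: appQ_put)
qed

lemma spQ_independent: fixes B :: "(nat list \<times> 'p \<Rightarrow> 'k) set" assumes "fun_vs.independent B" "B \<subseteq> spQ n e Q" "finite Q"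
  shows "finite B" "card B \<le> card (idx n e \<times> Q)"
proof -
  have "B \<subseteq> fun_vs.span (delta ` (idx n e \<times> Q))"
  proof
    fix F assume "F \<in> B"
    hence "F = (\<Sum>z\<in>idx n e \<times> Q. fscale (F z) (delta z))"
      using assms by (intro delta_expand) (auto simp: spQ_def)
    also have "\<dots> \<in> fun_vs.span (delta ` (idx n e \<times> Q))"
      by (intro fun_vs.span_sum fun_vs.span_scale fun_vs.span_base) auto
    finally show "F \<in> fun_vs.span (delta ` (idx n e \<times> Q))" .
  qed
  hence "finite B \<and> card B \<le> card ((delta :: nat list \<times> 'p \<Rightarrow> nat list \<times> 'p \<Rightarrow> 'k) ` (idx n e \<times> Q))"
    using assms by (intro fun_vs.independent_span_bound) auto
  thus "finite B" "card B \<le> card (idx n e \<times> Q)"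
    using card_image_le[of "idx n e \<times> Q" "delta :: nat list \<times> 'p \<Rightarrow> nat list \<times> 'p \<Rightarrow> 'k"] assms(3) by auto
qed

end

context generic_hecke begin

text \<open>Take a submodule \<open>C\<close> with \<open>A \<inter> C = 0\<close> of the largest possible dimension. If \<open>A + C\<close> missed a copy of a good submodule, that copy
would meet \<open>A + C\<close> trivially by simplicity and could be added to \<open>C\<close>.\<close>
lemma stable_complement:
  assumes Q: "finite Q" and A: "stableQ n e Q A"
  obtains C where "stableQ n e Q C" "\<And>F. F \<in> A \<Longrightarrow> F \<in> C \<Longrightarrow> F = 0"
    "\<And>F. F \<in> spQ n e Q \<Longrightarrow> \<exists>x\<in>A. \<exists>c\<in>C. F = x + c"
proof -
  \<comment> \<open>\<open>P k\<close>: some submodule meeting \<open>A\<close> trivially contains \<open>k\<close> independent vectors\<close>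
  define P where "P k \<longleftrightarrow> (\<exists>C B. stableQ n e Q C \<and> (\<forall>F. F \<in> A \<longrightarrow> F \<in> C \<longrightarrow> F = 0) \<and>
     fun_vs.independent B \<and> B \<subseteq> C \<and> card B = k)" for k
  have "P 0" unfolding P_def
  proof (intro exI conjI)
    show "stableQ n e Q {0}" by (rule stableQI) (auto simp: spQ_def lin_0[OF lin_appQ])
    show "fun_vs.independent ({} :: (nat list \<times> _ \<Rightarrow> 'k) set)" by (rule fun_vs.independent_empty)
  qed auto
  moreover have bd: "k \<le> card (idx n e \<times> Q)" if "P k" for k
  proof -
    obtain C B where "stableQ n e Q C" "fun_vs.independent B" "B \<subseteq> C" "card B = k" using \<open>P k\<close> unfolding P_def by metis
    thus ?thesis using spQ_independent(2)[of B n e Q] stableQD(2)[of n e Q C] Q by (metis subset_trans)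
  qed
  ultimately obtain k where k: "P k" "\<And>k'. P k' \<Longrightarrow> k' \<le> k"
    using GreatestI_nat[of P 0] Greatest_le_nat[of P] by metis
  then obtain C B where C: "stableQ n e Q C" "\<And>F. F \<in> A \<Longrightarrow> F \<in> C \<Longrightarrow> F = 0" and
    B: "fun_vs.independent B" "B \<subseteq> C" "card B = k" unfolding P_def by metis
  define Y where "Y = {x + c |x c. x \<in> A \<and> c \<in> C}"
  have Y: "stableQ n e Q Y" unfolding Y_def by (rule stableQ_sum[OF A C(1)])
  have AY: "x \<in> Y" if "x \<in> A" for x
    using that stableQD(4)[OF C(1)] unfolding Y_def by (intro CollectI exI[of _ x] exI[of _ 0]) auto
  have CY: "c \<in> Y" if "c \<in> C" for c
    using that stableQD(4)[OF A] unfolding Y_def by (intro CollectI exI[of _ 0] exI[of _ c]) auto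
  have all: "put p y \<in> Y" if p: "p \<in> Q" and G: "good n e G" "y \<in> G" for p G y
  proof (rule ccontr)
    assume ny: "put p y \<notin> Y"
    have stG: "stable n e G" using G(1) by (simp add: good_def)
    define Z where "Z = {y \<in> G. put p y \<in> Y}"
    have Z: "stable n e Z"
      by (rule stableI) (auto simp: Z_def lin_0[OF lin_put] lin_add[OF lin_put] lin_scale[OF lin_put]
          stableQD(4-6)[OF Y] stableD(4-7)[OF stG] stableD(3)[OF stG] stableQD(3)[OF Y] simp flip: appQ_put)
    have Z0: "x = 0" if "x \<in> Z" for x
    proof (rule ccontr)
      assume "x \<noteq> 0"
      hence "G \<subseteq> Z" using good_simple[OF G(1) Z _ that] by (auto simp: Z_def)
      thus False using G(2) ny by (auto simp: Z_def)
    qed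
    define C' where "C' = {c + g |c g. c \<in> C \<and> g \<in> put p ` G}"
    have C': "stableQ n e Q C'" unfolding C'_def by (rule stableQ_sum[OF C(1) stableQ_put[OF stG p]])
    have "F = 0" if F: "F \<in> A" "F \<in> C'" for F
    proof -
      obtain c g where cg: "c \<in> C" "g \<in> G" "F = c + put p g" using F(2) by (auto simp: C'_def)
      have "put p g = F + fscale (-1) c" by (simp add: cg fscale_def fun_eq_iff)
      hence "put p g \<in> Y" using AY[OF F(1)] stableQD(6)[OF Y CY[OF cg(1)], of "-1"] stableQD(5)[OF Y] by metis
      hence "g = 0" using Z0 cg(2) by (auto simp: Z_def)
      hence "F = c" using cg by (simp add: lin_0[OF lin_put])
      thus ?thesis using C(2) F cg by blast
    qed
    moreover have "fun_vs.independent (insert (put p y) B)"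
    proof (rule fun_vs.independent_insertI[OF _ B(1)])
      have "fun_vs.span B \<subseteq> C" by (rule fun_vs.span_minimal[OF B(2) stableQD(1)[OF C(1)]])
      thus "put p y \<notin> fun_vs.span B" using CY ny by auto
    qed
    moreover have "insert (put p y) B \<subseteq> C'"
    proof -
      have "c \<in> C'" if "c \<in> C" for c unfolding C'_def
        using that stableQD(4)[OF stableQ_put[OF stG p]] by (intro CollectI exI[of _ c] exI[of _ 0]) auto
      moreover have "put p y \<in> C'" unfolding C'_def
        using G(2) stableQD(4)[OF C(1)] by (intro CollectI exI[of _ 0] exI[of _ "put p y"]) auto
      ultimately show ?thesis using B(2) by auto
    qed
    moreover have "card (insert (put p y) B) = Suc k"
    proof -
      have "put p y \<notin> B" using B(2) CY ny by auto
      moreover have "finite B" using spQ_independent(1)[OF B(1) _ Q] B(2) stableQD(2)[OF C(1)] by (metis subset_trans)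
      ultimately show ?thesis using B(3) by simp
    qed
    ultimately have "P (Suc k)" unfolding P_def using C' by blast
    thus False using k(2)[of "Suc k"] by simp
  qed
  have "F \<in> Y" if F: "F \<in> spQ n e Q" for F
  proof -
    have "put p (slice p F) \<in> Y" if p: "p \<in> Q" for p
    proof -
      have "fun_vs.span (\<Union>{G. good n e G}) \<subseteq> {y. put p y \<in> Y}"
      proof (rule fun_vs.span_minimal)
        show "fun_vs.subspace {y. put p y \<in> Y}"
          by (rule subspaceI) (auto simp: lin_0[OF lin_put] lin_add[OF lin_put] lin_scale[OF lin_put] stableQD(4-6)[OF Y])
      qed (use all[OF p] in auto)
      hence "slice p F \<in> {y. put p y \<in> Y}" using subsetD[OF tensor_space_semisimple slice_spQ[OF F]] by (rule subsetD)
      thus ?thesis by simp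
    qed
    hence "(\<Sum>p\<in>Q. put p (slice p F)) \<in> Y" by (intro fun_vs.subspace_sum[OF stableQD(1)[OF Y]])
    thus ?thesis by (subst spQ_expand[OF Q F])
  qed
  hence "\<exists>x\<in>A. \<exists>c\<in>C. F = x + c" if "F \<in> spQ n e Q" for F using that unfolding Y_def by fastforce
  thus ?thesis using that C by blast
qed

end

context hecke begin

lemma comm_cong:
  assumes "\<And>K L. K \<in> idx n e \<Longrightarrow> L \<in> idx n e \<Longrightarrow> M K L = M' K L"
  shows "comm n e M \<longleftrightarrow> comm n e M'"
proof -
  have "T i (\<lambda>P. M P L) K = T i (\<lambda>P. M' P L) K" if "K \<in> idx n e" "L \<in> idx n e" for i K L
    using that assms by (intro T_idx_cong[of n e]) auto
  moreover have "T i (\<lambda>P. M K P) L = T i (\<lambda>P. M' K P) L" if "K \<in> idx n e" "L \<in> idx n e" for i K L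
    using that assms by (intro T_idx_cong[of n e]) auto
  ultimately show ?thesis by (simp add: comm_def)
qed

end

text \<open>A finite dimensional module over the commutant, in coordinates. \<open>\<rho>\<close> is linear on all matrices
but multiplicative on the commutant; \<open>rho_cong\<close> says that entries outside the index set \<open>idx n e\<close> do not count.\<close>
locale comm_module = generic_hecke q for q :: "'k::field" +
  fixes n e d :: nat and \<rho> :: "'k mat \<Rightarrow> nat \<Rightarrow> nat \<Rightarrow> 'k"
  assumes rho_cong: "\<And>M M' i j. i < d \<Longrightarrow> j < d \<Longrightarrow> (\<And>K L. K \<in> idx n e \<Longrightarrow> L \<in> idx n e \<Longrightarrow> M K L = M' K L) \<Longrightarrow> \<rho> M i j = \<rho> M' i j"
    and rho_add: "\<And>M M' i j. i < d \<Longrightarrow> j < d \<Longrightarrow> \<rho> (\<lambda>K L. M K L + M' K L) i j = \<rho> M i j + \<rho> M' i j"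
    and rho_scale: "\<And>M c i j. i < d \<Longrightarrow> j < d \<Longrightarrow> \<rho> (\<lambda>K L. c * M K L) i j = c * \<rho> M i j"
    and rho_mm: "\<And>M M' i j. i < d \<Longrightarrow> j < d \<Longrightarrow> comm n e M \<Longrightarrow> comm n e M' \<Longrightarrow>
       \<rho> (mm n e M M') i j = (\<Sum>k<d. \<rho> M i k * \<rho> M' k j)"
    and rho_id: "\<And>i j. i < d \<Longrightarrow> j < d \<Longrightarrow> \<rho> (\<lambda>K L. of_bool (K = L)) i j = of_bool (i = j)"
begin

definition Q :: "(nat \<times> nat list) set" where "Q = {..<d} \<times> idx n e"

type_synonym 'a big = "nat list \<times> (nat \<times> nat list) \<Rightarrow> 'a"

definition mt :: "nat \<Rightarrow> 'k big \<Rightarrow> 'k mat" where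
  "mt j f = (\<lambda>K L. f (K, (j, L)))"

text \<open>With multiplicity space \<open>Q\<close> of dimension \<open>d \<cdot> dim V\<^sub>n\<^bsup>\<otimes>e\<^esup>\<close>, a vector of \<open>spQ n e Q\<close> is a \<open>d\<close>-tuple of matrices, and
left multiplication makes it a multiple of tensor space. \<open>Z\<close> consists of the tuples in the commutant: it is
the free module of rank \<open>d\<close>, and \<open>proj\<close> is the surjection from it to the given module.\<close>
definition Z :: "'k big set" where
  "Z = {f \<in> spQ n e Q. \<forall>j<d. comm n e (mt j f)}"

definition proj :: "'k big \<Rightarrow> nat \<Rightarrow> 'k" where
  "proj f i = (\<Sum>j<d. \<rho> (mt j f) i j)"

lemma finite_Q: "finite Q" by (simp add: Q_def)

lemma mt_appQ: "K \<in> idx n e \<Longrightarrow> mt j (appQ n e M f) K L = mm n e M (mt j f) K L"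
  by (simp add: mt_def appQ_def mm_def app_def slice_def)

lemma proj_add: "i < d \<Longrightarrow> proj (f + g) i = proj f i + proj g i"
  using rho_add[of i _ "mt _ f" "mt _ g"] by (simp add: proj_def mt_def sum.distrib)

lemma proj_scale: "i < d \<Longrightarrow> proj (fscale c f) i = c * proj f i"
  using rho_scale[of i _ c "mt _ f"] by (simp add: proj_def mt_def fscale_def sum_distrib_left)

lemma proj_0: "i < d \<Longrightarrow> proj 0 i = 0"
  using proj_scale[of i 0 0] by simp

lemma proj_sum: "i < d \<Longrightarrow> proj (\<Sum>a\<in>A. f a) i = (\<Sum>a\<in>A. proj (f a) i)"
  by (induction A rule: infinite_finite_induct) (auto simp: proj_0 proj_add)

lemma proj_app:
  assumes i: "i < d" and M: "comm n e M" and f: "f \<in> Z"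
  shows "proj (appQ n e M f) i = (\<Sum>k<d. \<rho> M i k * proj f k)"
proof -
  have "proj (appQ n e M f) i = (\<Sum>j<d. \<rho> (mm n e M (mt j f)) i j)"
    unfolding proj_def by (intro sum.cong refl rho_cong i) (auto simp: mt_appQ)
  also have "\<dots> = (\<Sum>j<d. \<Sum>k<d. \<rho> M i k * \<rho> (mt j f) k j)"
    using f M i by (intro sum.cong refl rho_mm) (auto simp: Z_def)
  also have "\<dots> = (\<Sum>k<d. \<Sum>j<d. \<rho> M i k * \<rho> (mt j f) k j)" by (rule sum.swap)
  finally show ?thesis by (simp add: proj_def sum_distrib_left)
qed

lemma Z_stable: "stableQ n e Q Z"
proof (rule stableQI)
  show "0 \<in> Z" using comm_zero by (auto simp: Z_def spQ_def mt_def)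
  show "x + y \<in> Z" if "x \<in> Z" "y \<in> Z" for x y
  proof -
    have "mt j (x + y) = (\<lambda>K L. mt j x K L + mt j y K L)" for j by (simp add: mt_def)
    thus ?thesis using that comm_add by (auto simp: Z_def spQ_def)
  qed
  show "fscale c x \<in> Z" if "x \<in> Z" for c x
  proof -
    have "mt j (fscale c x) = (\<lambda>K L. c * mt j x K L)" for j by (simp add: mt_def fscale_def)
    thus ?thesis using that comm_scale by (auto simp: Z_def spQ_def fscale_def)
  qed
  show "x \<in> spQ n e Q" if "x \<in> Z" for x using that by (simp add: Z_def)
  show "appQ n e M x \<in> Z" if M: "comm n e M" and x: "x \<in> Z" for M x
  proof -
    have "comm n e (mt j (appQ n e M x))" if "j < d" for j
    proof -
      have "comm n e (mm n e M (mt j x))" using x that by (intro comm_mm[OF M]) (auto simp: Z_def)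
      thus ?thesis by (subst comm_cong) (auto simp: mt_appQ)
    qed
    thus ?thesis using x by (auto simp: Z_def appQ_spQ)
  qed
qed

lemma kernel_stable: "stableQ n e Q {f \<in> Z. \<forall>i<d. proj f i = 0}"
  by (rule stableQI) (use stableQD(3-7)[OF Z_stable] in \<open>auto simp: proj_0 proj_add proj_scale proj_app\<close>)

definition unit_vec :: "nat \<Rightarrow> 'k big" where
  "unit_vec i = (\<lambda>(K, (j, L)). of_bool (j = i \<and> K = L \<and> K \<in> idx n e))"

lemma mt_unit: "K \<in> idx n e \<Longrightarrow> mt j (unit_vec i) K L = of_bool (j = i) * of_bool (K = L)"
  by (auto simp: mt_def unit_vec_def)

lemma unit_Z: "i < d \<Longrightarrow> unit_vec i \<in> Z"
proof -
  assume i: "i < d"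
  have "comm n e (\<lambda>K L. of_bool (j = i) * of_bool (K = L))" for j by (rule comm_scale[OF comm_id])
  hence "comm n e (mt j (unit_vec i))" for j by (subst comm_cong) (auto simp: mt_unit)
  moreover have "unit_vec i \<in> spQ n e Q" using i by (auto simp: spQ_def unit_vec_def Q_def)
  ultimately show ?thesis by (simp add: Z_def)
qed

lemma proj_unit: "i < d \<Longrightarrow> k < d \<Longrightarrow> proj (unit_vec i) k = of_bool (k = i)"
proof -
  assume i: "i < d" and k: "k < d"
  have "\<rho> (mt j (unit_vec i)) k j = (if j = i then of_bool (k = i) else 0)" if j: "j < d" for j
  proof -
    have "\<rho> (mt j (unit_vec i)) k j = \<rho> (\<lambda>K L. of_bool (j = i) * of_bool (K = L)) k j"
      by (rule rho_cong[OF k j]) (simp add: mt_unit)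
    also have "\<dots> = of_bool (j = i) * of_bool (k = j)" by (simp add: rho_scale[OF k j] rho_id[OF k j])
    finally show ?thesis by simp
  qed
  thus ?thesis using i by (simp add: proj_def)
qed

text \<open>The free module \<open>Z\<close> is a submodule of a multiple of tensor space and so a summand of it; the kernel of \<open>proj\<close> has a
complement as well, so the module is a summand of \<open>Z\<close>. The three conclusions say, in
coordinates, that \<open>b a = 1\<close> and that \<open>a\<close> and \<open>b\<close> are module maps.\<close>
theorem module_summand:
  obtains a :: "nat list \<times> (nat \<times> nat list) \<Rightarrow> nat \<Rightarrow> 'k" and b where
    "\<And>i j. i < d \<Longrightarrow> j < d \<Longrightarrow> (\<Sum>z\<in>idx n e \<times> Q. b i z * a z j) = of_bool (i = j)"
    "\<And>M K p j. comm n e M \<Longrightarrow> K \<in> idx n e \<Longrightarrow> p \<in> Q \<Longrightarrow> j < d \<Longrightarrow>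
       (\<Sum>L\<in>idx n e. M K L * a (L, p) j) = (\<Sum>i<d. a (K, p) i * \<rho> M i j)"
    "\<And>M L p i. comm n e M \<Longrightarrow> L \<in> idx n e \<Longrightarrow> p \<in> Q \<Longrightarrow> i < d \<Longrightarrow>
       (\<Sum>j<d. \<rho> M i j * b j (L, p)) = (\<Sum>K\<in>idx n e. b i (K, p) * M K L)"
proof -
  obtain U where U: "stableQ n e Q U" "\<And>f. f \<in> {f \<in> Z. \<forall>i<d. proj f i = 0} \<Longrightarrow> f \<in> U \<Longrightarrow> f = 0"
    "\<And>f. f \<in> spQ n e Q \<Longrightarrow> \<exists>x\<in>{f \<in> Z. \<forall>i<d. proj f i = 0}. \<exists>c\<in>U. f = x + c"
  proof (rule stable_complement[OF finite_Q kernel_stable], goal_cases)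
    case (1 U) show ?case by (rule 1(1)[OF 1(2-4)])
  qed
  obtain V where V: "stableQ n e Q V" "\<And>f. f \<in> Z \<Longrightarrow> f \<in> V \<Longrightarrow> f = 0"
    "\<And>f. f \<in> spQ n e Q \<Longrightarrow> \<exists>x\<in>Z. \<exists>c\<in>V. f = x + c"
  proof (rule stable_complement[OF finite_Q Z_stable], goal_cases)
    case (1 U) show ?case by (rule 1(1)[OF 1(2-4)])
  qed
  note Zs = stableQD[OF Z_stable] and Us = stableQD[OF U(1)] and Vs = stableQD[OF V(1)]
  have Usub: "x - y \<in> U" if "x \<in> U" "y \<in> U" for x y using that fun_vs.subspace_diff[OF Us(1)] by metis
  have Zsub: "x - y \<in> Z" if "x \<in> Z" "y \<in> Z" for x y using that fun_vs.subspace_diff[OF Zs(1)] by metis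
  have Vsub: "x - y \<in> V" if "x \<in> V" "y \<in> V" for x y using that fun_vs.subspace_diff[OF Vs(1)] by metis
  \<comment> \<open>lifts of the basis vectors of the module to the complement \<open>U\<close> of the kernel\<close>
  have "\<exists>c. c \<in> U \<and> c \<in> Z \<and> (\<forall>k<d. proj c k = of_bool (k = i))" if i: "i < d" for i
  proof -
    obtain x c where x: "x \<in> Z" "\<forall>i<d. proj x i = 0" "c \<in> U" "unit_vec i = x + c"
      using U(3)[OF Zs(7)[OF unit_Z[OF i]]] by blast
    have "c = unit_vec i - x" using x by simp
    hence "c \<in> Z" using Zsub[OF unit_Z[OF i] x(1)] by simp
    moreover have "proj c k = of_bool (k = i)" if "k < d" for k
      using proj_add[OF that, of x c] proj_unit[OF i that] x that by simp
    ultimately show ?thesis using x by blast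
  qed
  then obtain cc where cc: "\<And>i. i < d \<Longrightarrow> cc i \<in> U" "\<And>i. i < d \<Longrightarrow> cc i \<in> Z"
    "\<And>i k. i < d \<Longrightarrow> k < d \<Longrightarrow> proj (cc i) k = of_bool (k = i)" by metis
  \<comment> \<open>the projection to \<open>Z\<close> along \<open>V\<close>, a module map\<close>
  obtain R where R: "\<And>f. f \<in> spQ n e Q \<Longrightarrow> R f \<in> Z \<and> f - R f \<in> V"
    using V(3) by (metis add_diff_cancel_left')
  have Runiq: "R f = z" if "f \<in> spQ n e Q" "z \<in> Z" "f - z \<in> V" for f z
  proof -
    have "(f - z) - (f - R f) \<in> V" by (rule Vsub[OF that(3)]) (use R[OF that(1)] in simp)
    hence "R f - z \<in> V" by simp
    moreover have "R f - z \<in> Z" using R[OF that(1)] that by (intro Zsub) auto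
    ultimately show ?thesis using V(2) by (metis right_minus_eq)
  qed
  have RZ: "R z = z" if "z \<in> Z" for z using Runiq[OF Zs(7)[OF that] that] Vs(4) by simp
  have Radd: "R (f + g) = R f + R g" if "f \<in> spQ n e Q" "g \<in> spQ n e Q" for f g
  proof (rule Runiq)
    show "f + g \<in> spQ n e Q" using that by (auto simp: spQ_def)
    show "R f + R g \<in> Z" using R that by (intro Zs(5)) auto
    have "(f - R f) + (g - R g) \<in> V" using R that by (intro Vs(5)) auto
    thus "f + g - (R f + R g) \<in> V" by (simp add: algebra_simps)
  qed
  have Rscale: "R (fscale c f) = fscale c (R f)" if "f \<in> spQ n e Q" for f c
  proof (rule Runiq)
    show "fscale c f \<in> spQ n e Q" using that by (auto simp: spQ_def fscale_def)
    show "fscale c (R f) \<in> Z" using R that by (intro Zs(6)) auto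
    have "fscale c (f - R f) \<in> V" using R that by (intro Vs(6)) auto
    thus "fscale c f - fscale c (R f) \<in> V" by (simp add: fun_vs.scale_right_diff_distrib)
  qed
  have Rapp: "R (appQ n e M f) = appQ n e M (R f)" if "f \<in> spQ n e Q" "comm n e M" for f M
  proof (rule Runiq)
    show "appQ n e M f \<in> spQ n e Q" by (rule appQ_spQ[OF that(1)])
    show "appQ n e M (R f) \<in> Z" using R that by (intro Zs(3)) auto
    have "appQ n e M (f - R f) \<in> V" using R that by (intro Vs(3)) auto
    thus "appQ n e M f - appQ n e M (R f) \<in> V" by (simp add: lin_diff[OF lin_appQ])
  qed
  have spd: "delta z \<in> spQ n e Q" if "z \<in> idx n e \<times> Q" for z using that by (auto simp: spQ_def delta_def)
  have projR: "proj (R f) i = (\<Sum>z\<in>idx n e \<times> Q. f z * proj (R (delta z)) i)"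
    if f: "f \<in> spQ n e Q" and i: "i < d" for f i
  proof -
    have R0: "R 0 = 0" by (rule RZ) (rule Zs(4))
    have "R (\<Sum>z\<in>S. fscale (f z) (delta z)) = (\<Sum>z\<in>S. fscale (f z) (R (delta z))) \<and> (\<Sum>z\<in>S. fscale (f z) (delta z)) \<in> spQ n e Q"
      if "finite S" "S \<subseteq> idx n e \<times> Q" for S
      using that
    proof (induction S rule: finite_induct)
      case empty show ?case using R0 by (auto simp: spQ_def zero_fun_def)
    next
      case (insert z S)
      have z: "fscale (f z) (delta z) \<in> spQ n e Q" using spd[of z] insert by (auto simp: spQ_def fscale_def)
      have "fscale (f z) (delta z) + (\<Sum>z\<in>S. fscale (f z) (delta z)) \<in> spQ n e Q"
        using z insert by (auto simp: spQ_def)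
      thus ?case using insert Radd[OF z] Rscale[OF spd, of z] by (simp add: plus_fun_def)
    qed
    from this[of "idx n e \<times> Q"] finite_Q
    have "R (\<Sum>z\<in>idx n e \<times> Q. fscale (f z) (delta z)) = (\<Sum>z\<in>idx n e \<times> Q. fscale (f z) (R (delta z)))" by simp
    moreover have "f = (\<Sum>z\<in>idx n e \<times> Q. fscale (f z) (delta z))"
      using f finite_Q by (intro delta_expand) (auto simp: spQ_def)
    ultimately have "R f = (\<Sum>z\<in>idx n e \<times> Q. fscale (f z) (R (delta z)))" by simp
    thus ?thesis by (simp add: proj_sum[OF i] proj_scale[OF i])
  qed
  define a where "a z i = cc i z" for z i
  \<comment> \<open>\<open>a\<close> is the chosen lift, \<open>b\<close> the projection to \<open>Z\<close> followed by \<open>proj\<close>\<close>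
  define b where "b i z = proj (R (delta z)) i" for i z
  show ?thesis
  proof (rule that[of b a])
    fix i j assume ij: "i < d" "j < d"
    have "(\<Sum>z\<in>idx n e \<times> Q. b i z * a z j) = proj (R (cc j)) i"
      by (subst projR) (use ij Zs(7)[OF cc(2)] in \<open>auto simp: a_def b_def mult.commute\<close>)
    thus "(\<Sum>z\<in>idx n e \<times> Q. b i z * a z j) = of_bool (i = j)" using RZ[OF cc(2)] cc(3) ij by simp
  next
    fix M K p j assume M: "comm n e M" and K: "K \<in> idx n e" and p: "p \<in> Q" and j: "j < d"
    \<comment> \<open>this difference lies in \<open>U\<close> and in the kernel of \<open>proj\<close>, hence vanishes\<close>
    define u where "u = appQ n e M (cc j) - (\<Sum>i<d. fscale (\<rho> M i j) (cc i))"
    have s: "(\<Sum>i<d. fscale (\<rho> M i j) (cc i)) \<in> U" "(\<Sum>i<d. fscale (\<rho> M i j) (cc i)) \<in> Z"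
      by (intro fun_vs.subspace_sum[OF Us(1)] Us(6) cc, simp) (intro fun_vs.subspace_sum[OF Zs(1)] Zs(6) cc, simp)
    have u: "u \<in> U" "u \<in> Z" unfolding u_def using s Us(3)[OF M cc(1)[OF j]] Zs(3)[OF M cc(2)[OF j]] Usub Zsub by auto
    have "proj u k = 0" if k: "k < d" for k
    proof -
      have "appQ n e M (cc j) = u + (\<Sum>i<d. fscale (\<rho> M i j) (cc i))" by (simp add: u_def)
      hence "proj (appQ n e M (cc j)) k = proj u k + (\<Sum>i<d. \<rho> M i j * proj (cc i) k)"
        by (simp add: proj_add k proj_sum proj_scale)
      also have "(\<Sum>i<d. \<rho> M i j * proj (cc i) k) = (\<Sum>i<d. if i = k then \<rho> M k j else 0)"
        by (rule sum.cong) (auto simp: cc k)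
      also have "\<dots> = \<rho> M k j" using k by simp
      also have "proj (appQ n e M (cc j)) k = (\<Sum>i<d. \<rho> M k i * proj (cc j) i)" by (rule proj_app[OF k M cc(2)[OF j]])
      also have "\<dots> = (\<Sum>i<d. if i = j then \<rho> M k j else 0)" by (rule sum.cong) (auto simp: cc j)
      also have "\<dots> = \<rho> M k j" using j by simp
      finally show ?thesis by simp
    qed
    hence "u = 0" using U(2) u by blast
    hence e: "appQ n e M (cc j) = (\<Sum>i<d. fscale (\<rho> M i j) (cc i))" by (simp add: u_def)
    have "appQ n e M (cc j) (K, p) = (\<Sum>L\<in>idx n e. M K L * a (L, p) j)"
      using K by (simp add: appQ_def app_def slice_def a_def)
    moreover have "(\<Sum>i<d. fscale (\<rho> M i j) (cc i)) (K, p) = (\<Sum>i<d. a (K, p) i * \<rho> M i j)"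
      by (simp add: sum_fun_apply a_def fscale_def mult.commute)
    ultimately show "(\<Sum>L\<in>idx n e. M K L * a (L, p) j) = (\<Sum>i<d. a (K, p) i * \<rho> M i j)" using e by simp
  next
    fix M L p i assume M: "comm n e M" and L: "L \<in> idx n e" and p: "p \<in> Q" and i: "i < d"
    have z: "(L, p) \<in> idx n e \<times> Q" using L p by simp
    have "proj (R (appQ n e M (delta (L, p)))) i = (\<Sum>j<d. \<rho> M i j * b j (L, p))"
      unfolding Rapp[OF spd[OF z] M] b_def using R[OF spd[OF z]] by (intro proj_app[OF i M]) simp
    moreover have "proj (R (appQ n e M (delta (L, p)))) i = (\<Sum>z\<in>idx n e \<times> Q. appQ n e M (delta (L, p)) z * b i z)"
      unfolding b_def by (rule projR[OF appQ_spQ[OF spd[OF z]] i])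
    moreover have "\<dots> = (\<Sum>K\<in>idx n e. \<Sum>r\<in>Q. appQ n e M (delta (L, p)) (K, r) * b i (K, r))"
      by (simp add: sum.cartesian_product)
    moreover have "\<dots> = (\<Sum>K\<in>idx n e. \<Sum>r\<in>Q. if r = p then M K L * b i (K, p) else 0)"
    proof (intro sum.cong refl)
      fix K r assume K: "K \<in> idx n e"
      have sl: "slice r (delta (L, p)) = (if r = p then delta L else (0 :: 'k vec))"
        by (auto simp: slice_def delta_def fun_eq_iff)
      show "appQ n e M (delta (L, p)) (K, r) * b i (K, r) = (if r = p then M K L * b i (K, p) else 0)"
        using app_delta[OF K L, of M] by (simp add: appQ_def sl lin_0[OF lin_app])
    qed
    moreover have "\<dots> = (\<Sum>K\<in>idx n e. b i (K, p) * M K L)" using p finite_Q by (simp add: mult.commute)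
    ultimately show "(\<Sum>j<d. \<rho> M i j * b j (L, p)) = (\<Sum>K\<in>idx n e. b i (K, p) * M K L)" by simp
  qed
qed

end

section \<open>Monoid algebras and their quotients\<close>

text \<open>The value on \<open>f\<close> of the linear functional with value \<open>g w\<close> on the basis element \<open>w\<close>. Identities
in free algebras are checked by evaluating all functionals on both sides (\<open>pev_ext\<close>), which turns them into
identities between finite sums.\<close>
definition pev :: "('w \<Rightarrow> 'k::field) \<Rightarrow> ('w \<Rightarrow>\<^sub>0 'k) \<Rightarrow> 'k" where
  "pev g f = (\<Sum>w\<in>Poly_Mapping.keys f. Poly_Mapping.lookup f w * g w)"

lemma pev_superset: "finite S \<Longrightarrow> Poly_Mapping.keys f \<subseteq> S \<Longrightarrow> pev g f = (\<Sum>w\<in>S. Poly_Mapping.lookup f w * g w)"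
  unfolding pev_def by (rule sum.mono_neutral_left) (auto simp: in_keys_iff)

lemma pev_add: "pev g (f + h) = pev g f + pev g h"
proof -
  let ?S = "Poly_Mapping.keys f \<union> Poly_Mapping.keys h"
  have "pev g (f + h) = (\<Sum>w\<in>?S. Poly_Mapping.lookup (f + h) w * g w)"
    by (rule pev_superset) (auto dest: subsetD[OF Poly_Mapping.keys_add])
  also have "\<dots> = (\<Sum>w\<in>?S. Poly_Mapping.lookup f w * g w) + (\<Sum>w\<in>?S. Poly_Mapping.lookup h w * g w)"
    by (simp add: lookup_add algebra_simps sum.distrib)
  also have "\<dots> = pev g f + pev g h" by (simp add: pev_superset[of ?S])
  finally show ?thesis .
qed

lemma pev_0 [simp]: "pev g 0 = 0" by (simp add: pev_def)
lemma pev_single [simp]: "pev g (Poly_Mapping.single w c) = c * g w"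
  by (simp add: pev_def)
lemma pev_uminus: "pev g (- f) = - pev g f"
  using pev_add[of g f "- f"] by (simp add: eq_neg_iff_add_eq_0 add.commute)
lemma pev_diff: "pev g (f - h) = pev g f - pev g h"
  using pev_add[of g f "- h"] by (simp add: pev_uminus)
lemma pev_sum: "pev g (\<Sum>a\<in>A. f a) = (\<Sum>a\<in>A. pev g (f a))"
  by (induction A rule: infinite_finite_induct) (auto simp: pev_add)

lemma pm_expand: "f = (\<Sum>w\<in>Poly_Mapping.keys f. Poly_Mapping.single w (Poly_Mapping.lookup f w))"
proof (rule poly_mapping_eqI)
  fix k
  have "Poly_Mapping.lookup (\<Sum>w\<in>Poly_Mapping.keys f. Poly_Mapping.single w (Poly_Mapping.lookup f w)) k
    = (\<Sum>w\<in>Poly_Mapping.keys f. if w = k then Poly_Mapping.lookup f k else 0)"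
    unfolding lookup_sum by (rule sum.cong) (auto simp: lookup_single when_def)
  thus "Poly_Mapping.lookup f k = Poly_Mapping.lookup (\<Sum>w\<in>Poly_Mapping.keys f. Poly_Mapping.single w (Poly_Mapping.lookup f w)) k"
    by (auto simp: in_keys_iff)
qed

lemma pev_mult: "pev g (f * h) = pev (\<lambda>u. pev (\<lambda>v. g (u + v)) h) f" for f h :: "'w::monoid_add \<Rightarrow>\<^sub>0 'k::field"
proof -
  have 1: "pev g (Poly_Mapping.single u c * h) = c * pev (\<lambda>v. g (u + v)) h" for u c
  proof -
    have "Poly_Mapping.single u c * h = (\<Sum>v\<in>Poly_Mapping.keys h. Poly_Mapping.single (u + v) (c * Poly_Mapping.lookup h v))"
      by (subst pm_expand[of h]) (simp add: sum_distrib_left mult_single)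
    hence "pev g (Poly_Mapping.single u c * h) = (\<Sum>v\<in>Poly_Mapping.keys h. c * Poly_Mapping.lookup h v * g (u + v))"
      by (simp add: pev_sum)
    thus ?thesis by (simp add: pev_def sum_distrib_left mult.assoc)
  qed
  have "f * h = (\<Sum>u\<in>Poly_Mapping.keys f. Poly_Mapping.single u (Poly_Mapping.lookup f u) * h)"
    by (subst pm_expand[of f]) (simp add: sum_distrib_right)
  hence "pev g (f * h) = (\<Sum>u\<in>Poly_Mapping.keys f. pev g (Poly_Mapping.single u (Poly_Mapping.lookup f u) * h))"
    by (simp add: pev_sum)
  thus ?thesis by (simp add: 1) (simp add: pev_def)
qed

lemma pev_cong: "(\<And>w. w \<in> Poly_Mapping.keys f \<Longrightarrow> g w = g' w) \<Longrightarrow> pev g f = pev g' f"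
  by (simp add: pev_def)

lemma pev_swap: "pev (\<lambda>u. pev (\<lambda>v. g u v) h) f = pev (\<lambda>v. pev (\<lambda>u. g u v) f) h"
  unfolding pev_def sum_distrib_left by (subst sum.swap) (simp add: algebra_simps)

text \<open>The free algebra and its tensor square are both of this form, so facts about their quotients are
proved once.\<close>
definition malg :: "'w::monoid_add set \<Rightarrow> ('w \<Rightarrow>\<^sub>0 'k::field) ring" where
  "malg W = \<lparr>carrier = {f. Poly_Mapping.keys f \<subseteq> W}, monoid.mult = (*), one = 1, zero = 0, add = (+)\<rparr>"

locale submonoid =
  fixes W :: "'w::monoid_add set"
  assumes W0: "0 \<in> W" and Wadd: "u \<in> W \<Longrightarrow> v \<in> W \<Longrightarrow> u + v \<in> W"
begin

lemma malg_simps [simp]: "carrier (malg W) = {f. Poly_Mapping.keys f \<subseteq> W}" "monoid.mult (malg W) = (*)" "one (malg W) = 1"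
  "zero (malg W) = 0" "add (malg W) = (+)"
  by (simp_all add: malg_def)

lemma malg_ring: "ring (malg W :: ('w \<Rightarrow>\<^sub>0 'k::field) ring)"
proof (rule ringI)
  show "abelian_group (malg W :: ('w \<Rightarrow>\<^sub>0 'k::field) ring)"
  proof (rule abelian_groupI)
    fix x :: "'w \<Rightarrow>\<^sub>0 'k" assume "x \<in> carrier (malg W)"
    thus "\<exists>y\<in>carrier (malg W). y \<oplus>\<^bsub>malg W\<^esub> x = \<zero>\<^bsub>malg W\<^esub>"
      by (intro bexI[of _ "- x"]) auto
  qed (auto dest: subsetD[OF Poly_Mapping.keys_add] simp: algebra_simps)
  show "Group.monoid (malg W :: ('w \<Rightarrow>\<^sub>0 'k::field) ring)"
    by (rule Group.monoidI) (use W0 Wadd in \<open>auto dest!: subsetD[OF Poly_Mapping.keys_mult] simp: algebra_simps\<close>)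
qed (auto simp: algebra_simps)

lemma malg_ideal:
  fixes I :: "('w \<Rightarrow>\<^sub>0 'k::field) set"
  assumes "I \<subseteq> carrier (malg W)" "0 \<in> I" "\<And>x y. x \<in> I \<Longrightarrow> y \<in> I \<Longrightarrow> x + y \<in> I" "\<And>x. x \<in> I \<Longrightarrow> - x \<in> I"
    "\<And>x y. x \<in> carrier (malg W) \<Longrightarrow> y \<in> I \<Longrightarrow> x * y \<in> I" "\<And>x y. x \<in> carrier (malg W) \<Longrightarrow> y \<in> I \<Longrightarrow> y * x \<in> I"
  shows "ideal I (malg W)"
proof -
  interpret R: ring "malg W :: ('w \<Rightarrow>\<^sub>0 'k) ring" by (rule malg_ring)
  have inv: "\<ominus>\<^bsub>malg W\<^esub> x = - x" if "x \<in> carrier (malg W)" for x :: "'w \<Rightarrow>\<^sub>0 'k"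
  proof (rule R.minus_equality)
    show "- x \<oplus>\<^bsub>malg W\<^esub> x = \<zero>\<^bsub>malg W\<^esub>" by simp
  qed (use that in auto)
  show ?thesis
  proof (rule idealI[OF malg_ring])
    show "subgroup I (add_monoid (malg W))"
    proof (rule R.add.subgroupI)
      show "\<ominus>\<^bsub>malg W\<^esub> a \<in> I" if "a \<in> I" for a
        using inv[of a] assms(1,4) that by auto
    qed (use assms in auto)
  qed (use assms in auto)
qed

lemma idealD:
  fixes I :: "('w \<Rightarrow>\<^sub>0 'k::field) set"
  assumes I: "ideal I (malg W)"
  shows "I \<subseteq> carrier (malg W)" "0 \<in> I" "\<And>x y. x \<in> I \<Longrightarrow> y \<in> I \<Longrightarrow> x + y \<in> I" "\<And>x. x \<in> I \<Longrightarrow> - x \<in> I"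
    "\<And>x y. x \<in> I \<Longrightarrow> y \<in> I \<Longrightarrow> x - y \<in> I"
    "\<And>x y. x \<in> carrier (malg W) \<Longrightarrow> y \<in> I \<Longrightarrow> x * y \<in> I" "\<And>x y. x \<in> carrier (malg W) \<Longrightarrow> y \<in> I \<Longrightarrow> y * x \<in> I"
proof -
  interpret I: ideal I "malg W" by (rule I)
  show sub: "I \<subseteq> carrier (malg W)" using I.Icarr by blast
  show "0 \<in> I" using additive_subgroup.zero_closed[OF I.additive_subgroup_axioms] by simp
  show add: "x + y \<in> I" if "x \<in> I" "y \<in> I" for x y using additive_subgroup.a_closed[OF I.additive_subgroup_axioms that] by simp
  show l: "x * y \<in> I" if "x \<in> carrier (malg W)" "y \<in> I" for x y using I.I_l_closed[OF that(2,1)] by simp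
  show "y * x \<in> I" if "x \<in> carrier (malg W)" "y \<in> I" for x y using I.I_r_closed[OF that(2,1)] by simp
  show neg: "- x \<in> I" if "x \<in> I" for x
  proof -
    have "Poly_Mapping.single 0 (-1) * x \<in> I" by (rule l) (use W0 that in auto)
    moreover have "Poly_Mapping.single 0 (-1) * x = - x" by (simp add: single_uminus)
    ultimately show ?thesis by simp
  qed
  show "x - y \<in> I" if "x \<in> I" "y \<in> I" for x y using add[OF that(1) neg[OF that(2)]] by simp
qed

lemma coset: "I +>\<^bsub>malg W\<^esub> f = (\<lambda>h. h + f) ` I"
  by (auto simp: a_r_coset_def')

lemma coset_eq:
  fixes I :: "('w \<Rightarrow>\<^sub>0 'k::field) set"
  assumes I: "ideal I (malg W)"
  shows "I +>\<^bsub>malg W\<^esub> f = I +>\<^bsub>malg W\<^esub> g \<longleftrightarrow> f - g \<in> I"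
proof
  assume "I +>\<^bsub>malg W\<^esub> f = I +>\<^bsub>malg W\<^esub> g"
  hence "0 + f \<in> (\<lambda>h. h + g) ` I" using idealD(2)[OF I] unfolding coset by (metis imageI)
  thus "f - g \<in> I" by auto
next
  assume fg: "f - g \<in> I"
  have "h + f = (h + (f - g)) + g" "h + g = (h - (f - g)) + f" for h by (simp_all add: algebra_simps)
  hence "h + f \<in> (\<lambda>h. h + g) ` I" "h + g \<in> (\<lambda>h. h + f) ` I" if "h \<in> I" for h
    using idealD(3,5)[OF I that fg] by (metis imageI)+
  thus "I +>\<^bsub>malg W\<^esub> f = I +>\<^bsub>malg W\<^esub> g" unfolding coset by blast
qed

text \<open>How a map on representatives descends to a quotient when the map on cosets is defined as the common
value on all representatives.\<close>
lemma coset_value: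
  fixes I :: "('w \<Rightarrow>\<^sub>0 'k::field) set"
  assumes I: "ideal I (malg W)" and h: "\<And>h. h \<in> I \<Longrightarrow> F (h + f) = F f"
  shows "the_elem (F ` (I +>\<^bsub>malg W\<^esub> f)) = F f"
proof -
  have "F ` (I +>\<^bsub>malg W\<^esub> f) = {F f}"
    using h idealD(2)[OF I] unfolding coset by (auto simp: image_image)
  thus ?thesis by simp
qed

lemma coset_finsum:
  fixes I :: "('w \<Rightarrow>\<^sub>0 'k::field) set"
  assumes I: "ideal I (malg W)" and "finite A" "\<And>a. a \<in> A \<Longrightarrow> f a \<in> carrier (malg W)"
  shows "finsum (malg W Quot I) (\<lambda>a. I +>\<^bsub>malg W\<^esub> f a) A = I +>\<^bsub>malg W\<^esub> (\<Sum>a\<in>A. f a) \<and> (\<Sum>a\<in>A. f a) \<in> carrier (malg W)"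
  using assms(2,3)
proof (induction A rule: finite_induct)
  interpret I: ideal I "malg W" by (rule I)
  interpret Q: ring "malg W Quot I" by (rule I.quotient_is_ring)
  {
    case empty
    have "zero (malg W Quot I) = I +>\<^bsub>malg W\<^esub> 0" unfolding coset by (simp add: FactRing_def)
    thus ?case by simp
  next
    case (insert a A)
    have c: "I +>\<^bsub>malg W\<^esub> f b \<in> carrier (malg W Quot I)" if "b \<in> insert a A" for b
      using insert.prems[OF that] by (simp add: FactRing_def A_RCOSETS_def')  blast
    have "finsum (malg W Quot I) (\<lambda>a. I +>\<^bsub>malg W\<^esub> f a) (insert a A)
        = (I +>\<^bsub>malg W\<^esub> f a) \<oplus>\<^bsub>malg W Quot I\<^esub> finsum (malg W Quot I) (\<lambda>a. I +>\<^bsub>malg W\<^esub> f a) A"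
      using insert c by (intro Q.finsum_insert) auto
    also have "\<dots> = (I +>\<^bsub>malg W\<^esub> f a) \<oplus>\<^bsub>malg W Quot I\<^esub> (I +>\<^bsub>malg W\<^esub> (\<Sum>a\<in>A. f a))"
      using insert by simp
    also have "\<dots> = I +>\<^bsub>malg W\<^esub> (f a + (\<Sum>a\<in>A. f a))"
      using I.a_rcos_sum[of "f a" "\<Sum>a\<in>A. f a"] insert by (simp add: FactRing_def)
    moreover have "f a + (\<Sum>a\<in>A. f a) \<in> carrier (malg W)"
      using insert.prems[of a] insert.IH insert.prems Poly_Mapping.keys_add[of "f a" "\<Sum>a\<in>A. f a"] by fastforce
    ultimately show ?case using insert(1,2) by simp
  }
qed

lemma coset_mult:
  fixes I :: "('w \<Rightarrow>\<^sub>0 'k::field) set"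
  assumes I: "ideal I (malg W)" and "f \<in> carrier (malg W)" "g \<in> carrier (malg W)"
  shows "(I +>\<^bsub>malg W\<^esub> f) \<otimes>\<^bsub>malg W Quot I\<^esub> (I +>\<^bsub>malg W\<^esub> g) = I +>\<^bsub>malg W\<^esub> (f * g)"
  using ideal.rcoset_mult_add[OF assms] by (simp add: FactRing_def)

text \<open>A space of functionals closed under left and right translation has an ideal as its annihilator. Applied to the
functionals of the commutant, this gives functionals on \<open>A\<^sub>q(n,n)\<close> without
computing in the ideal of relations.\<close>
lemma annihilator_ideal:
  fixes G :: "('w \<Rightarrow> 'k::field) set"
  assumes G: "\<And>g u. g \<in> G \<Longrightarrow> u \<in> W \<Longrightarrow> (\<lambda>v. g (u + v)) \<in> G" "\<And>g u. g \<in> G \<Longrightarrow> u \<in> W \<Longrightarrow> (\<lambda>v. g (v + u)) \<in> G"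
  shows "ideal {f \<in> carrier (malg W). \<forall>g\<in>G. pev g f = 0} (malg W)"
proof (rule malg_ideal)
  fix x y :: "'w \<Rightarrow>\<^sub>0 'k" assume x: "x \<in> carrier (malg W)" and y: "y \<in> {f \<in> carrier (malg W). \<forall>g\<in>G. pev g f = 0}"
  have "pev g (x * y) = 0" if "g \<in> G" for g
    unfolding pev_mult using x y G(1)[OF that] by (subst pev_cong[where g' = "\<lambda>_. 0"]) (auto simp: pev_def)
  moreover have "pev g (y * x) = 0" if "g \<in> G" for g
    unfolding pev_mult pev_swap[of _ x y] using x y G(2)[OF that]
    by (subst pev_cong[where g' = "\<lambda>_. 0"]) (auto simp: pev_def)
  moreover have "x * y \<in> carrier (malg W)" "y * x \<in> carrier (malg W)"
    using x y Wadd by (auto dest!: subsetD[OF Poly_Mapping.keys_mult])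
  ultimately show "x * y \<in> {f \<in> carrier (malg W). \<forall>g\<in>G. pev g f = 0}" "y * x \<in> {f \<in> carrier (malg W). \<forall>g\<in>G. pev g f = 0}"
    by auto
qed (auto simp: pev_add pev_uminus dest: subsetD[OF Poly_Mapping.keys_add])

end

section \<open>The bialgebra as a quotient of the free algebra\<close>

lemma pev_ext: "(\<And>g. pev g x = pev g y) \<Longrightarrow> x = y" for x y :: "'w \<Rightarrow>\<^sub>0 'k::field"
proof (rule poly_mapping_eqI)
  fix k assume e: "\<And>g. pev g x = pev g y"
  have "pev (delta k) z = Poly_Mapping.lookup z k" for z :: "'w \<Rightarrow>\<^sub>0 'k"
  proof -
    have "pev (delta k) z = (\<Sum>w\<in>Poly_Mapping.keys z. if w = k then Poly_Mapping.lookup z k else 0)"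
      unfolding pev_def delta_def by (rule sum.cong) auto
    thus ?thesis by (auto simp: in_keys_iff)
  qed
  thus "Poly_Mapping.lookup x k = Poly_Mapping.lookup y k" using e by metis
qed

lemma pev_one: "pev g 1 = g 0" by (simp flip: single_one)

lemma sum4_swap: "(\<Sum>a\<in>A. \<Sum>b\<in>B. \<Sum>k\<in>C. \<Sum>l\<in>D. f a b k l) = (\<Sum>k\<in>C. \<Sum>l\<in>D. \<Sum>a\<in>A. \<Sum>b\<in>B. f a b k l)"
proof -
  have "(\<Sum>a\<in>A. \<Sum>b\<in>B. \<Sum>k\<in>C. \<Sum>l\<in>D. f a b k l) = (\<Sum>a\<in>A. \<Sum>k\<in>C. \<Sum>b\<in>B. \<Sum>l\<in>D. f a b k l)"
    by (rule sum.cong[OF refl]) (rule sum.swap)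
  also have "\<dots> = (\<Sum>k\<in>C. \<Sum>a\<in>A. \<Sum>l\<in>D. \<Sum>b\<in>B. f a b k l)"
    by (subst sum.swap) (intro sum.cong[OF refl], rule sum.swap)
  also have "\<dots> = (\<Sum>k\<in>C. \<Sum>l\<in>D. \<Sum>a\<in>A. \<Sum>b\<in>B. f a b k l)"
    by (rule sum.cong[OF refl]) (rule sum.swap)
  finally show ?thesis .
qed

lemma pev_tensor: "pev g (free_tensor f h) = pev (\<lambda>u. pev (\<lambda>v. g (u, v)) h) f"
  by (simp add: free_tensor_def pev_sum) (simp add: pev_def sum_distrib_left mult.assoc)

lemma tensor_add_left: "free_tensor (f + f') h = free_tensor f h + free_tensor f' h"
  by (rule pev_ext) (simp add: pev_tensor pev_add)
lemma tensor_add_right: "free_tensor h (f + f') = free_tensor h f + free_tensor h f'"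
proof (rule pev_ext)
  fix g
  show "pev g (free_tensor h (f + f')) = pev g (free_tensor h f + free_tensor h f')"
    unfolding pev_add pev_tensor by (simp add: pev_def[of _ h] algebra_simps sum.distrib pev_add)
qed

lemma tensor_mult: "free_tensor a b * free_tensor c d = free_tensor (a * c) (b * d)"
proof (rule pev_ext)
  fix g :: "monom_word \<times> monom_word \<Rightarrow> 'a"
  have "pev g (free_tensor (a * c) (b * d)) = pev (\<lambda>u. pev (\<lambda>u'. pev (\<lambda>v. pev (\<lambda>v'. g (u + u', v + v')) d) b) c) a"
    by (simp add: pev_tensor pev_mult)
  also have "\<dots> = pev (\<lambda>u. pev (\<lambda>v. pev (\<lambda>u'. pev (\<lambda>v'. g (u + u', v + v')) d) c) b) a"
    by (rule pev_cong) (rule pev_swap)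
  also have "\<dots> = pev g (free_tensor a b * free_tensor c d)"
    by (simp add: pev_tensor pev_mult)
  finally show "pev g (free_tensor a b * free_tensor c d) = pev g (free_tensor (a * c) (b * d))" by simp
qed

lemma keys_tensor: "Poly_Mapping.keys (free_tensor f h) \<subseteq> Poly_Mapping.keys f \<times> Poly_Mapping.keys h"
  unfolding free_tensor_def
  by (rule order_trans[OF Poly_Mapping.keys_sum], rule UN_least, rule order_trans[OF Poly_Mapping.keys_sum], rule UN_least) auto

lemma pev_single0: "pev g (Poly_Mapping.single 0 c * x) = c * pev g x"
  by (simp add: pev_mult)

lemma pev_comult: "pev g (free_comult n f) = pev (\<lambda>w. pev g (free_comult_word n w)) f"
  by (simp add: free_comult_def pev_sum pev_single0) (simp add: pev_def)

lemma comult_word_add: "free_comult_word n (u + v) = free_comult_word n u * free_comult_word n v"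
  by (simp add: free_comult_word_def plus_monom_word_def)

lemma comult_add: "free_comult n (f + h) = free_comult n f + free_comult n h"
  by (rule pev_ext) (simp add: pev_comult pev_add)
lemma comult_uminus: "free_comult n (- f) = - free_comult n f"
  by (rule pev_ext) (simp add: pev_comult pev_uminus)
lemma comult_0: "free_comult n 0 = 0"
  by (simp add: free_comult_def)

lemma comult_mult: "free_comult n (f * h) = free_comult n f * free_comult n h"
proof (rule pev_ext)
  fix g :: "monom_word \<times> monom_word \<Rightarrow> 'a"
  have "pev g (free_comult n (f * h)) = pev (\<lambda>u. pev (\<lambda>v. pev (\<lambda>p. pev (\<lambda>r. g (p + r)) (free_comult_word n v)) (free_comult_word n u)) h) f"
    by (simp add: pev_comult pev_mult comult_word_add)
  also have "\<dots> = pev (\<lambda>u. pev (\<lambda>p. pev (\<lambda>v. pev (\<lambda>r. g (p + r)) (free_comult_word n v)) h) (free_comult_word n u)) f"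
    by (rule pev_cong) (rule pev_swap)
  also have "\<dots> = pev g (free_comult n f * free_comult n h)"
    by (simp add: pev_comult pev_mult)
  finally show "pev g (free_comult n (f * h)) = pev g (free_comult n f * free_comult n h)" .
qed

lemma pev_gen_tensor: "pev g (free_tensor (free_gen i k) (free_gen k' j)) = g (Word [(i, k)], Word [(k', j)])"
  by (simp add: pev_tensor free_gen_def)

lemma pev_comult_zip:
  fixes g :: "monom_word \<times> monom_word \<Rightarrow> 'k::field"
  shows "length K = length L \<Longrightarrow> pev g (free_comult_word n (Word (zip K L))) = (\<Sum>P\<in>idx n (length K). g (Word (zip K P), Word (zip P L)))"
proof (induction K L arbitrary: g rule: list_induct2)
  case Nil
  show ?case by (simp add: free_comult_word_def pev_one idx_0 zero_prod_def zero_monom_word_def)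
next
  case (Cons i K j L)
  have "(free_comult_word n (Word (zip (i # K) (j # L))) :: 'k free2) = (\<Sum>k<n. free_tensor (free_gen i k) (free_gen k j)) * free_comult_word n (Word (zip K L))"
    by (simp add: free_comult_word_def)
  hence "pev g (free_comult_word n (Word (zip (i # K) (j # L)))) =
     (\<Sum>k<n. \<Sum>P\<in>idx n (length K). g ((Word [(i, k)], Word [(k, j)]) + (Word (zip K P), Word (zip P L))))"
    by (simp add: pev_mult pev_sum pev_gen_tensor Cons.IH)
  also have "\<dots> = (\<Sum>P\<in>idx n (length (i # K)). g (Word (zip (i # K) P), Word (zip P (j # L))))"
    by (simp add: sum_idx_Cons plus_monom_word_def)
  finally show ?case .
qed

lemma comult_zip: "length K = length L \<Longrightarrow> free_comult_word n (Word (zip K L)) =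
    (\<Sum>P\<in>idx n (length K). Poly_Mapping.single (Word (zip K P), Word (zip P L)) 1)"
  by (rule pev_ext) (simp add: pev_comult_zip pev_sum)

lemma word_zip: "w \<in> words n \<Longrightarrow> \<exists>K L. w = Word (zip K L) \<and> K \<in> idx n (length (letters w)) \<and> L \<in> idx n (length (letters w))"
  by (intro exI[of _ "map fst (letters w)"] exI[of _ "map snd (letters w)"])
     (cases w, auto simp: words_def idx_def zip_map_fst_snd)

lemma zip_words: "K \<in> idx n e \<Longrightarrow> L \<in> idx n e \<Longrightarrow> Word (zip K L) \<in> words n"
  by (auto simp: words_def idx_def dest: set_zip_leftD set_zip_rightD) 

lemma submonoid_words: "submonoid (words n)"
  by standard (auto simp: words_def zero_monom_word_def plus_monom_word_def)

lemma free_alg_malg: "free_alg n = malg (words n)"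
  by (simp add: free_alg_def malg_def)
lemma free_alg2_malg: "free_alg2 n = malg (words n \<times> words n)"
  by (simp add: free_alg2_def malg_def)

lemma counit_zip: "length K = length L \<Longrightarrow> counit_word (zip K L) = of_bool (K = L)"
  by (induction K L rule: list_induct2) (auto simp: counit_word_def)

locale frt = hecke q for q :: "'k::field" +
  fixes n :: nat
begin

sublocale A: submonoid "words n" by (rule submonoid_words)
sublocale B: submonoid "words n \<times> words n"
  by standard (auto simp: zero_prod_def A.W0 A.Wadd)

abbreviation "carA \<equiv> {f :: 'k free. Poly_Mapping.keys f \<subseteq> words n}"
abbreviation "carB \<equiv> {f :: 'k free2. Poly_Mapping.keys f \<subseteq> words n \<times> words n}"
abbreviation "I1 \<equiv> frt_ideal q n"
abbreviation "I2 \<equiv> frt_ideal2 q n"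

lemma carA_gen: "i < n \<Longrightarrow> j < n \<Longrightarrow> free_gen i j \<in> carA"
  by (auto simp: free_gen_def words_def)

interpretation RA: ring "malg (words n) :: 'k free ring" by (rule A.malg_ring)
interpretation RB: ring "malg (words n \<times> words n) :: 'k free2 ring" by (rule B.malg_ring)

lemma carA_add: "f \<in> carA \<Longrightarrow> h \<in> carA \<Longrightarrow> f + h \<in> carA" using RA.a_closed[of f h] by simp
lemma carA_mult: "f \<in> carA \<Longrightarrow> h \<in> carA \<Longrightarrow> f * h \<in> carA" using RA.m_closed[of f h] by simp
lemma carB_add: "f \<in> carB \<Longrightarrow> h \<in> carB \<Longrightarrow> f + h \<in> carB" using RB.a_closed[of f h] by simp
lemma carB_mult: "f \<in> carB \<Longrightarrow> h \<in> carB \<Longrightarrow> f * h \<in> carB" using RB.m_closed[of f h] by simp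
lemma carA_sum: "(\<And>a. a \<in> S \<Longrightarrow> f a \<in> carA) \<Longrightarrow> (\<Sum>a\<in>S. f a) \<in> carA"
  by (induction S rule: infinite_finite_induct) (use carA_add in auto)
lemma carB_sum: "(\<And>a. a \<in> S \<Longrightarrow> f a \<in> carB) \<Longrightarrow> (\<Sum>a\<in>S. f a) \<in> carB"
  by (induction S rule: infinite_finite_induct) (use carB_add in auto)
lemma carA_scale: "f \<in> carA \<Longrightarrow> free_scale c f \<in> carA"
  unfolding free_scale_def by (rule carA_mult) (use A.W0 in auto)
lemma carA_diff: "f \<in> carA \<Longrightarrow> h \<in> carA \<Longrightarrow> f - h \<in> carA"
  using carA_add[of f "- h"] by simp
lemma carB_tensor: "f \<in> carA \<Longrightarrow> h \<in> carA \<Longrightarrow> free_tensor f h \<in> carB"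
  using keys_tensor[of f h] by auto
lemma carA_1: "1 \<in> carA" using A.W0 by simp

lemma rel_carA: "p < n \<Longrightarrow> s < n \<Longrightarrow> i < n \<Longrightarrow> j < n \<Longrightarrow> frt_relation q n p s i j \<in> carA"
  unfolding frt_relation_def by (intro carA_diff carA_sum carA_scale carA_mult carA_gen) auto

lemma I1_ideal: "ideal I1 (malg (words n))"
  unfolding frt_ideal_def free_alg_malg by (rule RA.genideal_ideal, unfold A.malg_simps) (use rel_carA in blast)

lemma I1_rel: "p < n \<Longrightarrow> s < n \<Longrightarrow> i < n \<Longrightarrow> j < n \<Longrightarrow> frt_relation q n p s i j \<in> I1"
proof -
  assume *: "p < n" "s < n" "i < n" "j < n"
  have "{frt_relation q n p s i j | p s i j. p < n \<and> s < n \<and> i < n \<and> j < n} \<subseteq> I1"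
    unfolding frt_ideal_def free_alg_malg by (rule RA.genideal_self, unfold A.malg_simps) (use rel_carA in blast)
  thus ?thesis using * by blast
qed

lemma I1_min: "ideal S (malg (words n)) \<Longrightarrow> (\<And>p s i j. p < n \<Longrightarrow> s < n \<Longrightarrow> i < n \<Longrightarrow> j < n \<Longrightarrow> frt_relation q n p s i j \<in> S) \<Longrightarrow> I1 \<subseteq> S"
  unfolding frt_ideal_def free_alg_malg by (rule RA.genideal_minimal) auto

lemmas I1 = A.idealD[OF I1_ideal, simplified]

lemma I2_gen: "(\<lambda>f. free_tensor f 1) ` I1 \<union> free_tensor 1 ` I1 \<subseteq> carrier (malg (words n \<times> words n) :: 'k free2 ring)"
  unfolding B.malg_simps using carB_tensor[OF _ carA_1] carB_tensor[OF carA_1] I1(1) by blast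

lemma I2_ideal: "ideal I2 (malg (words n \<times> words n))"
  unfolding frt_ideal2_def free_alg2_malg by (rule RB.genideal_ideal[OF I2_gen])

lemmas I2 = B.idealD[OF I2_ideal, simplified]

lemma I2_base: "f \<in> I1 \<Longrightarrow> free_tensor f 1 \<in> I2 \<and> free_tensor 1 f \<in> I2"
  using RB.genideal_self[OF I2_gen] unfolding frt_ideal2_def free_alg2_malg by blast

lemma I2_min: "ideal S (malg (words n \<times> words n)) \<Longrightarrow> (\<And>f. f \<in> I1 \<Longrightarrow> free_tensor f 1 \<in> S \<and> free_tensor 1 f \<in> S) \<Longrightarrow> I2 \<subseteq> S"
  unfolding frt_ideal2_def free_alg2_malg by (rule RB.genideal_minimal) auto

lemma I2_tensor_left: "f \<in> I1 \<Longrightarrow> h \<in> carA \<Longrightarrow> free_tensor f h \<in> I2"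
  using I2(7)[of "free_tensor 1 h" "free_tensor f 1"] I2_base[of f] carB_tensor[OF carA_1, of h]
  by (simp add: tensor_mult)
lemma I2_tensor_right: "f \<in> I1 \<Longrightarrow> h \<in> carA \<Longrightarrow> free_tensor h f \<in> I2"
  using I2(6)[of "free_tensor h 1" "free_tensor 1 f"] I2_base[of f] carB_tensor[OF _ carA_1, of h]
  by (simp add: tensor_mult)

lemma I2_sum: "(\<And>a. a \<in> S \<Longrightarrow> f a \<in> I2) \<Longrightarrow> (\<Sum>a\<in>S. f a) \<in> I2"
  by (induction S rule: infinite_finite_induct) (use I2(2,3) in auto)

text \<open>The functionals on words whose matrix of values in every degree lies in the commutant. In degree two this is
literally the defining relation of \<open>A\<^sub>q(n,n)\<close>, so they are functionals on \<open>A\<^sub>q(n,n)\<close>.\<close>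
definition G :: "(monom_word \<Rightarrow> 'k) set" where
  "G = {g. \<forall>e. comm n e (\<lambda>K L. g (Word (zip K L)))}"

lemma T_prefix: "length ks = s \<Longrightarrow> T (s + i) y (ks @ K) = T i (\<lambda>R. y (ks @ R)) K"
  by (auto simp: T_def nth_append swp_append2)

lemma G_left: assumes g: "g \<in> G" and u: "u \<in> words n" shows "(\<lambda>v. g (u + v)) \<in> G"
proof -
  obtain ks ls s where u: "u = Word (zip ks ls)" "ks \<in> idx n s" "ls \<in> idx n s" using word_zip[OF u] by blast
  have l: "length ks = s" "length ls = s" using u by (auto simp: idx_length)
  have "comm n e (\<lambda>K L. g (u + Word (zip K L)))" for e
    unfolding comm_def
  proof (intro allI impI)
    fix i K L assume i: "i + 1 < e" and K: "K \<in> idx n e" and L: "L \<in> idx n e"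
    have z: "u + Word (zip P R) = Word (zip (ks @ P) (ls @ R))" for P R
      using l by (simp add: u plus_monom_word_def)
    have c: "comm n (s + e) (\<lambda>K L. g (Word (zip K L)))" using g by (simp add: G_def)
    have "T (s + i) (\<lambda>P. g (Word (zip P (ls @ L)))) (ks @ K) = T (s + i) (\<lambda>P. g (Word (zip (ks @ K) P))) (ls @ L)"
      by (rule commD[OF c]) (use i K L u l in \<open>auto simp: append_idx\<close>)
    thus "T i (\<lambda>P. g (u + Word (zip P L))) K = T i (\<lambda>P. g (u + Word (zip K P))) L"
      unfolding T_prefix[OF l(1)] T_prefix[OF l(2)] z .
  qed
  thus ?thesis by (simp add: G_def)
qed

lemma G_right: assumes g: "g \<in> G" and u: "u \<in> words n" shows "(\<lambda>v. g (v + u)) \<in> G"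
proof -
  obtain ks ls s where u: "u = Word (zip ks ls)" "ks \<in> idx n s" "ls \<in> idx n s" using word_zip[OF u] by blast
  have l: "length ks = s" "length ls = s" using u by (auto simp: idx_length)
  have "comm n e (\<lambda>K L. g (Word (zip K L) + u))" for e
    unfolding comm_def
  proof (intro allI impI)
    fix i K L assume i: "i + 1 < e" and K: "K \<in> idx n e" and L: "L \<in> idx n e"
    have lK: "length K = e" "length L = e" using K L by (auto simp: idx_length)
    have z: "Word (zip P R) + u = Word (zip (P @ ks) (R @ ls))" if "length P = length R" for P R
      using that by (simp add: u plus_monom_word_def)
    have c: "comm n (e + s) (\<lambda>K L. g (Word (zip K L)))" using g by (simp add: G_def)
    have "T i (\<lambda>P. g (Word (zip P (L @ ls)))) (K @ ks) = T i (\<lambda>P. g (Word (zip (K @ ks) P))) (L @ ls)"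
      by (rule commD[OF c]) (use i K L u l lK in \<open>auto simp: append_idx\<close>)
    hence "T i (\<lambda>P. g (Word (zip (P @ ks) (L @ ls)))) K = T i (\<lambda>P. g (Word (zip (K @ ks) (P @ ls)))) L"
      using i lK by (simp add: T_append)
    moreover have "T i (\<lambda>P. g (Word (zip P L) + u)) K = T i (\<lambda>P. g (Word (zip (P @ ks) (L @ ls)))) K"
      by (rule T_cong) (use z lK in auto)
    moreover have "T i (\<lambda>P. g (Word (zip K P) + u)) L = T i (\<lambda>P. g (Word (zip (K @ ks) (P @ ls)))) L"
      by (rule T_cong) (use z lK in auto)
    ultimately show "T i (\<lambda>P. g (Word (zip P L) + u)) K = T i (\<lambda>P. g (Word (zip K P) + u)) L" by simp
  qed
  thus ?thesis by (simp add: G_def)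
qed

lemma gen_mult: "free_gen k i * free_gen l j = Poly_Mapping.single (Word [(k, i), (l, j)]) 1"
  by (simp add: free_gen_def mult_single plus_monom_word_def)

lemma pev_scale: "pev g (free_scale c f) = c * pev g f"
  by (simp add: free_scale_def pev_single0)

lemma pev_rel: "pev g (frt_relation q n p s i j) =
   (\<Sum>k<n. \<Sum>l<n. R_coef q p s k l * g (Word [(k, i), (l, j)])) - (\<Sum>k<n. \<Sum>l<n. R_coef q k l i j * g (Word [(p, k), (s, l)]))"
  by (simp add: frt_relation_def pev_diff pev_sum pev_scale gen_mult)

lemma R_sum_out: "p < n \<Longrightarrow> s < n \<Longrightarrow> (\<Sum>k<n. \<Sum>l<n. R_coef q p s k l * y k l) = Rdiag q p s * y p s + Roff p s * y s p"
proof -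
  assume ps: "p < n" "s < n"
  have "(\<Sum>k<n. \<Sum>l<n. R_coef q p s k l * y k l) =
    (\<Sum>k<n. \<Sum>l<n. (if k = p then if l = s then Rdiag q p s * y p s else 0 else 0) + (if k = s then if l = p then Roff p s * y s p else 0 else 0))"
    by (intro sum.cong refl) (auto simp: R_coef_split Roff_sym distrib_right)
  also have "\<dots> = (\<Sum>k<n. (if k = p then Rdiag q p s * y p s else 0) + (if k = s then Roff p s * y s p else 0))"
    using ps by (intro sum.cong refl) (auto simp: sum.distrib)
  also have "\<dots> = Rdiag q p s * y p s + Roff p s * y s p" using ps by (simp add: sum.distrib algebra_simps)
  finally show ?thesis .
qed

lemma R_sum_in: "i < n \<Longrightarrow> j < n \<Longrightarrow> (\<Sum>k<n. \<Sum>l<n. R_coef q k l i j * y k l) = Rdiag q i j * y i j + Roff i j * y j i"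
proof -
  assume ij: "i < n" "j < n"
  have "(\<Sum>k<n. \<Sum>l<n. R_coef q k l i j * y k l) =
    (\<Sum>k<n. \<Sum>l<n. (if k = i then if l = j then Rdiag q i j * y i j else 0 else 0) + (if k = j then if l = i then Roff i j * y j i else 0 else 0))"
    by (intro sum.cong refl) (auto simp: R_coef_split distrib_right)
  also have "\<dots> = (\<Sum>k<n. (if k = i then Rdiag q i j * y i j else 0) + (if k = j then Roff i j * y j i else 0))"
    using ij by (intro sum.cong refl) (auto simp: sum.distrib)
  also have "\<dots> = Rdiag q i j * y i j + Roff i j * y j i" using ij by (simp add: sum.distrib algebra_simps)
  finally show ?thesis .
qed

text \<open>\<open>G\<close> is closed under translations, so only the generators of the ideal must be tested.\<close>
lemma I1_annihilated: assumes f: "f \<in> I1" and g: "g \<in> G" shows "pev g f = 0"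
proof -
  have "I1 \<subseteq> {f \<in> carrier (malg (words n)). \<forall>g\<in>G. pev g f = 0}"
  proof (rule I1_min[OF A.annihilator_ideal[OF G_left G_right]])
    fix p s i j assume b: "p < n" "s < n" "i < n" "j < n"
    have "pev g (frt_relation q n p s i j) = 0" if g: "g \<in> G" for g
    proof -
      have c: "comm n 2 (\<lambda>K L. g (Word (zip K L)))" using g by (simp add: G_def)
      have "T 0 (\<lambda>P. g (Word (zip P [i,j]))) [p,s] = T 0 (\<lambda>P. g (Word (zip [p,s] P))) [i,j]"
        by (rule commD[OF c]) (use b in \<open>auto simp: idx_def\<close>)
      thus ?thesis by (simp add: pev_rel R_sum_out R_sum_in b T_def swp_def)
    qed
    thus "frt_relation q n p s i j \<in> {f \<in> carrier (malg (words n)). \<forall>g\<in>G. pev g f = 0}"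
      using rel_carA b by simp
  qed
  thus ?thesis using f g by blast
qed

definition G2 :: "(monom_word \<times> monom_word \<Rightarrow> 'k) set" where
  "G2 = {g. (\<forall>v\<in>words n. (\<lambda>u. g (u, v)) \<in> G) \<and> (\<forall>u\<in>words n. (\<lambda>v. g (u, v)) \<in> G)}"

lemma I2_annihilated: assumes f: "f \<in> I2" and g: "g \<in> G2" shows "pev g f = 0"
proof -
  have "I2 \<subseteq> {f \<in> carrier (malg (words n \<times> words n)). \<forall>g\<in>G2. pev g f = 0}"
  proof (rule I2_min[OF B.annihilator_ideal])
    show "(\<lambda>v. g (u + v)) \<in> G2" if "g \<in> G2" "u \<in> words n \<times> words n" for g u
      using that A.Wadd G_left[of "\<lambda>a. g (a, _)"] G_left[of "\<lambda>a. g (_, a)"] by (cases u) (auto simp: G2_def)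
    show "(\<lambda>v. g (v + u)) \<in> G2" if "g \<in> G2" "u \<in> words n \<times> words n" for g u
      using that A.Wadd G_right[of "\<lambda>a. g (a, _)"] G_right[of "\<lambda>a. g (_, a)"] by (cases u) (auto simp: G2_def)
    fix f assume f: "f \<in> I1"
    have 0: "(0 :: monom_word) \<in> words n" by (rule A.W0)
    have "pev g (free_tensor f 1) = 0 \<and> pev g (free_tensor 1 f) = 0" if "g \<in> G2" for g
    proof -
      have "pev h (1 :: 'k free) = h 0" for h by (simp flip: single_one)
      thus ?thesis using that 0 I1_annihilated[OF f, of "\<lambda>u. g (u, 0)"] I1_annihilated[OF f, of "\<lambda>u. g (0, u)"]
        by (simp add: pev_tensor G2_def)
    qed
    thus "free_tensor f 1 \<in> {f \<in> carrier (malg (words n \<times> words n)). \<forall>g\<in>G2. pev g f = 0} \<and>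
      free_tensor 1 f \<in> {f \<in> carrier (malg (words n \<times> words n)). \<forall>g\<in>G2. pev g f = 0}"
      using carB_tensor[OF subsetD[OF I1(1) f] carA_1] carB_tensor[OF carA_1 subsetD[OF I1(1) f]] by auto
  qed
  thus ?thesis using f g by blast
qed

lemma comult_word_carB: "w \<in> words n \<Longrightarrow> (free_comult_word n w :: 'k free2) \<in> carB"
proof -
  assume "w \<in> words n"
  then obtain K L e where w: "w = Word (zip K L)" "K \<in> idx n e" "L \<in> idx n e" using word_zip by blast
  have "Poly_Mapping.single (Word (zip K P), Word (zip P L)) (1::'k) \<in> carB" if "P \<in> idx n e" for P
    using that w zip_words by auto
  hence "(\<Sum>P\<in>idx n e. Poly_Mapping.single (Word (zip K P), Word (zip P L)) (1::'k)) \<in> carB" by (rule carB_sum)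
  thus ?thesis using comult_zip[of K L n, where 'a = 'k] w by (simp add: idx_length)
qed

lemma comult_carB: "f \<in> carA \<Longrightarrow> free_comult n f \<in> carB"
  unfolding free_comult_def
  by (intro carB_sum carB_mult comult_word_carB) (use B.W0 in auto)

lemma sum_idx2: "(\<Sum>P\<in>idx n (Suc (Suc 0)). g P) = (\<Sum>a<n. \<Sum>b<n. g [a, b])"
  by (simp add: sum_idx_Cons idx_0)

text \<open>The generators of the ideal span a coideal: add and subtract the mixed term in which \<open>R\<close> stands between the two
tensor factors.\<close>
lemma comult_rel: "free_comult n (frt_relation q n p s i j) =
   (\<Sum>a<n. \<Sum>b<n. free_tensor (frt_relation q n p s a b) (free_gen a i * free_gen b j))
   + (\<Sum>a<n. \<Sum>b<n. free_tensor (free_gen p a * free_gen s b) (frt_relation q n a b i j))"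
proof (rule pev_ext)
  fix g :: "monom_word \<times> monom_word \<Rightarrow> 'k"
  define y where "y k l a b i j = g (Word [(k, a), (l, b)], Word [(a, i), (b, j)])" for k l a b i j
  have w: "pev g (free_comult_word n (Word [(k, i), (l, j)])) = (\<Sum>a<n. \<Sum>b<n. y k l a b i j)" for k l i j
    using pev_comult_zip[of "[k,l]" "[i,j]" g n] by (simp add: sum_idx2 y_def)
  have "pev g (free_comult n (frt_relation q n p s i j)) =
     (\<Sum>k<n. \<Sum>l<n. \<Sum>a<n. \<Sum>b<n. R_coef q p s k l * y k l a b i j) - (\<Sum>k<n. \<Sum>l<n. \<Sum>a<n. \<Sum>b<n. R_coef q k l i j * y p s a b k l)"
    by (simp add: pev_comult pev_rel w sum_distrib_left)
  moreover have "pev g (\<Sum>a<n. \<Sum>b<n. free_tensor (frt_relation q n p s a b) (free_gen a i * free_gen b j)) =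
     (\<Sum>a<n. \<Sum>b<n. \<Sum>k<n. \<Sum>l<n. R_coef q p s k l * y k l a b i j) -
     (\<Sum>a<n. \<Sum>b<n. \<Sum>k<n. \<Sum>l<n. R_coef q k l a b * g (Word [(p, k), (s, l)], Word [(a, i), (b, j)]))"
    by (simp add: pev_sum pev_tensor gen_mult pev_rel sum_subtractf y_def)
  moreover have "pev g (\<Sum>a<n. \<Sum>b<n. free_tensor (free_gen p a * free_gen s b) (frt_relation q n a b i j)) =
     (\<Sum>a<n. \<Sum>b<n. \<Sum>k<n. \<Sum>l<n. R_coef q a b k l * g (Word [(p, a), (s, b)], Word [(k, i), (l, j)])) -
     (\<Sum>a<n. \<Sum>b<n. \<Sum>k<n. \<Sum>l<n. R_coef q k l i j * y p s a b k l)"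
    by (simp add: pev_sum pev_tensor gen_mult pev_rel sum_subtractf y_def)
  moreover have "(\<Sum>a<n. \<Sum>b<n. \<Sum>k<n. \<Sum>l<n. R_coef q p s k l * y k l a b i j) = (\<Sum>k<n. \<Sum>l<n. \<Sum>a<n. \<Sum>b<n. R_coef q p s k l * y k l a b i j)"
    by (rule sum4_swap)
  moreover have "(\<Sum>a<n. \<Sum>b<n. \<Sum>k<n. \<Sum>l<n. R_coef q k l i j * y p s a b k l) = (\<Sum>k<n. \<Sum>l<n. \<Sum>a<n. \<Sum>b<n. R_coef q k l i j * y p s a b k l)"
    by (rule sum4_swap)
  moreover have "(\<Sum>a<n. \<Sum>b<n. \<Sum>k<n. \<Sum>l<n. R_coef q k l a b * g (Word [(p, k), (s, l)], Word [(a, i), (b, j)]))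
     = (\<Sum>a<n. \<Sum>b<n. \<Sum>k<n. \<Sum>l<n. R_coef q a b k l * g (Word [(p, a), (s, b)], Word [(k, i), (l, j)]))"
    by (rule sum4_swap)
  ultimately show "pev g (free_comult n (frt_relation q n p s i j)) = pev g ((\<Sum>a<n. \<Sum>b<n. free_tensor (frt_relation q n p s a b) (free_gen a i * free_gen b j))
   + (\<Sum>a<n. \<Sum>b<n. free_tensor (free_gen p a * free_gen s b) (frt_relation q n a b i j)))"
    by (simp add: pev_add)
qed

lemma comult_I: "f \<in> I1 \<Longrightarrow> free_comult n f \<in> I2"
proof -
  have "ideal {f \<in> carA. free_comult n f \<in> I2} (malg (words n))"
    by (rule A.malg_ideal)
       (use carA_add carA_mult I2(2-4,6,7) comult_carB in \<open>auto simp: comult_add comult_0 comult_uminus comult_mult\<close>)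
  moreover have "frt_relation q n p s i j \<in> {f \<in> carA. free_comult n f \<in> I2}" if "p < n" "s < n" "i < n" "j < n" for p s i j
  proof -
    have "free_tensor (frt_relation q n p s a b) (free_gen a i * free_gen b j) \<in> I2" if "a < n" "b < n" for a b
      by (rule I2_tensor_left[OF I1_rel carA_mult[OF carA_gen carA_gen]]) (fact \<open>p < n\<close> \<open>s < n\<close> \<open>i < n\<close> \<open>j < n\<close> that)+
    moreover have "free_tensor (free_gen p a * free_gen s b) (frt_relation q n a b i j) \<in> I2" if "a < n" "b < n" for a b
      by (rule I2_tensor_right[OF I1_rel carA_mult[OF carA_gen carA_gen]]) (fact \<open>p < n\<close> \<open>s < n\<close> \<open>i < n\<close> \<open>j < n\<close> that)+
    ultimately have "free_comult n (frt_relation q n p s i j) \<in> I2" unfolding comult_rel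
      by (intro I2(3) I2_sum) auto
    thus ?thesis using that rel_carA by simp
  qed
  ultimately have "I1 \<subseteq> {f \<in> carA. free_comult n f \<in> I2}" by (rule I1_min)
  thus "f \<in> I1 \<Longrightarrow> free_comult n f \<in> I2" by blast
qed

lemma class2_eq: "aq2_class q n f = aq2_class q n h \<longleftrightarrow> f - h \<in> I2"
  unfolding aq2_class_def free_alg2_malg by (rule B.coset_eq[OF I2_ideal])

lemma class_set: "aq_class q n f = (\<lambda>h. h + f) ` I1"
  unfolding aq_class_def free_alg_malg by (rule A.coset)

lemma comult_class: "aq_comult q n (aq_class q n f) = aq2_class q n (free_comult n f)"
  unfolding aq_comult_def aq_class_def free_alg_malg
  by (rule A.coset_value[OF I1_ideal]) (simp add: class2_eq comult_add comult_I)

lemma counit_eq: "free_counit f = pev (\<lambda>w. counit_word (letters w)) f"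
  by (simp add: free_counit_def pev_def)

lemma counit_G: "(\<lambda>w. counit_word (letters w)) \<in> G"
proof -
  have "comm n e (\<lambda>K L. counit_word (zip K L))" for e
    by (subst comm_cong[where M' = "\<lambda>K L. of_bool (K = L)"]) (auto simp: counit_zip idx_length comm_id)
  thus ?thesis by (simp add: G_def)
qed

lemma counit_class: "aq_counit (aq_class q n f) = free_counit f"
  unfolding aq_counit_def aq_class_def free_alg_malg
  by (rule A.coset_value[OF I1_ideal]) (simp add: counit_eq pev_add I1_annihilated counit_G)

lemma the_elem_pair: "(\<And>f' h'. f' \<in> S \<Longrightarrow> h' \<in> R \<Longrightarrow> v f' h' = v0) \<Longrightarrow> S \<noteq> {} \<Longrightarrow> R \<noteq> {} \<Longrightarrow>
   the_elem ((\<lambda>(f, h). v f h) ` (S \<times> R)) = v0"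
proof -
  assume a: "\<And>f' h'. f' \<in> S \<Longrightarrow> h' \<in> R \<Longrightarrow> v f' h' = v0" "S \<noteq> {}" "R \<noteq> {}"
  hence "(\<lambda>(f, h). v f h) ` (S \<times> R) = {v0}" by (auto simp: image_iff)
  thus ?thesis by simp
qed

lemma tensor_class: assumes "f \<in> carA" "h \<in> carA"
  shows "aq_tensor q n (aq_class q n f) (aq_class q n h) = aq2_class q n (free_tensor f h)"
  unfolding aq_tensor_def
proof (rule the_elem_pair)
  fix f' h' assume "f' \<in> aq_class q n f" "h' \<in> aq_class q n h"
  then obtain a b where ab: "a \<in> I1" "f' = a + f" "b \<in> I1" "h' = b + h" by (auto simp: class_set)
  have "free_tensor f' h' - free_tensor f h = free_tensor a (b + h) + free_tensor f b"
    by (simp add: ab tensor_add_left tensor_add_right)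
  also have "\<dots> \<in> I2"
    using ab assms I1(1) by (intro I2(3) I2_tensor_left I2_tensor_right carA_add) auto
  finally show "aq2_class q n (free_tensor f' h') = aq2_class q n (free_tensor f h)" by (simp add: class2_eq)
qed (use I1(2) in \<open>auto simp: class_set\<close>)

lemma class_mult: "f \<in> carA \<Longrightarrow> h \<in> carA \<Longrightarrow> aq_class q n f \<otimes>\<^bsub>aq q n\<^esub> aq_class q n h = aq_class q n (f * h)"
  unfolding aq_class_def aq_def free_alg_malg by (rule A.coset_mult[OF I1_ideal]) auto

lemma class_one: "\<one>\<^bsub>aq q n\<^esub> = aq_class q n 1"
  by (simp add: aq_class_def aq_def FactRing_def free_alg_malg)

lemma class_zero: "\<zero>\<^bsub>aq q n\<^esub> = aq_class q n 0"
  using A.coset[of I1 0] by (simp add: aq_class_def aq_def FactRing_def free_alg_malg)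

lemma class_carrier: "f \<in> carA \<Longrightarrow> aq_class q n f \<in> carrier (aq q n)"
  by (auto simp: aq_class_def aq_def FactRing_def free_alg_malg A_RCOSETS_def')

lemma class2_finsum: "finite S \<Longrightarrow> (\<And>a. a \<in> S \<Longrightarrow> f a \<in> carB) \<Longrightarrow>
  finsum (aq2 q n) (\<lambda>a. aq2_class q n (f a)) S = aq2_class q n (\<Sum>a\<in>S. f a)"
  unfolding aq2_class_def aq2_def free_alg2_malg
  using B.coset_finsum[OF I2_ideal, of S f] by auto

end

section \<open>The r-form as a full crossing\<close>

context hecke begin

lemma C_hd: "C (Suc p) s y (l # P) = C p s (\<lambda>R. y (l # R)) P"
proof (induction s arbitrary: P)
  case (Suc s)
  have "C (Suc p) (Suc s) y (l # P) = T (p + s) (\<lambda>R. C (Suc p) s y (l # R)) P"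
    using T_hd[of "p + s" "C (Suc p) s y" l P] by simp
  also have "\<dots> = T (p + s) (C p s (\<lambda>R. y (l # R))) P" by (simp add: Suc)
  finally show ?case by simp
qed simp

lemma X_hd: "X (Suc p) e1 e2 y (l # P) = X p e1 e2 (\<lambda>R. y (l # R)) P"
  by (induction e1 arbitrary: p P) (simp_all add: C_hd)

lemma X_sp: "x \<in> sp n d \<Longrightarrow> X p e1 e2 x \<in> sp n d"
  by (induction e1 arbitrary: p) (auto intro: C_sp)

lemma delta_hd: "(\<lambda>R. delta (a # M) (l # R)) = (if l = a then delta M else 0)"
  by (auto simp: delta_def fun_eq_iff)

lemma T_delta_lin: assumes "lin f" "i + 1 < length L"
  shows "f (T i (delta L)) Y = T i (\<lambda>P. f (delta P) Y) L"
proof -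
  have "f (T i (delta L)) = fscale (Rdiag q (L ! i) (L ! (i+1))) (f (delta L)) + fscale (Roff (L ! i) (L ! (i+1))) (f (delta (swp i L)))"
    using assms(2) by (simp add: T_delta lin_add[OF assms(1)] lin_scale[OF assms(1)])
  thus ?thesis using assms(2) by (simp add: T_def fscale_def)
qed

text \<open>The recursions that define the r-form build up a braid crossing by crossing; for a single letter on the left it is one
strand passing over all the others.\<close>
lemma r_letter_C:
  "length L = length Jv \<Longrightarrow> set Jv \<subseteq> {..<n} \<Longrightarrow> i < n \<Longrightarrow>
   r_letter q n (k, i) (zip L Jv) = C 0 (length L) (delta (i # Jv)) (L @ [k])"
proof (induction L Jv arbitrary: i rule: list_induct2)
  case Nil thus ?case by (simp add: delta_def)
next
  case (Cons l L j Jv)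
  have j: "j < n" using Cons.prems by simp
  have "r_letter q n (k, i) (zip (l # L) (j # Jv)) =
    (\<Sum>m<n. (if m = j then Rdiag q i j * of_bool (l = i) * r_letter q n (k, j) (zip L Jv) else 0)
       + (if m = i then Roff i j * of_bool (l = j) * r_letter q n (k, i) (zip L Jv) else 0))"
    unfolding zip_Cons_Cons r_letter.simps by (rule sum.cong) (auto simp: R_coef_split algebra_simps)
  also have "\<dots> = Rdiag q i j * of_bool (l = i) * r_letter q n (k, j) (zip L Jv)
       + Roff i j * of_bool (l = j) * r_letter q n (k, i) (zip L Jv)"
    using j Cons.prems by (simp add: sum.distrib)
  also have "\<dots> = Rdiag q i j * of_bool (l = i) * C 0 (length L) (delta (j # Jv)) (L @ [k])
       + Roff i j * of_bool (l = j) * C 0 (length L) (delta (i # Jv)) (L @ [k])"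
    using Cons.IH[of j] Cons.IH[of i] Cons.prems by simp
  also have "\<dots> = C 0 (length (l # L)) (delta (i # j # Jv)) ((l # L) @ [k])"
  proof -
    have "T 0 (delta (i # j # Jv)) = fscale (Rdiag q i j) (delta (i # j # Jv)) + fscale (Roff i j) (delta (j # i # Jv))"
      by (simp add: T_delta swp_def)
    hence "C 0 (length (l # L)) (delta (i # j # Jv)) = fscale (Rdiag q i j) (C 1 (length L) (delta (i # j # Jv))) + fscale (Roff i j) (C 1 (length L) (delta (j # i # Jv)))"
      by (simp add: C_front lin_add[OF lin_C] lin_scale[OF lin_C] del: C.simps(2))
    thus ?thesis by (simp add: C_hd delta_hd fscale_def lin_0[OF lin_C] del: C.simps(2))
  qed
  finally show ?case .
qed

text \<open>The matrix of the universal r-form on words is the full crossing. All its properties thereby become properties of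
braids; in particular \<open>X_shift_left\<close> and \<open>X_shift_right\<close> show that it is in the commutant in both arguments.\<close>
lemma r_word_X:
  "K \<in> idx n e1 \<Longrightarrow> Iv \<in> idx n e1 \<Longrightarrow> L \<in> idx n e2 \<Longrightarrow> Jv \<in> idx n e2 \<Longrightarrow>
   r_word q n (zip K Iv) (zip L Jv) = X 0 e1 e2 (delta (Iv @ Jv)) (L @ K)"
proof (induction e1 arbitrary: K Iv L)
  case 0
  hence "length L = length Jv" by (simp add: idx_length)
  thus ?case using 0 by (simp add: idx_0 delta_def counit_zip)
next
  case (Suc e1)
  obtain k K' where K: "K = k # K'" "k < n" "K' \<in> idx n e1" using Suc.prems(1) by (auto simp: idx_Suc_Cons)
  obtain i I' where I: "Iv = i # I'" "i < n" "I' \<in> idx n e1" using Suc.prems(2) by (auto simp: idx_Suc_Cons)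
  have lL: "length L = e2" "length Jv = e2" using Suc.prems by (auto simp: idx_length)
  define y where "y = X 1 e1 e2 (delta (Iv @ Jv))"
  define z where "z = (\<Sum>M\<in>idx n e2. fscale (r_word q n (zip K' I') (zip M Jv)) (delta (i # M)))"
  have IJ: "I' @ Jv \<in> idx n (e1 + e2)" using I Suc.prems by (simp add: append_idx idx_length)
  have yz: "y (R @ K') = z R" if R: "length R = Suc e2" for R
  proof -
    obtain r R' where r: "R = r # R'" "length R' = e2" using R by (cases R) auto
    have "y (R @ K') = (if r = i then X 0 e1 e2 (delta (I' @ Jv)) (R' @ K') else 0)"
      using I r by (simp add: y_def X_hd delta_hd lin_0[OF lin_X])
    also have "X 0 e1 e2 (delta (I' @ Jv)) (R' @ K') = (if R' \<in> idx n e2 then r_word q n (zip K' I') (zip R' Jv) else 0)"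
    proof (cases "R' \<in> idx n e2")
      case True thus ?thesis using Suc.IH[OF K(3) I(3) True Suc.prems(4)] by simp
    next
      case False
      hence "R' @ K' \<notin> idx n (e1 + e2)" using r by (auto simp: idx_def)
      thus ?thesis using X_sp[OF sp_delta[OF IJ], of 0 e1 e2] False by (simp add: sp_def)
    qed
    also have "(if r = i then if R' \<in> idx n e2 then r_word q n (zip K' I') (zip R' Jv) else 0 else 0) = z R"
    proof -
      have "z R = (\<Sum>M\<in>idx n e2. if M = R' then (if r = i then r_word q n (zip K' I') (zip R' Jv) else 0) else 0)"
        unfolding z_def sum_fun_apply by (rule sum.cong) (auto simp: fscale_def delta_def r)
      thus ?thesis by simp
    qed
    finally show ?thesis .
  qed
  have "X 0 (Suc e1) e2 (delta (Iv @ Jv)) (L @ K) = C 0 e2 y ((L @ [k]) @ K')" by (simp add: y_def K)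
  also have "\<dots> = C 0 e2 (\<lambda>R. y (R @ K')) (L @ [k])" using lL by (subst C_append) auto
  also have "\<dots> = C 0 e2 z (L @ [k])" by (rule C_cong) (use yz lL in auto)
  also have "\<dots> = (\<Sum>M\<in>idx n e2. r_word q n (zip K' I') (zip M Jv) * C 0 e2 (delta (i # M)) (L @ [k]))"
    unfolding z_def by (simp add: lin_sum[OF lin_C] lin_scale[OF lin_C] sum_fun_apply) (simp add: fscale_def)
  also have "\<dots> = (\<Sum>M\<in>idx n e2. r_letter q n (k, i) (zip L M) * r_word q n (zip K' I') (zip M Jv))"
  proof (rule sum.cong[OF refl])
    fix M assume "M \<in> idx n e2"
    hence "length L = length M" "set M \<subseteq> {..<n}" using lL by (auto simp: idx_def)
    from r_letter_C[OF this I(2), of k] lL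
    show "r_word q n (zip K' I') (zip M Jv) * C 0 e2 (delta (i # M)) (L @ [k]) = r_letter q n (k, i) (zip L M) * r_word q n (zip K' I') (zip M Jv)"
      by simp
  qed
  also have "\<dots> = r_word q n (zip K Iv) (zip L Jv)" using lL by (simp add: K I)
  finally show ?case by simp
qed

end

context frt begin

abbreviation "rw a b \<equiv> r_word q n (letters a) (letters b)"

lemma r_left_G: assumes "b \<in> words n" shows "(\<lambda>a. rw a b) \<in> G"
proof -
  obtain L Jv e2 where b: "b = Word (zip L Jv)" "L \<in> idx n e2" "Jv \<in> idx n e2" using word_zip[OF assms] by blast
  have l: "length L = e2" "length Jv = e2" using b by (auto simp: idx_length)
  have "comm n e (\<lambda>K Iv. X 0 e e2 (delta (Iv @ Jv)) (L @ K))" for e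
    unfolding comm_def
  proof (intro allI impI)
    fix i K Iv assume i: "i + 1 < e" and K: "K \<in> idx n e" and I: "Iv \<in> idx n e"
    have lI: "length Iv = e" using I by (simp add: idx_length)
    have "T i (\<lambda>P. X 0 e e2 (delta (Iv @ Jv)) (L @ P)) K = T (e2 + i) (X 0 e e2 (delta (Iv @ Jv))) (L @ K)"
      by (rule T_prefix[OF l(1), symmetric])
    also have "\<dots> = X 0 e e2 (T i (delta (Iv @ Jv))) (L @ K)" using X_shift_left[OF i, of 0 e2] by simp
    also have "\<dots> = T i (\<lambda>P. X 0 e e2 (delta P) (L @ K)) (Iv @ Jv)" using i lI by (intro T_delta_lin[OF lin_X]) auto
    also have "\<dots> = T i (\<lambda>P. X 0 e e2 (delta (P @ Jv)) (L @ K)) Iv" using i lI by (intro T_append) auto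
    finally show "T i (\<lambda>P. X 0 e e2 (delta (Iv @ Jv)) (L @ P)) K = T i (\<lambda>P. X 0 e e2 (delta (P @ Jv)) (L @ K)) Iv" .
  qed
  hence "comm n e (\<lambda>K Iv. rw (Word (zip K Iv)) b)" for e
    by (subst comm_cong[where M' = "\<lambda>K Iv. X 0 e e2 (delta (Iv @ Jv)) (L @ K)"]) (auto simp: b r_word_X)
  thus ?thesis by (simp add: G_def)
qed

lemma r_right_G: assumes "a \<in> words n" shows "(\<lambda>b. rw a b) \<in> G"
proof -
  obtain K Iv e1 where a: "a = Word (zip K Iv)" "K \<in> idx n e1" "Iv \<in> idx n e1" using word_zip[OF assms] by blast
  have l: "length K = e1" "length Iv = e1" using a by (auto simp: idx_length)
  have "comm n e (\<lambda>L Jv. X 0 e1 e (delta (Iv @ Jv)) (L @ K))" for e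
    unfolding comm_def
  proof (intro allI impI)
    fix i L Jv assume i: "i + 1 < e" and L: "L \<in> idx n e" and Jv: "Jv \<in> idx n e"
    have lJ: "length Jv = e" "length L = e" using L Jv by (auto simp: idx_length)
    have "T i (\<lambda>P. X 0 e1 e (delta (Iv @ Jv)) (P @ K)) L = T i (X 0 e1 e (delta (Iv @ Jv))) (L @ K)"
      using i lJ by (intro T_append[symmetric]) auto
    also have "\<dots> = X 0 e1 e (T (e1 + i) (delta (Iv @ Jv))) (L @ K)" using X_shift_right[OF i, of 0 e1] by simp
    also have "\<dots> = T (e1 + i) (\<lambda>P. X 0 e1 e (delta P) (L @ K)) (Iv @ Jv)" using i lJ l by (intro T_delta_lin[OF lin_X]) auto
    also have "\<dots> = T i (\<lambda>P. X 0 e1 e (delta (Iv @ P)) (L @ K)) Jv" by (rule T_prefix[OF l(2)])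
    finally show "T i (\<lambda>P. X 0 e1 e (delta (Iv @ Jv)) (P @ K)) L = T i (\<lambda>P. X 0 e1 e (delta (Iv @ P)) (L @ K)) Jv" .
  qed
  hence "comm n e (\<lambda>L Jv. rw a (Word (zip L Jv)))" for e
    by (subst comm_cong[where M' = "\<lambda>L Jv. X 0 e1 e (delta (Iv @ Jv)) (L @ K)"]) (auto simp: a r_word_X)
  thus ?thesis by (simp add: G_def)
qed

lemma G_sum: "(\<And>a. a \<in> S \<Longrightarrow> g a \<in> G) \<Longrightarrow> (\<lambda>w. \<Sum>a\<in>S. c a * g a w) \<in> G"
  unfolding G_def by (auto intro!: comm_sum comm_scale)

lemma r_left: "h \<in> carA \<Longrightarrow> (\<lambda>a. pev (\<lambda>b. rw a b) h) \<in> G"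
  unfolding pev_def by (rule G_sum) (auto intro: r_left_G)
lemma r_right: "f \<in> carA \<Longrightarrow> (\<lambda>b. pev (\<lambda>a. rw a b) f) \<in> G"
  unfolding pev_def by (rule G_sum) (auto intro: r_right_G)

lemma free_r_pev: "free_r q n f h = pev (\<lambda>a. pev (\<lambda>b. rw a b) h) f"
  by (simp add: free_r_def pev_def sum_distrib_left mult.assoc)

lemma free_r_add_left: "free_r q n (f + f') h = free_r q n f h + free_r q n f' h"
  by (simp add: free_r_pev pev_add)
lemma free_r_add_right: "free_r q n f (h + h') = free_r q n f h + free_r q n f h'"
  unfolding free_r_pev pev_swap[of _ _ f] by (simp add: pev_add)

text \<open>In either argument the form lies in \<open>G\<close>, so its value depends only on the classes.\<close>
lemma r_class: assumes "f \<in> carA" "h \<in> carA"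
  shows "aq_r q n (aq_class q n f) (aq_class q n h) = free_r q n f h"
  unfolding aq_r_def
proof (rule the_elem_pair)
  fix f' h' assume "f' \<in> aq_class q n f" "h' \<in> aq_class q n h"
  then obtain a b where ab: "a \<in> I1" "f' = a + f" "b \<in> I1" "h' = b + h" by (auto simp: class_set)
  have b: "b \<in> carA" using ab I1(1) by blast
  have "free_r q n a x = 0" if "x \<in> carA" for x
    unfolding free_r_pev by (rule I1_annihilated[OF ab(1) r_left[OF that]])
  moreover have "free_r q n x b = 0" if "x \<in> carA" for x
    unfolding free_r_pev pev_swap[of _ _ x] by (rule I1_annihilated[OF ab(3) r_right[OF that]])
  ultimately show "free_r q n f' h' = free_r q n f h"
    using assms b by (simp add: ab(2,4) free_r_add_left free_r_add_right del: mem_Collect_eq)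
qed (use I1(2) in \<open>auto simp: class_set\<close>)

end

section \<open>Sums of copies of tensor space as comodules\<close>

lemma div_mod_block: "(m::nat) < N \<Longrightarrow> (c * N + m) div N = c \<and> (c * N + m) mod N = m"
  by (cases "N = 0") simp_all

primrec dig :: "nat \<Rightarrow> nat \<Rightarrow> nat \<Rightarrow> nat list" where
  "dig n 0 x = []"
| "dig n (Suc e) x = (x div n ^ e) # dig n e (x mod n ^ e)"

primrec num :: "nat \<Rightarrow> nat list \<Rightarrow> nat" where
  "num n [] = 0"
| "num n (a # L) = a * n ^ length L + num n L"

lemma num_lt: "L \<in> idx n e \<Longrightarrow> num n L < n ^ e"
proof (induction e arbitrary: L)
  case (Suc e)
  then obtain a L' where L: "L = a # L'" "a < n" "L' \<in> idx n e" by (auto simp: idx_Suc_Cons)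
  have "num n L < a * n ^ e + n ^ e" using Suc.IH[OF L(3)] L by (simp add: idx_length)
  also have "\<dots> = (a + 1) * n ^ e" by simp
  also have "\<dots> \<le> n * n ^ e" using L by (intro mult_right_mono) auto
  finally show ?case by simp
qed (simp add: idx_0)

lemma dig_num: "L \<in> idx n e \<Longrightarrow> dig n e (num n L) = L"
proof (induction e arbitrary: L)
  case (Suc e)
  then obtain a L' where L: "L = a # L'" "a < n" "L' \<in> idx n e" by (auto simp: idx_Suc_Cons)
  have "num n L' < n ^ e" using num_lt L by blast
  thus ?case using L Suc.IH[OF L(3)] by (simp add: idx_length)
qed (simp add: idx_0)

lemma dig_idx: "x < n ^ e \<Longrightarrow> dig n e x \<in> idx n e"
proof (induction e arbitrary: x)
  case (Suc e)
  hence "n > 0" by (cases n) auto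
  thus ?case using Suc by (simp add: less_mult_imp_div_less)
qed (simp add: idx_0)

lemma num_dig: "x < n ^ e \<Longrightarrow> num n (dig n e x) = x"
proof (induction e arbitrary: x)
  case (Suc e)
  hence n: "n > 0" by (cases n) auto
  have l: "length (dig n e y) = e" for y by (induction e arbitrary: y) auto
  have "num n (dig n e (x mod n ^ e)) = x mod n ^ e" using n by (intro Suc.IH) simp
  thus ?case using div_mult_mod_eq[of x "n ^ e"] by (simp only: dig.simps num.simps l)
qed simp

text \<open>The basis vector number \<open>x\<close> of a sum of copies of \<open>V\<^sub>n\<^bsup>\<otimes>e\<^esup>\<close> has a colour, the number of the copy, and a word of
length \<open>e\<close>, its digits in base \<open>n\<close>.\<close>
definition clr :: "nat \<Rightarrow> nat \<Rightarrow> nat \<Rightarrow> nat" where "clr n e x = x div n ^ e"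
definition wrd :: "nat \<Rightarrow> nat \<Rightarrow> nat \<Rightarrow> nat list" where "wrd n e x = dig n e (x mod n ^ e)"
definition enc :: "nat \<Rightarrow> nat \<Rightarrow> nat \<Rightarrow> nat list \<Rightarrow> nat" where "enc n e c L = c * n ^ e + num n L"

lemma clr_lt: "x < r * n ^ e \<Longrightarrow> clr n e x < r"
  by (simp add: clr_def less_mult_imp_div_less)
lemma wrd_idx: "x < r * n ^ e \<Longrightarrow> wrd n e x \<in> idx n e"
  unfolding wrd_def by (rule dig_idx) (metis mod_less_divisor not_gr_zero not_less0 mult_0_right)
lemma enc_lt: "c < r \<Longrightarrow> L \<in> idx n e \<Longrightarrow> enc n e c L < r * n ^ e"
proof -
  assume "c < r" "L \<in> idx n e"
  have "enc n e c L < c * n ^ e + n ^ e" using num_lt[OF \<open>L \<in> idx n e\<close>] by (simp add: enc_def)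
  also have "\<dots> = (c + 1) * n ^ e" by simp
  also have "\<dots> \<le> r * n ^ e" using \<open>c < r\<close> by (intro mult_right_mono) auto
  finally show ?thesis .
qed
lemma clr_enc: "L \<in> idx n e \<Longrightarrow> clr n e (enc n e c L) = c"
  using div_mod_block[OF num_lt[of L n e], of c] by (simp add: clr_def enc_def)
lemma wrd_enc: "L \<in> idx n e \<Longrightarrow> wrd n e (enc n e c L) = L"
  using div_mod_block[OF num_lt[of L n e], of c] by (simp add: wrd_def enc_def dig_num)
lemma enc_dec: "x < r * n ^ e \<Longrightarrow> enc n e (clr n e x) (wrd n e x) = x"
proof -
  assume "x < r * n ^ e"
  hence "x mod n ^ e < n ^ e" by (metis mod_less_divisor not_gr_zero not_less0 mult_0_right)
  hence "num n (dig n e (x mod n ^ e)) = x mod n ^ e" by (rule num_dig)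
  thus ?thesis using div_mult_mod_eq[of x "n ^ e"] by (simp only: enc_def clr_def wrd_def)
qed

lemma dec_inj: "x < r * n ^ e \<Longrightarrow> y < r * n ^ e \<Longrightarrow> clr n e x = clr n e y \<Longrightarrow> wrd n e x = wrd n e y \<Longrightarrow> x = y"
  by (metis enc_dec)

lemma sum_dec: "(\<Sum>x<r * n ^ e. g (clr n e x) (wrd n e x)) = (\<Sum>c<r. \<Sum>L\<in>idx n e. g c L)"
proof -
  have "bij_betw (\<lambda>(c, L). enc n e c L) ({..<r} \<times> idx n e) {..<r * n ^ e}"
    by (rule bij_betwI[where g = "\<lambda>x. (clr n e x, wrd n e x)"])
       (auto simp: enc_lt clr_lt wrd_idx clr_enc wrd_enc enc_dec)
  from sum.reindex_bij_betw[OF this, of "\<lambda>x. g (clr n e x) (wrd n e x)", symmetric]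
  show ?thesis by (auto simp: sum.cartesian_product case_prod_unfold clr_enc wrd_enc intro!: sum.cong)
qed

lemma mk_comod_simps [simp]: "level (mk_comod n N a) = n" "dimn (mk_comod n N a) = N"
  "i < N \<Longrightarrow> j < N \<Longrightarrow> coef (mk_comod n N a) i j = a i j"
  by (simp_all add: mk_comod_def)

lemma mk_comod_cong: "(\<And>i j. i < N \<Longrightarrow> j < N \<Longrightarrow> a i j = b i j) \<Longrightarrow> mk_comod n N a = mk_comod n N b"
  by (auto simp: mk_comod_def fun_eq_iff)

text \<open>Representatives in the free algebra of the coefficients of a direct sum of copies of \<open>V\<^sub>n\<^bsup>\<otimes>e\<^esup>\<close>.\<close>
definition hW :: "nat \<Rightarrow> nat \<Rightarrow> nat \<Rightarrow> nat \<Rightarrow> 'k::field free" where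
  "hW n e i j = (if clr n e i = clr n e j then Poly_Mapping.single (Word (zip (wrd n e i) (wrd n e j))) 1 else 0)"

context frt begin

lemma power_mk: "comod_power q (comod_std q n) e =
   mk_comod n (n ^ e) (\<lambda>i j. aq_class q n (Poly_Mapping.single (Word (zip (dig n e i) (dig n e j))) 1))"
proof (induction e)
  case 0
  have "Poly_Mapping.single (Word []) 1 = (1 :: 'k free)" by (simp flip: zero_monom_word_def)
  thus ?case by (simp add: comod_unit_def comod_std_def class_one)
next
  case (Suc e)
  show ?case
  proof (cases "n = 0")
    case True thus ?thesis by (simp add: comod_tensor_def Suc) (simp add: comod_std_def mk_comod_def)
  next
    case False
    let ?w = "\<lambda>i j. Poly_Mapping.single (Word (zip (dig n e i) (dig n e j))) 1 :: 'k free"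
    have "coef (comod_std q n) (i div n ^ e) (j div n ^ e) \<otimes>\<^bsub>aq q n\<^esub>
        coef (comod_power q (comod_std q n) e) (i mod n ^ e) (j mod n ^ e)
      = aq_class q n (Poly_Mapping.single (Word (zip (dig n (Suc e) i) (dig n (Suc e) j))) 1)"
      if ij: "i < n * n ^ e" "j < n * n ^ e" for i j
    proof -
      have d: "i div n ^ e < n" "j div n ^ e < n" using ij by (auto simp: less_mult_imp_div_less)
      have m: "i mod n ^ e < n ^ e" "j mod n ^ e < n ^ e" using False by auto
      have "?w (i mod n ^ e) (j mod n ^ e) \<in> carA" using zip_words[OF dig_idx[OF m(1)] dig_idx[OF m(2)]] by simp
      hence "aq_gen q n (i div n ^ e) (j div n ^ e) \<otimes>\<^bsub>aq q n\<^esub> aq_class q n (?w (i mod n ^ e) (j mod n ^ e))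
         = aq_class q n (free_gen (i div n ^ e) (j div n ^ e) * ?w (i mod n ^ e) (j mod n ^ e))"
        unfolding aq_gen_def by (rule class_mult[OF carA_gen[OF d]])
      moreover have "coef (comod_std q n) (i div n ^ e) (j div n ^ e) = aq_gen q n (i div n ^ e) (j div n ^ e)"
        using d by (simp add: comod_std_def)
      moreover have "coef (comod_power q (comod_std q n) e) (i mod n ^ e) (j mod n ^ e) = aq_class q n (?w (i mod n ^ e) (j mod n ^ e))"
        unfolding Suc using m by simp
      ultimately show ?thesis by (simp add: free_gen_def mult_single plus_monom_word_def)
    qed
    moreover have l: "level (comod_std q n) = n" "dimn (comod_std q n) = n" by (simp_all add: comod_std_def)
    moreover have "dimn (comod_power q (comod_std q n) e) = n ^ e" unfolding Suc by simp
    ultimately show ?thesis unfolding comod_power.simps comod_tensor_def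
      by (simp only: power_Suc) (rule mk_comod_cong, simp)
  qed
qed

lemma W_mk: "W_pair q e n r = mk_comod n (r * n ^ e) (\<lambda>i j. aq_class q n (hW n e i j))"
proof -
  have "i mod n ^ e < n ^ e" if "i < r * n ^ e" for i
    using that by (metis mod_less_divisor not_gr_zero not_less0 mult_0_right)
  thus ?thesis unfolding W_pair_def comod_copies_def power_mk mk_comod_simps
    by (intro mk_comod_cong) (auto simp: hW_def clr_def wrd_def class_zero)
qed

lemma hW_carA: "i < r * n ^ e \<Longrightarrow> j < r * n ^ e \<Longrightarrow> hW n e i j \<in> carA"
  using zip_words[OF wrd_idx wrd_idx, of i r n e j r] by (simp add: hW_def)

lemma hW_comult: assumes i: "i < r * n ^ e" and j: "j < r * n ^ e"
  shows "free_comult n (hW n e i j :: 'k free) = (\<Sum>k<r * n ^ e. free_tensor (hW n e i k) (hW n e k j))"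
proof (rule pev_ext)
  fix g :: "monom_word \<times> monom_word \<Rightarrow> 'k"
  have l: "length (wrd n e i) = e" "length (wrd n e j) = e" using wrd_idx[OF i] wrd_idx[OF j] by (auto simp: idx_length)
  have c: "clr n e i < r" by (rule clr_lt[OF i])
  have "pev g (\<Sum>k<r * n ^ e. free_tensor (hW n e i k) (hW n e k j :: 'k free))
    = (\<Sum>k<r * n ^ e. (\<lambda>c L. if clr n e i = c \<and> c = clr n e j then g (Word (zip (wrd n e i) L), Word (zip L (wrd n e j))) else 0) (clr n e k) (wrd n e k))"
    unfolding pev_sum by (rule sum.cong) (auto simp: hW_def pev_tensor)
  also have "\<dots> = (\<Sum>c<r. \<Sum>L\<in>idx n e. if clr n e i = c \<and> c = clr n e j then g (Word (zip (wrd n e i) L), Word (zip L (wrd n e j))) else 0)"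
    by (rule sum_dec)
  also have "\<dots> = (\<Sum>c<r. if c = clr n e i then \<Sum>L\<in>idx n e. if clr n e i = clr n e j then g (Word (zip (wrd n e i) L), Word (zip L (wrd n e j))) else 0 else 0)"
    by (intro sum.cong) auto
  also have "\<dots> = pev g (free_comult n (hW n e i j :: 'k free))"
    using c l by (simp add: hW_def pev_comult pev_comult_zip)
  finally show "pev g (free_comult n (hW n e i j :: 'k free)) = pev g (\<Sum>k<r * n ^ e. free_tensor (hW n e i k) (hW n e k j))" by simp
qed

lemma hW_counit: "i < r * n ^ e \<Longrightarrow> j < r * n ^ e \<Longrightarrow> free_counit (hW n e i j :: 'k free) = of_bool (i = j)"
  using wrd_idx[of i r n e] wrd_idx[of j r n e] dec_inj[of i r n e j]
  by (auto simp: counit_eq hW_def counit_zip idx_length)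

lemma hW_degree: "i < r * n ^ e \<Longrightarrow> j < r * n ^ e \<Longrightarrow> w \<in> Poly_Mapping.keys (hW n e i j :: 'k free) \<Longrightarrow> length (letters w) = e"
  using wrd_idx[of i r n e] wrd_idx[of j r n e] by (auto simp: hW_def idx_length split: if_splits)

text \<open>With the coefficients written as monomials, the comodule axioms are the formulas for comultiplication and
counit on monomials.\<close>
lemma W_hecke: assumes "n \<ge> 1" shows "hecke_pair q e (W_pair q e n r)"
  unfolding W_mk hecke_pair_def comodule_def mk_comod_simps
proof (intro conjI allI impI)
  fix i j assume ij: "i < r * n ^ e" "j < r * n ^ e"
  show "coef (mk_comod n (r * n ^ e) (\<lambda>i j. aq_class q n (hW n e i j))) i j \<in> carrier (aq q n)"
    using ij class_carrier hW_carA by simp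
  show "aq_counit (coef (mk_comod n (r * n ^ e) (\<lambda>i j. aq_class q n (hW n e i j :: 'k free))) i j) = (of_bool (i = j) :: 'k)"
    using ij by (simp add: counit_class hW_counit)
  show "coef (mk_comod n (r * n ^ e) (\<lambda>i j. aq_class q n (hW n e i j))) i j \<in> aq_degree q n e"
    using ij hW_carA[OF ij] hW_degree[OF ij] by (auto simp: aq_degree_def free_alg_malg)
  have "finsum (aq2 q n) (\<lambda>k. aq_tensor q n (coef (mk_comod n (r * n ^ e) (\<lambda>i j. aq_class q n (hW n e i j :: 'k free))) i k)
      (coef (mk_comod n (r * n ^ e) (\<lambda>i j. aq_class q n (hW n e i j))) k j)) {..<r * n ^ e}
      = finsum (aq2 q n) (\<lambda>k. aq2_class q n (free_tensor (hW n e i k) (hW n e k j))) {..<r * n ^ e}"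
  proof -
    interpret R: ring "aq2 q n" unfolding aq2_def free_alg2_malg by (rule ideal.quotient_is_ring[OF I2_ideal])
    have "aq2_class q n (free_tensor (hW n e i k) (hW n e k j)) \<in> carrier (aq2 q n)" if "k < r * n ^ e" for k
      using carB_tensor[OF hW_carA[OF ij(1) that] hW_carA[OF that ij(2)]]
      by (auto simp: aq2_class_def aq2_def FactRing_def free_alg2_malg A_RCOSETS_def')
    thus ?thesis using ij hW_carA by (intro R.finsum_cong') (auto simp: tensor_class simp del: mem_Collect_eq)
  qed
  also have "\<dots> = aq2_class q n (\<Sum>k<r * n ^ e. free_tensor (hW n e i k) (hW n e k j))"
    using ij by (intro class2_finsum carB_tensor hW_carA) auto
  also have "\<dots> = aq_comult q n (coef (mk_comod n (r * n ^ e) (\<lambda>i j. aq_class q n (hW n e i j))) i j)"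
    using ij by (simp add: comult_class hW_comult)
  finally show "aq_comult q n (coef (mk_comod n (r * n ^ e) (\<lambda>i j. aq_class q n (hW n e i j))) i j)
    = finsum (aq2 q n) (\<lambda>k. aq_tensor q n (coef (mk_comod n (r * n ^ e) (\<lambda>i j. aq_class q n (hW n e i j :: 'k free))) i k)
      (coef (mk_comod n (r * n ^ e) (\<lambda>i j. aq_class q n (hW n e i j))) k j)) {..<r * n ^ e}" by simp
qed (use assms in \<open>auto simp: mk_comod_def\<close>)

end

section \<open>Hecke pairs as modules over the commutant\<close>

lemma sum_two:
  assumes K: "K \<in> idx N d" and i: "i + 1 < d"
  shows "(\<Sum>M\<in>idx N d. if \<forall>p<d. p \<noteq> i \<and> p \<noteq> i + 1 \<longrightarrow> K ! p = M ! p then g M else 0)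
    = (\<Sum>x<N. \<Sum>y<N. g (K[i := x, i + 1 := y]))"
proof -
  have l: "length K = d" using K by (simp add: idx_length)
  let ?S = "{M \<in> idx N d. \<forall>p<d. p \<noteq> i \<and> p \<noteq> i + 1 \<longrightarrow> K ! p = M ! p}"
  have upd: "K[i := x, i + 1 := y] \<in> idx N d" if "x < N" "y < N" for x y
    using K that by (auto simp: idx_def dest!: subsetD[OF set_update_subset_insert])
  have lt: "M ! p < N" if "M \<in> idx N d" "p < d" for M p
    using that by (auto simp: idx_def subset_iff)
  have "bij_betw (\<lambda>(x, y). K[i := x, i + 1 := y]) ({..<N} \<times> {..<N}) ?S"
  proof (rule bij_betwI[where g = "\<lambda>M. (M ! i, M ! (i + 1))"])
    show "(\<lambda>(x, y). K[i := x, i + 1 := y]) \<in> {..<N} \<times> {..<N} \<rightarrow> ?S"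
      using upd by auto
    show "(\<lambda>M. (M ! i, M ! (i + 1))) \<in> ?S \<rightarrow> {..<N} \<times> {..<N}"
      using lt i by auto
    show "(\<lambda>(x, y). K[i := x, i + 1 := y]) (M ! i, M ! (i + 1)) = M" if "M \<in> ?S" for M
    proof -
      have "K[i := M ! i, i + 1 := M ! (i + 1)] ! p = M ! p" if "p < d" for p
        using \<open>M \<in> ?S\<close> that l i by (cases "p = i"; cases "p = i + 1") (auto simp: nth_list_update)
      thus ?thesis using that l by (auto simp: idx_length intro!: nth_equalityI)
    qed
  qed (use l i in \<open>auto simp: nth_list_update\<close>)
  from sum.reindex_bij_betw[OF this, of g]
  have "(\<Sum>M\<in>?S. g M) = (\<Sum>x<N. \<Sum>y<N. g (K[i := x, i + 1 := y]))"
    by (simp add: sum.cartesian_product case_prod_unfold)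
  thus ?thesis by (simp add: sum.inter_filter)
qed

lemma sum_prod_idx: "(\<Sum>M\<in>idx N d. \<Prod>p<d. g p (M ! p)) = (\<Prod>p<d. \<Sum>x<N. (g p x :: 'k::field))"
proof (induction d arbitrary: g)
  case 0 show ?case by (simp add: idx_0)
next
  case (Suc d)
  have "(\<Sum>M\<in>idx N (Suc d). \<Prod>p<Suc d. g p (M ! p)) = (\<Sum>x<N. \<Sum>M\<in>idx N d. g 0 x * (\<Prod>p<d. g (Suc p) (M ! p)))"
    by (simp only: sum_idx_Cons prod.lessThan_Suc_shift nth_Cons_0 nth_Cons_Suc)
  also have "\<dots> = (\<Sum>x<N. g 0 x * (\<Prod>p<d. \<Sum>x<N. g (Suc p) x))"
    by (simp add: Suc.IH[of "\<lambda>p. g (Suc p)"] flip: sum_distrib_left)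
  finally show ?case by (simp only: prod.lessThan_Suc_shift sum_distrib_right)
qed

lemma pev_left_add: "pev (\<lambda>w. g w + h w) f = pev g f + pev h f"
  by (simp add: pev_def algebra_simps sum.distrib)
lemma pev_left_scale: "pev (\<lambda>w. c * g w) f = c * pev g f"
  by (simp add: pev_def sum_distrib_left algebra_simps)

lemma pev_right_scale: "pev (\<lambda>w. g w * c) f = pev g f * c"
  by (simp add: pev_def sum_distrib_right mult.assoc)

definition tp :: "nat \<Rightarrow> nat \<Rightarrow> nat \<Rightarrow> (nat \<Rightarrow> nat \<Rightarrow> 'k::field) \<Rightarrow> 'k tmat" where
  "tp d N N' a = (\<lambda>(K, L). if K \<in> idx N' d \<and> L \<in> idx N d then \<Prod>p<d. a (K ! p) (L ! p) else 0)"

lemma tp_comp: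
  assumes "dimn V = N'" and inv: "\<And>i j. i < N \<Longrightarrow> j < N \<Longrightarrow> (\<Sum>z<N'. b i z * a z j) = of_bool (i = j)" "dimn U = N"
  shows "tmat_comp d V (tp d N' N b) (tp d N N' a) = tmat_id d U"
proof (rule ext, clarify)
  fix K L
  show "tmat_comp d V (tp d N' N b) (tp d N N' a) (K, L) = tmat_id d U (K, L)"
  proof (cases "K \<in> idx N d \<and> L \<in> idx N d")
    case True
    have KL: "K ! p < N" "L ! p < N" if "p < d" for p using True that by (auto simp: idx_def subset_iff)
    have "tmat_comp d V (tp d N' N b) (tp d N N' a) (K, L) = (\<Sum>M\<in>idx N' d. \<Prod>p<d. b (K ! p) (M ! p) * a (M ! p) (L ! p))"
      using True by (simp add: tmat_comp_def tp_def assms(1) prod.distrib)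
    also have "\<dots> = (\<Prod>p<d. \<Sum>z<N'. b (K ! p) z * a z (L ! p))" by (rule sum_prod_idx)
    also have "\<dots> = (\<Prod>p<d. of_bool (K ! p = L ! p))" using KL by (intro prod.cong) (auto simp: inv)
    also have "\<dots> = of_bool (K = L)"
    proof (cases "K = L")
      case False
      then obtain p where "p < d" "K ! p \<noteq> L ! p" using True by (metis idx_length nth_equalityI)
      thus ?thesis using False by (auto intro!: prod_zero)
    qed simp
    finally show ?thesis using True inv by (simp add: tmat_id_def)
  next
    case False
    thus ?thesis using inv by (auto simp: tmat_comp_def tp_def tmat_id_def assms(1) intro!: sum.neutral)
  qed
qed

context frt begin

text \<open>The functional on words of length \<open>e\<close> with matrix \<open>M\<close>. For \<open>M\<close> in the commutant it is a functional on
\<open>A\<^sub>q(n,n)\<^sub>e\<close>, and applied to the coefficients of a comodule it gives the action of \<open>M\<close>.\<close>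
definition gw :: "nat \<Rightarrow> 'k mat \<Rightarrow> monom_word \<Rightarrow> 'k" where
  "gw e M w = (if length (letters w) = e then M (map fst (letters w)) (map snd (letters w)) else 0)"

definition homog :: "nat \<Rightarrow> 'k free \<Rightarrow> bool" where
  "homog e f \<longleftrightarrow> f \<in> carA \<and> (\<forall>w\<in>Poly_Mapping.keys f. length (letters w) = e)"

definition realizes :: "nat \<Rightarrow> 'k comod \<Rightarrow> (nat \<Rightarrow> nat \<Rightarrow> 'k free) \<Rightarrow> bool" where
  "realizes e V f \<longleftrightarrow> level V = n \<and> (\<forall>i<dimn V. \<forall>j<dimn V. homog e (f i j) \<and> coef V i j = aq_class q n (f i j))"

lemma gw_add: "gw e (\<lambda>K L. M K L + M' K L) = (\<lambda>w. gw e M w + gw e M' w)"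
  by (auto simp: gw_def)
lemma gw_scale: "gw e (\<lambda>K L. c * M K L) = (\<lambda>w. c * gw e M w)"
  by (auto simp: gw_def)

lemma gw_zip: "length K = e \<Longrightarrow> length L = e \<Longrightarrow> gw e M (Word (zip K L)) = M K L"
  by (simp add: gw_def)

lemma gw_G: assumes "comm n e M" shows "gw e M \<in> G"
proof -
  have "comm n e' (\<lambda>K L. gw e M (Word (zip K L)))" for e'
  proof (cases "e' = e")
    case True
    thus ?thesis using assms by (subst comm_cong[where M' = M]) (auto simp: gw_zip idx_length)
  next
    case False
    thus ?thesis using comm_zero by (subst comm_cong[where M' = "\<lambda>K L. 0"]) (auto simp: gw_def idx_length)
  qed
  thus ?thesis by (simp add: G_def)
qed

lemma homog_word: "homog e f \<Longrightarrow> w \<in> Poly_Mapping.keys f \<Longrightarrow> \<exists>K\<in>idx n e. \<exists>L\<in>idx n e. w = Word (zip K L)"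
  using word_zip[of w n] by (auto simp: homog_def)

lemma homog_pev: "homog e f \<Longrightarrow> (\<And>K L. K \<in> idx n e \<Longrightarrow> L \<in> idx n e \<Longrightarrow> g (Word (zip K L)) = g' (Word (zip K L))) \<Longrightarrow> pev g f = pev g' f"
  using homog_word by (intro pev_cong) metis

lemma hecke_realizes: assumes "hecke_pair q e V" "level V = n" obtains f where "realizes e V f"
proof -
  have "\<exists>f. homog e f \<and> coef V i j = aq_class q n f" if "i < dimn V" "j < dimn V" for i j
  proof -
    have "coef V i j \<in> aq_degree q n e" using assms that by (auto simp: hecke_pair_def)
    thus ?thesis by (auto simp: aq_degree_def homog_def free_alg_malg)
  qed
  then obtain f where "\<And>i j. i < dimn V \<Longrightarrow> j < dimn V \<Longrightarrow> homog e (f i j) \<and> coef V i j = aq_class q n (f i j)" by metis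
  thus ?thesis using assms(2) that[of f] by (simp add: realizes_def)
qed

lemma W_realizes: "realizes e (W_pair q e n r) (hW n e)"
  unfolding realizes_def W_mk mk_comod_simps using hW_carA hW_degree by (auto simp: homog_def)

lemma braiding_free: "realizes e V f \<Longrightarrow> i < dimn V \<Longrightarrow> k < dimn V \<Longrightarrow> l < dimn V \<Longrightarrow> j < dimn V \<Longrightarrow>
   braiding q V V l k i j = free_r q n (f k i) (f l j)"
  by (simp add: braiding_def realizes_def homog_def r_class)

lemma free_r_left: "homog e f \<Longrightarrow> free_r q n f h = pev (gw e (\<lambda>K Iv. pev (\<lambda>b. rw (Word (zip K Iv)) b) h)) f"
  unfolding free_r_pev by (rule homog_pev) (auto simp: gw_zip idx_length)
lemma free_r_right: "homog e h \<Longrightarrow> free_r q n f h = pev (gw e (\<lambda>L Jv. pev (\<lambda>a. rw a (Word (zip L Jv))) f)) h"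
  unfolding free_r_pev pev_swap[of _ _ f] by (rule homog_pev) (auto simp: gw_zip idx_length)
lemma comm_left: "h \<in> carA \<Longrightarrow> comm n e (\<lambda>K Iv. pev (\<lambda>b. rw (Word (zip K Iv)) b) h)"
  using r_left[of h] by (simp add: G_def)
lemma comm_right: "f \<in> carA \<Longrightarrow> comm n e (\<lambda>L Jv. pev (\<lambda>a. rw a (Word (zip L Jv))) f)"
  using r_right[of f] by (simp add: G_def)

text \<open>The matrix \<open>a\<close> intertwines the actions of the commutant. Comodule maps enter the argument in this form.\<close>
definition intertw :: "nat \<Rightarrow> nat \<Rightarrow> (nat \<Rightarrow> nat \<Rightarrow> 'k free) \<Rightarrow> nat \<Rightarrow> (nat \<Rightarrow> nat \<Rightarrow> 'k free) \<Rightarrow> (nat \<Rightarrow> nat \<Rightarrow> 'k) \<Rightarrow> bool" where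
  "intertw e N f N' f' a \<longleftrightarrow> (\<forall>M. comm n e M \<longrightarrow> (\<forall>x<N'. \<forall>i<N.
     (\<Sum>j<N'. pev (gw e M) (f' x j) * a j i) = (\<Sum>j<N. a x j * pev (gw e M) (f j i))))"

text \<open>With one argument fixed the r-form is a functional \<open>gw e M\<close> with \<open>M\<close> in the commutant, so \<open>a\<close> can be moved across
the form in one argument at a time.\<close>
lemma braiding_natural:
  assumes a: "intertw e N f N' f' a"
    and f: "\<And>i j. i < N \<Longrightarrow> j < N \<Longrightarrow> homog e (f i j)" and f': "\<And>i j. i < N' \<Longrightarrow> j < N' \<Longrightarrow> homog e (f' i j)"
    and k: "k < N'" and l: "l < N'" and i: "i < N" and j: "j < N"
  shows "(\<Sum>x<N'. \<Sum>y<N'. free_r q n (f' k x) (f' l y) * (a x i * a y j)) =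
         (\<Sum>x<N. \<Sum>y<N. (a k x * a l y) * free_r q n (f x i) (f y j))"
proof -
  have 1: "(\<Sum>x<N'. free_r q n (f' k x) h * a x i) = (\<Sum>x<N. a k x * free_r q n (f x i) h)" if h: "homog e h" for h
  proof -
    have "comm n e (\<lambda>K Iv. pev (\<lambda>b. rw (Word (zip K Iv)) b) h)" by (rule comm_left) (use h in \<open>simp add: homog_def\<close>)
    thus ?thesis using a k i f f' by (simp add: intertw_def free_r_left[where e = e])
  qed
  have 2: "(\<Sum>y<N'. free_r q n h (f' l y) * a y j) = (\<Sum>y<N. a l y * free_r q n h (f y j))" if h: "homog e h" for h
  proof -
    have "comm n e (\<lambda>L Jv. pev (\<lambda>a. rw a (Word (zip L Jv))) h)" by (rule comm_right) (use h in \<open>simp add: homog_def\<close>)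
    thus ?thesis using a l j f f' by (simp add: intertw_def free_r_right[where e = e])
  qed
  have "(\<Sum>x<N'. \<Sum>y<N'. free_r q n (f' k x) (f' l y) * (a x i * a y j)) = (\<Sum>y<N'. (\<Sum>x<N'. free_r q n (f' k x) (f' l y) * a x i) * a y j)"
    by (subst sum.swap) (simp add: sum_distrib_right mult.assoc)
  also have "\<dots> = (\<Sum>y<N'. (\<Sum>x<N. a k x * free_r q n (f x i) (f' l y)) * a y j)" using 1 f' l by (intro sum.cong) auto
  also have "\<dots> = (\<Sum>x<N. a k x * (\<Sum>y<N'. free_r q n (f x i) (f' l y) * a y j))"
    unfolding sum_distrib_right sum_distrib_left by (subst sum.swap) (simp add: mult.assoc)
  also have "\<dots> = (\<Sum>x<N. a k x * (\<Sum>y<N. a l y * free_r q n (f x i) (f y j)))" using 2 f i by (intro sum.cong) auto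
  finally show ?thesis by (simp add: sum_distrib_left mult.assoc)
qed

text \<open>By naturality of the braiding, the \<open>d\<close>-th tensor power of a module map commutes with the braid group.\<close>
lemma tp_braid_hom:
  assumes V: "realizes e V f" and V': "realizes e V' f'" and a: "intertw e (dimn V) f (dimn V') f' a"
  shows "tp d (dimn V) (dimn V') a \<in> braid_hom q d V V'"
proof -
  let ?N = "dimn V" and ?N' = "dimn V'"
  have tm: "tp d ?N ?N' a \<in> tmaps d V V'" by (auto simp: tmaps_def tp_def)
  have "tmat_comp d V' (braid_act q d V' i) (tp d ?N ?N' a) = tmat_comp d V (tp d ?N ?N' a) (braid_act q d V i)" if i: "i + 1 < d" for i
  proof (rule ext, clarify)
    fix K L
    show "tmat_comp d V' (braid_act q d V' i) (tp d ?N ?N' a) (K, L) = tmat_comp d V (tp d ?N ?N' a) (braid_act q d V i) (K, L)"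
    proof (cases "K \<in> idx ?N' d \<and> L \<in> idx ?N d")
      case False thus ?thesis by (auto simp: tmat_comp_def tp_def braid_act_def intro!: sum.neutral)
    next
      case True
      hence K: "K \<in> idx ?N' d" and L: "L \<in> idx ?N d" by auto
      have lt: "K ! p < ?N'" "L ! p < ?N" if "p < d" for p using True that by (auto simp: idx_def subset_iff)
      have len: "length K = d" "length L = d" using True by (auto simp: idx_length)
      define rest where "rest = (\<Prod>p\<in>{..<d} - {i, i+1}. a (K ! p) (L ! p))"
      have split: "(\<Prod>p<d. g p) = g i * g (i+1) * (\<Prod>p\<in>{..<d} - {i, i+1}. g p)" for g :: "nat \<Rightarrow> 'k"
      proof -
        have "(\<Prod>p<d. g p) = (\<Prod>p\<in>{i, i+1}. g p) * (\<Prod>p\<in>{..<d} - {i, i+1}. g p)"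
          using i by (subst prod.subset_diff[of "{i,i+1}"]) auto
        thus ?thesis by simp
      qed
      have uK: "K[i := x, i + 1 := y] \<in> idx ?N' d" if "x < ?N'" "y < ?N'" for x y
        using K that by (auto simp: idx_def dest!: subsetD[OF set_update_subset_insert])
      have uL: "L[i := x, i + 1 := y] \<in> idx ?N d" if "x < ?N" "y < ?N" for x y
        using L that by (auto simp: idx_def dest!: subsetD[OF set_update_subset_insert])
      have pK: "(\<Prod>p<d. a (K[i := x, i + 1 := y] ! p) (L ! p)) = a x (L ! i) * a y (L ! (i+1)) * rest" for x y
      proof -
        have "(\<Prod>p\<in>{..<d} - {i, i+1}. a (K[i := x, i + 1 := y] ! p) (L ! p)) = rest"
          unfolding rest_def by (rule prod.cong) auto
        thus ?thesis unfolding split using i len by (simp add: nth_list_update)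
      qed
      have pL: "(\<Prod>p<d. a (K ! p) (L[i := x, i + 1 := y] ! p)) = a (K ! i) x * a (K ! (i+1)) y * rest" for x y
      proof -
        have "(\<Prod>p\<in>{..<d} - {i, i+1}. a (K ! p) (L[i := x, i + 1 := y] ! p)) = rest"
          unfolding rest_def by (rule prod.cong) auto
        thus ?thesis unfolding split using i len by (simp add: nth_list_update)
      qed
      have "tmat_comp d V' (braid_act q d V' i) (tp d ?N ?N' a) (K, L)
        = (\<Sum>M\<in>idx ?N' d. if \<forall>p<d. p \<noteq> i \<and> p \<noteq> i + 1 \<longrightarrow> K ! p = M ! p then
             braiding q V' V' (K ! i) (K ! (i+1)) (M ! i) (M ! (i+1)) * (\<Prod>p<d. a (M ! p) (L ! p)) else 0)"
        unfolding tmat_comp_def case_prod_conv using K L by (intro sum.cong) (auto simp: braid_act_def tp_def)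
      also have "\<dots> = (\<Sum>x<?N'. \<Sum>y<?N'. free_r q n (f' (K ! (i+1)) x) (f' (K ! i) y) * (a x (L ! i) * a y (L ! (i+1)) * rest))"
        unfolding sum_two[OF K i] pK
        using i len lt by (intro sum.cong refl) (simp add: nth_list_update braiding_free[OF V'])
      also have "\<dots> = (\<Sum>x<?N'. \<Sum>y<?N'. free_r q n (f' (K ! (i+1)) x) (f' (K ! i) y) * (a x (L ! i) * a y (L ! (i+1)))) * rest"
        by (simp add: sum_distrib_right mult.assoc)
      also have "\<dots> = (\<Sum>x<?N. \<Sum>y<?N. (a (K ! (i+1)) x * a (K ! i) y) * free_r q n (f x (L ! i)) (f y (L ! (i+1)))) * rest"
        using V V' lt i by (subst braiding_natural[OF a]) (auto simp: realizes_def)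
      also have "\<dots> = (\<Sum>x<?N. \<Sum>y<?N. a (K ! i) x * a (K ! (i+1)) y * rest * free_r q n (f y (L ! i)) (f x (L ! (i+1))))"
        by (subst sum.swap) (simp add: sum_distrib_left sum_distrib_right mult_ac)
      also have "\<dots> = (\<Sum>M\<in>idx ?N d. if \<forall>p<d. p \<noteq> i \<and> p \<noteq> i + 1 \<longrightarrow> L ! p = M ! p then
             (\<Prod>p<d. a (K ! p) (M ! p)) * braiding q V V (M ! i) (M ! (i+1)) (L ! i) (L ! (i+1)) else 0)"
        unfolding sum_two[OF L i] pL
        using i len lt by (intro sum.cong refl) (simp add: nth_list_update braiding_free[OF V])
      also have "\<dots> = tmat_comp d V (tp d ?N ?N' a) (braid_act q d V i) (K, L)"
        unfolding tmat_comp_def case_prod_conv using K L by (intro sum.cong) (auto simp: braid_act_def tp_def)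
      finally show ?thesis .
    qed
  qed
  thus ?thesis using tm by (simp add: braid_hom_def)
qed

lemma tensor_finsum:
  fixes N :: nat
  assumes "\<And>k. k < N \<Longrightarrow> f k \<in> carA" "\<And>k. k < N \<Longrightarrow> h k \<in> carA"
  shows "finsum (aq2 q n) (\<lambda>k. aq_tensor q n (aq_class q n (f k)) (aq_class q n (h k))) {..<N} = aq2_class q n (\<Sum>k<N. free_tensor (f k) (h k))"
proof -
  interpret R: ring "aq2 q n" unfolding aq2_def free_alg2_malg by (rule ideal.quotient_is_ring[OF I2_ideal])
  have c: "aq2_class q n (free_tensor (f k) (h k)) \<in> carrier (aq2 q n)" if "k < N" for k
    using carB_tensor[OF assms(1)[OF that] assms(2)[OF that]]
    by (auto simp: aq2_class_def aq2_def FactRing_def free_alg2_malg A_RCOSETS_def')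
  have "finsum (aq2 q n) (\<lambda>k. aq_tensor q n (aq_class q n (f k)) (aq_class q n (h k))) {..<N}
     = finsum (aq2 q n) (\<lambda>k. aq2_class q n (free_tensor (f k) (h k))) {..<N}"
    using c assms by (intro R.finsum_cong') (auto simp: tensor_class simp del: mem_Collect_eq)
  also have "\<dots> = aq2_class q n (\<Sum>k<N. free_tensor (f k) (h k))"
    by (intro class2_finsum carB_tensor assms) auto
  finally show ?thesis .
qed

text \<open>Coassociativity of the comodule turns into multiplicativity of the action. The functional that
pairs \<open>M\<close> with the first and \<open>M'\<close> with the second factor of \<open>A \<otimes> A\<close> lies in \<open>G2\<close>, and after the
comultiplication it pairs with the product of the two matrices.\<close>
lemma rho_comult:
  assumes U: "hecke_pair q e U" and f: "realizes e U f" and ij: "i < dimn U" "j < dimn U"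
    and M: "comm n e M" "comm n e M'"
  shows "pev (gw e (mm n e M M')) (f i j) = (\<Sum>k<dimn U. pev (gw e M) (f i k) * pev (gw e M') (f k j))"
proof -
  have car: "f i j \<in> carA" if "i < dimn U" "j < dimn U" for i j using f that by (simp add: realizes_def homog_def)
  have lv: "level U = n" using f by (simp add: realizes_def)
  have cf: "coef U i j = aq_class q n (f i j)" if "i < dimn U" "j < dimn U" for i j using f that by (simp add: realizes_def)
  have "aq_comult q n (coef U i j) = finsum (aq2 q n) (\<lambda>k. aq_tensor q n (coef U i k) (coef U k j)) {..<dimn U}"
    using U ij lv by (simp add: hecke_pair_def comodule_def)
  also have "\<dots> = finsum (aq2 q n) (\<lambda>k. aq_tensor q n (aq_class q n (f i k)) (aq_class q n (f k j))) {..<dimn U}"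
  proof -
    interpret R: ring "aq2 q n" unfolding aq2_def free_alg2_malg by (rule ideal.quotient_is_ring[OF I2_ideal])
    have c: "aq2_class q n (free_tensor (f i k) (f k j)) \<in> carrier (aq2 q n)" if "k < dimn U" for k
      using carB_tensor[OF car[OF ij(1) that] car[OF that ij(2)]]
      by (auto simp: aq2_class_def aq2_def FactRing_def free_alg2_malg A_RCOSETS_def')
    show ?thesis using c ij car by (intro R.finsum_cong') (auto simp: tensor_class cf simp del: mem_Collect_eq)
  qed
  also have "\<dots> = aq2_class q n (\<Sum>k<dimn U. free_tensor (f i k) (f k j))" by (rule tensor_finsum) (use car ij in auto)
  finally have inI: "free_comult n (f i j) - (\<Sum>k<dimn U. free_tensor (f i k) (f k j)) \<in> I2"
    using ij by (simp add: cf comult_class class2_eq)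
  define g where "g = (\<lambda>(u, v). gw e M u * gw e M' v)"
  have gG: "g \<in> G2"
  proof -
    have s: "(\<lambda>u. c * h u) \<in> G" if "h \<in> G" for c h
      using that comm_scale by (auto simp: G_def)
    have "(\<lambda>u. gw e M u * c) \<in> G" for c using s[OF gw_G[OF M(1)], of c] by (simp add: mult.commute)
    thus ?thesis using s[OF gw_G[OF M(2)]] by (simp add: G2_def g_def)
  qed
  have "pev g (free_comult n (f i j)) = pev g (\<Sum>k<dimn U. free_tensor (f i k) (f k j))"
    using I2_annihilated[OF inI gG] by (simp add: pev_diff)
  moreover have "pev g (free_comult n (f i j)) = pev (gw e (mm n e M M')) (f i j)"
    unfolding pev_comult
  proof (rule homog_pev)
    show "homog e (f i j)" using f ij by (simp add: realizes_def)
    fix K L assume K: "K \<in> idx n e" and L: "L \<in> idx n e"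
    hence l: "length K = e" "length L = e" by (auto simp: idx_length)
    have "pev g (free_comult_word n (Word (zip K L))) = (\<Sum>P\<in>idx n e. g (Word (zip K P), Word (zip P L)))"
      using pev_comult_zip[of K L g n] l by simp
    also have "\<dots> = mm n e M M' K L" unfolding mm_def g_def using l by (intro sum.cong) (auto simp: gw_zip idx_length)
    finally show "pev g (free_comult_word n (Word (zip K L))) = gw e (mm n e M M') (Word (zip K L))" using l by (simp add: gw_zip)
  qed
  moreover have "pev g (free_tensor x y) = pev (gw e M) x * pev (gw e M') y" for x y
    unfolding pev_tensor g_def case_prod_conv pev_left_scale pev_right_scale ..
  ultimately show ?thesis by (simp add: pev_sum)
qed

lemma rho_counit:
  assumes U: "hecke_pair q e U" and f: "realizes e U f" and ij: "i < dimn U" "j < dimn U"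
  shows "pev (gw e (\<lambda>K L. of_bool (K = L))) (f i j) = of_bool (i = j)"
proof -
  have "aq_counit (coef U i j) = (of_bool (i = j) :: 'k)" using U ij by (simp add: hecke_pair_def comodule_def)
  hence "free_counit (f i j) = of_bool (i = j)" using f ij by (simp add: realizes_def counit_class)
  thus ?thesis unfolding counit_eq using f ij
    by (subst homog_pev[of e _ _ "\<lambda>w. counit_word (letters w)"]) (auto simp: realizes_def gw_zip counit_zip idx_length)
qed

end

context generic_hecke begin

text \<open>A comodule with coefficients in degree \<open>e\<close> is a module over the commutant, hence a summand of a multiple of tensor
space by \<open>module_summand\<close>; the \<open>d\<close>-th tensor powers of inclusion and projection are morphisms of the category.\<close>
lemma hecke_pair_retract:
  assumes U: "hecke_pair q e U" and n: "n = level U"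
  obtains r a b where "a \<in> braid_hom q d U (W_pair q e n r)" "b \<in> braid_hom q d (W_pair q e n r) U"
    "tmat_comp d (W_pair q e n r) b a = tmat_id d U"
proof -
  interpret f: frt q n ..
  obtain f where f: "f.realizes e U f" by (rule f.hecke_realizes[OF U n[symmetric]])
  have hf: "f.homog e (f i j)" if "i < dimn U" "j < dimn U" for i j using f that by (simp add: f.realizes_def)
  define \<rho> where "\<rho> M i j = pev (f.gw e M) (f i j)" for M i j
  interpret m: comm_module q n e "dimn U" \<rho>
  proof unfold_locales
    fix M M' :: "'k mat" and i j assume ij: "i < dimn U" "j < dimn U"
    show "\<rho> M i j = \<rho> M' i j" if "\<And>K L. K \<in> idx n e \<Longrightarrow> L \<in> idx n e \<Longrightarrow> M K L = M' K L"
      unfolding \<rho>_def using that by (intro f.homog_pev[OF hf[OF ij]]) (simp add: f.gw_zip idx_length)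
    show "\<rho> (\<lambda>K L. M K L + M' K L) i j = \<rho> M i j + \<rho> M' i j"
      by (simp add: \<rho>_def f.gw_add pev_left_add)
    show "\<rho> (\<lambda>K L. c * M K L) i j = c * \<rho> M i j" for c
      by (simp add: \<rho>_def f.gw_scale pev_left_scale)
    show "\<rho> (mm n e M M') i j = (\<Sum>k<dimn U. \<rho> M i k * \<rho> M' k j)" if "comm n e M" "comm n e M'"
      unfolding \<rho>_def by (rule f.rho_comult[OF U f ij that])
    show "\<rho> (\<lambda>K L. of_bool (K = L)) i j = of_bool (i = j)"
      unfolding \<rho>_def by (rule f.rho_counit[OF U f ij])
  qed
  obtain a b where ab: "\<And>i j. i < dimn U \<Longrightarrow> j < dimn U \<Longrightarrow> (\<Sum>z\<in>idx n e \<times> m.Q. b i z * a z j) = of_bool (i = j)"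
    "\<And>M K p j. comm n e M \<Longrightarrow> K \<in> idx n e \<Longrightarrow> p \<in> m.Q \<Longrightarrow> j < dimn U \<Longrightarrow>
       (\<Sum>L\<in>idx n e. M K L * a (L, p) j) = (\<Sum>i<dimn U. a (K, p) i * \<rho> M i j)"
    "\<And>M L p i. comm n e M \<Longrightarrow> L \<in> idx n e \<Longrightarrow> p \<in> m.Q \<Longrightarrow> i < dimn U \<Longrightarrow>
       (\<Sum>j<dimn U. \<rho> M i j * b j (L, p)) = (\<Sum>K\<in>idx n e. b i (K, p) * M K L)"
  proof (rule m.module_summand, goal_cases)
    case (1 a b) show ?case by (rule 1(1)[OF 1(2-4)])
  qed
  define r where "r = card m.Q"
  obtain h where h: "bij_betw h {..<r} m.Q" using ex_bij_betw_nat_finite[OF m.finite_Q] by (auto simp: r_def atLeast0LessThan)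
  have hQ: "h c \<in> m.Q" if "c < r" for c using h that by (auto simp: bij_betw_def)
  let ?W = "W_pair q e n r"
  have dW: "dimn ?W = r * n ^ e" by (simp add: f.W_mk)
  define a' where "a' z i = a (wrd n e z, h (clr n e z)) i" for z i
  define b' where "b' i z = b i (wrd n e z, h (clr n e z))" for i z
  have gwW: "pev (f.gw e M) (hW n e z z') = (if clr n e z = clr n e z' then M (wrd n e z) (wrd n e z') else 0)"
    if "z < r * n ^ e" "z' < r * n ^ e" for M z z'
    using wrd_idx[OF that(1)] wrd_idx[OF that(2)] by (simp add: hW_def f.gw_zip idx_length)
  have ia: "f.intertw e (dimn U) f (r * n ^ e) (hW n e) a'"
    unfolding f.intertw_def
  proof (intro allI impI)
    fix M x i assume M: "comm n e M" and x: "x < r * n ^ e" and i: "i < dimn U"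
    have c: "clr n e x < r" by (rule clr_lt[OF x])
    have "(\<Sum>j<r * n ^ e. pev (f.gw e M) (hW n e x j) * a' j i) =
      (\<Sum>j<r * n ^ e. (\<lambda>c L. (if clr n e x = c then M (wrd n e x) L else 0) * a (L, h c) i) (clr n e j) (wrd n e j))"
      using gwW x by (intro sum.cong) (auto simp: a'_def)
    also have "\<dots> = (\<Sum>c<r. \<Sum>L\<in>idx n e. (if clr n e x = c then M (wrd n e x) L else 0) * a (L, h c) i)" by (rule sum_dec)
    also have "\<dots> = (\<Sum>c<r. if c = clr n e x then \<Sum>L\<in>idx n e. M (wrd n e x) L * a (L, h c) i else 0)"
      by (intro sum.cong) auto
    also have "\<dots> = (\<Sum>L\<in>idx n e. M (wrd n e x) L * a (L, h (clr n e x)) i)" using c by simp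
    also have "\<dots> = (\<Sum>j<dimn U. a' x j * \<rho> M j i)" unfolding a'_def by (rule ab(2)[OF M wrd_idx[OF x] hQ[OF c] i])
    finally show "(\<Sum>j<r * n ^ e. pev (f.gw e M) (hW n e x j) * a' j i) = (\<Sum>j<dimn U. a' x j * pev (f.gw e M) (f j i))"
      by (simp add: \<rho>_def)
  qed
  have ib: "f.intertw e (r * n ^ e) (hW n e) (dimn U) f b'"
    unfolding f.intertw_def
  proof (intro allI impI)
    fix M x i assume M: "comm n e M" and x: "x < dimn U" and i: "i < r * n ^ e"
    have c: "clr n e i < r" by (rule clr_lt[OF i])
    have "(\<Sum>j<r * n ^ e. b' x j * pev (f.gw e M) (hW n e j i)) =
      (\<Sum>j<r * n ^ e. (\<lambda>c L. b x (L, h c) * (if c = clr n e i then M L (wrd n e i) else 0)) (clr n e j) (wrd n e j))"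
      using gwW i by (intro sum.cong) (auto simp: b'_def)
    also have "\<dots> = (\<Sum>c<r. \<Sum>L\<in>idx n e. b x (L, h c) * (if c = clr n e i then M L (wrd n e i) else 0))" by (rule sum_dec)
    also have "\<dots> = (\<Sum>c<r. if c = clr n e i then \<Sum>L\<in>idx n e. b x (L, h c) * M L (wrd n e i) else 0)"
      by (intro sum.cong) auto
    also have "\<dots> = (\<Sum>L\<in>idx n e. b x (L, h (clr n e i)) * M L (wrd n e i))" using c by simp
    also have "\<dots> = (\<Sum>j<dimn U. \<rho> M x j * b' j i)" unfolding b'_def by (rule ab(3)[OF M wrd_idx[OF i] hQ[OF c] x, symmetric])
    finally show "(\<Sum>j<dimn U. pev (f.gw e M) (f x j) * b' j i) = (\<Sum>j<r * n ^ e. b' x j * pev (f.gw e M) (hW n e j i))"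
      by (simp add: \<rho>_def)
  qed
  have inv: "(\<Sum>z<r * n ^ e. b' i z * a' z j) = of_bool (i = j)" if ij: "i < dimn U" "j < dimn U" for i j
  proof -
    have "(\<Sum>z<r * n ^ e. b' i z * a' z j) = (\<Sum>c<r. \<Sum>L\<in>idx n e. b i (L, h c) * a (L, h c) j)"
      unfolding a'_def b'_def using sum_dec[where g = "\<lambda>c L. b i (L, h c) * a (L, h c) j"] by simp
    also have "\<dots> = (\<Sum>p\<in>m.Q. \<Sum>L\<in>idx n e. b i (L, p) * a (L, p) j)"
      by (rule sum.reindex_bij_betw[OF h])
    also have "\<dots> = (\<Sum>z\<in>idx n e \<times> m.Q. b i z * a z j)" by (subst sum.swap) (simp add: sum.cartesian_product)
    finally show ?thesis using ab(1)[OF ij] by simp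
  qed
  show ?thesis
  proof (rule that)
    show "tp d (dimn U) (r * n ^ e) a' \<in> braid_hom q d U ?W"
      using f.tp_braid_hom[OF f f.W_realizes[of e r], where a = a' and d = d] ia by (simp add: dW)
    show "tp d (r * n ^ e) (dimn U) b' \<in> braid_hom q d ?W U"
      using f.tp_braid_hom[OF f.W_realizes[of e r] f, where a = b' and d = d] ib by (simp add: dW)
    show "tmat_comp d ?W (tp d (r * n ^ e) (dimn U) b') (tp d (dimn U) (r * n ^ e) a') = tmat_id d U"
      by (rule tp_comp[OF dW inv refl])
  qed
qed

end

section \<open>Changing colours and letters\<close>

definition ctn :: "nat \<Rightarrow> nat \<Rightarrow> nat list \<Rightarrow> nat set" where
  "ctn n e L = (\<Union>x\<in>set L. set (wrd n e x))"

text \<open>A basis vector of the \<open>d\<close>-th tensor power with exactly the colours \<open>cs\<close> and exactly the letters \<open>ls\<close>. \<open>rth\<close> changes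
the colours by \<open>\<gamma>\<close> and the letters by \<open>\<sigma>\<close>, and \<open>rmat\<close> is the matrix that does this on the
basis vectors with the given content and kills all the others.\<close>
definition cond :: "nat \<Rightarrow> nat \<Rightarrow> nat \<Rightarrow> nat \<Rightarrow> nat set \<Rightarrow> nat set \<Rightarrow> nat list \<Rightarrow> bool" where
  "cond n e r d cs ls L \<longleftrightarrow> L \<in> idx (r * n ^ e) d \<and> clr n e ` set L = cs \<and> ctn n e L = ls"

definition rth :: "nat \<Rightarrow> nat \<Rightarrow> nat \<Rightarrow> (nat \<Rightarrow> nat) \<Rightarrow> (nat \<Rightarrow> nat) \<Rightarrow> nat \<Rightarrow> nat" where
  "rth n m e \<gamma> \<sigma> x = enc m e (\<gamma> (clr n e x)) (map \<sigma> (wrd n e x))"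

definition rmat :: "nat \<Rightarrow> nat \<Rightarrow> nat \<Rightarrow> nat \<Rightarrow> nat \<Rightarrow> nat set \<Rightarrow> nat set \<Rightarrow> (nat \<Rightarrow> nat) \<Rightarrow> (nat \<Rightarrow> nat) \<Rightarrow> 'k::field tmat" where
  "rmat n m e r d cs ls \<gamma> \<sigma> = (\<lambda>(K, L). of_bool (cond n e r d cs ls L \<and> K = map (rth n m e \<gamma> \<sigma>) L))"

context hecke begin

lemma X_wtv: "wtv \<mu> x \<Longrightarrow> wtv \<mu> (X p e1 e2 x)"
  by (induction e1 arbitrary: p) (auto intro: C_wtv)

lemma X_delta_mset: "X p e1 e2 (delta L) K \<noteq> 0 \<Longrightarrow> mset K = mset L"
  using X_wtv[of "mset L" "delta L" p e1 e2] by (auto simp: wtv_def delta_def)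

lemma T_map:
  assumes \<sigma>: "strict_mono_on S \<sigma>" and P: "set P \<subseteq> S" and y: "\<And>R. mset R = mset P \<Longrightarrow> y (map \<sigma> R) = y' R"
  shows "T i y (map \<sigma> P) = T i y' P"
proof (cases "i + 1 < length P")
  case True
  have i: "P ! i \<in> S" "P ! Suc i \<in> S" using P True by auto
  have "Rdiag q (\<sigma> (P ! i)) (\<sigma> (P ! Suc i)) = Rdiag q (P ! i) (P ! Suc i)"
    "Roff (\<sigma> (P ! i)) (\<sigma> (P ! Suc i)) = (Roff (P ! i) (P ! Suc i) :: 'k)"
    using strict_mono_onD[OF \<sigma> i] strict_mono_onD[OF \<sigma> i(2,1)]
    by (cases "P ! i" "P ! Suc i" rule: linorder_cases; force simp: Rdiag_def Roff_def)+
  moreover have "swp i (map \<sigma> P) = map \<sigma> (swp i P)" using True by (simp add: swp_def map_update)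
  ultimately show ?thesis using True y[of P] y[of "swp i P"] mset_swp[OF True] by (simp add: T_def)
qed (simp add: T_def)

lemma C_map:
  assumes \<sigma>: "strict_mono_on S \<sigma>"
  shows "set P \<subseteq> S \<Longrightarrow> (\<And>R. mset R = mset P \<Longrightarrow> y (map \<sigma> R) = y' R) \<Longrightarrow> C p s y (map \<sigma> P) = C p s y' P"
proof (induction s arbitrary: P)
  case (Suc s)
  have "C p s y (map \<sigma> R) = C p s y' R" if "mset R = mset P" for R
    by (rule Suc.IH) (use that Suc.prems mset_eq_setD[OF that] in auto)
  thus ?case using T_map[OF \<sigma> Suc.prems(1), of "C p s y" "C p s y'" "p + s"] by simp
qed simp

lemma X_map:
  assumes \<sigma>: "strict_mono_on S \<sigma>"
  shows "set P \<subseteq> S \<Longrightarrow> (\<And>R. mset R = mset P \<Longrightarrow> y (map \<sigma> R) = y' R) \<Longrightarrow> X p e1 e2 y (map \<sigma> P) = X p e1 e2 y' P"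
proof (induction e1 arbitrary: P p)
  case (Suc e1)
  have "X (Suc p) e1 e2 y (map \<sigma> R) = X (Suc p) e1 e2 y' R" if "mset R = mset P" for R
    by (rule Suc.IH) (use that Suc.prems mset_eq_setD[OF that] in auto)
  thus ?case using C_map[OF \<sigma> Suc.prems(1), of "X (Suc p) e1 e2 y" "X (Suc p) e1 e2 y'" p e2] by simp
qed simp

text \<open>The entries of \<open>R\<^sub>n\<close> depend only on the order of the indices, so an order preserving change of letters commutes with
every braid.\<close>
lemma X_delta_map:
  assumes \<sigma>: "strict_mono_on S \<sigma>" and P: "set P \<subseteq> S" and Q: "set Q \<subseteq> S"
  shows "X p e1 e2 (delta (map \<sigma> Q)) (map \<sigma> P) = X p e1 e2 (delta Q) P"
proof (rule X_map[OF \<sigma> P])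
  fix R assume "mset R = mset P"
  hence R: "set R \<subseteq> S" using P mset_eq_setD by blast
  have "inj_on \<sigma> (set R \<union> set Q)" using strict_mono_on_imp_inj_on[OF \<sigma>] R Q by (meson Un_least inj_on_subset)
  hence "map \<sigma> R = map \<sigma> Q \<longleftrightarrow> R = Q" by (rule inj_on_map_eq_map)
  thus "delta (map \<sigma> Q) (map \<sigma> R) = delta Q R" by (simp add: delta_def)
qed

lemma W_dim: "dimn (W_pair q e n r) = r * n ^ e"
proof -
  interpret f: frt q n ..
  show ?thesis by (simp add: f.W_mk)
qed

lemma W_braiding:
  assumes "i < r * n ^ e" "j < r * n ^ e" "k < r * n ^ e" "l < r * n ^ e"
  shows "braiding q (W_pair q e n r) (W_pair q e n r) l k i j =
    (if clr n e k = clr n e i \<and> clr n e l = clr n e j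
     then X 0 e e (delta (wrd n e i @ wrd n e j)) (wrd n e l @ wrd n e k) else 0)"
proof -
  interpret f: frt q n ..
  have "braiding q (W_pair q e n r) (W_pair q e n r) l k i j = free_r q n (hW n e k i) (hW n e l j)"
    using assms by (intro f.braiding_free[OF f.W_realizes]) (simp_all add: W_dim)
  thus ?thesis using r_word_X[OF wrd_idx[OF assms(3)] wrd_idx[OF assms(1)] wrd_idx[OF assms(4)] wrd_idx[OF assms(2)]]
    by (simp add: f.free_r_pev hW_def)
qed

text \<open>The braid generators permute the colours, and the entries of the braiding preserve the multiset of letters; so the
sets of colours and letters are invariant.\<close>
lemma W_act_content:
  assumes nz: "braid_act q d (W_pair q e n r) i (K, L) \<noteq> 0" and i: "i + 1 < d"
  shows "cond n e r d cs ls K \<longleftrightarrow> cond n e r d cs ls L"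
proof -
  have KL: "K \<in> idx (r * n ^ e) d" "L \<in> idx (r * n ^ e) d" and off: "\<And>p. p < d \<Longrightarrow> p \<noteq> i \<Longrightarrow> p \<noteq> i + 1 \<Longrightarrow> K ! p = L ! p"
    and b: "braiding q (W_pair q e n r) (W_pair q e n r) (K ! i) (K ! (i+1)) (L ! i) (L ! (i+1)) \<noteq> 0"
    using nz by (auto simp: braid_act_def W_dim split: if_splits)
  have lt: "K ! p < r * n ^ e" "L ! p < r * n ^ e" if "p < d" for p using KL that by (auto simp: idx_def subset_iff)
  have c: "clr n e (K ! (i+1)) = clr n e (L ! i)" "clr n e (K ! i) = clr n e (L ! (i+1))"
    and x: "X 0 e e (delta (wrd n e (L ! i) @ wrd n e (L ! (i+1)))) (wrd n e (K ! i) @ wrd n e (K ! (i+1))) \<noteq> 0"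
    using b i lt by (auto simp: W_braiding split: if_splits)
  have m: "set (wrd n e (K ! i)) \<union> set (wrd n e (K ! (i+1))) = set (wrd n e (L ! i)) \<union> set (wrd n e (L ! (i+1)))"
    using mset_eq_setD[OF X_delta_mset[OF x]] by simp
  have s: "set M = {M ! i, M ! (i+1)} \<union> (\<lambda>p. M ! p) ` ({..<d} - {i, i+1})" if "M \<in> idx (r * n ^ e) d" for M
  proof -
    have "set M = (\<lambda>p. M ! p) ` {..<d}" using that by (auto simp: idx_length set_conv_nth)
    also have "\<dots> = (\<lambda>p. M ! p) ` ({i, i+1} \<union> ({..<d} - {i, i+1}))" using i by (intro arg_cong[where f = "image _"]) auto
    finally show ?thesis by (simp only: image_Un image_insert image_empty)
  qed
  have o: "(\<lambda>p. K ! p) ` ({..<d} - {i, i+1}) = (\<lambda>p. L ! p) ` ({..<d} - {i, i+1})"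
    using off by (intro image_cong) auto
  have "clr n e ` set K = clr n e ` set L" unfolding s[OF KL(1)] s[OF KL(2)] o image_Un using c by auto
  moreover have "ctn n e K = ctn n e L" unfolding ctn_def s[OF KL(1)] s[OF KL(2)] o UN_Un using m by auto
  ultimately show ?thesis using KL by (simp add: cond_def)
qed

end

text \<open>A change of colours and letters, injective on the given content, with its inverse. Only letters need to keep their
order: colours are merely permuted by the braiding.\<close>
locale relabel = hecke q for q :: "'k::field" +
  fixes n m e r r' d :: nat and cs ls :: "nat set" and \<gamma> \<sigma> \<gamma>' \<sigma>' :: "nat \<Rightarrow> nat"
  assumes cs: "cs \<subseteq> {..<r}" and ls: "ls \<subseteq> {..<n}" and \<gamma>: "\<gamma> ` cs \<subseteq> {..<r'}" and \<sigma>: "\<sigma> ` ls \<subseteq> {..<m}"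
    and \<gamma>': "\<And>c. c \<in> cs \<Longrightarrow> \<gamma>' (\<gamma> c) = c" and \<sigma>': "\<And>x. x \<in> ls \<Longrightarrow> \<sigma>' (\<sigma> x) = x" and mono: "strict_mono_on ls \<sigma>"
begin

abbreviation "ok x \<equiv> x < r * n ^ e \<and> clr n e x \<in> cs \<and> set (wrd n e x) \<subseteq> ls"
abbreviation "\<theta> \<equiv> rth n m e \<gamma> \<sigma>"
abbreviation "\<theta>' \<equiv> rth m n e \<gamma>' \<sigma>'"

lemma swapped: "relabel q m n r' r (\<gamma> ` cs) (\<sigma> ` ls) \<gamma>' \<sigma>' \<gamma> \<sigma>"
proof unfold_locales
  show "strict_mono_on (\<sigma> ` ls) \<sigma>'"
  proof (rule strict_mono_onI)
    fix a b assume "a \<in> \<sigma> ` ls" "b \<in> \<sigma> ` ls" "a < b"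
    then obtain x y where xy: "x \<in> ls" "y \<in> ls" "a = \<sigma> x" "b = \<sigma> y" "\<sigma> x < \<sigma> y" by auto
    have "x < y" using xy strict_mono_onD[OF mono, of y x] by (cases x y rule: linorder_cases) auto
    thus "\<sigma>' a < \<sigma>' b" using xy \<sigma>' by simp
  qed
qed (use cs ls \<gamma> \<sigma> \<gamma>' \<sigma>' in auto)

lemma ok_image:
  assumes "ok x"
  shows "map \<sigma> (wrd n e x) \<in> idx m e" "\<theta> x < r' * m ^ e" "clr m e (\<theta> x) = \<gamma> (clr n e x)" "wrd m e (\<theta> x) = map \<sigma> (wrd n e x)"
    "\<theta>' (\<theta> x) = x"
proof -
  have l: "length (wrd n e x) = e" using assms wrd_idx idx_length by blast
  show w: "map \<sigma> (wrd n e x) \<in> idx m e" using assms \<sigma> l by (auto simp: idx_def)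
  show "\<theta> x < r' * m ^ e" unfolding rth_def using assms \<gamma> by (intro enc_lt w) auto
  show c: "clr m e (\<theta> x) = \<gamma> (clr n e x)" unfolding rth_def by (rule clr_enc[OF w])
  show d: "wrd m e (\<theta> x) = map \<sigma> (wrd n e x)" unfolding rth_def by (rule wrd_enc[OF w])
  have "map \<sigma>' (map \<sigma> (wrd n e x)) = wrd n e x" using assms \<sigma>' by (auto intro!: map_idI)
  thus "\<theta>' (\<theta> x) = x" unfolding rth_def[of m n] c d using assms \<gamma>' enc_dec[of x r n e] by simp
qed

lemma cond_ok: "cond n e r d cs ls L \<Longrightarrow> x \<in> set L \<Longrightarrow> ok x"
  by (auto simp: cond_def ctn_def idx_def)

lemma cond_image:
  assumes L: "cond n e r d cs ls L"
  shows "cond m e r' d (\<gamma> ` cs) (\<sigma> ` ls) (map \<theta> L)" "map \<theta>' (map \<theta> L) = L"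
proof -
  note ok = ok_image[OF cond_ok[OF L]]
  have "map \<theta> L \<in> idx (r' * m ^ e) d" using L ok(2) by (auto simp: cond_def idx_def)
  moreover have "clr m e ` set (map \<theta> L) = \<gamma> ` cs"
  proof -
    have "clr m e ` set (map \<theta> L) = (\<lambda>x. \<gamma> (clr n e x)) ` set L" unfolding set_map image_image using ok(3) by (intro image_cong) auto
    thus ?thesis using L by (simp add: cond_def image_image[symmetric])
  qed
  moreover have "ctn m e (map \<theta> L) = \<sigma> ` ls"
  proof -
    have "ctn m e (map \<theta> L) = (\<Union>x\<in>set L. \<sigma> ` set (wrd n e x))" unfolding ctn_def set_map
      using ok(4) by auto
    thus ?thesis using L by (simp add: cond_def ctn_def image_UN[symmetric])
  qed
  ultimately show "cond m e r' d (\<gamma> ` cs) (\<sigma> ` ls) (map \<theta> L)" by (simp add: cond_def)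
  show "map \<theta>' (map \<theta> L) = L" using ok(5) by (auto intro!: map_idI)
qed

lemma act_image:
  assumes K: "cond n e r d cs ls K" and L: "cond n e r d cs ls L" and i: "i + 1 < d"
  shows "braid_act q d (W_pair q e m r') i (map \<theta> K, map \<theta> L) = braid_act q d (W_pair q e n r) i (K, L)"
proof -
  have KL: "K \<in> idx (r * n ^ e) d" "L \<in> idx (r * n ^ e) d" using K L by (auto simp: cond_def)
  have len: "length K = d" "length L = d" using KL by (auto simp: idx_length)
  have KL': "map \<theta> K \<in> idx (r' * m ^ e) d" "map \<theta> L \<in> idx (r' * m ^ e) d"
    using cond_image(1)[OF K] cond_image(1)[OF L] by (auto simp: cond_def)
  have ok: "ok (K ! p)" "ok (L ! p)" if "p < d" for p using cond_ok[OF K] cond_ok[OF L] len that by auto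
  have inj: "\<theta> x = \<theta> y \<longleftrightarrow> x = y" if "ok x" "ok y" for x y using ok_image(5)[OF that(1)] ok_image(5)[OF that(2)] by metis
  have off: "(\<forall>p<d. p \<noteq> i \<and> p \<noteq> i + 1 \<longrightarrow> map \<theta> K ! p = map \<theta> L ! p) \<longleftrightarrow> (\<forall>p<d. p \<noteq> i \<and> p \<noteq> i + 1 \<longrightarrow> K ! p = L ! p)"
    using inj ok len by auto
  have \<gamma>i: "\<gamma> c = \<gamma> c' \<longleftrightarrow> c = c'" if "c \<in> cs" "c' \<in> cs" for c c' using \<gamma>' that by metis
  have "braiding q (W_pair q e m r') (W_pair q e m r') (\<theta> k) (\<theta> l) (\<theta> x) (\<theta> y) = braiding q (W_pair q e n r) (W_pair q e n r) k l x y"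
    if o: "ok k" "ok l" "ok x" "ok y" for k l x y
  proof -
    note o' = ok_image[OF o(1)] ok_image[OF o(2)] ok_image[OF o(3)] ok_image[OF o(4)]
    have "X 0 e e (delta (map \<sigma> (wrd n e x @ wrd n e y))) (map \<sigma> (wrd n e k @ wrd n e l)) = X 0 e e (delta (wrd n e x @ wrd n e y)) (wrd n e k @ wrd n e l)"
      by (rule X_delta_map[OF mono]) (use o in auto)
    thus ?thesis using o o' by (simp add: W_braiding \<gamma>i)
  qed
  hence "braiding q (W_pair q e m r') (W_pair q e m r') (map \<theta> K ! i) (map \<theta> K ! (i+1)) (map \<theta> L ! i) (map \<theta> L ! (i+1))
    = braiding q (W_pair q e n r) (W_pair q e n r) (K ! i) (K ! (i+1)) (L ! i) (L ! (i+1))"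
    using ok i len by simp
  thus ?thesis unfolding braid_act_def W_dim case_prod_conv off using KL KL' by (simp only: simp_thms)
qed

text \<open>The projection to a given content commutes with the braid group by \<open>W_act_content\<close>, and relabelling does so by
\<open>act_image\<close>.\<close>
lemma rmat_hom: "rmat n m e r d cs ls \<gamma> \<sigma> \<in> braid_hom q d (W_pair q e n r) (W_pair q e m r')"
proof -
  interpret s: relabel q m n e r' r d "\<gamma> ` cs" "\<sigma> ` ls" \<gamma>' \<sigma>' \<gamma> \<sigma> by (rule swapped)
  let ?V = "W_pair q e n r" and ?W = "W_pair q e m r'"
  let ?g = "rmat n m e r d cs ls \<gamma> \<sigma> :: 'k tmat"
  have bk: "\<gamma>' ` \<gamma> ` cs = cs" "\<sigma>' ` \<sigma> ` ls = ls" using \<gamma>' \<sigma>' by (auto simp: image_image)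
  have "?g \<in> tmaps d ?V ?W"
    using cond_image(1) by (auto simp: tmaps_def rmat_def W_dim cond_def)
  moreover have "tmat_comp d ?W (braid_act q d ?W i) ?g = tmat_comp d ?V ?g (braid_act q d ?V i)" if i: "i + 1 < d" for i
  proof (rule ext, clarify)
    fix K L
    have "tmat_comp d ?W (braid_act q d ?W i) ?g (K, L)
      = (\<Sum>M\<in>idx (r' * m ^ e) d. if M = map \<theta> L then (if cond n e r d cs ls L then braid_act q d ?W i (K, map \<theta> L) else 0) else 0)"
      unfolding tmat_comp_def case_prod_conv W_dim by (rule sum.cong) (auto simp: rmat_def)
    also have "\<dots> = (if cond n e r d cs ls L then braid_act q d ?W i (K, map \<theta> L) else 0)"
      using cond_image(1)[of L] by (auto simp: cond_def)
    finally have lhs: "tmat_comp d ?W (braid_act q d ?W i) ?g (K, L) = \<dots>" .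
    have rhs: "tmat_comp d ?V ?g (braid_act q d ?V i) (K, L)
      = (\<Sum>M\<in>idx (r * n ^ e) d. if cond n e r d cs ls M \<and> K = map \<theta> M then braid_act q d ?V i (M, L) else 0)"
      unfolding tmat_comp_def case_prod_conv W_dim by (rule sum.cong) (auto simp: rmat_def)
    show "tmat_comp d ?W (braid_act q d ?W i) ?g (K, L) = tmat_comp d ?V ?g (braid_act q d ?V i) (K, L)"
    proof (cases "\<exists>M. cond n e r d cs ls M \<and> K = map \<theta> M")
      case True
      then obtain M0 where M0: "cond n e r d cs ls M0" "K = map \<theta> M0" by blast
      have "M = M0" if "cond n e r d cs ls M" "K = map \<theta> M" for M
        using cond_image(2)[OF that(1)] cond_image(2)[OF M0(1)] that(2) M0(2) by metis
      hence "tmat_comp d ?V ?g (braid_act q d ?V i) (K, L) = (\<Sum>M\<in>idx (r * n ^ e) d. if M = M0 then braid_act q d ?V i (M0, L) else 0)"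
        unfolding rhs using M0 by (intro sum.cong) auto
      also have "\<dots> = braid_act q d ?V i (M0, L)" using M0 by (simp add: cond_def)
      also have "\<dots> = (if cond n e r d cs ls L then braid_act q d ?W i (K, map \<theta> L) else 0)"
        using act_image[OF M0(1) _ i, of L] W_act_content[OF _ i, of e n r M0 L cs ls] M0 by auto
      finally show ?thesis using lhs by simp
    next
      case False
      have "braid_act q d ?W i (K, map \<theta> L) = 0" if L: "cond n e r d cs ls L"
      proof (rule ccontr)
        assume "braid_act q d ?W i (K, map \<theta> L) \<noteq> 0"
        hence K: "cond m e r' d (\<gamma> ` cs) (\<sigma> ` ls) K" using W_act_content[OF _ i] cond_image(1)[OF L] by blast
        have "cond n e r d cs ls (map \<theta>' K)" using s.cond_image(1)[OF K] by (simp add: bk)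
        moreover have "K = map \<theta> (map \<theta>' K)" using s.cond_image(2)[OF K] by simp
        ultimately show False using False by blast
      qed
      hence "tmat_comp d ?W (braid_act q d ?W i) ?g (K, L) = 0" unfolding lhs by simp
      moreover have "tmat_comp d ?V ?g (braid_act q d ?V i) (K, L) = 0" unfolding rhs using False by (intro sum.neutral) auto
      ultimately show ?thesis by simp
    qed
  qed
  ultimately show ?thesis by (simp add: braid_hom_def)
qed

lemma rmat_back: "rmat m n e r' d (\<gamma> ` cs) (\<sigma> ` ls) \<gamma>' \<sigma>' \<in> braid_hom q d (W_pair q e m r') (W_pair q e n r)"
proof -
  interpret s: relabel q m n e r' r d "\<gamma> ` cs" "\<sigma> ` ls" \<gamma>' \<sigma>' \<gamma> \<sigma> by (rule swapped)
  show ?thesis by (rule s.rmat_hom)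
qed

lemma rmat_comp: "tmat_comp d (W_pair q e m r') (rmat m n e r' d (\<gamma> ` cs) (\<sigma> ` ls) \<gamma>' \<sigma>') (rmat n m e r d cs ls \<gamma> \<sigma>) (K, L)
   = (of_bool (K = L \<and> cond n e r d cs ls L) :: 'k)"
proof -
  have "tmat_comp d (W_pair q e m r') (rmat m n e r' d (\<gamma> ` cs) (\<sigma> ` ls) \<gamma>' \<sigma>') (rmat n m e r d cs ls \<gamma> \<sigma>) (K, L)
    = (\<Sum>M\<in>idx (r' * m ^ e) d. if M = map \<theta> L then (of_bool (K = L \<and> cond n e r d cs ls L) :: 'k) else 0)"
    unfolding tmat_comp_def case_prod_conv W_dim
  proof (rule sum.cong[OF refl])
    fix M
    show "rmat m n e r' d (\<gamma> ` cs) (\<sigma> ` ls) \<gamma>' \<sigma>' (K, M) * rmat n m e r d cs ls \<gamma> \<sigma> (M, L) = (if M = map \<theta> L then (of_bool (K = L \<and> cond n e r d cs ls L) :: 'k) else 0)"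
    proof (cases "cond n e r d cs ls L")
      case True thus ?thesis using cond_image[OF True] unfolding rmat_def by (auto simp del: map_map)
    next
      case False thus ?thesis by (simp add: rmat_def)
    qed
  qed
  also have "\<dots> = of_bool (K = L \<and> cond n e r d cs ls L)" using cond_image(1)[of L] by (auto simp: cond_def)
  finally show ?thesis .
qed

end

text \<open>The order preserving bijection from a finite set to an initial segment.\<close>
definition rank :: "nat set \<Rightarrow> nat \<Rightarrow> nat" where "rank A x = card {y \<in> A. y < x}"

lemma rank_mono: "finite A \<Longrightarrow> strict_mono_on A (rank A)"
  unfolding rank_def by (intro strict_mono_onI psubset_card_mono) auto

lemma rank_lt: "finite A \<Longrightarrow> x \<in> A \<Longrightarrow> rank A x < card A"
  unfolding rank_def by (intro psubset_card_mono) auto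

context hecke begin

text \<open>A basis vector of \<open>(V\<^sub>n\<^bsup>\<otimes>e\<^esup>)\<^sup>r\<close> to the \<open>d\<close>-th tensor power involves at most \<open>d\<close> colours and at most \<open>e d \<le> m\<close> letters.
So the part with given content can be relabelled into \<open>W_pair q e m d\<close> and back, and the identity is the
sum of these round trips over all contents.\<close>
lemma W_reduce:
  assumes m: "m \<ge> e * d"
  obtains S :: "(nat set \<times> nat set) set" and g f where "finite S"
    "\<And>s. s \<in> S \<Longrightarrow> g s \<in> braid_hom q d (W_pair q e n r) (W_pair q e m d)"
    "\<And>s. s \<in> S \<Longrightarrow> f s \<in> braid_hom q d (W_pair q e m d) (W_pair q e n r)"
    "(\<Sum>s\<in>S. tmat_comp d (W_pair q e m d) (f s) (g s)) = tmat_id d (W_pair q e n r)"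
proof -
  define S where "S = (\<lambda>L. (clr n e ` set L, ctn n e L)) ` idx (r * n ^ e) d"
  define g :: "nat set \<times> nat set \<Rightarrow> 'k tmat" where "g = (\<lambda>(cs, ls). rmat n m e r d cs ls (rank cs) (rank ls))"
  define f :: "nat set \<times> nat set \<Rightarrow> 'k tmat" where "f = (\<lambda>(cs, ls). rmat m n e d d (rank cs ` cs) (rank ls ` ls) (inv_into cs (rank cs)) (inv_into ls (rank ls)))"
  have rl: "relabel q n m r d cs ls (rank cs) (rank ls) (inv_into cs (rank cs)) (inv_into ls (rank ls))" if inS: "(cs, ls) \<in> S" for cs ls
  proof -
    obtain L where L: "L \<in> idx (r * n ^ e) d" "cs = clr n e ` set L" "ls = ctn n e L" using inS by (auto simp: S_def)
    have fin: "finite cs" "finite ls" using L by (auto simp: ctn_def)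
    have lL: "length L = d" using L by (simp add: idx_length)
    have lt: "x < r * n ^ e" if "x \<in> set L" for x using L that by (auto simp: idx_def)
    have "card cs \<le> card (set L)" unfolding L by (rule card_image_le) simp
    also have "\<dots> \<le> d" using card_length[of L] lL by simp
    finally have cc: "card cs \<le> d" .
    have "ls = set (concat (map (wrd n e) L))" by (auto simp: L ctn_def)
    hence "card ls \<le> length (concat (map (wrd n e) L))" using card_length by metis
    also have "\<dots> = sum_list (map (\<lambda>x. e) L)"
      unfolding length_concat map_map using lt wrd_idx idx_length by (intro arg_cong[where f = sum_list] map_cong) fastforce+
    also have "\<dots> = e * d" by (simp add: sum_list_triv lL)
    finally have cl: "card ls \<le> m" using m by simp
    show ?thesis
    proof unfold_locales
      show "cs \<subseteq> {..<r}" using lt clr_lt by (auto simp: L)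
      show "ls \<subseteq> {..<n}" using lt wrd_idx by (fastforce simp: L ctn_def idx_def)
      show "rank cs ` cs \<subseteq> {..<d}" using rank_lt[OF fin(1)] cc by (auto intro: less_le_trans)
      show "rank ls ` ls \<subseteq> {..<m}" using rank_lt[OF fin(2)] cl by (auto intro: less_le_trans)
      show "inv_into cs (rank cs) (rank cs c) = c" if "c \<in> cs" for c
        using inv_into_f_f[OF strict_mono_on_imp_inj_on[OF rank_mono[OF fin(1)]] that] .
      show "inv_into ls (rank ls) (rank ls c) = c" if "c \<in> ls" for c
        using inv_into_f_f[OF strict_mono_on_imp_inj_on[OF rank_mono[OF fin(2)]] that] .
      show "strict_mono_on ls (rank ls)" by (rule rank_mono[OF fin(2)])
    qed
  qed
  show ?thesis
  proof (rule that[of S g f])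
    show fS: "finite S" by (simp add: S_def)
    fix s assume s: "s \<in> S"
    obtain cs ls where cl: "s = (cs, ls)" by (cases s)
    show "g s \<in> braid_hom q d (W_pair q e n r) (W_pair q e m d)"
      using relabel.rmat_hom[OF rl] s by (auto simp: g_def cl)
    show "f s \<in> braid_hom q d (W_pair q e m d) (W_pair q e n r)"
      using relabel.rmat_back[OF rl] s by (auto simp: f_def cl)
  next
    have fS: "finite S" by (simp add: S_def)
    show "(\<Sum>s\<in>S. tmat_comp d (W_pair q e m d) (f s) (g s)) = tmat_id d (W_pair q e n r)"
    proof (rule ext, clarify)
      fix K L
      have "(\<Sum>s\<in>S. tmat_comp d (W_pair q e m d) (f s) (g s)) (K, L) = (\<Sum>s\<in>S. if s = (clr n e ` set L, ctn n e L) then of_bool (K = L \<and> L \<in> idx (r * n ^ e) d) else 0)"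
        unfolding sum_fun_apply
      proof (rule sum.cong[OF refl])
        fix s assume s: "s \<in> S"
        obtain cs ls where cl: "s = (cs, ls)" by (cases s)
        show "tmat_comp d (W_pair q e m d) (f s) (g s) (K, L) = (if s = (clr n e ` set L, ctn n e L) then of_bool (K = L \<and> L \<in> idx (r * n ^ e) d) else 0)"
          using relabel.rmat_comp[OF rl[of cs ls], where K = K and L = L and e = e] s by (auto simp: f_def g_def cl cond_def)
      qed
      also have "\<dots> = tmat_id d (W_pair q e n r) (K, L)"
        using fS by (auto simp: tmat_id_def W_dim S_def)
      finally show "(\<Sum>s\<in>S. tmat_comp d (W_pair q e m d) (f s) (g s)) (K, L) = tmat_id d (W_pair q e n r) (K, L)" .
    qed
  qed
qed

end

section \<open>Morphisms and representable functors\<close>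

lemma tmat_comp_add_left: "tmat_comp d V (g + g') f = tmat_comp d V g f + tmat_comp d V g' f"
  by (simp add: tmat_comp_def fun_eq_iff plus_fun_def distrib_right sum.distrib)

lemma tmat_comp_add_right: "tmat_comp d V g (f + f') = tmat_comp d V g f + tmat_comp d V g f'"
  by (simp add: tmat_comp_def fun_eq_iff plus_fun_def distrib_left sum.distrib)

lemma tmat_comp_scale_left: "tmat_comp d V (fscale c g) f = fscale c (tmat_comp d V g f)"
  by (simp add: tmat_comp_def fun_eq_iff fscale_def sum_distrib_left mult.assoc)

lemma tmat_comp_scale_right: "tmat_comp d V g (fscale c f) = fscale c (tmat_comp d V g f)"
  by (simp add: tmat_comp_def fun_eq_iff fscale_def sum_distrib_left mult.left_commute)

lemma tmat_comp_assoc: "tmat_comp d V (tmat_comp d W h g) f = tmat_comp d W h (tmat_comp d V g f)"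
proof (rule ext, clarify)
  fix K L
  show "tmat_comp d V (tmat_comp d W h g) f (K, L) = tmat_comp d W h (tmat_comp d V g f) (K, L)"
    unfolding tmat_comp_def case_prod_conv sum_distrib_left sum_distrib_right
    by (subst sum.swap) (simp add: mult.assoc)
qed

lemma tmat_comp_id_left: "f \<in> tmaps d V W \<Longrightarrow> tmat_comp d W (tmat_id d W) f = f"
proof (rule ext, clarify)
  fix K L assume f: "f \<in> tmaps d V W"
  have "tmat_comp d W (tmat_id d W) f (K, L) = (\<Sum>M\<in>idx (dimn W) d. if M = K then f (K, L) else 0)"
    unfolding tmat_comp_def case_prod_conv tmat_id_def by (rule sum.cong) auto
  also have "\<dots> = f (K, L)" using f by (simp add: tmaps_def)
  finally show "tmat_comp d W (tmat_id d W) f (K, L) = f (K, L)" .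
qed

lemma tmat_comp_id_right: "f \<in> tmaps d V W \<Longrightarrow> tmat_comp d V f (tmat_id d V) = f"
proof (rule ext, clarify)
  fix K L assume f: "f \<in> tmaps d V W"
  have "tmat_comp d V f (tmat_id d V) (K, L) = (\<Sum>M\<in>idx (dimn V) d. if M = L then f (K, L) else 0)"
    unfolding tmat_comp_def case_prod_conv tmat_id_def by (rule sum.cong) auto
  also have "\<dots> = f (K, L)" using f by (simp add: tmaps_def)
  finally show "tmat_comp d V f (tmat_id d V) (K, L) = f (K, L)" .
qed

lemma braid_act_tmaps: "braid_act q d V i \<in> tmaps d V V"
  by (simp add: tmaps_def braid_act_def)

lemma tmat_comp_tmaps: "f \<in> tmaps d U V \<Longrightarrow> g \<in> tmaps d V W \<Longrightarrow> tmat_comp d V g f \<in> tmaps d U W"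
  by (auto simp: tmaps_def tmat_comp_def intro!: sum.neutral)

lemma braid_hom_tmaps: "f \<in> braid_hom q d V W \<Longrightarrow> f \<in> tmaps d V W"
  by (simp add: braid_hom_def)

lemma braid_hom_comp:
  assumes f: "f \<in> braid_hom q d U V" and g: "g \<in> braid_hom q d V W"
  shows "tmat_comp d V g f \<in> braid_hom q d U W"
proof -
  have "tmat_comp d W (braid_act q d W i) (tmat_comp d V g f) = tmat_comp d U (tmat_comp d V g f) (braid_act q d U i)"
    if i: "i + 1 < d" for i
  proof -
    have "tmat_comp d W (braid_act q d W i) (tmat_comp d V g f) = tmat_comp d V (tmat_comp d V g (braid_act q d V i)) f"
      using g i by (simp add: braid_hom_def tmat_comp_assoc[symmetric])
    also have "\<dots> = tmat_comp d V g (tmat_comp d U f (braid_act q d U i))"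
      using f i by (simp add: braid_hom_def tmat_comp_assoc)
    finally show ?thesis by (simp add: tmat_comp_assoc)
  qed
  thus ?thesis using f g by (simp add: braid_hom_def tmat_comp_tmaps)
qed

lemma braid_hom_id: "tmat_id d V \<in> braid_hom q d V V"
proof -
  have "tmat_id d V \<in> tmaps d V V" by (simp add: tmaps_def tmat_id_def)
  thus ?thesis by (simp add: braid_hom_def tmat_comp_id_left[OF braid_act_tmaps] tmat_comp_id_right[OF braid_act_tmaps])
qed

lemma braid_hom_subspace: "fun_vs.subspace (braid_hom q d V W)"
proof (rule fun_vs.subspaceI)
  have z: "tmat_comp d W h 0 = 0" "tmat_comp d V 0 h = 0" for h :: "'a tmat" by (simp_all add: tmat_comp_def fun_eq_iff)
  show "0 \<in> braid_hom q d V W" by (simp add: braid_hom_def z) (simp add: tmaps_def)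
  show "f + g \<in> braid_hom q d V W" if "f \<in> braid_hom q d V W" "g \<in> braid_hom q d V W" for f g
    using that by (simp add: braid_hom_def tmat_comp_add_left tmat_comp_add_right) (simp add: tmaps_def plus_fun_def)
  show "fscale c f \<in> braid_hom q d V W" if "f \<in> braid_hom q d V W" for c f
    using that by (simp add: braid_hom_def tmat_comp_scale_left tmat_comp_scale_right) (simp add: tmaps_def fscale_def)
qed

lemma fd_space_subspace:
  assumes S: "fun_vs.subspace S" and B: "finite B" "S \<subseteq> fun_vs.span B"
  shows "fd_space S"
proof -
  obtain B' where B': "B' \<subseteq> S" "fun_vs.independent B'" "S \<subseteq> fun_vs.span B'" using fun_vs.basis_exists[of S] by metis
  have "finite B'" using fun_vs.independent_span_bound[OF B(1) B'(2)] B' B(2) by blast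
  moreover have "S = fun_vs.span B'" using fun_vs.span_minimal[OF B'(1) S] B'(3) by blast
  ultimately show ?thesis using S by (auto simp: fd_space_def)
qed

lemma braid_hom_fd: "fd_space (braid_hom q d V W)"
proof (rule fd_space_subspace[OF braid_hom_subspace])
  let ?A = "idx (dimn W) d \<times> idx (dimn V) d"
  show "finite (delta ` ?A :: 'a tmat set)" by simp
  show "braid_hom q d V W \<subseteq> fun_vs.span (delta ` ?A)"
  proof
    fix f assume "f \<in> braid_hom q d V W"
    hence "\<And>K. K \<notin> ?A \<Longrightarrow> f K = 0" by (auto simp: braid_hom_def tmaps_def)
    hence e: "f = (\<Sum>L\<in>?A. fscale (f L) (delta L))" by (intro delta_expand) simp_all
    have "(\<Sum>L\<in>?A. fscale (f L) (delta L)) \<in> fun_vs.span (delta ` ?A)"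
      by (intro fun_vs.span_sum fun_vs.span_scale fun_vs.span_base imageI)
    thus "f \<in> fun_vs.span (delta ` ?A)" using e by metis
  qed
qed

lemma rep_poly_functor:
  assumes W: "hecke_pair q e W"
  shows "poly_functor q d e (rep_functor q d W)"
  unfolding poly_functor_def rep_functor_def pfunctor.simps linear_map_def
  using braid_hom_comp[of _ q d W]
  by (auto simp: braid_hom_fd tmat_comp_add_left tmat_comp_add_right tmat_comp_scale_left tmat_comp_scale_right tmat_comp_assoc tmat_comp_id_left[OF braid_hom_tmaps])

text \<open>A linear projection with kernel \<open>N\<close>. Its image serves as a model of the quotient by \<open>N\<close> inside the same
space.\<close>
lemma projection_along:
  fixes N :: "('x \<Rightarrow> 'k::field) set"
  assumes N: "fun_vs.subspace N"
  obtains \<pi> where "lin \<pi>" "\<And>x. x \<in> N \<Longrightarrow> \<pi> x = 0" "\<And>x. x - \<pi> x \<in> N"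
proof -
  interpret vector_space_pair "fscale :: 'k \<Rightarrow> ('x \<Rightarrow> 'k) \<Rightarrow> _" "fscale :: 'k \<Rightarrow> ('x \<Rightarrow> 'k) \<Rightarrow> _" ..
  obtain B where B: "B \<subseteq> N" "fun_vs.independent B" "N \<subseteq> fun_vs.span B" using fun_vs.basis_exists[of N] by metis
  obtain \<pi> where \<pi>: "lin \<pi>" "\<forall>b\<in>fun_vs.extend_basis B. \<pi> b = (if b \<in> B then 0 else b)"
    using linear_independent_extend[OF fun_vs.independent_extend_basis[OF B(2)], of "\<lambda>b. if b \<in> B then 0 else b"] by blast
  have 0: "\<pi> b = 0" if "b \<in> B" for b using that \<pi>(2) fun_vs.extend_basis_superset[OF B(2)] by auto
  show ?thesis
  proof (rule that[OF \<pi>(1)])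
    show "\<pi> x = 0" if "x \<in> N" for x using linear_eq_0_on_span[OF \<pi>(1) 0] B(3) that by blast
    have s: "fun_vs.subspace {x. x - \<pi> x \<in> N}"
    proof (rule fun_vs.subspaceI)
      show "0 \<in> {x. x - \<pi> x \<in> N}" using fun_vs.subspace_0[OF N] by (simp add: lin_0[OF \<pi>(1)])
    next
      fix x y assume "x \<in> {x. x - \<pi> x \<in> N}" "y \<in> {x. x - \<pi> x \<in> N}"
      hence "(x - \<pi> x) + (y - \<pi> y) \<in> N" by (intro fun_vs.subspace_add[OF N]) auto
      thus "x + y \<in> {x. x - \<pi> x \<in> N}" by (simp add: lin_add[OF \<pi>(1)] algebra_simps)
    next
      fix x c assume "x \<in> {x. x - \<pi> x \<in> N}"
      hence "fscale c (x - \<pi> x) \<in> N" by (intro fun_vs.subspace_scale[OF N]) auto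
      thus "fscale c x \<in> {x. x - \<pi> x \<in> N}" by (simp add: lin_scale[OF \<pi>(1)] fun_vs.scale_right_diff_distrib)
    qed
    have "fun_vs.extend_basis B \<subseteq> {x. x - \<pi> x \<in> N}" using \<pi>(2) B(1) fun_vs.subspace_0[OF N] by auto
    hence "fun_vs.span (fun_vs.extend_basis B) \<subseteq> {x. x - \<pi> x \<in> N}" using s by (rule fun_vs.span_minimal)
    thus "x - \<pi> x \<in> N" for x using fun_vs.span_extend_basis[OF B(2)] by auto
  qed
qed

lemma linear_map_image_subspace:
  assumes S: "fun_vs.subspace S" and h: "linear_map S T h"
  shows "fun_vs.subspace (h ` S)"
proof (rule fun_vs.subspaceI)
  have "h (fscale 0 0) = fscale 0 (h 0)" using h fun_vs.subspace_0[OF S] unfolding linear_map_def by blast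
  hence "h 0 = 0" by simp
  thus "0 \<in> h ` S" using fun_vs.subspace_0[OF S] by force
  show "x + y \<in> h ` S" if "x \<in> h ` S" "y \<in> h ` S" for x y
    using that h fun_vs.subspace_add[OF S] unfolding linear_map_def by (auto simp: image_iff) metis
  show "fscale c x \<in> h ` S" if "x \<in> h ` S" for c x
    using that h fun_vs.subspace_scale[OF S] unfolding linear_map_def by (auto simp: image_iff) metis
qed

lemma poly_functorD:
  assumes F: "poly_functor q d e F" and U: "hecke_pair q e U"
  shows poly_functor_fd: "fd_space (fob F U)"
    and poly_functor_id: "\<And>x. x \<in> fob F U \<Longrightarrow> fmap F U U (tmat_id d U) x = x"
  using assms by (simp_all add: poly_functor_def)

lemma poly_functor_linear:
  assumes F: "poly_functor q d e F" and U: "hecke_pair q e U" and V: "hecke_pair q e V" and f: "f \<in> braid_hom q d U V"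
  shows "linear_map (fob F U) (fob F V) (fmap F U V f)"
    and poly_functor_mem: "\<And>x. x \<in> fob F U \<Longrightarrow> fmap F U V f x \<in> fob F V"
proof -
  show *: "linear_map (fob F U) (fob F V) (fmap F U V f)" using assms by (simp add: poly_functor_def)
  show "\<And>x. x \<in> fob F U \<Longrightarrow> fmap F U V f x \<in> fob F V" using * unfolding linear_map_def by blast
qed

lemma poly_functor_comp:
  assumes F: "poly_functor q d e F" and U: "hecke_pair q e U" and V: "hecke_pair q e V" and W: "hecke_pair q e W"
    and fg: "f \<in> braid_hom q d U V" "g \<in> braid_hom q d V W" and x: "x \<in> fob F U"
  shows "fmap F U W (tmat_comp d V g f) x = fmap F V W g (fmap F U V f x)"
proof -
  have "\<forall>U V W f g. hecke_pair q e U \<and> hecke_pair q e V \<and> hecke_pair q e W \<and>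
        f \<in> braid_hom q d U V \<and> g \<in> braid_hom q d V W \<longrightarrow>
        (\<forall>x\<in>fob F U. fmap F U W (tmat_comp d V g f) x = fmap F V W g (fmap F U V f x))"
    using F unfolding poly_functor_def by (elim conjE)
  thus ?thesis using assms by simp
qed

lemma poly_functor_bilinear:
  assumes F: "poly_functor q d e F" and U: "hecke_pair q e U" and V: "hecke_pair q e V"
    and f: "f \<in> braid_hom q d U V" and x: "x \<in> fob F U"
  shows poly_functor_add: "\<And>g. g \<in> braid_hom q d U V \<Longrightarrow> fmap F U V (f + g) x = fmap F U V f x + fmap F U V g x"
    and poly_functor_scale: "fmap F U V (fscale c f) x = fscale c (fmap F U V f x)"
  using assms by (simp_all add: poly_functor_def)

section \<open>Projectivity and generation\<close>

text \<open>The cokernel of \<open>p\<close>, formed objectwise, is again a functor \<open>H\<close>: on each object it is the image of a projection \<open>\<pi> U\<close>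
along the image of \<open>p U\<close>. The projection \<open>\<pi>\<close> and the zero transformation agree after \<open>p\<close>, so they are equal, and
the cokernel vanishes.\<close>
lemma nt_epi_surj:
  assumes F: "poly_functor q d e F" and G: "poly_functor q d e G" and p: "nt_epi q d e F G p" and W: "hecke_pair q e W"
  shows "fob G W \<subseteq> p W ` fob F W"
proof -
  let ?h = "hecke_pair q e" and ?N = "\<lambda>U. p U ` fob F U"
  have pt: "nat_trans q d e F G p" using p by (simp add: nt_epi_def)
  have pl: "linear_map (fob F U) (fob G U) (p U)" if "?h U" for U using pt that by (simp add: nat_trans_def)
  have sF: "fun_vs.subspace (fob F U)" and sG: "fun_vs.subspace (fob G U)" if "?h U" for U
    using poly_functor_fd[OF F that] poly_functor_fd[OF G that] by (simp_all add: fd_space_def)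
  have sN: "fun_vs.subspace (?N U)" if "?h U" for U by (rule linear_map_image_subspace[OF sF pl]) fact+
  have NG: "?N U \<subseteq> fob G U" if "?h U" for U using pl[OF that] by (simp add: linear_map_def)
  have "\<exists>\<pi>. ?h U \<longrightarrow> lin \<pi> \<and> (\<forall>x\<in>?N U. \<pi> x = 0) \<and> (\<forall>x. x - \<pi> x \<in> ?N U)" for U
    by (cases "?h U") (use projection_along[OF sN, of U] in metis, blast)
  then obtain \<pi> where pi: "\<And>U. ?h U \<longrightarrow> lin (\<pi> U) \<and> (\<forall>x\<in>?N U. \<pi> U x = 0) \<and> (\<forall>x. x - \<pi> U x \<in> ?N U)" by metis
  have pil: "lin (\<pi> U)" and pi0: "\<And>x. x \<in> ?N U \<Longrightarrow> \<pi> U x = 0" and piN: "\<And>x. x - \<pi> U x \<in> ?N U" if "?h U" for U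
    using pi that by auto
  have pii: "\<pi> U (\<pi> U x) = \<pi> U x" if "?h U" for U x
    using pi0[OF that piN[OF that, of x]] lin_diff[OF pil[OF that]] by simp
  have piG: "\<pi> U x \<in> fob G U" if U: "?h U" and x: "x \<in> fob G U" for U x
  proof -
    have "x - (x - \<pi> U x) \<in> fob G U" by (rule fun_vs.subspace_diff[OF sG[OF U] x subsetD[OF NG[OF U] piN[OF U]]])
    thus ?thesis by simp
  qed
  have Gl: "linear_map (fob G U) (fob G V) (fmap G U V f)" if "?h U" "?h V" "f \<in> braid_hom q d U V" for U V f
    by (rule poly_functor_linear[OF G that])
  have nat: "\<pi> V (fmap G U V f (\<pi> U x)) = \<pi> V (fmap G U V f x)" if h: "?h U" "?h V" "f \<in> braid_hom q d U V" and x: "x \<in> fob G U" for U V f x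
  proof -
    obtain z where z: "z \<in> fob F U" "x - \<pi> U x = p U z" using piN[OF h(1), of x] by auto
    have pF: "fmap F U V f z \<in> fob F V" using z(1) by (rule poly_functor_mem[OF F h])
    have "x = \<pi> U x + p U z" using z(2) by (simp add: algebra_simps)
    moreover have "p U z \<in> fob G U" using NG[OF h(1)] z by auto
    ultimately have "fmap G U V f x = fmap G U V f (\<pi> U x) + fmap G U V f (p U z)"
      using Gl[OF h] piG[OF h(1) x] unfolding linear_map_def by metis
    moreover have "fmap G U V f (p U z) = p V (fmap F U V f z)" using pt h z(1) by (simp add: nat_trans_def)
    ultimately have "\<pi> V (fmap G U V f x) = \<pi> V (fmap G U V f (\<pi> U x)) + \<pi> V (p V (fmap F U V f z))"
      by (simp only: lin_add[OF pil[OF h(2)]])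
    also have "\<pi> V (p V (fmap F U V f z)) = 0" using pF by (intro pi0[OF h(2)] imageI)
    finally show ?thesis by simp
  qed
  \<comment> \<open>the cokernel of \<open>p\<close>\<close>
  define H where "H = \<lparr>fob = (\<lambda>U. \<pi> U ` fob G U), fmap = (\<lambda>U V f x. \<pi> V (fmap G U V f x))\<rparr>"
  have HG: "x \<in> fob G U" "\<pi> U x = x" if "?h U" "x \<in> fob H U" for U x using that piG pii by (auto simp: H_def)
  have H: "poly_functor q d e H" unfolding poly_functor_def
  proof (intro conjI allI impI ballI; (elim conjE)?)
    fix U assume U: "?h U"
    obtain B where B: "finite B" "fob G U = fun_vs.span B" using poly_functor_fd[OF G U] by (auto simp: fd_space_def)
    have "fob H U = fun_vs.span (\<pi> U ` B)"
      using module_hom.span_image[OF lin_module_hom[OF pil[OF U]], of B] B by (simp add: H_def)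
    moreover have "finite (\<pi> U ` B)" using B(1) by simp
    ultimately show "fd_space (fob H U)" unfolding fd_space_def by (metis fun_vs.subspace_span)
    show "fmap H U U (tmat_id d U) x = x" if "x \<in> fob H U" for x
      using HG[OF U that] poly_functor_id[OF G U] by (simp add: H_def)
  next
    fix U V f assume h: "?h U" "?h V" "f \<in> braid_hom q d U V"
    note G' = Gl[OF h, unfolded linear_map_def]
    show "linear_map (fob H U) (fob H V) (fmap H U V f)"
      unfolding linear_map_def
    proof (intro conjI ballI allI)
      show "fmap H U V f ` fob H U \<subseteq> fob H V"
      proof
        fix y assume "y \<in> fmap H U V f ` fob H U"
        then obtain x where x: "x \<in> fob H U" "y = fmap H U V f x" by blast
        have "fmap G U V f x \<in> fob G V" using G' HG(1)[OF h(1) x(1)] by blast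
        thus "y \<in> fob H V" by (simp add: x(2) H_def)
      qed
      show "fmap H U V f (x + y) = fmap H U V f x + fmap H U V f y" if "x \<in> fob H U" "y \<in> fob H U" for x y
        using G' HG(1)[OF h(1) that(1)] HG(1)[OF h(1) that(2)] by (simp add: H_def lin_add[OF pil[OF h(2)]])
      show "fmap H U V f (fscale c x) = fscale c (fmap H U V f x)" if "x \<in> fob H U" for c x
        using G' HG(1)[OF h(1) that] by (simp add: H_def lin_scale[OF pil[OF h(2)]])
    qed
  next
    fix U V W f g x assume h: "?h U" "?h V" "?h W" "f \<in> braid_hom q d U V" "g \<in> braid_hom q d V W" and x: "x \<in> fob H U"
    note x = HG[OF h(1) x]
    have "fmap G U V f x \<in> fob G V" using x(1) by (rule poly_functor_mem[OF G h(1,2,4)])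
    moreover have "fmap G U W (tmat_comp d V g f) x = fmap G V W g (fmap G U V f x)"
      by (rule poly_functor_comp[OF G h x(1)])
    ultimately show "fmap H U W (tmat_comp d V g f) x = fmap H V W g (fmap H U V f x)"
      using nat[OF h(2,3,5)] by (simp add: H_def)
  next
    fix U V f g c x assume h: "?h U" "?h V" "f \<in> braid_hom q d U V" "g \<in> braid_hom q d U V" and x: "x \<in> fob H U"
    note x = HG[OF h(1) x]
    have "fmap G U V (f + g) x = fmap G U V f x + fmap G U V g x" "fmap G U V (fscale c f) x = fscale c (fmap G U V f x)"
      using poly_functor_add[OF G h(1,2,3) x(1) h(4)] poly_functor_scale[OF G h(1,2,3) x(1)] by simp_all
    thus "fmap H U V (f + g) x = fmap H U V f x + fmap H U V g x" "fmap H U V (fscale c f) x = fscale c (fmap H U V f x)"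
      by (simp_all add: H_def lin_add[OF pil[OF h(2)]] lin_scale[OF pil[OF h(2)]])
  qed
  have b: "nat_trans q d e G H \<pi>"
    unfolding nat_trans_def linear_map_def using nat by (auto simp: H_def lin_add[OF pil] lin_scale[OF pil])
  have z: "0 \<in> fob H U" if "?h U" for U using fun_vs.subspace_0[OF sG[OF that]] lin_0[OF pil[OF that]] by (force simp: H_def)
  have c: "nat_trans q d e G H (\<lambda>U x. 0)"
    unfolding nat_trans_def linear_map_def
  proof (intro conjI allI impI ballI; (elim conjE)?)
    fix U V f x assume h: "?h U" "?h V" "f \<in> braid_hom q d U V"
    have "fmap G U V f (fscale 0 0) = fscale 0 (fmap G U V f 0)"
      using Gl[OF h] fun_vs.subspace_0[OF sG[OF h(1)]] unfolding linear_map_def by blast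
    thus "0 = fmap H U V f 0" by (simp add: H_def lin_0[OF pil[OF h(2)]])
  qed (use z in auto)
  have "nt_eq q e F (nt_comp \<pi> p) (nt_comp (\<lambda>U x. 0) p)" using pi0 by (simp add: nt_eq_def nt_comp_def zero_fun_def)
  hence "nt_eq q e G \<pi> (\<lambda>U x. 0)" using p H b c unfolding nt_epi_def by blast
  hence zero: "\<pi> W x = 0" if "x \<in> fob G W" for x using that W by (simp add: nt_eq_def zero_fun_def)
  show ?thesis
  proof
    fix x assume "x \<in> fob G W"
    hence "\<pi> W x = 0" by (rule zero)
    thus "x \<in> ?N W" using piN[OF W, of x] by simp
  qed
qed

text \<open>Yoneda: a transformation out of the representable functor is determined by the image of the identity,
which lifts because epimorphisms are surjective on objects.\<close>
lemma rep_projective: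
  assumes W: "hecke_pair q e W"
  shows "projective_functor q d e (rep_functor q d W)"
  unfolding projective_functor_def
proof (intro conjI allI impI rep_poly_functor[OF W], elim conjE)
  fix F G p \<alpha> assume F: "poly_functor q d e F" and G: "poly_functor q d e G" and p: "nt_epi q d e F G p"
    and \<alpha>: "nat_trans q d e (rep_functor q d W) G \<alpha>"
  have "\<alpha> W (tmat_id d W) \<in> fob G W" 
    using \<alpha> W braid_hom_id[of d W q] unfolding nat_trans_def linear_map_def rep_functor_def pfunctor.simps by blast
  then obtain x where x: "x \<in> fob F W" "p W x = \<alpha> W (tmat_id d W)" using nt_epi_surj[OF F G p W] by auto
  define \<beta> where "\<beta> U f = fmap F W U f x" for U f
  have "nat_trans q d e (rep_functor q d W) F \<beta>"
    unfolding nat_trans_def linear_map_def \<beta>_def rep_functor_def pfunctor.simps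
    using poly_functor_mem[OF F W _ _ x(1)] poly_functor_add[OF F W _ _ x(1)] poly_functor_scale[OF F W _ _ x(1)]
      poly_functor_comp[OF F W _ _ _ _ x(1)] by (auto simp: image_subset_iff)
  moreover have "p U (\<beta> U f) = \<alpha> U f" if U: "hecke_pair q e U" and f: "f \<in> braid_hom q d W U" for U f
  proof -
    have "p U (\<beta> U f) = fmap G W U f (\<alpha> W (tmat_id d W))" using p W U f x by (simp add: nt_epi_def nat_trans_def \<beta>_def)
    also have "\<dots> = \<alpha> U (tmat_comp d W f (tmat_id d W))"
      using \<alpha> W U f braid_hom_id[of d W q] by (simp add: nat_trans_def rep_functor_def)
    also have "tmat_comp d W f (tmat_id d W) = f" using f by (intro tmat_comp_id_right[of _ _ _ U]) (simp add: braid_hom_def)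
    finally show ?thesis .
  qed
  ultimately show "\<exists>\<beta>. nat_trans q d e (rep_functor q d W) F \<beta> \<and> nt_eq q e (rep_functor q d W) (nt_comp p \<beta>) \<alpha>"
    by (intro exI[of _ \<beta>]) (simp add: nt_eq_def nt_comp_def rep_functor_def)
qed

lemma fmap_sum:
  assumes F: "poly_functor q d e F" and U: "hecke_pair q e U" and V: "hecke_pair q e V" and x: "x \<in> fob F U" and S: "finite S"
    and f: "\<And>s. s \<in> S \<Longrightarrow> f s \<in> braid_hom q d U V"
  shows "fmap F U V (\<Sum>s\<in>S. f s) x = (\<Sum>s\<in>S. fmap F U V (f s) x)"
  using S f
proof (induction S rule: finite_induct)
  case empty
  have "0 \<in> braid_hom q d U V" by (rule fun_vs.subspace_0[OF braid_hom_subspace])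
  hence "fmap F U V (fscale 0 0) x = fscale 0 (fmap F U V 0 x)" by (intro poly_functor_scale[OF F U V _ x])
  thus ?case by (simp add: zero_fun_def)
next
  case (insert s S)
  have "(\<Sum>s\<in>S. f s) \<in> braid_hom q d U V" using insert.prems by (intro fun_vs.subspace_sum[OF braid_hom_subspace]) auto
  hence "fmap F U V (f s + (\<Sum>s\<in>S. f s)) x = fmap F U V (f s) x + fmap F U V (\<Sum>s\<in>S. f s) x"
    using insert.prems by (intro poly_functor_add[OF F U V _ x]) auto
  thus ?case using insert by (simp add: plus_fun_def)
qed

lemma tmat_comp_sum_left: "tmat_comp d V (\<Sum>s\<in>S. g s) f = (\<Sum>s\<in>S. tmat_comp d V (g s) f)"
  by (rule lin_sum[of "\<lambda>g. tmat_comp d V g f"]) (rule linI; simp add: tmat_comp_add_left tmat_comp_scale_left)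

lemma tmat_comp_sum_right: "tmat_comp d V f (\<Sum>s\<in>S. g s) = (\<Sum>s\<in>S. tmat_comp d V f (g s))"
  by (rule lin_sum[of "\<lambda>g. tmat_comp d V f g"]) (rule linI; simp add: tmat_comp_add_right tmat_comp_scale_right)

text \<open>If the identity of every object is a sum of endomorphisms that factor through \<open>W\<close>, then applying \<open>F\<close> to it
shows that \<open>F(U)\<close> is spanned by images of \<open>F(W)\<close>.\<close>
lemma projective_generatorI:
  assumes W: "hecke_pair q e W"
    and id: "\<And>U. hecke_pair q e U \<Longrightarrow> \<exists>(S :: 's set) f g. finite S \<and> (\<forall>s\<in>S. f s \<in> braid_hom q d W U \<and> g s \<in> braid_hom q d U W)
      \<and> (\<Sum>s\<in>S. tmat_comp d W (f s) (g s)) = tmat_id d U"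
  shows "projective_generator q d e W"
  unfolding projective_generator_def
proof (intro conjI)
  show "projective_functor q d e (rep_functor q d W)" by (rule rep_projective[OF W])
  show "\<forall>F U. poly_functor q d e F \<and> hecke_pair q e U \<longrightarrow> (\<forall>y\<in>fob F U. \<exists>(r::nat) f v.
    (\<forall>s<r. f s \<in> fob (rep_functor q d W) U \<and> v s \<in> fob F W) \<and> y = (\<Sum>s<r. fmap F W U (f s) (v s)))"
  proof (intro allI impI ballI, elim conjE)
  fix F U y assume F: "poly_functor q d e F" and U: "hecke_pair q e U" and y: "y \<in> fob F U"
  obtain S :: "'s set" and f g where S: "finite S" and fg: "\<forall>s\<in>S. f s \<in> braid_hom q d W U \<and> g s \<in> braid_hom q d U W"
    and sum: "(\<Sum>s\<in>S. tmat_comp d W (f s) (g s)) = tmat_id d U"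
    using id[OF U] by (elim exE conjE) (rule that)
  have "y = fmap F U U (\<Sum>s\<in>S. tmat_comp d W (f s) (g s)) y" using poly_functor_id[OF F U y] by (simp add: sum)
  also have "\<dots> = (\<Sum>s\<in>S. fmap F U U (tmat_comp d W (f s) (g s)) y)" using fg by (intro fmap_sum[OF F U U y S] braid_hom_comp) auto
  also have "\<dots> = (\<Sum>s\<in>S. fmap F W U (f s) (fmap F U W (g s) y))"
  proof (rule sum.cong[OF refl])
    fix s assume "s \<in> S"
    thus "fmap F U U (tmat_comp d W (f s) (g s)) y = fmap F W U (f s) (fmap F U W (g s) y)"
      using fg by (intro poly_functor_comp[OF F U W U _ _ y]) auto
  qed
  finally have y_sum: "y = (\<Sum>s\<in>S. fmap F W U (f s) (fmap F U W (g s) y))" .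
  obtain h where h: "bij_betw h {0..<card S} S" using ex_bij_betw_nat_finite[OF S] by blast
  have "fmap F U W (g s) y \<in> fob F W" if "s \<in> S" for s
    using fg that y by (intro poly_functor_mem[OF F U W]) auto
  moreover have "h s \<in> S" if "s < card S" for s using bij_betwE[OF h] that by auto
  moreover have "y = (\<Sum>s<card S. fmap F W U (f (h s)) (fmap F U W (g (h s)) y))"
    using sum.reindex_bij_betw[OF h, of "\<lambda>s. fmap F W U (f s) (fmap F U W (g s) y)"] y_sum by (simp add: lessThan_atLeast0)
  ultimately have "(\<forall>s<card S. f (h s) \<in> fob (rep_functor q d W) U \<and> fmap F U W (g (h s)) y \<in> fob F W)
    \<and> y = (\<Sum>s<card S. fmap F W U (f (h s)) (fmap F U W (g (h s)) y))"
    using fg by (simp only: rep_functor_def pfunctor.simps) blast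
  thus "\<exists>(r::nat) f v. (\<forall>s<r. f s \<in> fob (rep_functor q d W) U \<and> v s \<in> fob F W) \<and> y = (\<Sum>s<r. fmap F W U (f s) (v s))"
    by (intro exI[of _ "card S"] exI[of _ "\<lambda>s. f (h s)"] exI[of _ "\<lambda>s. fmap F U W (g (h s)) y"])
  qed
qed (rule W)

theorem theorem6p13:
  fixes q :: "'k::field_char_0" and d e m :: nat
  assumes "q \<noteq> 0"
    and "\<And>l::nat. l > 0 \<Longrightarrow> q ^ l \<noteq> 1"
    and "m \<ge> 1"
    and "m \<ge> e * d"
  shows "projective_generator q d e (W_pair q e m d)"
proof -
  interpret generic_hecke q using assms(1,2) by unfold_locales
  interpret frt q m ..
  show ?thesis
  proof (rule projective_generatorI[OF W_hecke[OF assms(3)]])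
    fix U assume U: "hecke_pair q e U"
    let ?n = "level U" and ?W = "W_pair q e m d"
    obtain r a b where a: "a \<in> braid_hom q d U (W_pair q e ?n r)" and b: "b \<in> braid_hom q d (W_pair q e ?n r) U"
      and ba: "tmat_comp d (W_pair q e ?n r) b a = tmat_id d U"
      by (rule hecke_pair_retract[OF U refl])
    obtain S g f where S: "finite (S :: (nat set \<times> nat set) set)"
      and g: "\<And>s. s \<in> S \<Longrightarrow> g s \<in> braid_hom q d (W_pair q e ?n r) ?W"
      and f: "\<And>s. s \<in> S \<Longrightarrow> f s \<in> braid_hom q d ?W (W_pair q e ?n r)"
      and sum: "(\<Sum>s\<in>S. tmat_comp d ?W (f s) (g s)) = tmat_id d (W_pair q e ?n r)"
    proof (rule W_reduce[OF assms(4), of ?n r], goal_cases)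
      case (1 S g f)
      show ?case by (rule 1(1)[OF 1(2-5)])
    qed
    let ?f = "\<lambda>s. tmat_comp d (W_pair q e ?n r) b (f s)" and ?g = "\<lambda>s. tmat_comp d (W_pair q e ?n r) (g s) a"
    have "(\<Sum>s\<in>S. tmat_comp d ?W (?f s) (?g s)) = tmat_comp d (W_pair q e ?n r) b (tmat_comp d (W_pair q e ?n r) (\<Sum>s\<in>S. tmat_comp d ?W (f s) (g s)) a)"
      by (simp add: tmat_comp_sum_left tmat_comp_sum_right tmat_comp_assoc)
    also have "\<dots> = tmat_id d U"
      using a by (simp add: sum tmat_comp_id_left[of a d U] braid_hom_def ba)
    finally show "\<exists>(S :: (nat set \<times> nat set) set) f g. finite S \<and> (\<forall>s\<in>S. f s \<in> braid_hom q d ?W U \<and> g s \<in> braid_hom q d U ?W)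
      \<and> (\<Sum>s\<in>S. tmat_comp d ?W (f s) (g s)) = tmat_id d U"
      using S braid_hom_comp[OF f b] braid_hom_comp[OF a g] by (intro exI[of _ S] exI[of _ ?f] exI[of _ ?g]) blast
  qed
qed

end
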